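(* Let $(\Sigma,g,\phi)$ be a complete manifold with density. Then $(\Sigma,g,\phi)$ has finite $\phi$-capacity if and only if it is $\phi$-parabolic.
   Context: All manifolds are smooth, connected, orientable and without boundary unless stated otherwise. A manifold with density $(\Sigma,g,\phi)$ is a Riemannian manifold $(\Sigma,g)$ together with a function $\phi\in C^\infty(\Sigma)$; it is complete if $(\Sigma,g)$ is. $\Delta$, $\nabla$ and $dv_\Sigma$ are the Laplacian, gradient and volume measure of $g$. $C_0^\infty(\Sigma)$ denotes the space of compactly supported piecewise smooth functions on $\Sigma$. $(\Sigma,g,\phi)$ has finite $\phi$-capacity if there is a sequence $\{\psi_i\}_i\subset C_0^\infty(\Sigma)$ such that $0\le\psi_i\le 1$ on $\Sigma$, the compact sets $\Omega_i:=\psi_i^{-1}(1)$ form an increasing exhaustion of $\Sigma$, and the sequence $\left\{\int_\Sigma|\nabla\psi_i|^2e^\phi\,dv_\Sigma\right\}_i$ is bounded. $(\Sigma,g,\phi)$ is $\phi$-parabolic if every function $u\ge 0$ on $\Sigma$ with $\Delta_\phi u:=\Delta u+g(\nabla\phi,\nabla u)\le 0$ is constant. *)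

theory Defs
  imports "HOL-Analysis.Analysis"
begin

section \<open>Smooth functions on open subsets of a normed space\<close>

text \<open>Only used for open sets \<open>S\<close>. Continuity of all derivatives up to order \<open>k\<close>, where the
  derivatives of order at least two are iterated directional derivatives.\<close>

primrec Ck_on ::
  "nat \<Rightarrow> 'e set \<Rightarrow> ('e::real_normed_vector \<Rightarrow> 'f::real_normed_vector) \<Rightarrow> bool" where
  "Ck_on 0 S f \<longleftrightarrow> continuous_on S f"
| "Ck_on (Suc k) S f \<longleftrightarrow>
     (\<forall>x\<in>S. f differentiable (at x)) \<and> (\<forall>v. Ck_on k S (\<lambda>x. frechet_derivative f (at x) v))"

definition smooth_on :: "'e set \<Rightarrow> ('e::real_normed_vector \<Rightarrow> 'f::real_normed_vector) \<Rightarrow> bool" where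
  "smooth_on S f \<longleftrightarrow> (\<forall>k. Ck_on k S f)"

section \<open>Smooth manifolds\<close>

text \<open>The points of the manifold are all elements of a Hausdorff second countable type \<open>'a\<close>, and
  its dimension is \<open>CARD('n)\<close>. A chart is a pair of its domain and its coordinate map; the
  coordinate map is a total function whose values outside the domain are irrelevant.\<close>

type_synonym ('a, 'n) chart = "'a set \<times> ('a \<Rightarrow> real ^ 'n)"

definition is_chart :: "('a::topological_space, 'n::finite) chart \<Rightarrow> bool" where
  "is_chart c \<longleftrightarrow> open (fst c) \<and> open (snd c ` fst c) \<and>
     homeomorphism (fst c) (snd c ` fst c) (snd c) (inv_into (fst c) (snd c))"

definition transition ::
  "('a, 'n::finite) chart \<Rightarrow> ('a, 'n) chart \<Rightarrow> real ^ 'n \<Rightarrow> real ^ 'n" where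
  "transition c c' = snd c' \<circ> inv_into (fst c) (snd c)"

definition transition_jacobian ::
  "('a, 'n::finite) chart \<Rightarrow> ('a, 'n) chart \<Rightarrow> 'a \<Rightarrow> real ^ 'n ^ 'n" where
  "transition_jacobian c c' p = matrix (frechet_derivative (transition c c') (at (snd c p)))"

definition smoothly_compatible :: "('a, 'n::finite) chart \<Rightarrow> ('a, 'n) chart \<Rightarrow> bool" where
  "smoothly_compatible c c' \<longleftrightarrow>
     smooth_on (snd c ` (fst c \<inter> fst c')) (transition c c') \<and>
     smooth_on (snd c' ` (fst c \<inter> fst c')) (transition c' c)"

definition smooth_atlas :: "('a::topological_space, 'n::finite) chart set \<Rightarrow> bool" where
  "smooth_atlas A \<longleftrightarrow>
     (\<forall>c\<in>A. is_chart c) \<and> (\<Union>c\<in>A. fst c) = UNIV \<and> (\<forall>c\<in>A. \<forall>c'\<in>A. smoothly_compatible c c')"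

definition orientable :: "('a::topological_space, 'n::finite) chart set \<Rightarrow> bool" where
  "orientable A \<longleftrightarrow>
     (\<exists>B. smooth_atlas B \<and> (\<forall>b\<in>B. \<forall>c\<in>A. smoothly_compatible b c) \<and>
        (\<forall>b\<in>B. \<forall>b'\<in>B. \<forall>p\<in>fst b \<inter> fst b'. det (transition_jacobian b b' p) > 0))"

text \<open>Some chart of the atlas around \<open>p\<close>, used to evaluate at \<open>p\<close> scalar quantities given by
  coordinate expressions that do not depend on the chart.\<close>

definition chart_at :: "('a, 'n::finite) chart set \<Rightarrow> 'a \<Rightarrow> ('a, 'n) chart" where
  "chart_at A p = (SOME c. c \<in> A \<and> p \<in> fst c)"

definition in_chart :: "('a, 'n::finite) chart \<Rightarrow> ('a \<Rightarrow> 'f) \<Rightarrow> real ^ 'n \<Rightarrow> 'f" where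
  "in_chart c f = f \<circ> inv_into (fst c) (snd c)"

definition Ck_fun :: "('a, 'n::finite) chart set \<Rightarrow> nat \<Rightarrow> ('a \<Rightarrow> real) \<Rightarrow> bool" where
  "Ck_fun A k f \<longleftrightarrow> (\<forall>c\<in>A. Ck_on k (snd c ` fst c) (in_chart c f))"

definition smooth_fun_on :: "('a, 'n::finite) chart set \<Rightarrow> 'a set \<Rightarrow> ('a \<Rightarrow> real) \<Rightarrow> bool" where
  "smooth_fun_on A W f \<longleftrightarrow> (\<forall>c\<in>A. smooth_on (snd c ` (fst c \<inter> W)) (in_chart c f))"

text \<open>Piecewise smooth: continuous, and near each point obtained by choosing pointwise among
  finitely many smooth functions \<open>h\<close>. The pieces are the relatively closed sets where \<open>f = h\<close>, and
  on each of them \<open>f\<close> has a smooth extension, so \<open>f\<close> is locally Lipschitz and differentiable almost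
  everywhere.\<close>

definition piecewise_smooth_fun ::
  "('a::topological_space, 'n::finite) chart set \<Rightarrow> ('a \<Rightarrow> real) \<Rightarrow> bool" where
  "piecewise_smooth_fun A f \<longleftrightarrow> continuous_on UNIV f \<and>
     (\<forall>p. \<exists>W H. open W \<and> p \<in> W \<and> finite H \<and> (\<forall>h\<in>H. smooth_fun_on A W h) \<and>
        (\<forall>q\<in>W. \<exists>h\<in>H. f q = h q))"

definition compact_piecewise_smooth ::
  "('a::topological_space, 'n::finite) chart set \<Rightarrow> ('a \<Rightarrow> real) set" where
  "compact_piecewise_smooth A = {f. piecewise_smooth_fun A f \<and> compact (closure {p. f p \<noteq> 0})}"

definition partial_deriv ::
  "('a, 'n::finite) chart \<Rightarrow> 'n \<Rightarrow> ('a \<Rightarrow> real) \<Rightarrow> 'a \<Rightarrow> real" where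
  "partial_deriv c i f p = frechet_derivative (in_chart c f) (at (snd c p)) (axis i 1)"

section \<open>Riemannian metrics\<close>

text \<open>A metric is given by its matrix of components \<open>g c p\<close> with respect to the coordinate frame
  of each chart \<open>c\<close> of the atlas at each point \<open>p\<close> of its domain, subject to the transformation law
  of covariant 2-tensors. Likewise a vector field \<open>X\<close> is given by its components \<open>X c p\<close>.\<close>

type_synonym ('a, 'n) metric_tensor = "('a, 'n) chart \<Rightarrow> 'a \<Rightarrow> real ^ 'n ^ 'n"
type_synonym ('a, 'n) vector_field = "('a, 'n) chart \<Rightarrow> 'a \<Rightarrow> real ^ 'n"

definition riemannian_metric ::
  "('a, 'n::finite) chart set \<Rightarrow> ('a, 'n) metric_tensor \<Rightarrow> bool" where
  "riemannian_metric A g \<longleftrightarrow>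
     (\<forall>c\<in>A. smooth_on (snd c ` fst c) (in_chart c (g c)) \<and>
        (\<forall>p\<in>fst c. transpose (g c p) = g c p \<and> (\<forall>v. v \<noteq> 0 \<longrightarrow> v \<bullet> (g c p *v v) > 0))) \<and>
     (\<forall>c\<in>A. \<forall>c'\<in>A. \<forall>p\<in>fst c \<inter> fst c'.
        g c p = transpose (transition_jacobian c c' p) ** g c' p ** transition_jacobian c c' p)"

definition metric_inner :: "('a, 'n::finite) chart set \<Rightarrow> ('a, 'n) metric_tensor \<Rightarrow>
    ('a, 'n) vector_field \<Rightarrow> ('a, 'n) vector_field \<Rightarrow> 'a \<Rightarrow> real" where
  "metric_inner A g X Y p = (let c = chart_at A p in X c p \<bullet> (g c p *v Y c p))"

definition gradient ::
  "('a, 'n::finite) metric_tensor \<Rightarrow> ('a \<Rightarrow> real) \<Rightarrow> ('a, 'n) vector_field" where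
  "gradient g f c p = matrix_inv (g c p) *v (\<chi> i. partial_deriv c i f p)"

definition volume_density ::
  "('a, 'n::finite) metric_tensor \<Rightarrow> ('a, 'n) chart \<Rightarrow> 'a \<Rightarrow> real" where
  "volume_density g c p = sqrt (det (g c p))"

definition divergence :: "('a, 'n::finite) chart set \<Rightarrow> ('a, 'n) metric_tensor \<Rightarrow>
    ('a, 'n) vector_field \<Rightarrow> 'a \<Rightarrow> real" where
  "divergence A g X p = (let c = chart_at A p in
     (\<Sum>i\<in>UNIV. partial_deriv c i (\<lambda>q. volume_density g c q * X c q $ i) p) / volume_density g c p)"

definition laplacian :: "('a, 'n::finite) chart set \<Rightarrow> ('a, 'n) metric_tensor \<Rightarrow>
    ('a \<Rightarrow> real) \<Rightarrow> 'a \<Rightarrow> real" where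
  "laplacian A g u = divergence A g (gradient g u)"

text \<open>The unique Borel measure that has density \<open>volume_density\<close> with respect to Lebesgue measure
  in the coordinates of each chart.\<close>

definition volume_measure ::
  "('a::topological_space, 'n::finite) chart set \<Rightarrow> ('a, 'n) metric_tensor \<Rightarrow> 'a measure" where
  "volume_measure A g = (THE M. sets M = sets borel \<and>
     (\<forall>c\<in>A. \<forall>B\<in>sets borel. B \<subseteq> fst c \<longrightarrow>
        emeasure M B =
          (\<integral>\<^sup>+y\<in>snd c ` B. ennreal (in_chart c (volume_density g c) y) \<partial>lborel)))"

section \<open>Completeness\<close>

definition piecewise_C1_curve ::
  "('a::topological_space, 'n::finite) chart set \<Rightarrow> (real \<Rightarrow> 'a) \<Rightarrow> bool" where
  "piecewise_C1_curve A \<gamma> \<longleftrightarrow> path \<gamma> \<and>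
     (\<forall>c\<in>A. \<forall>a b. {a..b} \<subseteq> {0..1} \<and> \<gamma> ` {a..b} \<subseteq> fst c \<longrightarrow>
        (snd c \<circ> \<gamma>) piecewise_C1_differentiable_on {a..b})"

definition speed :: "('a, 'n::finite) chart set \<Rightarrow> ('a, 'n) metric_tensor \<Rightarrow>
    (real \<Rightarrow> 'a) \<Rightarrow> real \<Rightarrow> real" where
  "speed A g \<gamma> t = (let c = chart_at A (\<gamma> t); v = vector_derivative (snd c \<circ> \<gamma>) (at t)
     in sqrt (v \<bullet> (g c (\<gamma> t) *v v)))"

definition curve_length :: "('a, 'n::finite) chart set \<Rightarrow> ('a, 'n) metric_tensor \<Rightarrow>
    (real \<Rightarrow> 'a) \<Rightarrow> ennreal" where
  "curve_length A g \<gamma> = (\<integral>\<^sup>+t\<in>{0..1}. ennreal (speed A g \<gamma> t) \<partial>lborel)"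

definition riemannian_dist :: "('a::topological_space, 'n::finite) chart set \<Rightarrow>
    ('a, 'n) metric_tensor \<Rightarrow> 'a \<Rightarrow> 'a \<Rightarrow> real" where
  "riemannian_dist A g p q =
     enn2real (INF \<gamma>\<in>{\<gamma>. piecewise_C1_curve A \<gamma> \<and> pathstart \<gamma> = p \<and> pathfinish \<gamma> = q}.
       curve_length A g \<gamma>)"

definition complete_manifold ::
  "('a::topological_space, 'n::finite) chart set \<Rightarrow> ('a, 'n) metric_tensor \<Rightarrow> bool" where
  "complete_manifold A g \<longleftrightarrow> Metric_space.mcomplete UNIV (riemannian_dist A g)"

section \<open>Manifolds with density\<close>

definition manifold_with_density ::
  "('a::{t2_space, second_countable_topology}, 'n::finite) chart set \<Rightarrow>
    ('a, 'n) metric_tensor \<Rightarrow> ('a \<Rightarrow> real) \<Rightarrow> bool" where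
  "manifold_with_density A g \<phi> \<longleftrightarrow>
     smooth_atlas A \<and> connected (UNIV :: 'a set) \<and> orientable A \<and> riemannian_metric A g \<and>
     smooth_fun_on A UNIV \<phi>"

definition weighted_laplacian :: "('a, 'n::finite) chart set \<Rightarrow> ('a, 'n) metric_tensor \<Rightarrow>
    ('a \<Rightarrow> real) \<Rightarrow> ('a \<Rightarrow> real) \<Rightarrow> 'a \<Rightarrow> real" where
  "weighted_laplacian A g \<phi> u p =
     laplacian A g u p + metric_inner A g (gradient g \<phi>) (gradient g u) p"

text \<open>The integrand is nonnegative, so the energy is taken in \<open>[0, \<infinity>]\<close>; the values of the gradient
  on the null set where \<open>\<psi>\<close> is not differentiable do not matter.\<close>

definition weighted_energy :: "('a::topological_space, 'n::finite) chart set \<Rightarrow>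
    ('a, 'n) metric_tensor \<Rightarrow> ('a \<Rightarrow> real) \<Rightarrow> ('a \<Rightarrow> real) \<Rightarrow> ennreal" where
  "weighted_energy A g \<phi> \<psi> =
     (\<integral>\<^sup>+p. ennreal (metric_inner A g (gradient g \<psi>) (gradient g \<psi>) p * exp (\<phi> p))
        \<partial>volume_measure A g)"

definition finite_capacity :: "('a::topological_space, 'n::finite) chart set \<Rightarrow>
    ('a, 'n) metric_tensor \<Rightarrow> ('a \<Rightarrow> real) \<Rightarrow> bool" where
  "finite_capacity A g \<phi> \<longleftrightarrow>
     (\<exists>\<psi> :: nat \<Rightarrow> 'a \<Rightarrow> real.
        (\<forall>i. \<psi> i \<in> compact_piecewise_smooth A \<and> (\<forall>p. 0 \<le> \<psi> i p \<and> \<psi> i p \<le> 1)) \<and>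
        (\<forall>i. compact (\<psi> i -` {1})) \<and> incseq (\<lambda>i. \<psi> i -` {1}) \<and> (\<Union>i. \<psi> i -` {1}) = UNIV \<and>
        (\<exists>C::real. \<forall>i. weighted_energy A g \<phi> (\<psi> i) \<le> ennreal C))"

definition parabolic :: "('a::topological_space, 'n::finite) chart set \<Rightarrow>
    ('a, 'n) metric_tensor \<Rightarrow> ('a \<Rightarrow> real) \<Rightarrow> bool" where
  "parabolic A g \<phi> \<longleftrightarrow>
     (\<forall>u. Ck_fun A 2 u \<and> (\<forall>p. u p \<ge> 0) \<and> (\<forall>p. weighted_laplacian A g \<phi> u p \<le> 0) \<longrightarrow>
        u constant_on UNIV)"

end

theory Submission
  imports Defs
begin

text \<open>If the capacity is finite and \<open>u \<ge> 0\<close> is superharmonic, testing the inequality with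
  \<open>\<psi>\<^sup>2 / (1 + u)\<close> bounds \<open>\<integral> \<psi>\<^sup>2 q\<close> with \<open>q = |\<nabla>u|\<^sup>2 / (1 + u)\<^sup>2\<close> by four times the energy of
  \<open>\<psi>\<close>. So \<open>q\<close> is integrable, and since \<open>\<nabla>\<psi>\<close> vanishes on \<open>\<Omega> = \<psi>\<^sup>-\<^sup>1(1)\<close>, for every \<open>t > 0\<close> also
  \<open>\<integral>\<^sub>\<Omega> q\<close> is at most \<open>t\<close> times the energy plus \<open>1 / t\<close> times the integral of \<open>q\<close> off \<open>\<Omega>\<close>.
  Exhausting the manifold and then letting \<open>t\<close> tend to \<open>0\<close> gives \<open>q = 0\<close>.

  Conversely, fix a smooth integrable weight \<open>f > 0\<close> and take a minimizing sequence
  \<open>0 \<le> v\<^sub>k \<le> 1\<close> of compactly supported functions for \<open>\<integral> |\<nabla>v|\<^sup>2 + f (1 - v)\<^sup>2\<close>. It converges almost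
  everywhere to a weak solution \<open>u\<close> of \<open>\<Delta>\<^sub>\<phi> u = - f (1 - u)\<close> with values in \<open>[0, 1]\<close>, which is
  \<open>C\<^sup>2\<close> by elliptic regularity. Parabolicity makes \<open>u\<close> constant, the equation forces \<open>u = 1\<close>, and
  then the energies of the \<open>v\<^sub>k\<close> tend to \<open>0\<close>. Given a cutoff \<open>\<eta>\<close> that is \<open>1\<close> on a compact set,
  \<open>\<eta> + (1 - \<eta>) v\<^sub>k\<close> has small energy for large \<open>k\<close>.

  For the regularity, the weak equation of a bounded \<open>s\<close> is tested with an amplitude times
  \<open>cos (\<xi> \<bullet> x + d)\<close>. Dividing the amplitude by the principal symbol gains a factor \<open>1 / |\<xi>|\<close>, so the
  Fourier coefficients of a bump times \<open>s\<close> decay faster than any power.\<close>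

subsection \<open>Functions of class Ck\<close>

text \<open>The proof works with actual functions, and this decides which classes of functions
  occur. Truncation leaves the smooth functions, and \<open>\<psi>\<^sup>2 / (1 + u)\<close> with
  \<open>u\<close> only C2 leaves the piecewise smooth ones. Integration by parts is therefore
  proved for locally Lipschitz functions that are differentiable almost everywhere; it rests on the
  translation invariance of Lebesgue measure. That a gradient vanishes where a function attains its
  maximum is then an elementary fact about points of differentiability. The term
  \<open>f (1 - v)\<^sup>2\<close> lets the functional control a weighted L2 distance on the whole
  manifold. Near-minimizers are close in this distance by the parallelogram law, so one global limit
  is obtained at once and interior regularity applies to it. Since constants have zero Laplacian,
  the equation is homogeneous in \<open>1 - u\<close>, and regularity is proved in that form. Finite
  capacity bounds the energies of the cutoffs but does not make them small. The free parameter
  \<open>t\<close> compensates: it multiplies the energy, while \<open>1 / t\<close> multiplies a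
  mass that tends to zero along the exhaustion.\<close>

lemma frechet_derivative_cong_open:
  assumes "open S" "x \<in> S" "\<And>y. y \<in> S \<Longrightarrow> f y = g y"
  shows "frechet_derivative f (at x) = frechet_derivative g (at x)"
proof -
  have "(f has_derivative D) (at x) \<longleftrightarrow> (g has_derivative D) (at x)" for D
    using has_derivative_transform_within_open[of f D x UNIV S g]
      has_derivative_transform_within_open[of g D x UNIV S f] assms by auto
  then show ?thesis unfolding frechet_derivative_def by simp
qed

lemma differentiable_cong_open:
  assumes "open S" "x \<in> S" "\<And>y. y \<in> S \<Longrightarrow> f y = g y" "f differentiable (at x)"
  shows "g differentiable (at x)"
  using assms has_derivative_transform_within_open[of f _ x UNIV S g]
  unfolding differentiable_def by auto

lemma Ck_on_cong:
  assumes "open S" "\<And>x. x \<in> S \<Longrightarrow> f x = g x" "Ck_on k S f"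
  shows "Ck_on k S g"
  using assms(2,3)
proof (induction k arbitrary: f g)
  case 0
  then show ?case using continuous_on_cong[of S S f g] by simp
next
  case (Suc k)
  show ?case
    unfolding Ck_on.simps
  proof (intro conjI ballI allI)
    fix x assume "x \<in> S"
    then show "g differentiable at x"
      using differentiable_cong_open[OF assms(1), of x f g] Suc.prems by auto
  next
    fix v
    show "Ck_on k S (\<lambda>x. frechet_derivative g (at x) v)"
    proof (rule Suc.IH[of "\<lambda>x. frechet_derivative f (at x) v"])
      show "frechet_derivative f (at x) v = frechet_derivative g (at x) v" if "x \<in> S" for x
        by (rule fun_cong[OF frechet_derivative_cong_open[OF assms(1) that Suc.prems(1)]])
    qed (use Suc.prems(2) in simp)
  qed
qed

lemma Ck_on_subset: "Ck_on k S f \<Longrightarrow> T \<subseteq> S \<Longrightarrow> Ck_on k T f"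
  by (induction k arbitrary: f) (auto intro: continuous_on_subset)

lemma Ck_on_local:
  assumes "\<And>x. x \<in> S \<Longrightarrow> \<exists>T. open T \<and> x \<in> T \<and> Ck_on k T f"
  shows "Ck_on k S f"
  using assms
proof (induction k arbitrary: f)
  case 0
  then show ?case
    by (metis Ck_on.simps(1) continuous_at_imp_continuous_on continuous_on_eq_continuous_at)
next
  case (Suc k)
  show ?case
    unfolding Ck_on.simps
  proof (intro conjI ballI allI)
    fix x assume "x \<in> S"
    then show "f differentiable at x" using Suc.prems by force
  next
    fix v
    show "Ck_on k S (\<lambda>x. frechet_derivative f (at x) v)"
      by (rule Suc.IH) (use Suc.prems in force)
  qed
qed

lemma Ck_on_SucD: "Ck_on (Suc k) S f \<Longrightarrow> Ck_on k S f"
proof (induction k arbitrary: f)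
  case 0
  then show ?case
    by (auto intro!: differentiable_imp_continuous_on simp: differentiable_on_def differentiable_at_withinI)
next
  case (Suc k)
  then show ?case by (metis Ck_on.simps(2))
qed

lemma Ck_on_le: "Ck_on k S f \<Longrightarrow> j \<le> k \<Longrightarrow> Ck_on j S f"
  by (induction k) (auto simp: le_Suc_eq simp del: Ck_on.simps dest: Ck_on_SucD)

lemma Ck_on_imp_continuous_on: "Ck_on k S f \<Longrightarrow> continuous_on S f"
  using Ck_on_le[of k S f 0] by simp

text \<open>Explicit derivatives can stand in for \<open>frechet_derivative\<close>, because on an
  open set the two agree. Most closure properties below follow by this rule and induction on the
  order.\<close>

lemma Ck_on_SucI:
  assumes "open S" "\<And>x. x \<in> S \<Longrightarrow> (f has_derivative D x) (at x)" "\<And>v. Ck_on k S (\<lambda>x. D x v)"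
  shows "Ck_on (Suc k) S f"
  unfolding Ck_on.simps
proof (intro conjI ballI allI)
  show "f differentiable at x" if "x \<in> S" for x
    using assms(2)[OF that] by (rule differentiableI)
  show "Ck_on k S (\<lambda>x. frechet_derivative f (at x) v)" for v
    by (rule Ck_on_cong[OF assms(1) _ assms(3)[of v]])
      (use assms(2) frechet_derivative_at in metis)
qed

lemma Ck_on_SucE:
  assumes "Ck_on (Suc k) S f" "x \<in> S"
  shows "(f has_derivative frechet_derivative f (at x)) (at x)"
  using assms by (simp add: frechet_derivative_works[symmetric])

lemma Ck_on_const [simp]: "Ck_on k S (\<lambda>x. c)"
proof (induction k arbitrary: c)
  case (Suc k)
  then show ?case by (simp add: frechet_derivative_const)
qed simp

lemma Ck_on_bounded_linear:
  assumes "bounded_linear f" "open S" shows "Ck_on k S f"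
proof (cases k)
  case 0
  then show ?thesis using assms by (simp add: linear_continuous_on)
next
  case (Suc j)
  have "Ck_on (Suc j) S f"
    by (rule Ck_on_SucI[OF assms(2)]) (auto intro: bounded_linear_imp_has_derivative assms)
  then show ?thesis using Suc by simp
qed

lemma Ck_on_linear_comp:
  assumes "bounded_linear L" "open S" "Ck_on k S f"
  shows "Ck_on k S (\<lambda>x. L (f x))"
  using assms(3)
proof (induction k arbitrary: f)
  case 0
  then show ?case using assms by (simp add: bounded_linear.continuous_on)
next
  case (Suc k)
  show ?case
    by (rule Ck_on_SucI[OF assms(2), where D = "\<lambda>x v. L (frechet_derivative f (at x) v)"])
      (use Suc in \<open>auto intro!: bounded_linear.has_derivative[OF assms(1)] Ck_on_SucE[of k S f]\<close>)
qed

lemma Ck_on_add: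
  assumes "open S" "Ck_on k S f" "Ck_on k S g"
  shows "Ck_on k S (\<lambda>x. f x + g x)"
  using assms(2,3)
proof (induction k arbitrary: f g)
  case (Suc k)
  show ?case
    by (rule Ck_on_SucI[OF assms(1),
          where D = "\<lambda>x v. frechet_derivative f (at x) v + frechet_derivative g (at x) v"])
      (use Suc in \<open>auto intro!: has_derivative_add Ck_on_SucE[of k S]\<close>)
qed (auto intro: continuous_on_add)

lemma Ck_on_bilinear:
  assumes "bounded_bilinear B" "open S" "Ck_on k S f" "Ck_on k S g"
  shows "Ck_on k S (\<lambda>x. B (f x) (g x))"
  using assms(3,4)
proof (induction k arbitrary: f g)
  case 0
  then show ?case using assms by (simp add: bounded_bilinear.continuous_on)
next
  case (Suc k)
  show ?case
    by (rule Ck_on_SucI[OF assms(2),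
          where D = "\<lambda>x v. B (f x) (frechet_derivative g (at x) v)
             + B (frechet_derivative f (at x) v) (g x)"])
      (use Suc in \<open>auto intro!: bounded_bilinear.FDERIV[OF assms(1)] Ck_on_SucE[of k S] Ck_on_add
         Suc.IH assms(2) intro: Ck_on_SucD\<close>)
qed

lemma Ck_on_sum:
  assumes "open S" "\<And>i. i \<in> I \<Longrightarrow> Ck_on k S (f i)"
  shows "Ck_on k S (\<lambda>x. \<Sum>i\<in>I. f i x)"
  using assms(2) by (induction I rule: infinite_finite_induct) (auto intro: Ck_on_add[OF assms(1)])

lemma Ck_on_scaleR: 
  assumes "open S" "Ck_on k S f" "Ck_on k S g"
  shows "Ck_on k S (\<lambda>x. f x *\<^sub>R g x)"
  by (rule Ck_on_bilinear[OF bounded_bilinear_scaleR assms])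

lemma Ck_on_mult: 
  fixes f g :: "'a::real_normed_vector \<Rightarrow> 'b::real_normed_algebra"
  assumes "open S" "Ck_on k S f" "Ck_on k S g"
  shows "Ck_on k S (\<lambda>x. f x * g x)"
  by (rule Ck_on_bilinear[OF bounded_bilinear_mult assms])

lemma Ck_on_compose:
  fixes f :: "'a::real_normed_vector \<Rightarrow> 'b::euclidean_space"
    and g :: "'b \<Rightarrow> 'c::real_normed_vector"
  assumes "open S" "open T" "f ` S \<subseteq> T" "Ck_on k S f" "Ck_on k T g"
  shows "Ck_on k S (\<lambda>x. g (f x))"
  using assms(4,5)
proof (induction k arbitrary: g)
  case 0
  then show ?case using assms(3) by (auto intro: continuous_on_compose2)
next
  case (Suc k)
  \<comment> \<open>In the chain rule the direction fed to the derivative of \<open>g\<close> moves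
    with \<open>x\<close>, whereas \<open>Ck_on\<close> speaks of fixed directions. Expanding it in
    the basis leaves products to which the product rule and the induction hypothesis apply.\<close>
  have D: "((\<lambda>x. g (f x)) has_derivative
      (\<lambda>v. \<Sum>b\<in>Basis. (frechet_derivative f (at x) v \<bullet> b) *\<^sub>R frechet_derivative g (at (f x)) b)) (at x)"
    if "x \<in> S" for x
  proof -
    have 1: "(g has_derivative frechet_derivative g (at (f x))) (at (f x))"
      using Ck_on_SucE[OF Suc.prems(2)] that assms(3) by auto
    then have "linear (frechet_derivative g (at (f x)))"
      by (simp add: has_derivative_linear)
    moreover have "((\<lambda>x. g (f x)) has_derivative
        (\<lambda>v. frechet_derivative g (at (f x)) (frechet_derivative f (at x) v))) (at x)"
      by (rule has_derivative_compose[OF Ck_on_SucE[OF Suc.prems(1) that] 1])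
    ultimately show ?thesis
      by (subst (asm) euclidean_representation[symmetric])
        (simp add: linear_sum linear_cmul)
  qed
  show ?case
  proof (rule Ck_on_SucI[OF assms(1) D])
    fix v
    show "Ck_on k S (\<lambda>x. \<Sum>b\<in>Basis. (frechet_derivative f (at x) v \<bullet> b) *\<^sub>R frechet_derivative g (at (f x)) b)"
    proof (rule Ck_on_sum[OF assms(1)], rule Ck_on_scaleR[OF assms(1)])
      fix b :: 'b
      show "Ck_on k S (\<lambda>x. frechet_derivative f (at x) v \<bullet> b)"
        by (rule Ck_on_linear_comp[OF bounded_linear_inner_left assms(1)]) (use Suc in simp)
      show "Ck_on k S (\<lambda>x. frechet_derivative g (at (f x)) b)"
        by (rule Suc.IH) (use Suc.prems Ck_on_SucD in auto)
    qed
  qed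
qed

text \<open>Differentiation lowers the exponent, so the induction needs all exponents at once. The
  exponents \<open>-1\<close> and \<open>1/2\<close> later supply reciprocals and square
  roots.\<close>

lemma Ck_on_powr: "Ck_on k {0<..} (\<lambda>x::real. x powr a)"
proof (induction k arbitrary: a)
  case 0
  then show ?case by (auto intro!: continuous_intros)
next
  case (Suc k)
  have "((\<lambda>x::real. x powr a) has_real_derivative a * x powr (a - 1)) (at x)" if "x > 0" for x
    using has_real_derivative_powr[OF that] .
  then show ?case
    by (intro Ck_on_SucI[where D = "\<lambda>x v. v * (a * x powr (a - 1))"] Ck_on_mult Suc)
      (auto simp: has_field_derivative_def mult_commute_abs)
qed

lemma Ck_on_exp: "Ck_on k UNIV (\<lambda>x::real. exp x)"
proof (induction k)
  case (Suc k)
  show ?case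
    by (rule Ck_on_SucI[where D = "\<lambda>x v. v * exp x"])
      (auto intro!: derivative_eq_intros Ck_on_mult Suc)
qed (auto intro!: continuous_intros)

text \<open>Differentiating a cosine shifts its phase by \<open>pi/2\<close>, so cosines with free
  phase are closed under differentiation. The whole Fourier part uses them in place of pairs of
  cosines and sines.\<close>

lemma Ck_on_cos_sin: "Ck_on k UNIV (\<lambda>x::real. cos (x + d))"
proof (induction k arbitrary: d)
  case (Suc k)
  have "cos (x + (d + pi/2)) = - sin (x + d)" for x
    using cos_add[of "x + d" "pi/2"] by (simp add: add.assoc)
  then have "((\<lambda>x. cos (x + d)) has_derivative (\<lambda>v. v * cos (x + (d + pi/2)))) (at x)" for x
    by (auto intro!: derivative_eq_intros)
  then show ?case
    by (intro Ck_on_SucI[where D = "\<lambda>x v. v * cos (x + (d + pi/2))"] Ck_on_mult Suc) auto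
qed (auto intro!: continuous_intros)

subsection \<open>Smooth functions\<close>

lemma smooth_onD: "smooth_on S f \<Longrightarrow> Ck_on k S f" by (simp add: smooth_on_def)

lemma smooth_on_cong: "open S \<Longrightarrow> (\<And>x. x \<in> S \<Longrightarrow> f x = g x) \<Longrightarrow> smooth_on S f \<Longrightarrow> smooth_on S g"
  unfolding smooth_on_def using Ck_on_cong by blast

lemma smooth_on_subset: "smooth_on S f \<Longrightarrow> T \<subseteq> S \<Longrightarrow> smooth_on T f"
  unfolding smooth_on_def using Ck_on_subset by blast

lemma smooth_on_local: "(\<And>x. x \<in> S \<Longrightarrow> \<exists>T. open T \<and> x \<in> T \<and> smooth_on T f) \<Longrightarrow> smooth_on S f"
  unfolding smooth_on_def using Ck_on_local by metis

lemma smooth_on_imp_continuous_on: "smooth_on S f \<Longrightarrow> continuous_on S f"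
  using smooth_onD[of S f 0] by simp

lemma smooth_on_has_derivative:
  "smooth_on S f \<Longrightarrow> x \<in> S \<Longrightarrow> (f has_derivative frechet_derivative f (at x)) (at x)"
  by (rule Ck_on_SucE[of 0 S]) (rule smooth_onD)

lemma smooth_on_frechet: "smooth_on S f \<Longrightarrow> smooth_on S (\<lambda>x. frechet_derivative f (at x) v)"
  unfolding smooth_on_def by (metis Ck_on.simps(2))

lemma smooth_on_const [simp]: "smooth_on S (\<lambda>x. c)" by (simp add: smooth_on_def)

lemma smooth_on_bounded_linear: "bounded_linear f \<Longrightarrow> open S \<Longrightarrow> smooth_on S f"
  by (simp add: smooth_on_def Ck_on_bounded_linear)

lemma smooth_on_linear_comp:
  "bounded_linear L \<Longrightarrow> open S \<Longrightarrow> smooth_on S f \<Longrightarrow> smooth_on S (\<lambda>x. L (f x))"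
  by (simp add: smooth_on_def Ck_on_linear_comp)

lemma smooth_on_add:
  "open S \<Longrightarrow> smooth_on S f \<Longrightarrow> smooth_on S g \<Longrightarrow> smooth_on S (\<lambda>x. f x + g x)"
  by (simp add: smooth_on_def Ck_on_add)

lemma smooth_on_sum:
  "open S \<Longrightarrow> (\<And>i. i \<in> I \<Longrightarrow> smooth_on S (f i)) \<Longrightarrow> smooth_on S (\<lambda>x. \<Sum>i\<in>I. f i x)"
  by (simp add: smooth_on_def Ck_on_sum)

lemma smooth_on_mult:
  fixes f g :: "'a::real_normed_vector \<Rightarrow> 'b::real_normed_algebra"
  shows "open S \<Longrightarrow> smooth_on S f \<Longrightarrow> smooth_on S g \<Longrightarrow> smooth_on S (\<lambda>x. f x * g x)"
  by (simp add: smooth_on_def Ck_on_mult)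

lemma smooth_on_minus:
  "open S \<Longrightarrow> smooth_on S f \<Longrightarrow> smooth_on S (\<lambda>x. - f x)"
  by (rule smooth_on_linear_comp[of uminus]) (auto intro: bounded_linear_minus bounded_linear_ident)

lemma smooth_on_diff:
  "open S \<Longrightarrow> smooth_on S f \<Longrightarrow> smooth_on S g \<Longrightarrow> smooth_on S (\<lambda>x. f x - g x)"
  using smooth_on_add[OF _ _ smooth_on_minus, of S f g] by simp

lemma smooth_on_prod:
  fixes f :: "'i \<Rightarrow> 'a::real_normed_vector \<Rightarrow> real"
  shows "open S \<Longrightarrow> (\<And>i. i \<in> I \<Longrightarrow> smooth_on S (f i)) \<Longrightarrow> smooth_on S (\<lambda>x. \<Prod>i\<in>I. f i x)"
  by (induction I rule: infinite_finite_induct) (auto intro: smooth_on_mult)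

lemma smooth_on_power:
  fixes f :: "'a::real_normed_vector \<Rightarrow> real"
  shows "open S \<Longrightarrow> smooth_on S f \<Longrightarrow> smooth_on S (\<lambda>x. f x ^ m)"
  by (induction m) (auto intro: smooth_on_mult)

lemma smooth_on_inner:
  "open S \<Longrightarrow> smooth_on S f \<Longrightarrow> smooth_on S g \<Longrightarrow> smooth_on S (\<lambda>x. f x \<bullet> g x)"
  by (simp add: smooth_on_def Ck_on_bilinear[OF bounded_bilinear_inner])

lemma smooth_on_compose:
  fixes f :: "'a::real_normed_vector \<Rightarrow> 'b::euclidean_space"
    and g :: "'b \<Rightarrow> 'c::real_normed_vector"
  shows "open S \<Longrightarrow> open T \<Longrightarrow> f ` S \<subseteq> T \<Longrightarrow> smooth_on S f \<Longrightarrow> smooth_on T g \<Longrightarrow> smooth_on S (\<lambda>x. g (f x))"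
  by (simp add: smooth_on_def Ck_on_compose)

lemma smooth_on_powr:
  "open S \<Longrightarrow> smooth_on S f \<Longrightarrow> (\<And>x. x \<in> S \<Longrightarrow> f x > (0::real)) \<Longrightarrow> smooth_on S (\<lambda>x. f x powr a)"
  by (rule smooth_on_compose[where T = "{0<..}"]) (auto simp: smooth_on_def Ck_on_powr)

lemma smooth_on_inverse:
  fixes f :: "'a::real_normed_vector \<Rightarrow> real"
  assumes "open S" "smooth_on S f" "\<And>x. x \<in> S \<Longrightarrow> f x \<noteq> 0"
  shows "smooth_on S (\<lambda>x. inverse (f x))"
\<comment> \<open>\<open>powr\<close> wants a positive base. The square of \<open>f\<close> provides
  one whatever the sign of \<open>f\<close>, and the extra factor \<open>f\<close> restores the
  reciprocal.\<close>
proof (rule smooth_on_cong[OF assms(1), of "\<lambda>x. f x * (f x ^ 2) powr (-1)"])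
  show "smooth_on S (\<lambda>x. f x * (f x ^ 2) powr (-1))"
    using assms by (intro smooth_on_mult smooth_on_powr smooth_on_power) auto
qed (use assms in \<open>auto simp: powr_minus power2_eq_square field_simps\<close>)

lemma smooth_on_divide:
  fixes f :: "'a::real_normed_vector \<Rightarrow> real"
  assumes "open S" "smooth_on S g" "smooth_on S f" "\<And>x. x \<in> S \<Longrightarrow> f x \<noteq> 0"
  shows "smooth_on S (\<lambda>x. g x / f x)"
  unfolding divide_inverse by (intro smooth_on_mult smooth_on_inverse assms)

lemma smooth_on_sqrt:
  assumes "open S" "smooth_on S f" "\<And>x. x \<in> S \<Longrightarrow> f x > (0::real)"
  shows "smooth_on S (\<lambda>x. sqrt (f x))"
  by (rule smooth_on_cong[OF assms(1) _ smooth_on_powr[OF assms, of "1/2"]])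
    (use assms in \<open>auto simp: powr_half_sqrt dest!: assms(3)\<close>)

lemma smooth_on_exp:
  "open S \<Longrightarrow> smooth_on S f \<Longrightarrow> smooth_on S (\<lambda>x. exp (f x :: real))"
  by (rule smooth_on_compose[where T = UNIV]) (auto simp: smooth_on_def Ck_on_exp)

lemma smooth_on_cos:
  "open S \<Longrightarrow> smooth_on S f \<Longrightarrow> smooth_on S (\<lambda>x. cos (f x + d :: real))"
  by (rule smooth_on_compose[where T = UNIV and g = "\<lambda>x. cos (x + d)"])
    (auto simp: smooth_on_def Ck_on_cos_sin)

lemma smooth_on_vec:
  fixes f :: "'a::real_normed_vector \<Rightarrow> 'b::real_normed_vector ^ 'n"
  shows "open S \<Longrightarrow> smooth_on S f \<Longrightarrow> smooth_on S (\<lambda>x. f x $ i)"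
  by (rule smooth_on_linear_comp[OF bounded_linear_vec_nth])

lemma smooth_on_det:
  fixes f :: "'a::real_normed_vector \<Rightarrow> real ^ 'n ^ 'n"
  assumes "open S" "\<And>i j. smooth_on S (\<lambda>x. f x $ i $ j)"
  shows "smooth_on S (\<lambda>x. det (f x))"
  unfolding det_def
  by (intro smooth_on_sum smooth_on_mult smooth_on_prod assms) auto

subsection \<open>A smooth cutoff\<close>

definition flat_exp :: "real \<Rightarrow> real" where
  "flat_exp t = (if t > 0 then exp (- (1 / t)) else 0)"

lemma flat_exp_limit: "((\<lambda>t::real. exp (- (1/t)) / t ^ m) \<longlongrightarrow> 0) (at_right 0)"
proof -
  have 1: "((\<lambda>x::real. x ^ m / exp x) \<longlongrightarrow> 0) at_top"
    by (rule tendsto_power_div_exp_0)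
  have 2: "filterlim (\<lambda>t::real. 1/t) at_top (at_right 0)"
    using filterlim_inverse_at_top_right by (simp add: inverse_eq_divide)
  have "((\<lambda>t::real. (1/t) ^ m / exp (1/t)) \<longlongrightarrow> 0) (at_right 0)"
    by (rule filterlim_compose[OF 1 2])
  then show ?thesis
    by (simp add: exp_minus field_simps power_one_over)
qed

text \<open>The functions \<open>exp (- (1/t)) / t ^ m\<close>, extended by zero, span a space
  closed under differentiation, at \<open>0\<close> as well. This permits an induction on the order
  for \<open>flat_exp\<close>, the case \<open>m = 0\<close>.\<close>

lemma flat_exp_deriv:
  "((\<lambda>t. if t > 0 then exp (- (1/t)) / t ^ m else 0) has_real_derivative
    (if t > 0 then exp (- (1/t)) / t ^ (m + 2) - of_nat m * (exp (- (1/t)) / t ^ (m + 1)) else 0)) (at t)"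
    (is "(?f has_real_derivative _) _")
proof (cases t "0::real" rule: linorder_cases)
  case less
  have "(?f has_real_derivative 0) (at t)"
    by (rule DERIV_cong_ev[THEN iffD1, rotated -1, of "\<lambda>_. 0" 0 t])
      (use less in \<open>auto intro!: eventually_mono[OF eventually_nhds_in_open[of "{..<0}"]]\<close>)
  then show ?thesis using less by auto
next
  case greater
  have "((\<lambda>t. exp (- (1/t)) / t ^ m) has_real_derivative
     exp (- (1/t)) / t ^ (m + 2) - of_nat m * (exp (- (1/t)) / t ^ (m + 1))) (at t)"
  proof (cases m)
    case 0
    then show ?thesis
      using greater by (auto intro!: derivative_eq_intros simp: field_simps power2_eq_square)
  next
    case (Suc k)
    have d: "((\<lambda>t. t ^ Suc k) has_real_derivative of_nat (Suc k) * t ^ k) (at t)"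
      using DERIV_pow[of "Suc k" t UNIV] by simp
    have e: "((\<lambda>t. exp (- (1/t))) has_real_derivative exp (- (1/t)) / t ^ 2) (at t)"
      using greater by (auto intro!: derivative_eq_intros simp: field_simps power2_eq_square)
    show ?thesis
      unfolding Suc
      by (rule DERIV_cong[OF DERIV_divide[OF e d]])
        (use greater in \<open>auto simp: field_simps power2_eq_square\<close>)
  qed
  then have "(?f has_real_derivative exp (- (1/t)) / t ^ (m + 2) - of_nat m * (exp (- (1/t)) / t ^ (m + 1))) (at t)"
    by (rule DERIV_cong_ev[THEN iffD1, rotated -1])
      (use greater in \<open>auto intro!: eventually_mono[OF eventually_nhds_in_open[of "{0<..}"]]\<close>)
  then show ?thesis using greater by auto
next
  case equal
  have r: "((\<lambda>h. ?f h / h) \<longlongrightarrow> 0) (at_right 0)"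
    by (rule Lim_transform_eventually[OF flat_exp_limit[of "Suc m"]])
      (auto simp: eventually_at_filter field_simps)
  have l: "((\<lambda>h. ?f h / h) \<longlongrightarrow> 0) (at_left 0)"
    by (rule Lim_transform_eventually[OF tendsto_const]) (auto simp: eventually_at_filter)
  have "((\<lambda>h. ?f h / h) \<longlongrightarrow> 0) (at 0)"
    using filterlim_split_at[OF l r] .
  then show ?thesis
    unfolding equal DERIV_def add_0 by simp
qed

lemma smooth_on_flat_exp: "smooth_on UNIV flat_exp"
proof -
  have "Ck_on k UNIV (\<lambda>t. if t > 0 then exp (- (1/t)) / t ^ m else (0::real))" for k m
  proof (induction k arbitrary: m)
    case 0
    show ?case 
      using flat_exp_deriv[of m, THEN DERIV_isCont] by (simp add: continuous_at_imp_continuous_on)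
  next
    case (Suc k)
    show ?case
    proof (rule Ck_on_SucI)
      show "((\<lambda>t. if t > 0 then exp (- (1/t)) / t ^ m else 0) has_derivative
        (\<lambda>v. v * ((if x > 0 then exp (- (1/x)) / x ^ (m + 2) else 0) +
           (- of_nat m) * (if x > 0 then exp (- (1/x)) / x ^ (m + 1) else 0)))) (at x)" for x :: real
        using flat_exp_deriv[of m x, unfolded has_field_derivative_def]
        by (rule has_derivative_eq_rhs) (auto simp: algebra_simps)
      show "Ck_on k UNIV (\<lambda>x::real. v * ((if x > 0 then exp (- (1/x)) / x ^ (m + 2) else 0) +
           (- of_nat m) * (if x > 0 then exp (- (1/x)) / x ^ (m + 1) else 0)))" for v
        by (intro Ck_on_mult Ck_on_add Suc Ck_on_const open_UNIV)
    qed simp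
  qed
  from this[of _ 0] show ?thesis unfolding smooth_on_def flat_exp_def power_0 div_by_1 by blast
qed

section \<open>Functions that are Lipschitz near a point\<close>

definition lip_at :: "('a::metric_space \<Rightarrow> real) \<Rightarrow> 'a \<Rightarrow> bool" where
  "lip_at f x \<longleftrightarrow> (\<exists>r>0. \<exists>L. \<forall>y\<in>ball x r. \<forall>z\<in>ball x r. \<bar>f y - f z\<bar> \<le> L * dist y z)"

lemma lip_atE:
  assumes "lip_at f x"
  obtains r L where "r > 0" "L \<ge> 0" "\<And>y z. y \<in> ball x r \<Longrightarrow> z \<in> ball x r \<Longrightarrow> \<bar>f y - f z\<bar> \<le> L * dist y z"
proof -
  obtain r L where r: "r > 0" and L: "\<And>y z. y \<in> ball x r \<Longrightarrow> z \<in> ball x r \<Longrightarrow> \<bar>f y - f z\<bar> \<le> L * dist y z"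
    using assms unfolding lip_at_def by metis
  have "L * dist y z \<le> max L 0 * dist y z" for y z :: 'a
    by (intro mult_right_mono) auto
  then show thesis using that[OF r, of "max L 0"] L order_trans by (metis max.cobounded2)
qed

lemma lip_atI:
  assumes "open S" "x \<in> S" "\<And>y z. y \<in> S \<Longrightarrow> z \<in> S \<Longrightarrow> \<bar>f y - f z\<bar> \<le> L * dist y z"
  shows "lip_at f x"
proof -
  obtain r where "r > 0" "ball x r \<subseteq> S" using assms open_contains_ball by metis
  then show ?thesis unfolding lip_at_def using assms(3) by blast
qed

lemma lip_at_cong:
  assumes "lip_at f x" "open S" "x \<in> S" "\<And>y. y \<in> S \<Longrightarrow> f y = g y"
  shows "lip_at g x"
proof -
  obtain r L where r: "r > 0" and L: "\<And>y z. y \<in> ball x r \<Longrightarrow> z \<in> ball x r \<Longrightarrow> \<bar>f y - f z\<bar> \<le> L * dist y z"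
    using lip_atE[OF assms(1)] by metis
  show ?thesis
  proof (rule lip_atI[of "ball x r \<inter> S" x g L])
    fix y z assume "y \<in> ball x r \<inter> S" "z \<in> ball x r \<inter> S"
    then show "\<bar>g y - g z\<bar> \<le> L * dist y z"
      using L[of y z] assms(4)[of y] assms(4)[of z] by auto
  qed (use assms r in auto)
qed

lemma lip_at_const [simp]: "lip_at (\<lambda>x. c) x"
  by (rule lip_atI[of UNIV _ _ 0]) auto

lemma lip_at_isCont: assumes "lip_at f x" shows "isCont f x"
proof -
  obtain r L where r: "r > 0" and L: "\<And>y z. y \<in> ball x r \<Longrightarrow> z \<in> ball x r \<Longrightarrow> \<bar>f y - f z\<bar> \<le> L * dist y z"
    using lip_atE[OF assms] by metis
  have "((\<lambda>y. f y - f x) \<longlongrightarrow> 0) (at x)"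
  proof (rule Lim_null_comparison)
    show "\<forall>\<^sub>F y in at x. norm (f y - f x) \<le> L * dist y x"
      unfolding eventually_at using r L[of _ x] by (intro exI[of _ r]) (auto simp: dist_commute)
    show "((\<lambda>y. L * dist y x) \<longlongrightarrow> 0) (at x)"
      by (auto intro!: tendsto_eq_intros)
  qed
  then show ?thesis by (simp add: isCont_def LIM_zero_iff)
qed

lemma lip_at_add:
  assumes "lip_at f x" "lip_at g x" shows "lip_at (\<lambda>y. f y + g y) x"
proof -
  obtain r L where r: "r > 0" and L: "\<And>y z. y \<in> ball x r \<Longrightarrow> z \<in> ball x r \<Longrightarrow> \<bar>f y - f z\<bar> \<le> L * dist y z"
    using lip_atE[OF assms(1)] by metis
  obtain r' L' where r': "r' > 0" and L': "\<And>y z. y \<in> ball x r' \<Longrightarrow> z \<in> ball x r' \<Longrightarrow> \<bar>g y - g z\<bar> \<le> L' * dist y z"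
    using lip_atE[OF assms(2)] by metis
  show ?thesis
  proof (rule lip_atI[of "ball x r \<inter> ball x r'" x _ "L + L'"])
    fix y z assume "y \<in> ball x r \<inter> ball x r'" "z \<in> ball x r \<inter> ball x r'"
    then show "\<bar>f y + g y - (f z + g z)\<bar> \<le> (L + L') * dist y z"
      using L[of y z] L'[of y z] by (auto simp: algebra_simps)
  qed (use r r' in auto)
qed

lemma lip_at_mult:
  assumes "lip_at f x" "lip_at g x" shows "lip_at (\<lambda>y. f y * g y) x"
proof -
  obtain r L where r: "r > 0" and L0: "L \<ge> 0" and L: "\<And>y z. y \<in> ball x r \<Longrightarrow> z \<in> ball x r \<Longrightarrow> \<bar>f y - f z\<bar> \<le> L * dist y z"
    using lip_atE[OF assms(1)] by metis
  obtain r' L' where r': "r' > 0" and L'0: "L' \<ge> 0" and L': "\<And>y z. y \<in> ball x r' \<Longrightarrow> z \<in> ball x r' \<Longrightarrow> \<bar>g y - g z\<bar> \<le> L' * dist y z"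
    using lip_atE[OF assms(2)] by metis
  define A where "A = \<bar>f x\<bar> + L * r"
  define B where "B = \<bar>g x\<bar> + L' * r'"
  show ?thesis
  proof (rule lip_atI[of "ball x r \<inter> ball x r'" x _ "A * L' + B * L"])
    fix y z assume y: "y \<in> ball x r \<inter> ball x r'" and z: "z \<in> ball x r \<inter> ball x r'"
    have fy: "\<bar>f y\<bar> \<le> A"
    proof -
      have "L * dist y x \<le> L * r" using y L0 by (intro mult_left_mono) (auto simp: dist_commute)
      then show ?thesis using L[of y x] y r unfolding A_def by auto
    qed
    have gz: "\<bar>g z\<bar> \<le> B"
    proof -
      have "L' * dist z x \<le> L' * r'" using z L'0 by (intro mult_left_mono) (auto simp: dist_commute)
      then show ?thesis using L'[of z x] z r' unfolding B_def by auto
    qed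
    have "f y * g y - f z * g z = f y * (g y - g z) + (f y - f z) * g z" by (simp add: algebra_simps)
    then have "\<bar>f y * g y - f z * g z\<bar> \<le> \<bar>f y\<bar> * \<bar>g y - g z\<bar> + \<bar>f y - f z\<bar> * \<bar>g z\<bar>"
      by (metis abs_mult abs_triangle_ineq)
    also have "\<dots> \<le> A * (L' * dist y z) + (L * dist y z) * B"
      using L[of y z] L'[of y z] y z fy gz L0 by (intro add_mono mult_mono) auto
    finally show "\<bar>f y * g y - f z * g z\<bar> \<le> (A * L' + B * L) * dist y z" by (simp add: algebra_simps)
  qed (use r r' in auto)
qed

lemma C1_lipschitz_cball:
  fixes f :: "'a::euclidean_space \<Rightarrow> real"
  assumes "open S" "cball x r \<subseteq> S" "Ck_on 1 S f"
  obtains L where "L \<ge> 0" "\<And>y z. y \<in> cball x r \<Longrightarrow> z \<in> cball x r \<Longrightarrow> \<bar>f y - f z\<bar> \<le> L * dist y z"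
proof -
  \<comment> \<open>This sum dominates the operator norm of the derivative and is visibly
    continuous, hence bounded on the compact ball.\<close>
  define N where "N y = (\<Sum>i\<in>Basis. \<bar>frechet_derivative f (at y) i\<bar>)" for y
  have "continuous_on (cball x r) N"
    unfolding N_def using assms(2,3) by (intro continuous_intros) (auto intro: continuous_on_subset)
  then have "compact (N ` cball x r)" by (rule compact_continuous_image) simp
  then obtain L where L: "\<And>y. y \<in> cball x r \<Longrightarrow> \<bar>N y\<bar> \<le> L"
    using compact_imp_bounded[of "N ` cball x r"] unfolding bounded_iff by (auto simp del: mem_cball)
  have "\<bar>f y - f z\<bar> \<le> L * norm (y - z)" if "y \<in> cball x r" "z \<in> cball x r" for y z
    unfolding real_norm_def[symmetric]
  proof (rule differentiable_bound[OF convex_cball _ _ that, where f' = "\<lambda>y. frechet_derivative f (at y)"])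
    fix w assume w: "w \<in> cball x r"
    then have d: "(f has_derivative frechet_derivative f (at w)) (at w)"
      using Ck_on_SucE[of 0 S f w] assms by auto
    then show "(f has_derivative frechet_derivative f (at w)) (at w within cball x r)"
      by (rule has_derivative_at_withinI)
    have "onorm (frechet_derivative f (at w)) \<le> N w"
      using onorm_componentwise[OF has_derivative_bounded_linear[OF d]] by (simp add: N_def)
    then show "onorm (frechet_derivative f (at w)) \<le> L" using L[OF w] by simp
  qed
  then have "\<bar>f y - f z\<bar> \<le> \<bar>L\<bar> * dist y z" if "y \<in> cball x r" "z \<in> cball x r" for y z
    using that mult_right_mono[of L "\<bar>L\<bar>" "dist y z"] by (force simp: dist_norm)
  then show thesis using that[of "\<bar>L\<bar>"] by auto
qed

lemma lip_at_C1:
  fixes f :: "'a::euclidean_space \<Rightarrow> real"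
  assumes "open S" "x \<in> S" "Ck_on (Suc k) S f"
  shows "lip_at f x"
proof -
  obtain r where r: "r > 0" "cball x r \<subseteq> S" using assms open_contains_cball by metis
  have "Ck_on 1 S f" using Ck_on_le[OF assms(3), of 1] by simp
  from C1_lipschitz_cball[OF assms(1) r(2) this]
  obtain L where "\<And>y z. y \<in> cball x r \<Longrightarrow> z \<in> cball x r \<Longrightarrow> \<bar>f y - f z\<bar> \<le> L * dist y z" by metis
  then show ?thesis by (intro lip_atI[of "ball x r" x f L]) (use r in auto)
qed

text \<open>Compactness of the support turns the local constants into one constant and one step
  length, in the manner of a Lebesgue number.\<close>

lemma lip_at_uniform:
  fixes F :: "'a::euclidean_space \<Rightarrow> real"
  assumes "\<And>x. lip_at F x" "compact K" "\<And>x. x \<notin> K \<Longrightarrow> F x = 0"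
  obtains d L where "d > 0" "L \<ge> 0" "\<And>x h. norm h < d \<Longrightarrow> \<bar>F (x + h) - F x\<bar> \<le> L * norm h"
proof (cases "K = {}")
  case True
  then show thesis using that[of 1 0] assms(3) by auto
next
  case False
  have "\<exists>r L. r > 0 \<and> L \<ge> 0 \<and> (\<forall>y\<in>ball x r. \<forall>z\<in>ball x r. \<bar>F y - F z\<bar> \<le> L * dist y z)" for x
    using lip_atE[OF assms(1)[of x]] by metis
  then obtain r L where r: "\<And>x. r x > 0" and L0: "\<And>x. L x \<ge> 0"
    and L: "\<And>x y z. y \<in> ball x (r x) \<Longrightarrow> z \<in> ball x (r x) \<Longrightarrow> \<bar>F y - F z\<bar> \<le> L x * dist y z"
    by metis
  \<comment> \<open>Half radii in the cover leave room for a step: a point closer than half a radius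
    to a covered point still lies in the full ball.\<close>
  obtain T where T: "T \<subseteq> K" "finite T" "K \<subseteq> (\<Union>x\<in>T. ball x (r x / 2))"
  proof (rule compactE_image[OF assms(2), of K "\<lambda>x. ball x (r x / 2)"])
    show "K \<subseteq> (\<Union>x\<in>K. ball x (r x / 2))" using r by force
  qed auto
  then have "T \<noteq> {}" using False by auto
  define d where "d = Min ((\<lambda>x. r x / 2) ` T)"
  define M where "M = (\<Sum>x\<in>T. L x)"
  have d: "d > 0" unfolding d_def using T \<open>T \<noteq> {}\<close> r by auto
  have LM: "L x \<le> M" if "x \<in> T" for x
    unfolding M_def using T that L0 by (intro member_le_sum) auto
  have main: "\<bar>F x - F y\<bar> \<le> M * dist x y" if xK: "x \<in> K" and xy: "dist x y < d" for x y
  proof -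
    obtain c where c: "c \<in> T" "x \<in> ball c (r c / 2)" using T xK by blast
    have "d \<le> r c / 2" unfolding d_def using T c by (intro Min_le) auto
    then have "x \<in> ball c (r c)" "y \<in> ball c (r c)"
      using c xy r[of c] dist_triangle[of c y x] by (auto simp: dist_commute)
    then have "\<bar>F x - F y\<bar> \<le> L c * dist x y" by (rule L)
    also have "\<dots> \<le> M * dist x y" using LM[OF c(1)] by (intro mult_right_mono) auto
    finally show ?thesis .
  qed
  show thesis
  proof (rule that[OF d])
    show "M \<ge> 0" unfolding M_def using L0 by (simp add: sum_nonneg)
    fix x h :: 'a assume h: "norm h < d"
    show "\<bar>F (x + h) - F x\<bar> \<le> M * norm h"
    proof (cases "x \<in> K")
      case True
      then show ?thesis using main[of x "x + h"] h by (auto simp: dist_norm abs_minus_commute)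
    next
      case False
      show ?thesis
      proof (cases "x + h \<in> K")
        case True
        then show ?thesis using main[of "x + h" x] h by (auto simp: dist_norm)
      next
        case False
        then show ?thesis using \<open>x \<notin> K\<close> assms(3) \<open>M \<ge> 0\<close> by simp
      qed
    qed
  qed
qed

text \<open>A limit of a sequence, so that it is Borel measurable whether or not \<open>f\<close> is differentiable.\<close>

definition dird :: "('a::real_normed_vector \<Rightarrow> real) \<Rightarrow> 'a \<Rightarrow> 'a \<Rightarrow> real" where
  "dird f v x = lim (\<lambda>k. (f (x + v /\<^sub>R Suc k) - f x) * Suc k)"

lemma dird_tendsto:
  fixes D :: "'a::real_normed_vector \<Rightarrow> real"
  assumes "(f has_derivative D) (at x)"
  shows "(\<lambda>k. (f (x + v /\<^sub>R Suc k) - f x) * Suc k) \<longlonglongrightarrow> D v"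
proof -
  have "((\<lambda>t. (f (x + t *\<^sub>R v) - f x) / t) \<longlongrightarrow> D v) (at 0)"
  proof -
    have "((\<lambda>t. x + t *\<^sub>R v) has_derivative (\<lambda>t. t *\<^sub>R v)) (at 0)"
      by (auto intro!: derivative_eq_intros)
    then have "((\<lambda>t. f (x + t *\<^sub>R v)) has_derivative (\<lambda>t. D (t *\<^sub>R v))) (at 0)"
      by (rule has_derivative_compose) (use assms in simp)
    moreover have "(\<lambda>t. D (t *\<^sub>R v)) = (\<lambda>t. D v * t)"
      using has_derivative_linear[OF assms] by (intro ext) (simp add: linear_cmul)
    ultimately have "((\<lambda>t. f (x + t *\<^sub>R v)) has_real_derivative D v) (at 0)"
      by (simp add: has_field_derivative_def)
    then show ?thesis by (simp add: DERIV_def)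
  qed
  moreover have "filterlim (\<lambda>k. inverse (real (Suc k))) (at 0) sequentially"
    using LIMSEQ_inverse_real_of_nat by (auto simp: filterlim_at intro!: always_eventually)
  ultimately have "(\<lambda>k. (f (x + inverse (real (Suc k)) *\<^sub>R v) - f x) / inverse (real (Suc k))) \<longlonglongrightarrow> D v"
    by (rule filterlim_compose)
  then show ?thesis by (simp add: field_simps)
qed

lemma dird_eq: "(f has_derivative D) (at x) \<Longrightarrow> dird f v x = D v"
  unfolding dird_def by (rule limI) (rule dird_tendsto)

lemma borel_measurable_dird [measurable]:
  fixes f :: "'a::euclidean_space \<Rightarrow> real"
  assumes [measurable]: "f \<in> borel_measurable borel"
  shows "dird f v \<in> borel_measurable borel"
  unfolding dird_def by measurable

section \<open>Vanishing integrals of directional derivatives\<close>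

lemma integral_translation:
  fixes F :: "'a::euclidean_space \<Rightarrow> real"
  shows "(\<integral>x. F (x + h) \<partial>lborel) = (\<integral>x. F x \<partial>lborel)"
    "integrable lborel F \<Longrightarrow> integrable lborel (\<lambda>x. F (x + h))"
proof -
  show "(\<integral>x. F (x + h) \<partial>lborel) = (\<integral>x. F x \<partial>lborel)"
  proof (cases "F \<in> borel_measurable borel")
    case True
    have "(\<integral>x. F x \<partial>lborel) = (\<integral>x. F x \<partial>distr lborel borel ((+) h))"
      by (simp add: lborel_distr_plus)
    also have "\<dots> = (\<integral>x. F (h + x) \<partial>lborel)"
      using True by (intro integral_distr) auto
    finally show ?thesis by (simp add: add.commute)
  next
    \<comment> \<open>Measurability passes between a function and its translate, so without it both
      integrals take the default value \<open>0\<close>.\<close>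
    case False
    have "(\<lambda>x. F (x + h)) \<notin> borel_measurable borel"
    proof
      assume "(\<lambda>x. F (x + h)) \<in> borel_measurable borel"
      then have "(\<lambda>x. F ((x - h) + h)) \<in> borel_measurable borel" by measurable
      then show False using False by simp
    qed
    then have "\<not> integrable lborel (\<lambda>x. F (x + h))" "\<not> integrable lborel F"
      using False borel_measurable_integrable[of lborel F]
        borel_measurable_integrable[of lborel "\<lambda>x. F (x + h)"] by auto
    then show ?thesis by (simp add: not_integrable_integral_eq)
  qed
  show "integrable lborel (\<lambda>x. F (x + h))" if "integrable lborel F"
  proof -
    have "integrable (distr lborel borel ((+) h)) F" using that by (simp add: lborel_distr_plus)
    then show ?thesis
      using that by (subst (asm) integrable_distr_eq) (auto simp: add.commute)
  qed
qed

text \<open>Each difference quotient has integral zero by translation invariance, and the uniform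
  Lipschitz bound permits the passage to the limit. This is the divergence theorem for compactly
  supported functions, the source of every integration by parts below.\<close>

lemma integral_dird_eq_0:
  fixes F :: "'a::euclidean_space \<Rightarrow> real"
  assumes lip: "\<And>x. lip_at F x" and K: "compact K" "\<And>x. x \<notin> K \<Longrightarrow> F x = 0"
    and diff: "AE x in lborel. F differentiable (at x)"
  shows "integrable lborel (dird F v)" "(\<integral>x. dird F v x \<partial>lborel) = 0"
proof -
  obtain d L where d: "d > 0" and L0: "L \<ge> 0" and L: "\<And>x h. norm h < d \<Longrightarrow> \<bar>F (x + h) - F x\<bar> \<le> L * norm h"
    using lip_at_uniform[OF lip K] by metis
  have cont: "continuous_on UNIV F"
    using lip lip_at_isCont continuous_at_imp_continuous_on by blast
  then have [measurable]: "F \<in> borel_measurable borel" by (rule borel_measurable_continuous_onI)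
  have intF: "integrable lborel F"
  proof -
    have "integrable lborel (\<lambda>x. indicator K x *\<^sub>R F x)"
      by (rule borel_integrable_compact[OF K(1)]) (use cont in \<open>auto intro: continuous_on_subset\<close>)
    moreover have "(\<lambda>x. indicator K x *\<^sub>R F x) = F" using K(2) by (intro ext) (auto simp: indicator_def)
    ultimately show ?thesis by simp
  qed
  obtain R where R: "K \<subseteq> cball 0 R"
    using bounded_subset_ballD[OF compact_imp_bounded[OF K(1)], of 0] ball_subset_cball by blast
  \<comment> \<open>Skipping the first \<open>N\<close> quotients makes all steps shorter than
    \<open>d\<close>, the range of the uniform Lipschitz bound.\<close>
  obtain N where N: "norm v / d < real N" using reals_Archimedean2 by blast
  define q where "q k x = (F (x + v /\<^sub>R Suc (k + N)) - F x) * Suc (k + N)" for k x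
  \<comment> \<open>Outside the ball enlarged by \<open>d\<close> neither \<open>x\<close> nor the
    shifted point lies in \<open>K\<close>, so the quotients vanish there.\<close>
  define w where "w x = L * norm v * indicator (cball (0::'a) (R + d)) x" for x
  have step: "norm (v /\<^sub>R Suc (k + N)) < d" for k
  proof -
    have "norm v < d * real N" using N d by (simp add: field_simps)
    also have "\<dots> \<le> d * real (Suc (k + N))" using d by (intro mult_left_mono) auto
    finally show ?thesis by (simp add: field_simps)
  qed
  have bound: "\<bar>q k x\<bar> \<le> w x" for k x
  proof (cases "x \<in> cball 0 (R + d)")
    case True
    have "\<bar>q k x\<bar> \<le> (L * norm (v /\<^sub>R Suc (k + N))) * Suc (k + N)"
      unfolding q_def abs_mult using L[OF step, of x k] by (intro mult_mono) auto
    also have "\<dots> = L * norm v" by (simp add: field_simps)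
    finally show ?thesis using True by (simp add: w_def)
  next
    case False
    then have "norm x > R + d" by (simp add: dist_norm)
    define u where "u = v /\<^sub>R Suc (k + N)"
    have "norm x \<le> norm (x + u) + norm u" using norm_triangle_ineq4[of "x + u" u] by simp
    moreover have "norm u < d" using step[of k] unfolding u_def .
    moreover have "norm y \<le> R" if "y \<in> K" for y using R that by auto
    ultimately have "x \<notin> K" "x + u \<notin> K" using \<open>norm x > R + d\<close> d by force+
    then have "x \<notin> K" "x + v /\<^sub>R Suc (k + N) \<notin> K" unfolding u_def .
    then show ?thesis using K(2) L0 by (simp add: q_def w_def)
  qed
  have w: "integrable lborel w"
    unfolding w_def by (intro integrable_mult_right integrable_real_indicator)
      (auto intro!: emeasure_bounded_finite[unfolded infinity_ennreal_def])
  have conv: "AE x in lborel. (\<lambda>k. q k x) \<longlonglongrightarrow> dird F v x"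
    using diff
  proof eventually_elim
    case (elim x)
    then obtain D where D: "(F has_derivative D) (at x)" unfolding differentiable_def by auto
    show ?case
      unfolding q_def dird_eq[OF D]
      using dird_tendsto[OF D, of v, THEN LIMSEQ_ignore_initial_segment[where k = N]] by simp
  qed
  have m: "dird F v \<in> borel_measurable lborel" by simp
  have q: "q k \<in> borel_measurable lborel" for k unfolding q_def by measurable
  have bd: "\<And>k. AE x in lborel. norm (q k x) \<le> w x" using bound by simp
  show "integrable lborel (dird F v)"
    by (rule integrable_dominated_convergence[OF m q w conv bd])
  have "(\<integral>x. q k x \<partial>lborel) = 0" for k
    unfolding q_def using intF integral_translation[of F] by simp
  then show "(\<integral>x. dird F v x \<partial>lborel) = 0"
    using integral_dominated_convergence[OF m q w conv bd] LIMSEQ_unique[OF _ tendsto_const] by simp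
qed

subsection \<open>Continuous selections of smooth functions\<close>

text \<open>Follow a candidate \<open>h\<close> that agrees with \<open>f\<close> at
  \<open>a\<close> up to the last parameter \<open>c\<close> where the two agree. The increment of
  \<open>f\<close> from \<open>a\<close> to \<open>c\<close> is one of \<open>h\<close>, and beyond
  \<open>c\<close> the candidate \<open>h\<close> is never selected, so induction on the number of
  candidates covers the rest.\<close>

lemma selection_lipschitz:
  fixes f :: "real \<Rightarrow> real"
  assumes "finite H" "a \<le> b" "continuous_on {a..b} f" "\<And>t. t \<in> {a..b} \<Longrightarrow> \<exists>h\<in>H. f t = h t"
    and "\<And>h s t. h \<in> H \<Longrightarrow> s \<in> {a..b} \<Longrightarrow> t \<in> {a..b} \<Longrightarrow> \<bar>h s - h t\<bar> \<le> L * \<bar>s - t\<bar>"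
    and hcont: "\<And>h. h \<in> H \<Longrightarrow> continuous_on {a..b} h"
  shows "\<bar>f b - f a\<bar> \<le> L * (b - a)"
  using assms
proof (induction "card H" arbitrary: H a rule: less_induct)
  case less
  obtain h where h: "h \<in> H" "f a = h a" using less.prems by force
  define C where "C = {t\<in>{a..b}. f t - h t = 0}"
  have "continuous_on {a..b} (\<lambda>t. f t - h t)"
    using less.prems h by (intro continuous_intros) auto
  then have "closed C" unfolding C_def by (rule continuous_closed_preimage_constant) simp
  moreover have "bounded C" by (rule bounded_subset[of "{a..b}"]) (auto simp: C_def)
  ultimately have "compact C" by (simp add: compact_eq_bounded_closed)
  moreover have "C \<noteq> {}" using less.prems h by (auto simp: C_def)
  ultimately obtain c where c: "c \<in> C" "\<And>t. t \<in> C \<Longrightarrow> t \<le> c"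
    using compact_attains_sup by metis
  then have cab: "c \<in> {a..b}" "f c = h c" by (auto simp: C_def)
  have ac: "\<bar>f c - f a\<bar> \<le> L * (c - a)"
    using less.prems(5)[OF h(1), of c a] cab less.prems(2) h by auto
  show ?case
  proof (cases "c = b")
    case True
    then show ?thesis using ac by simp
  next
    case False
    then have "c < b" using cab by simp
    \<comment> \<open>At \<open>c\<close> itself \<open>h\<close> is still selected. The induction
      hypothesis is therefore used from points \<open>s > c\<close>, and continuity of
      \<open>f\<close> lets \<open>s\<close> tend to \<open>c\<close>.\<close>
    have *: "\<bar>f b - f s\<bar> \<le> L * (b - s)" if s: "s \<in> {c<..b}" for s
    proof (rule less.hyps[of "H - {h}" s])
      show "card (H - {h}) < card H" using h less.prems by (intro card_Diff1_less) auto
      fix t assume t: "t \<in> {s..b}"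
      then have "t \<notin> C" using c(2)[of t] s by auto
      then have "f t \<noteq> h t" using t s cab by (auto simp: C_def)
      then show "\<exists>h\<in>H - {h}. f t = h t" using less.prems(4)[of t] t s cab by auto
    next
      show "continuous_on {s..b} f" using less.prems(3) s cab by (auto intro: continuous_on_subset)
      show "continuous_on {s..b} k" if "k \<in> H - {h}" for k
        using less.prems(6)[of k] that s cab by (auto intro: continuous_on_subset)
    qed (use less.prems s cab in auto)
    have "continuous_on {c..b} f" using less.prems(3) cab by (auto intro: continuous_on_subset)
    then have "(f \<longlongrightarrow> f c) (at_right c)"
      using \<open>c < b\<close> by (metis continuous_on_Icc_at_rightD)
    then have l: "((\<lambda>s. \<bar>f b - f s\<bar>) \<longlongrightarrow> \<bar>f b - f c\<bar>) (at_right c)"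
      by (intro tendsto_intros)
    have r: "((\<lambda>s. L * (b - s)) \<longlongrightarrow> L * (b - c)) (at_right c)" by (intro tendsto_intros)
    have "\<bar>f b - f c\<bar> \<le> L * (b - c)"
      by (rule tendsto_le[OF _ r l])
        (use * eventually_at_right_real[OF \<open>c < b\<close>] in \<open>auto elim!: eventually_mono\<close>)
    then show ?thesis using ac by (simp add: algebra_simps)
  qed
qed

text \<open>Along a segment the selection is one from finitely many functions of a real variable.
  The sum of their Lipschitz constants bounds each of them and hence serves for
  \<open>f\<close>.\<close>

lemma selection_lip_at:
  fixes f :: "'a::euclidean_space \<Rightarrow> real"
  assumes S: "open S" "x \<in> S" and f: "continuous_on S f" and H: "finite H"
    and sel: "\<And>y. y \<in> S \<Longrightarrow> \<exists>h\<in>H. f y = h y" and C1: "\<And>h. h \<in> H \<Longrightarrow> Ck_on 1 S h"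
  shows "lip_at f x"
proof -
  obtain r where r: "r > 0" "cball x r \<subseteq> S" using S open_contains_cball by metis
  have "\<exists>L. L \<ge> 0 \<and> (\<forall>y\<in>cball x r. \<forall>z\<in>cball x r. \<bar>h y - h z\<bar> \<le> L * dist y z)" if "h \<in> H" for h
    using C1_lipschitz_cball[OF S(1) r(2) C1[OF that]] by metis
  then obtain L where L0: "\<And>h. h \<in> H \<Longrightarrow> L h \<ge> 0"
    and L: "\<And>h y z. h \<in> H \<Longrightarrow> y \<in> cball x r \<Longrightarrow> z \<in> cball x r \<Longrightarrow> \<bar>h y - h z\<bar> \<le> L h * dist y z"
    by metis
  define M where "M = (\<Sum>h\<in>H. L h)"
  have LM: "L h \<le> M" if "h \<in> H" for h
    unfolding M_def using H that L0 by (intro member_le_sum) auto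
  have "\<bar>f y - f z\<bar> \<le> M * dist y z" if yz: "y \<in> ball x r" "z \<in> ball x r" for y z
  proof -
    define p where "p t = z + t *\<^sub>R (y - z)" for t :: real
    have p: "p t \<in> ball x r" if "t \<in> {0..1}" for t
      using convexD_alt[OF convex_ball yz(2,1), of t] that unfolding p_def by (auto simp: algebra_simps)
    have pc: "continuous_on {0..1} p" unfolding p_def by (intro continuous_intros)
    have pS: "p ` {0..1} \<subseteq> S" using p r by fastforce
    have "\<bar>f (p 1) - f (p 0)\<bar> \<le> (M * dist y z) * (1 - 0)"
    proof (rule selection_lipschitz[where H = "(\<lambda>h. h \<circ> p) ` H" and f = "f \<circ> p", unfolded o_def])
      show "continuous_on {0..1} (\<lambda>t. f (p t))"
        by (rule continuous_on_compose2[OF f pc pS])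
      show "\<exists>h\<in>(\<lambda>h t. h (p t)) ` H. f (p t) = h t" if "t \<in> {0..1}" for t
        using sel[of "p t"] subsetD[OF pS imageI[OF that]] by simp
      show "continuous_on {0..1} h" if "h \<in> (\<lambda>h t. h (p t)) ` H" for h
        using that continuous_on_compose2[OF Ck_on_imp_continuous_on[OF C1] pc pS] by auto
      fix h s t assume h: "h \<in> (\<lambda>h t. h (p t)) ` H" and st: "s \<in> {0..1::real}" "t \<in> {0..1::real}"
      then obtain k where k: "k \<in> H" "h = (\<lambda>t. k (p t))" by auto
      have "\<bar>h s - h t\<bar> \<le> L k * dist (p s) (p t)"
        unfolding k(2) using p[OF st(1)] p[OF st(2)] by (intro L[OF k(1)]) auto
      also have "dist (p s) (p t) = \<bar>s - t\<bar> * dist y z"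
        by (simp add: p_def dist_norm flip: scaleR_left_diff_distrib)
      also have "L k * (\<bar>s - t\<bar> * dist y z) \<le> M * (\<bar>s - t\<bar> * dist y z)"
        using LM[OF k(1)] by (intro mult_right_mono) auto
      finally show "\<bar>h s - h t\<bar> \<le> M * dist y z * \<bar>s - t\<bar>" by (simp add: algebra_simps)
    qed (use H in auto)
    then show ?thesis by (simp add: p_def)
  qed
  then show ?thesis using r by (intro lip_atI[of "ball x r" x f M]) auto
qed

text \<open>The translates by \<open>v / (k + 1)\<close> are pairwise disjoint, have equal measure
  and lie in one bounded set. Infinitely many of them fit only if that measure is zero.\<close>

lemma negligible_disjoint_translates:
  fixes Z :: "'a::euclidean_space set"
  assumes Z: "compact Z" and inj: "\<And>z t. z \<in> Z \<Longrightarrow> t \<noteq> 0 \<Longrightarrow> z + t *\<^sub>R v \<notin> Z"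
  shows "negligible Z"
proof -
  have lm: "Z \<in> lmeasurable" using Z lmeasurable_compact by blast
  obtain R where R: "Z \<subseteq> cball 0 R" using bounded_subset_ballD[OF compact_imp_bounded[OF Z], of 0] ball_subset_cball by blast
  define B where "B = cball (0::'a) (R + norm v)"
  have "real m * measure lebesgue Z \<le> measure lebesgue B" for m
  proof -
    define T where "T k = (+) ((1 / real (Suc k)) *\<^sub>R v) ` Z" for k
    have Tm: "T k \<in> lmeasurable" for k unfolding T_def by (rule measurable_translation[OF lm])
    have "measure lebesgue (\<Union>k<m. T k) = (\<Sum>k<m. measure lebesgue (T k))"
    proof (rule measure_UNION')
      show "pairwise (\<lambda>i j. disjnt (T i) (T j)) {..<m}"
      proof (rule pairwiseI)
        fix i j :: nat assume "i \<noteq> j"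
        show "disjnt (T i) (T j)"
        proof (rule ccontr)
          assume "\<not> disjnt (T i) (T j)"
          then obtain z w where zw: "z \<in> Z" "w \<in> Z"
            "(1 / real (Suc i)) *\<^sub>R v + z = (1 / real (Suc j)) *\<^sub>R v + w"
            unfolding disjnt_def T_def by auto
          then have "z + (1 / real (Suc i) - 1 / real (Suc j)) *\<^sub>R v = w"
            by (simp add: algebra_simps)
          moreover have "1 / real (Suc i) - 1 / real (Suc j) \<noteq> 0" using \<open>i \<noteq> j\<close> by (simp add: divide_eq_eq eq_divide_eq)
          ultimately show False using inj zw by blast
        qed
      qed
    qed (use Tm in auto)
    also have "\<dots> = real m * measure lebesgue Z" by (simp add: T_def measure_translation)
    finally have "real m * measure lebesgue Z = measure lebesgue (\<Union>k<m. T k)" by simp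
    also have "\<dots> \<le> measure lebesgue B"
    proof (rule measure_mono_fmeasurable)
      show "(\<Union>k<m. T k) \<subseteq> B"
      proof
        fix y assume "y \<in> (\<Union>k<m. T k)"
        then obtain k z where z: "z \<in> Z" "y = (1 / real (Suc k)) *\<^sub>R v + z" by (auto simp: T_def)
        then have "norm z \<le> R" using R by auto
        moreover have "norm ((1 / real (Suc k)) *\<^sub>R v) \<le> norm v" by (simp add: field_simps)
        ultimately show "y \<in> B"
          using norm_triangle_ineq[of "(1 / real (Suc k)) *\<^sub>R v" z] z(2) by (simp add: B_def del: norm_scaleR)
      qed
      show "(\<Union>k<m. T k) \<in> sets lebesgue" using Tm by (intro sets.finite_UN) auto
    qed (simp add: B_def)
    finally show ?thesis .
  qed
  then have "measure lebesgue Z \<le> 0"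
    by (metis (no_types, opaque_lifting) linorder_not_less mult.commute reals_Archimedean3)
  then have "measure lebesgue Z = 0" using measure_nonneg[of lebesgue Z] by linarith
  then show ?thesis using lm negligible_iff_measure0 by blast
qed

text \<open>Near a point where the derivative in direction \<open>v\<close> is nonzero, Rolle's
  theorem allows at most one zero on each line in that direction, so the local zero set is disjoint
  from its translates along \<open>v\<close>.\<close>

lemma negligible_regular_zeros:
  fixes k :: "'a::euclidean_space \<Rightarrow> real"
  assumes S: "open S" and k: "Ck_on 1 S k"
  shows "negligible {x\<in>S. k x = 0 \<and> frechet_derivative k (at x) v \<noteq> 0}" (is "negligible ?N")
proof (subst locally_negligible_alt, rule)
  fix x assume x: "x \<in> ?N"
  have d: "(k has_derivative frechet_derivative k (at y)) (at y)" if "y \<in> S" for y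
    using Ck_on_SucE[of 0 S k y] k that by simp
  have "continuous_on S (\<lambda>y. frechet_derivative k (at y) v)" using k by simp
  then have "open {y\<in>S. frechet_derivative k (at y) v \<in> - {0}}"
    using S by (intro continuous_open_preimage[unfolded vimage_def Int_def mem_Collect_eq]) auto
  then obtain r where r: "r > 0" "cball x r \<subseteq> {y\<in>S. frechet_derivative k (at y) v \<in> - {0}}"
    using x open_contains_cball by (metis (mono_tags, lifting) ComplI mem_Collect_eq singletonD)
  define Z where "Z = {y\<in>cball x r. k y = 0}"
  have "continuous_on (cball x r) k"
    using Ck_on_imp_continuous_on[OF k] r by (auto intro: continuous_on_subset)
  then have "closed Z" unfolding Z_def by (rule continuous_closed_preimage_constant) simp
  moreover have "bounded Z" by (rule bounded_subset[of "cball x r"]) (auto simp: Z_def)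
  ultimately have "compact Z" by (simp add: compact_eq_bounded_closed)
  moreover have "z + t *\<^sub>R v \<notin> Z" if z: "z \<in> Z" and t: "t \<noteq> 0" for z t
  proof
    assume w: "z + t *\<^sub>R v \<in> Z"
    define p where "p s = k (z + s *\<^sub>R (t *\<^sub>R v))" for s :: real
    have inb: "z + s *\<^sub>R (t *\<^sub>R v) \<in> cball x r" if "s \<in> {0..1}" for s
      using convexD_alt[OF convex_cball, of z x r "z + t *\<^sub>R v" s] z w that
      by (auto simp: Z_def algebra_simps)
    have dp: "(p has_derivative (\<lambda>u. u * (t * frechet_derivative k (at (z + s *\<^sub>R (t *\<^sub>R v))) v))) (at s)"
      if "s \<in> {0..1}" for s
    proof -
      have 1: "(k has_derivative frechet_derivative k (at (z + s *\<^sub>R (t *\<^sub>R v)))) (at (z + s *\<^sub>R (t *\<^sub>R v)))"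
        using d inb[OF that] r by auto
      have 2: "((\<lambda>s. z + s *\<^sub>R (t *\<^sub>R v)) has_derivative (\<lambda>u. u *\<^sub>R (t *\<^sub>R v))) (at s)"
        by (auto intro!: derivative_eq_intros)
      show ?thesis
        unfolding p_def
        by (rule has_derivative_eq_rhs[OF has_derivative_compose[OF 2 1]])
          (use has_derivative_linear[OF 1] in \<open>auto simp: linear_cmul\<close>)
    qed
    have "\<exists>s>0. s < 1 \<and> (\<lambda>u. u * (t * frechet_derivative k (at (z + s *\<^sub>R (t *\<^sub>R v))) v)) = (\<lambda>v. 0)"
    proof (rule Rolle_deriv)
      show "p 0 = p 1" using z w by (simp add: p_def Z_def)
      show "continuous_on {0..1} p"
        by (intro continuous_at_imp_continuous_on) (use dp in \<open>blast intro: has_derivative_continuous\<close>)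
      show "(p has_derivative (\<lambda>u. u * (t * frechet_derivative k (at (z + s *\<^sub>R (t *\<^sub>R v))) v))) (at s)"
        if "0 < s" "s < 1" for s using dp[of s] that by simp
    qed simp
    then obtain s where s: "0 < s" "s < 1" "(\<lambda>u. u * (t * frechet_derivative k (at (z + s *\<^sub>R (t *\<^sub>R v))) v)) = (\<lambda>v. 0)"
      by auto
    from fun_cong[OF s(3), of 1] t have "frechet_derivative k (at (z + s *\<^sub>R (t *\<^sub>R v))) v = 0" by simp
    moreover have "z + s *\<^sub>R (t *\<^sub>R v) \<in> cball x r" using inb s by simp
    ultimately show False using r by auto
  qed
  ultimately have "negligible Z" by (rule negligible_disjoint_translates)
  then have "negligible (?N \<inter> ball x r)"
    by (rule negligible_subset) (auto simp: Z_def)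
  then show "\<exists>U. openin (top_of_set ?N) U \<and> x \<in> U \<and> negligible U"
    using x r by (intro exI[of _ "?N \<inter> ball x r"]) auto
qed

text \<open>Two candidates that meet at a point with different derivatives do so only on a null set.
  At any other point all candidates through the value of \<open>f\<close> share one derivative, and
  it is the derivative of \<open>f\<close>.\<close>

lemma selection_differentiable_AE:
  fixes f :: "'a::euclidean_space \<Rightarrow> real"
  assumes S: "open S" and f: "continuous_on S f" and H: "finite H"
    and sel: "\<And>y. y \<in> S \<Longrightarrow> \<exists>h\<in>H. f y = h y" and C1: "\<And>h. h \<in> H \<Longrightarrow> Ck_on 1 S h"
  shows "negligible {y\<in>S. \<not> f differentiable (at y)}"
proof (rule negligible_subset)
  define N where "N h k v = {y\<in>S. h y - k y = 0 \<and> frechet_derivative (\<lambda>y. h y - k y) (at y) v \<noteq> 0}"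
    for h k :: "'a \<Rightarrow> real" and v
  have "Ck_on 1 S (\<lambda>y. h y - k y)" if "h \<in> H" "k \<in> H" for h k
    using Ck_on_add[OF S C1[OF that(1)], of "\<lambda>y. - k y"] Ck_on_linear_comp[OF bounded_linear_minus[OF bounded_linear_ident] S C1[OF that(2)]]
    by simp
  then show "negligible (\<Union>h\<in>H. \<Union>k\<in>H. \<Union>v\<in>Basis. N h k v)"
    unfolding N_def using H
    by (intro negligible_Union ballI finite_imageI) 
      (auto intro!: negligible_Union negligible_regular_zeros[OF S] simp del: Ck_on.simps right_minus_eq)
  have d: "(h has_derivative frechet_derivative h (at y)) (at y)" if "h \<in> H" "y \<in> S" for h y
    using Ck_on_SucE[of 0 S h y] C1 that by simp
  show "{y\<in>S. \<not> f differentiable (at y)} \<subseteq> (\<Union>h\<in>H. \<Union>k\<in>H. \<Union>v\<in>Basis. N h k v)"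
  proof (rule ccontr)
    assume "\<not> ?thesis"
    then obtain y where y: "y \<in> S" "\<not> f differentiable (at y)"
      and notN: "\<And>h k v. h \<in> H \<Longrightarrow> k \<in> H \<Longrightarrow> v \<in> Basis \<Longrightarrow> y \<notin> N h k v" by blast
    obtain h0 where h0: "h0 \<in> H" "f y = h0 y" using sel y by blast
    define D where "D = frechet_derivative h0 (at y)"
    have same: "frechet_derivative k (at y) = D" if k: "k \<in> H" "k y = f y" for k
    proof -
      have dk: "((\<lambda>y. h0 y - k y) has_derivative (\<lambda>v. D v - frechet_derivative k (at y) v)) (at y)"
        unfolding D_def using d h0 k y by (intro has_derivative_diff) auto
      then have "frechet_derivative (\<lambda>y. h0 y - k y) (at y) = (\<lambda>v. D v - frechet_derivative k (at y) v)"
        by (rule frechet_derivative_at[symmetric])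
      then have "\<And>v. v \<in> Basis \<Longrightarrow> D v = frechet_derivative k (at y) v"
        using notN[OF h0(1) k(1)] h0 k y by (auto simp: N_def)
      moreover have "linear D" "linear (frechet_derivative k (at y))"
        unfolding D_def using d h0 k y has_derivative_linear by blast+
      ultimately show ?thesis by (metis linear_eq_stdbasis)
    qed
    have "(f has_derivative D) (at y)"
      unfolding has_derivative_at_alt
    proof (intro conjI allI impI)
      show "bounded_linear D" unfolding D_def using d h0 y has_derivative_bounded_linear by blast
      fix e :: real assume e: "e > 0"
      \<comment> \<open>A candidate with another value at \<open>y\<close> is not selected near
        \<open>y\<close>, by continuity, so for it the implication holds vacuously.\<close>
      have ev: "\<forall>\<^sub>F z in nhds y. f z = h z \<longrightarrow> norm (f z - f y - D (z - y)) \<le> e * norm (z - y)" if "h \<in> H" for h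
      proof (cases "h y = f y")
        case True
        have "(h has_derivative D) (at y)" using d[OF that y(1)] same[OF that True] by simp
        then obtain r where "r > 0" "\<And>z. norm (z - y) < r \<Longrightarrow> norm (h z - h y - D (z - y)) \<le> e * norm (z - y)"
          unfolding has_derivative_at_alt using e by blast
        then show ?thesis unfolding eventually_nhds_metric
          using True by (intro exI[of _ r]) (auto simp: dist_norm)
      next
        case False
        have "isCont h y" using d[OF that y(1)] has_derivative_continuous by blast
        moreover have "isCont f y" using f S y continuous_on_eq_continuous_at by blast
        ultimately have "((\<lambda>z. h z - f z) \<longlongrightarrow> h y - f y) (nhds y)"
          by (intro tendsto_diff) (auto simp: isCont_def tendsto_at_iff_tendsto_nhds)
        then have "\<forall>\<^sub>F z in nhds y. h z - f z \<noteq> 0"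
          using False by (intro tendsto_imp_eventually_ne) auto
        then show ?thesis by eventually_elim auto
      qed
      have "\<forall>\<^sub>F z in nhds y. \<forall>h\<in>H. f z = h z \<longrightarrow> norm (f z - f y - D (z - y)) \<le> e * norm (z - y)"
        using H ev by (simp add: eventually_ball_finite)
      moreover have "\<forall>\<^sub>F z in nhds y. z \<in> S" using S y eventually_nhds_in_open by blast
      ultimately have "\<forall>\<^sub>F z in nhds y. norm (f z - f y - D (z - y)) \<le> e * norm (z - y)"
        by eventually_elim (use sel in blast)
      then show "\<exists>d>0. \<forall>z. norm (z - y) < d \<longrightarrow> norm (f z - f y - D (z - y)) \<le> e * norm (z - y)"
        unfolding eventually_nhds_metric by (auto simp: dist_norm)
    qed
    then show False using y differentiableI by blast
  qed
qed

subsection \<open>Fourier series on the unit cube\<close>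

text \<open>Each derivative costs one factor of size at most \<open>norm (\<xi> j)\<close> and
  shifts the phase by \<open>pi/2\<close>, so the differentiated series is of the same kind with one
  power less to spare. The induction therefore runs over all coefficients and phases.\<close>

lemma Ck_on_cos_series:
  fixes \<xi> :: "nat \<Rightarrow> 'a::euclidean_space"
  assumes "summable (\<lambda>j. \<bar>r j\<bar> * (1 + norm (\<xi> j)) ^ k)"
  shows "Ck_on k UNIV (\<lambda>x. \<Sum>j. r j * cos (\<xi> j \<bullet> x + d))"
  using assms
proof (induction k arbitrary: r d)
  case 0
  have "uniform_limit UNIV (\<lambda>n x. \<Sum>j<n. r j * cos (\<xi> j \<bullet> x + d)) (\<lambda>x. \<Sum>j. r j * cos (\<xi> j \<bullet> x + d)) sequentially"
    by (rule Weierstrass_m_test[where M = "\<lambda>j. \<bar>r j\<bar>"]) (use 0 in \<open>auto simp: abs_mult mult_left_le\<close>)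
  then have "continuous_on UNIV (\<lambda>x. \<Sum>j. r j * cos (\<xi> j \<bullet> x + d))"
    by (rule uniform_limit_theorem[rotated]) (auto intro!: always_eventually continuous_intros)
  then show ?case by simp
next
  case (Suc k)
  define R where "R j = \<bar>r j\<bar> * (1 + norm (\<xi> j)) ^ Suc k" for j
  have R: "summable R" using Suc.prems unfolding R_def .
  have rR: "\<bar>r j\<bar> * norm (\<xi> j) \<le> R j" "\<bar>r j\<bar> \<le> R j" for j
  proof -
    have "1 + norm (\<xi> j) \<le> (1 + norm (\<xi> j)) ^ Suc k"
      using self_le_power[of "1 + norm (\<xi> j)" "Suc k"] by simp
    then have "norm (\<xi> j) \<le> (1 + norm (\<xi> j)) ^ Suc k" "1 \<le> (1 + norm (\<xi> j)) ^ Suc k"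
      using norm_ge_zero[of "\<xi> j"] by linarith+
    then show "\<bar>r j\<bar> * norm (\<xi> j) \<le> R j" "\<bar>r j\<bar> \<le> R j"
      unfolding R_def by (auto intro: mult_left_mono simp: mult_le_cancel_left1 simp del: power_Suc)
  qed
  define f' where "f' j x h = r j * (\<xi> j \<bullet> h) * cos (\<xi> j \<bullet> x + (d + pi/2))" for j and x h :: 'a
  have f'b: "\<bar>f' j x h\<bar> \<le> R j * norm h" for j x h
  proof -
    have "\<bar>f' j x h\<bar> \<le> \<bar>r j * (\<xi> j \<bullet> h)\<bar> * 1"
      unfolding f'_def abs_mult by (intro mult_left_mono) auto
    also have "\<dots> \<le> \<bar>r j\<bar> * (norm (\<xi> j) * norm h)"
      by (simp add: abs_mult mult_left_mono Cauchy_Schwarz_ineq2)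
    also have "\<dots> \<le> R j * norm h" using rR(1)[of j] by (metis mult.assoc mult_right_mono norm_ge_zero)
    finally show ?thesis .
  qed
  have f's: "summable (\<lambda>j. f' j x h)" for x h
    by (rule summable_comparison_test'[OF summable_mult2[OF R, of "norm h"], of 0]) (use f'b in auto)
  define g' where "g' x h = (\<Sum>j. f' j x h)" for x h
  have "\<exists>g. \<forall>x\<in>UNIV. (\<lambda>j. r j * cos (\<xi> j \<bullet> x + d)) sums g x \<and> (g has_derivative g' x) (at x within UNIV)"
  proof (rule has_derivative_series[where f' = f' and x = 0])
    fix n and x :: 'a
    have "- sin (\<xi> n \<bullet> x + d) = cos (\<xi> n \<bullet> x + (d + pi/2))"
      using cos_add[of "\<xi> n \<bullet> x + d" "pi/2"] by (simp add: add.assoc)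
    then show "((\<lambda>x. r n * cos (\<xi> n \<bullet> x + d)) has_derivative f' n x) (at x within UNIV)"
      unfolding f'_def by (auto intro!: derivative_eq_intros simp: fun_eq_iff)
  next
    fix e :: real assume e: "e > 0"
    have "(\<lambda>n. \<Sum>j. R (j + n)) \<longlonglongrightarrow> 0"
      by (rule suminf_exist_split2[OF R])
    then have "\<forall>\<^sub>F n in sequentially. (\<Sum>j. R (j + n)) < e" using e by (rule order_tendstoD)
    then show "\<forall>\<^sub>F n in sequentially. \<forall>x\<in>UNIV. \<forall>h. norm ((\<Sum>i<n. f' i x h) - g' x h) \<le> e * norm h"
    proof eventually_elim
      case (elim n)
      show ?case
      proof (intro ballI allI)
        fix x h :: 'a
        have R': "summable (\<lambda>j. R (j + n) * norm h)" using summable_ignore_initial_segment[OF R] summable_mult2 by blast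
        have "g' x h = (\<Sum>j. f' (j + n) x h) + (\<Sum>i<n. f' i x h)"
          unfolding g'_def by (rule suminf_split_initial_segment[OF f's])
        then have "norm ((\<Sum>i<n. f' i x h) - g' x h) = \<bar>\<Sum>j. f' (j + n) x h\<bar>" by simp
        also have "\<dots> \<le> (\<Sum>j. R (j + n) * norm h)"
          using norm_suminf_le[of "\<lambda>j. f' (j + n) x h" "\<lambda>j. R (j + n) * norm h"] f'b R' by simp
        also have "\<dots> = (\<Sum>j. R (j + n)) * norm h"
          by (rule suminf_mult2[symmetric, OF summable_ignore_initial_segment[OF R]])
        also have "\<dots> \<le> e * norm h" using elim by (intro mult_right_mono) auto
        finally show "norm ((\<Sum>i<n. f' i x h) - g' x h) \<le> e * norm h" .
      qed
    qed
  next
    have "summable (\<lambda>j. r j * cos (\<xi> j \<bullet> 0 + d))"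
      by (rule summable_comparison_test'[OF R, of 0])
        (use rR(2) in \<open>auto simp: abs_mult intro: order_trans[OF mult_left_le]\<close>)
    then show "(\<lambda>j. r j * cos (\<xi> j \<bullet> 0 + d)) sums (\<Sum>j. r j * cos (\<xi> j \<bullet> 0 + d))" by (rule summable_sums)
  qed auto
  then obtain g where g: "\<And>x. (\<lambda>j. r j * cos (\<xi> j \<bullet> x + d)) sums g x" "\<And>x. (g has_derivative g' x) (at x)"
    by auto
  have geq: "(\<lambda>x. \<Sum>j. r j * cos (\<xi> j \<bullet> x + d)) = g"
    by (rule ext) (rule sums_unique[OF g(1), symmetric])
  show ?case
    unfolding geq
  proof (rule Ck_on_SucI[OF open_UNIV g(2)])
    fix v
    have "summable (\<lambda>j. \<bar>r j * (\<xi> j \<bullet> v)\<bar> * (1 + norm (\<xi> j)) ^ k)"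
    proof (rule summable_comparison_test'[OF summable_mult2[OF R, of "norm v"], of 0])
      fix j
      have "\<bar>r j * (\<xi> j \<bullet> v)\<bar> \<le> \<bar>r j\<bar> * ((1 + norm (\<xi> j)) * norm v)"
        unfolding abs_mult
        by (intro mult_left_mono order_trans[OF Cauchy_Schwarz_ineq2] mult_right_mono) auto
      then have "\<bar>r j * (\<xi> j \<bullet> v)\<bar> * (1 + norm (\<xi> j)) ^ k \<le> \<bar>r j\<bar> * ((1 + norm (\<xi> j)) * norm v) * (1 + norm (\<xi> j)) ^ k"
        by (intro mult_right_mono) auto
      then show "norm (\<bar>r j * (\<xi> j \<bullet> v)\<bar> * (1 + norm (\<xi> j)) ^ k) \<le> R j * norm v"
        by (simp add: R_def abs_mult mult_ac)
    qed
    from Suc.IH[OF this, of "d + pi/2"] show "Ck_on k UNIV (\<lambda>x. g' x v)"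
      unfolding g'_def f'_def .
  qed
qed

section \<open>Lattice frequencies and orthogonality on the unit cube\<close>

definition freq :: "int ^ 'n \<Rightarrow> real ^ 'n" where
  "freq k = (\<chi> i. 2 * pi * of_int (k $ i))"

lemma freq_add: "freq (k + l) = freq k + freq l"
  and freq_diff: "freq (k - l) = freq k - freq l"
  and freq_zero [simp]: "freq 0 = 0"
  by (auto simp: freq_def vec_eq_iff algebra_simps)

text \<open>The weight is a product over the coordinates, so its sum over a box is a product of
  one-dimensional sums. The factor \<open>2\<close> accounts for the two signs of an
  integer.\<close>

lemma lattice_weight_bounded:
  fixes F :: "(int ^ 'n) set"
  assumes "finite F"
  shows "(\<Sum>k\<in>F. \<Prod>i\<in>UNIV. inverse ((1 + \<bar>real_of_int (k $ i)\<bar>) ^ 2)) \<le> (2 * (\<Sum>m. inverse (real (Suc m) ^ 2))) ^ CARD('n)"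
proof -
  define w where "w m = inverse ((1 + \<bar>real_of_int m\<bar>) ^ 2)" for m :: int
  have s: "summable (\<lambda>m. inverse (real (Suc m) ^ 2))"
    using inverse_power_summable[of 2, where 'a = real] by (subst summable_Suc_iff) simp
  define B where "B = Max (insert 0 ((\<lambda>(k, i). \<bar>k $ i\<bar>) ` (F \<times> UNIV)))"
  have B: "\<bar>k $ i\<bar> \<le> B" if "k \<in> F" for k i
    unfolding B_def using assms that by (intro Max_ge) force+
  have B0: "B \<ge> 0" unfolding B_def using assms by (intro Max_ge) auto
  have w1: "(\<Sum>m\<in>{-B..B}. w m) \<le> 2 * (\<Sum>m. inverse (real (Suc m) ^ 2))"
  proof -
    have "(\<Sum>m\<in>{-B..B}. w m) \<le> (\<Sum>m\<in>{0..B}. w m) + (\<Sum>m\<in>uminus ` {0..B}. w m)"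
    proof -
      have "{-B..B} \<subseteq> {0..B} \<union> uminus ` {0..B}"
      proof
        fix m assume "m \<in> {-B..B}"
        then show "m \<in> {0..B} \<union> uminus ` {0..B}"
          by (cases "m \<ge> 0") (auto intro!: image_eqI[where x = "-m"])
      qed
      then have "(\<Sum>m\<in>{-B..B}. w m) \<le> (\<Sum>m\<in>{0..B} \<union> uminus ` {0..B}. w m)"
        by (intro sum_mono2) (auto simp: w_def)
      also have "\<dots> \<le> (\<Sum>m\<in>{0..B}. w m) + (\<Sum>m\<in>uminus ` {0..B}. w m)"
        by (subst sum_Un) (auto simp: w_def intro: sum_nonneg)
      finally show ?thesis .
    qed
    also have "(\<Sum>m\<in>uminus ` {0..B}. w m) = (\<Sum>m\<in>{0..B}. w m)"
      by (subst sum.reindex) (auto simp: w_def inj_on_def)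
    also have "(\<Sum>m\<in>{0..B}. w m) = (\<Sum>m\<in>int ` {0..nat B}. w m)"
    proof -
      have "{0..B} = int ` {0..nat B}" using B0 by (simp add: image_int_atLeastAtMost)
      then show ?thesis by simp
    qed
    also have "\<dots> = (\<Sum>m\<in>{0..nat B}. inverse (real (Suc m) ^ 2))"
      by (subst sum.reindex) (auto simp: w_def inj_on_def)
    also have "\<dots> \<le> (\<Sum>m. inverse (real (Suc m) ^ 2))"
      by (rule sum_le_suminf[OF s]) auto
    finally show ?thesis by simp
  qed
  have "(\<Sum>k\<in>F. \<Prod>i\<in>UNIV. w (k $ i)) = (\<Sum>f\<in>(\<lambda>k. ($) k) ` F. \<Prod>i\<in>UNIV. w (f i))"
    by (subst sum.reindex) (auto simp: inj_on_def vec_eq_iff)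
  also have "\<dots> \<le> (\<Sum>f\<in>PiE (UNIV :: 'n set) (\<lambda>_. {-B..B}). \<Prod>i\<in>UNIV. w (f i))"
  proof (rule sum_mono2)
    have "k $ i \<in> {-B..B}" if "k \<in> F" for k i
      using B[OF that, of i] by auto
    then show "($) ` F \<subseteq> UNIV \<rightarrow>\<^sub>E {- B..B}" by auto
  qed (auto simp: w_def intro!: prod_nonneg finite_PiE)
  also have "\<dots> = (\<Prod>i\<in>(UNIV::'n set). \<Sum>m\<in>{-B..B}. w m)"
    by (rule prod_sum_PiE[symmetric]) auto
  also have "\<dots> = (\<Sum>m\<in>{-B..B}. w m) ^ CARD('n)" by simp
  also have "\<dots> \<le> (2 * (\<Sum>m. inverse (real (Suc m) ^ 2))) ^ CARD('n)"
    using w1 by (intro power_mono) (auto simp: w_def intro: sum_nonneg)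
  finally show ?thesis by (simp add: w_def)
qed

text \<open>A period cell for the frequencies \<open>freq k\<close>, centred so that the ball of
  radius \<open>1/8\<close> about the origin lies well inside.\<close>

definition unit_cube :: "(real ^ 'n) set" where
  "unit_cube = cbox (\<chi> i. -1/2) (\<chi> i. 1/2)"

lemma mem_unit_cube: "x \<in> unit_cube \<longleftrightarrow> (\<forall>i. \<bar>x $ i\<bar> \<le> 1/2)"
proof -
  have "\<bar>t\<bar> \<le> 1/2 \<longleftrightarrow> -1/2 \<le> t \<and> t \<le> 1/2" for t :: real by auto
  then show ?thesis by (simp add: unit_cube_def mem_box_cart)
qed

lemma compact_unit_cube: "compact (unit_cube :: (real ^ 'n) set)" by (simp add: unit_cube_def)

lemma borel_unit_cube [measurable]: "unit_cube \<in> sets borel" by (simp add: unit_cube_def)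

abbreviation cube_measure :: "(real ^ 'n) measure" where
  "cube_measure \<equiv> density lborel (\<lambda>x. ennreal (indicator unit_cube x))"

lemma integral_cube: 
  fixes f :: "real ^ 'n \<Rightarrow> real"
  assumes [measurable]: "f \<in> borel_measurable borel"
  shows "(\<integral>x. f x \<partial>cube_measure) = (\<integral>x. indicator unit_cube x * f x \<partial>lborel)"
  by (subst integral_density) auto

lemma finite_cube_measure: "finite_measure (cube_measure :: (real ^ 'n) measure)"
proof
  have "emeasure (cube_measure :: (real ^ 'n) measure) UNIV = emeasure lborel (unit_cube :: (real ^ 'n) set)"
    by (subst emeasure_density) (auto simp: ennreal_indicator)
  also have "\<dots> < \<infinity>" by (rule emeasure_bounded_finite) (simp add: unit_cube_def)
  finally show "emeasure (cube_measure :: (real ^ 'n) measure) (space cube_measure) \<noteq> \<infinity>" by simp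
qed

lemma integrable_cube_bounded:
  fixes f :: "real ^ 'n \<Rightarrow> real"
  assumes "f \<in> borel_measurable borel" "\<And>x. \<bar>f x\<bar> \<le> B"
  shows "integrable cube_measure f"
  by (rule finite_measure.integrable_const_bound[OF finite_cube_measure, where B = B]) (use assms in auto)

lemma integral_cis_interval:
  "(\<integral>t. indicator {-1/2..1/2::real} t *\<^sub>R cis (2 * pi * real_of_int m * t) \<partial>lborel) = (if m = 0 then 1 else 0)"
proof (cases "m = 0")
  case True
  then show ?thesis by (simp add: cis_zero)
next
  case False
  define c where "c = 2 * pi * real_of_int m"
  have c: "c \<noteq> 0" using False by (simp add: c_def)
  have "(\<integral>t. indicator {-1/2..1/2} t *\<^sub>R cis (c * t) \<partial>lborel) = cis (c * (1/2)) / (\<i> * c) - cis (c * (-1/2)) / (\<i> * c)"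
  proof (rule integral_FTC_Icc)
    fix x :: real
    show "((\<lambda>t. cis (c * t) / (\<i> * c)) has_vector_derivative cis (c * x)) (at x within {-1/2..1/2})"
    proof -
      have "((\<lambda>z. exp (\<i> * c * z) / (\<i> * c)) has_field_derivative exp (\<i> * c * of_real x)) (at (of_real x))"
        using c by (auto intro!: derivative_eq_intros)
      from has_vector_derivative_real_field[OF this]
      show ?thesis by (simp add: cis_conv_exp mult.assoc has_vector_derivative_at_within)
    qed
  qed (auto intro!: continuous_intros)
  also have "cis (c * (1/2)) = cis (c * (-1/2))"
  proof -
    have "cis (c * (1/2)) = cis (c * (-1/2)) * cis c" by (simp add: cis_mult)
    also have "cis c = 1" unfolding c_def by (simp add: complex_eq_iff)
    finally show ?thesis by simp
  qed
  finally show ?thesis using False by (simp add: c_def)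
qed

text \<open>The complex exponential is a product over the coordinates, so Fubini reduces the
  integral to one variable. Multiplying by \<open>cis d\<close> before taking real parts brings in
  the phase.\<close>

lemma integral_cube_cos:
  fixes k :: "int ^ 'n"
  shows "(\<integral>x. cos (freq k \<bullet> x + d) \<partial>cube_measure) = (if k = 0 then cos d else 0)"
proof -
  interpret product_sigma_finite "\<lambda>_::real ^ 'n. lborel :: real measure" ..
  define e where "e b t = indicator {-1/2..1/2::real} t *\<^sub>R cis ((freq k \<bullet> b) * t)" for b :: "real ^ 'n" and t :: real
  define E where "E x = (\<Prod>b\<in>Basis. e b (x \<bullet> b))" for x :: "real ^ 'n"
  have [measurable]: "(\<lambda>t. cis (c * t)) \<in> borel_measurable borel" for c
    by (intro borel_measurable_continuous_onI continuous_intros)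
  have [measurable]: "e b \<in> borel_measurable borel" for b unfolding e_def by measurable
  have [measurable]: "E \<in> borel_measurable borel" unfolding E_def by measurable
  have eint: "integrable lborel (e b)" for b
    unfolding e_def by (rule borel_integrable_compact) (auto intro!: continuous_intros)
  have 1: "(\<integral>x. E x \<partial>lborel) = (\<Prod>b\<in>Basis. \<integral>t. e b t \<partial>lborel)"
  proof -
    have "(\<integral>x. E x \<partial>lborel) = (\<integral>f. E (\<Sum>b\<in>Basis. f b *\<^sub>R b) \<partial>(\<Pi>\<^sub>M b\<in>Basis. lborel))"
      by (subst lborel_eq, subst integral_distr) auto
    also have "\<dots> = (\<integral>f. (\<Prod>b\<in>Basis. e b (f b)) \<partial>(\<Pi>\<^sub>M b\<in>Basis. lborel))"
      unfolding E_def by (intro Bochner_Integration.integral_cong prod.cong) (auto simp: inner_sum_left_Basis)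
    also have "\<dots> = (\<Prod>b\<in>Basis. \<integral>t. e b t \<partial>lborel)"
      by (rule product_integral_prod) (use eint in auto)
    finally show ?thesis .
  qed
  have Eint: "integrable lborel E"
  proof -
    have "integrable (\<Pi>\<^sub>M b\<in>Basis. lborel) (\<lambda>f. \<Prod>b\<in>Basis. e b (f b))"
      by (rule product_integrable_prod) (use eint in auto)
    then have "integrable (\<Pi>\<^sub>M b\<in>Basis. lborel) (\<lambda>f. E (\<Sum>b\<in>Basis. f b *\<^sub>R b))"
      unfolding E_def by (rule Bochner_Integration.integrable_cong[THEN iffD1, rotated -1])
        (auto simp: inner_sum_left_Basis)
    then show ?thesis by (subst lborel_eq, subst integrable_distr_eq) auto
  qed
  have E: "E x = indicator unit_cube x *\<^sub>R cis (freq k \<bullet> x)" for x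
  proof -
    have "E x = (\<Prod>b\<in>Basis. indicator {-1/2..1/2} (x \<bullet> b)) *\<^sub>R (\<Prod>b\<in>Basis. cis ((freq k \<bullet> b) * (x \<bullet> b)))"
      unfolding E_def e_def scaleR_conv_of_real by (simp add: prod.distrib)
    also have "(\<Prod>b\<in>Basis. cis ((freq k \<bullet> b) * (x \<bullet> b))) = cis (\<Sum>b\<in>Basis. (freq k \<bullet> b) * (x \<bullet> b))"
      by (induction rule: infinite_finite_induct) (auto simp: cis_mult cis_zero)
    also have "(\<Sum>b\<in>Basis. (freq k \<bullet> b) * (x \<bullet> b)) = freq k \<bullet> x"
      by (rule euclidean_inner[symmetric])
    also have "(\<Prod>b\<in>Basis. indicator {-1/2..1/2} (x \<bullet> b)) = (indicator unit_cube x :: real)"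
    proof (cases "x \<in> unit_cube")
      case True
      then have "x $ i \<in> {-1/2..1/2}" for i by (auto simp: unit_cube_def mem_box_cart)
      then show ?thesis using True by (auto simp: Basis_vec_def inner_axis intro!: prod.neutral)
    next
      case False
      then obtain i where "\<not> \<bar>x $ i\<bar> \<le> 1/2" by (auto simp: mem_unit_cube)
      then have "indicator {-1/2..1/2} (x \<bullet> axis i 1) = (0::real)"
        by (auto simp: inner_axis indicator_def)
      moreover have "axis i 1 \<in> (Basis :: (real ^ 'n) set)" by (simp add: axis_in_Basis_iff)
      ultimately have "(\<Prod>b\<in>Basis. indicator {-1/2..1/2} (x \<bullet> b)) = (0::real)"
        by (intro prod_zero) auto
      then show ?thesis using False by simp
    qed
    finally show ?thesis .
  qed
  have "(\<integral>x. E x \<partial>lborel) = (if k = 0 then 1 else 0)"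
  proof -
    have "(\<integral>t. e (axis i 1) t \<partial>lborel) = (if k $ i = 0 then 1 else 0)" for i
      unfolding e_def using integral_cis_interval[of "k $ i"] by (simp add: inner_axis freq_def)
    then have "(\<integral>x. E x \<partial>lborel) = (\<Prod>i\<in>UNIV. if k $ i = 0 then 1 else 0)"
      unfolding 1 Basis_vec_def by (simp add: UNION_singleton_eq_range prod.reindex inj_on_def axis_eq_axis o_def)
    also have "\<dots> = (if k = 0 then 1 else 0)"
    proof (cases "k = 0")
      case False
      then obtain i where "k $ i \<noteq> 0" by (auto simp: vec_eq_iff)
      then show ?thesis using False by (auto intro!: prod_zero)
    qed simp
    finally show ?thesis .
  qed
  then have 2: "Re (cis d * (\<integral>x. E x \<partial>lborel)) = (if k = 0 then cos d else 0)" by simp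
  have ReE: "Re (cis d * E x) = indicator unit_cube x * cos (freq k \<bullet> x + d)" for x
    unfolding E by (simp add: cos_add algebra_simps)
  have "(\<integral>x. cos (freq k \<bullet> x + d) \<partial>cube_measure) = (\<integral>x. Re (cis d * E x) \<partial>lborel)"
    unfolding ReE by (rule integral_cube) simp
  also have "\<dots> = Re (\<integral>x. cis d * E x \<partial>lborel)"
    using Eint by (intro integral_Re) auto
  also have "(\<integral>x. cis d * E x \<partial>lborel) = cis d * (\<integral>x. E x \<partial>lborel)"
    by (rule Bochner_Integration.integral_mult_right) (use Eint in auto)
  finally show ?thesis unfolding 2 .
qed

text \<open>Cosines with arbitrary phase already contain the sines and, at frequency zero, the
  constants, so one kind of generator is enough.\<close>

inductive trig_poly :: "(real ^ 'n \<Rightarrow> real) \<Rightarrow> bool" where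
  trig_cos: "trig_poly (\<lambda>x. cos (freq k \<bullet> x + d))"
| trig_add: "trig_poly f \<Longrightarrow> trig_poly h \<Longrightarrow> trig_poly (\<lambda>x. f x + h x)"
| trig_scale: "trig_poly f \<Longrightarrow> trig_poly (\<lambda>x. c * f x)"

lemma trig_poly_const: "trig_poly (\<lambda>x. c)"
  using trig_scale[OF trig_cos[of 0 0], of c] by simp

text \<open>The product of two cosines is half the sum of the cosines at the difference and the sum
  of the frequencies, and these stay in the lattice.\<close>

lemma trig_poly_mult:
  assumes "trig_poly f" "trig_poly h" shows "trig_poly (\<lambda>x. f x * h x)"
  using assms(1)
proof induction
  case (trig_cos k d)
  show ?case
    using assms(2)
  proof induction
    case (trig_cos l e)
    have *: "cos (freq k \<bullet> x + d) * cos (freq l \<bullet> x + e)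
      = (1/2) * (cos (freq (k - l) \<bullet> x + (d - e)) + cos (freq (k + l) \<bullet> x + (d + e)))" for x
      by (simp add: cos_times_cos freq_add freq_diff inner_add_left inner_diff_left algebra_simps)
    show ?case
      unfolding * by (rule trig_poly.trig_scale[OF trig_poly.trig_add[OF trig_poly.trig_cos trig_poly.trig_cos]])
  next
    case (trig_add f h)
    then show ?case using trig_poly.trig_add by (simp add: distrib_left)
  next
    case (trig_scale f c)
    then show ?case using trig_poly.trig_scale[OF trig_scale.IH, of c] by (simp add: mult.left_commute)
  qed
next
  case (trig_add f h)
  then show ?case using trig_poly.trig_add by (simp add: distrib_right)
next
  case (trig_scale f c)
  then show ?case using trig_poly.trig_scale[OF trig_scale.IH, of c] by (simp add: mult.assoc)
qed

lemma trig_poly_continuous: "trig_poly f \<Longrightarrow> continuous_on UNIV f"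
  by (induction rule: trig_poly.induct) (auto intro!: continuous_intros)

definition torus_map :: "real ^ 'n \<Rightarrow> (real ^ 'n) \<times> (real ^ 'n)" where
  "torus_map x = (\<chi> i. cos (2 * pi * x $ i), \<chi> i. sin (2 * pi * x $ i))"

lemma trig_poly_coord:
  fixes i :: "'n::finite"
  shows "trig_poly (\<lambda>x. fst (torus_map x) $ i)" "trig_poly (\<lambda>x. snd (torus_map x) $ i)"
proof -
  let ?ax = "axis i 1 :: int ^ 'n"
  have f: "freq ?ax \<bullet> x = 2 * pi * x $ i" for x :: "real ^ 'n"
  proof -
    have "freq ?ax = (2 * pi) *\<^sub>R axis i 1"
      by (auto simp: freq_def vec_eq_iff axis_def)
    then show ?thesis by (simp add: inner_axis' )
  qed
  show "trig_poly (\<lambda>x. fst (torus_map x) $ i)"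
    using trig_cos[of "axis i 1" 0] by (simp add: f torus_map_def)
  have "cos (freq ?ax \<bullet> x + (- pi/2)) = sin (2 * pi * x $ i)" for x :: "real ^ 'n"
    by (simp add: f cos_diff)
  then show "trig_poly (\<lambda>x. snd (torus_map x) $ i)"
    using trig_cos[of "axis i 1" "-pi/2"] by (simp add: torus_map_def)
qed

text \<open>The left inverse of the torus map on small vectors is given by the arcsine; the cutoff in the
  cosines removes the other preimages of the sines.\<close>

lemma trig_poly_approx:
  fixes h :: "real ^ 'n \<Rightarrow> real"
  assumes h: "continuous_on UNIV h" "\<And>x. x \<notin> ball 0 (1/8) \<Longrightarrow> h x = 0" and e: "e > 0"
  obtains p where "trig_poly p" "\<And>x. x \<in> unit_cube \<Longrightarrow> \<bar>h x - p x\<bar> < e"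
proof -
  \<comment> \<open>Stone-Weierstrass is applied on the image of the cube in the torus, where the
    coordinates separate points; periodic functions cannot separate opposite faces of the cube
    itself.\<close>
  define S where "S = torus_map ` (unit_cube :: (real ^ 'n) set)"
  have Tc: "continuous_on UNIV (torus_map :: real ^ 'n \<Rightarrow> _)"
    unfolding torus_map_def by (intro continuous_intros)
  have S: "compact S"
    unfolding S_def by (intro compact_continuous_image compact_unit_cube continuous_on_subset[OF Tc]) auto
  define R where "R = {f. continuous_on S f \<and> trig_poly (\<lambda>x. f (torus_map x))}"
  interpret function_ring_on R S
  proof
    show "compact S" by fact
  next
    fix x y assume "x \<in> S" "y \<in> S" "x \<noteq> y"
    then obtain i where "fst x $ i \<noteq> fst y $ i \<or> snd x $ i \<noteq> snd y $ i"
      by (metis prod_eqI vec_eq_iff)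
    moreover have "(\<lambda>z. fst z $ i) \<in> R" "(\<lambda>z. snd z $ i) \<in> R"
      unfolding R_def using trig_poly_coord by (auto intro!: continuous_intros)
    ultimately show "\<exists>f\<in>R. f x \<noteq> f y"
      using bexI[of "\<lambda>f. f x \<noteq> f y" "\<lambda>z. fst z $ i" R] bexI[of "\<lambda>f. f x \<noteq> f y" "\<lambda>z. snd z $ i" R]
      by argo
  qed (auto simp: R_def intro!: continuous_intros trig_poly_const trig_add trig_poly_mult)
  define H where "H z = h (\<chi> i. arcsin (snd z $ i) / (2 * pi)) * (\<Prod>i\<in>UNIV. min 1 (max 0 (fst z $ i) / cos (pi/4)))"
    for z :: "(real ^ 'n) \<times> (real ^ 'n)"
  have "continuous_on S H"
    unfolding H_def
  proof (intro continuous_intros continuous_on_compose2[OF h(1)])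
    fix i
    show "\<forall>z\<in>S. - 1 \<le> snd z $ i \<and> snd z $ i \<le> 1" by (auto simp: S_def torus_map_def)
  qed (auto simp: cos_45)
  from Stone_Weierstrass_basic[OF this e] obtain f where f: "f \<in> R" "\<And>z. z \<in> S \<Longrightarrow> \<bar>H z - f z\<bar> < e"
    by blast
  have arc: "arcsin (sin (2 * pi * t)) / (2 * pi) = t" if "\<bar>t\<bar> \<le> 1/4" for t
  proof -
    have "\<bar>t\<bar> * (2 * pi) \<le> (1/4) * (2 * pi)" using that by (intro mult_right_mono) auto
    then have "\<bar>2 * pi * t\<bar> \<le> pi/2" by (simp add: abs_mult)
    then have "- (pi/2) \<le> 2 * pi * t" "2 * pi * t \<le> pi/2" by linarith+
    then show ?thesis by (simp add: arcsin_sin)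
  qed
  have HT: "H (torus_map x) = h x" if x: "x \<in> unit_cube" for x
  proof (cases "\<forall>i. \<bar>x $ i\<bar> < 1/4")
    case True
    then have inv: "(\<chi> i. arcsin (snd (torus_map x) $ i) / (2 * pi)) = x"
      using arc by (auto simp: torus_map_def vec_eq_iff less_imp_le)
    show ?thesis
    proof (cases "x \<in> ball 0 (1/8)")
      case True
      \<comment> \<open>In the ball of radius \<open>1/8\<close> the angles are at most
        \<open>pi/4\<close>, so every factor is cut down to \<open>1\<close>. If instead some
        coordinate is at least \<open>1/4\<close> in absolute value, its cosine is not positive and
        the product vanishes.\<close>
      have "min 1 (max 0 (cos (2 * pi * x $ i)) / cos (pi/4)) = 1" for i
      proof -
        have "\<bar>x $ i\<bar> \<le> 1/8" using True component_le_norm_cart[of x i] by auto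
        then have "\<bar>2 * pi * x $ i\<bar> \<le> pi/4" by (simp add: abs_mult field_simps)
        then have "cos (pi/4) \<le> cos \<bar>2 * pi * x $ i\<bar>"
          by (intro cos_monotone_0_pi_le) auto
        then have "cos (pi/4) \<le> cos (2 * pi * x $ i)" by (simp only: cos_abs_real)
        moreover have "cos (pi/4) > 0" by (simp add: cos_45)
        ultimately have "1 \<le> max 0 (cos (2 * pi * x $ i)) / cos (pi/4)"
          by (simp add: le_divide_eq)
        then show ?thesis by simp
      qed
      then show ?thesis unfolding H_def inv by (simp add: torus_map_def)
    next
      case False
      then show ?thesis unfolding H_def inv using h(2) by simp
    qed
  next
    case False
    then obtain i where i: "\<bar>x $ i\<bar> \<ge> 1/4" by (meson not_less)
    have "norm x \<ge> 1/4" using i component_le_norm_cart[of x i] by linarith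
    then have "h x = 0" using h(2) by auto
    have "\<bar>x $ i\<bar> \<le> 1/2" using x by (simp add: mem_unit_cube)
    then have "pi/2 \<le> \<bar>2 * pi * x $ i\<bar>" "\<bar>2 * pi * x $ i\<bar> \<le> pi"
      using i by (auto simp: abs_mult field_simps)
    then have "cos \<bar>2 * pi * x $ i\<bar> \<le> cos (pi/2)" by (intro cos_monotone_0_pi_le) auto
    then have "max 0 (cos (2 * pi * x $ i)) = 0" by (simp only: cos_abs_real cos_pi_half max_absorb1)
    then have "(\<Prod>i\<in>UNIV. min 1 (max 0 (cos (2 * pi * x $ i)) / cos (pi/4))) = 0"
      by (intro prod_zero bexI[of _ i]) auto
    then show ?thesis unfolding H_def using \<open>h x = 0\<close> by (simp add: torus_map_def)
  qed
  show thesis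
  proof (rule that[of "\<lambda>x. f (torus_map x)"])
    show "trig_poly (\<lambda>x. f (torus_map x))" using f by (simp add: R_def)
    show "\<bar>h x - f (torus_map x)\<bar> < e" if "x \<in> unit_cube" for x
      using f(2)[of "torus_map x"] HT[OF that] that by (auto simp: S_def)
  qed
qed

lemma AE_cube_measure: 
  "(AE x in cube_measure. P x) \<longleftrightarrow> (AE x in (lborel :: (real ^ 'n) measure). x \<in> unit_cube \<longrightarrow> P x)"
  by (subst AE_density) (auto simp: ennreal_indicator indicator_def)

text \<open>Orthogonality passes from cosines to trigonometric polynomials, by uniform approximation
  to continuous functions supported in the small ball, and by dominated convergence to indicators of
  compact subsets. Inner regularity then shows that the sets where \<open>G\<close> is positive or
  negative are null.\<close>

lemma fourier_uniqueness:
  fixes G :: "real ^ 'n \<Rightarrow> real"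
  assumes [measurable]: "G \<in> borel_measurable borel" and B: "\<And>x. \<bar>G x\<bar> \<le> B"
    and z: "\<And>k d. (\<integral>x. G x * cos (freq k \<bullet> x + d) \<partial>cube_measure) = 0"
  shows "AE x in lborel. x \<in> ball 0 (1/8) \<longrightarrow> G x = 0"
proof -
  interpret cm: finite_measure "cube_measure :: (real ^ 'n) measure" by (rule finite_cube_measure)
  have B0: "B \<ge> 0" using B[of 0] by simp
  have AEc: "AE x in cube_measure. x \<in> (unit_cube :: (real ^ 'n) set)" by (simp add: AE_cube_measure)
  have bI: "integrable cube_measure f"
    if [measurable]: "f \<in> borel_measurable borel" and "\<And>x. x \<in> unit_cube \<Longrightarrow> \<bar>f x\<bar> \<le> C" for f :: "real ^ 'n \<Rightarrow> real" and C
    by (rule cm.integrable_const_bound[where B = C]) (use that AEc in \<open>auto elim!: eventually_mono\<close>)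
  have int_trig: "(\<integral>x. G x * p x \<partial>cube_measure) = 0 \<and> integrable cube_measure (\<lambda>x. G x * p x)" if "trig_poly p" for p
    using that
  proof induction
    case (trig_cos k d)
    have "\<bar>G x * cos (freq k \<bullet> x + d)\<bar> \<le> B" for x
      unfolding abs_mult using B[of x] by (intro order_trans[OF mult_left_le]) auto
    then show ?case using z by (auto intro!: bI)
  qed (auto simp: distrib_left mult.left_commute)
  have cont0: "(\<integral>x. G x * h x \<partial>cube_measure) = 0"
    if hc: "continuous_on UNIV h" and h0: "\<And>x. x \<notin> ball 0 (1/8) \<Longrightarrow> h x = 0" for h
  proof (rule ccontr)
    assume ne: "(\<integral>x. G x * h x \<partial>cube_measure) \<noteq> 0"
    define M where "M = measure (cube_measure :: (real ^ 'n) measure) UNIV"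
    \<comment> \<open>An approximation error below \<open>e\<close> changes the integral by at most
      \<open>B * e * M\<close>, which is less than its assumed absolute value
      \<open>e * (B * M + 1)\<close>.\<close>
    define e where "e = \<bar>\<integral>x. G x * h x \<partial>cube_measure\<bar> / (B * M + 1)"
    have M0: "B * M + 1 > 0" using B0 unfolding M_def by (simp add: add_nonneg_pos)
    then have e: "e > 0" using ne by (simp add: e_def)
    obtain p where p: "trig_poly p" "\<And>x. x \<in> unit_cube \<Longrightarrow> \<bar>h x - p x\<bar> < e"
      using trig_poly_approx[OF hc h0 e] by blast
    have [measurable]: "h \<in> borel_measurable borel" "p \<in> borel_measurable borel"
      using hc trig_poly_continuous[OF p(1)] by (auto intro: borel_measurable_continuous_onI)
    have bd: "\<bar>G x * (h x - p x)\<bar> \<le> B * e" if "x \<in> unit_cube" for x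
      unfolding abs_mult using B[of x] p(2)[OF that] B0 by (intro mult_mono) auto
    have i1: "integrable cube_measure (\<lambda>x. G x * (h x - p x))"
      by (rule bI[OF _ bd]) auto
    have "integrable cube_measure (\<lambda>x. G x * (h x - p x) + G x * p x)"
      using i1 int_trig[OF p(1)] by auto
    have "(\<integral>x. G x * h x \<partial>cube_measure) = (\<integral>x. G x * (h x - p x) + G x * p x \<partial>cube_measure)"
      by (simp add: algebra_simps)
    also have "\<dots> = (\<integral>x. G x * (h x - p x) \<partial>cube_measure)"
      using i1 int_trig[OF p(1)] by simp
    finally have "\<bar>\<integral>x. G x * h x \<partial>cube_measure\<bar> = \<bar>\<integral>x. G x * (h x - p x) \<partial>cube_measure\<bar>" by simp
    also have "\<dots> \<le> (\<integral>x. \<bar>G x * (h x - p x)\<bar> \<partial>cube_measure)" by (rule integral_abs_bound)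
    also have "\<dots> \<le> (\<integral>x. B * e \<partial>(cube_measure :: (real ^ 'n) measure))"
      by (rule integral_mono_AE) (use i1 AEc bd in \<open>auto elim!: eventually_mono\<close>)
    also have "\<dots> = B * e * M" by (simp add: M_def)
    finally have "e * (B * M + 1) \<le> B * e * M" using M0 by (simp add: e_def)
    then show False using e by (simp add: algebra_simps)
  qed
  have K0: "(\<integral>x. G x * indicator K x \<partial>cube_measure) = 0" if K: "compact K" "K \<subseteq> ball 0 (1/8)" "K \<noteq> {}" for K
  proof -
    obtain r where r: "0 < r" "r < 1/8" "K \<subseteq> cball 0 r"
    proof -
      obtain y where y: "y \<in> K" "\<And>x. x \<in> K \<Longrightarrow> dist 0 x \<le> dist 0 y"
        using distance_attains_sup[OF K(1,3), of 0] by blast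
      have "norm y < 1/8" using y(1) K(2) by auto
      moreover have "norm x \<le> (norm y + 1/8) / 2" if "x \<in> K" for x
        using y(2)[OF that] \<open>norm y < 1/8\<close> by simp
      ultimately show thesis by (intro that[of "(norm y + 1/8) / 2"]) (auto intro: add_nonneg_pos)
    qed
    \<comment> \<open>The hat functions below vanish at distance \<open>1 / (m + N)\<close> from
      \<open>K\<close>; this \<open>N\<close> keeps them zero outside the ball even for
      \<open>m = 0\<close>.\<close>
    obtain N where N: "1 / (1/8 - r) < real N" using reals_Archimedean2 by blast
    define h where "h m x = max 0 (1 - real (m + N) * infdist x K)" for m x
    have hc: "continuous_on UNIV (h m)" for m unfolding h_def by (intro continuous_intros)
    have h0: "h m x = 0" if "x \<notin> ball 0 (1/8)" for m x
    proof -
      have "infdist x K \<ge> 1/8 - r"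
        unfolding infdist_notempty[OF K(3)]
      proof (rule cINF_greatest[OF K(3)])
        fix y assume "y \<in> K"
        then have "norm y \<le> r" using r by auto
        then show "1/8 - r \<le> dist x y" using that norm_triangle_ineq2[of x y] by (auto simp: dist_norm)
      qed
      then have "real N * (1/8 - r) \<le> real (m + N) * infdist x K" using r by (intro mult_mono) auto
      moreover have "1 < real N * (1/8 - r)" using N r by (simp add: field_simps)
      ultimately show ?thesis by (simp add: h_def)
    qed
    have lim: "(\<lambda>m. \<integral>x. G x * h m x \<partial>cube_measure) \<longlonglongrightarrow> (\<integral>x. G x * indicator K x \<partial>cube_measure)"
    proof (rule integral_dominated_convergence[where w = "\<lambda>_. B"])
      show "AE x in cube_measure. (\<lambda>m. G x * h m x) \<longlonglongrightarrow> G x * indicator K x"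
      proof (intro AE_I2 tendsto_mult tendsto_const)
        fix x
        show "(\<lambda>m. h m x) \<longlonglongrightarrow> indicator K x"
        proof (cases "x \<in> K")
          case True
          then show ?thesis by (simp add: h_def)
        next
          case False
          then have d: "infdist x K > 0"
            using in_closed_iff_infdist_zero[OF compact_imp_closed[OF K(1)] K(3)] infdist_nonneg[of x K]
            by (metis less_eq_real_def)
          obtain m0 where m0: "1 / infdist x K < real m0" using reals_Archimedean2 by blast
          have "h m x = 0" if "m \<ge> m0" for m
          proof -
            have "1 < real m0 * infdist x K" using m0 d by (simp add: field_simps)
            also have "\<dots> \<le> real (m + N) * infdist x K" using that d by (intro mult_right_mono) auto
            finally show ?thesis by (simp add: h_def)
          qed
          then have "(\<lambda>m. h m x) \<longlonglongrightarrow> 0" by (intro tendsto_eventually eventually_sequentiallyI)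
          then show ?thesis using False by simp
        qed
      qed
      show "AE x in cube_measure. norm (G x * h m x) \<le> B" for m
      proof (rule AE_I2)
        fix x
        have "\<bar>h m x\<bar> \<le> 1" by (simp add: h_def infdist_nonneg)
        then show "norm (G x * h m x) \<le> B"
          unfolding real_norm_def abs_mult using B[of x] by (metis abs_ge_zero mult_left_le order_trans)
      qed
    next
      have [measurable]: "K \<in> sets borel" "h m \<in> borel_measurable borel" for m
        using compact_imp_closed[OF K(1)] hc by (auto intro: borel_measurable_continuous_onI)
      show "(\<lambda>x. G x * indicator K x) \<in> borel_measurable cube_measure"
        "(\<lambda>x. G x * h m x) \<in> borel_measurable cube_measure" for m by simp_all
    qed simp
    moreover have "(\<integral>x. G x * h m x \<partial>cube_measure) = 0" for m
      by (rule cont0[OF hc h0])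
    ultimately show ?thesis by (simp add: LIMSEQ_const_iff)
  qed
  have sub: "x \<in> unit_cube" if "x \<in> ball 0 (1/8)" for x :: "real ^ 'n"
  proof -
    have "norm x < 1/8" using that by simp
    then have "\<bar>x $ i\<bar> \<le> 1/2" for i using component_le_norm_cart[of x i] by linarith
    then show "x \<in> unit_cube" by (simp add: mem_unit_cube)
  qed
  \<comment> \<open>The factor \<open>s\<close>, later \<open>1\<close> and \<open>-1\<close>,
    treats both signs of \<open>G\<close> by one argument.\<close>
  have null: "emeasure cube_measure (ball 0 (1/8) \<inter> {x. s * G x > 0}) = 0" if s: "s \<noteq> 0" for s :: real
  proof -
    define E where "E = ball 0 (1/8) \<inter> {x. s * G x > 0}"
    have Em [measurable]: "E \<in> sets borel" unfolding E_def by measurable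
    have Kz: "emeasure cube_measure K = 0" if K: "compact K" "K \<subseteq> E" for K
    proof (cases "K = {}")
      case False
      have [measurable]: "K \<in> sets borel" using compact_imp_closed[OF K(1)] by auto
      have i: "integrable cube_measure (\<lambda>x. s * (G x * indicator K x))"
        by (rule bI[where C = "\<bar>s\<bar> * B"])
          (use B B0 in \<open>auto simp: abs_mult indicator_def intro!: mult_left_mono\<close>)
      have "(\<integral>x. s * (G x * indicator K x) \<partial>cube_measure) = 0"
        using K0[OF K(1) _ False] K(2) by (simp add: E_def)
      moreover have nn: "s * (G x * indicator K x) \<ge> 0" for x
        using K(2) by (auto simp: E_def indicator_def less_imp_le)
      ultimately have "AE x in cube_measure. s * (G x * indicator K x) = 0"
        using integral_nonneg_eq_0_iff_AE[OF i] by auto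
      then have "AE x in cube_measure. x \<notin> K"
      proof eventually_elim
        case (elim x)
        then show ?case using K(2) by (auto simp: E_def indicator_def split: if_splits)
      qed
      then show ?thesis using AE_iff_measurable[of K cube_measure "\<lambda>x. x \<notin> K"] by auto
    qed simp
    have "emeasure cube_measure E = (SUP K\<in>{K. K \<subseteq> E \<and> compact K}. emeasure cube_measure K)"
      by (rule inner_regular) (use Em cm.emeasure_finite[of UNIV] in auto)
    also have "\<dots> = (SUP K\<in>{K. K \<subseteq> E \<and> compact K}. 0)" by (rule SUP_cong) (use Kz in auto)
    also have "\<dots> = 0" by (simp add: bot_ennreal[symmetric])
    finally show ?thesis unfolding E_def .
  qed
  have "AE x in cube_measure. x \<notin> ball 0 (1/8) \<inter> {x. 1 * G x > 0}"
    "AE x in cube_measure. x \<notin> ball 0 (1/8) \<inter> {x. (-1) * G x > 0}"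
    by (intro AE_not_in null_setsI null; simp)+
  then have "AE x in cube_measure. x \<in> ball 0 (1/8) \<longrightarrow> G x = 0"
    by eventually_elim (auto simp: not_less)
  then show ?thesis unfolding AE_cube_measure
    by eventually_elim (use sub in auto)
qed


section \<open>From decay of Fourier coefficients to two continuous derivatives\<close>

lemma summable_lattice_weight:
  fixes e :: "nat \<Rightarrow> int ^ 'n"
  assumes "inj e"
  shows "summable (\<lambda>j. \<Prod>i\<in>UNIV. inverse ((1 + \<bar>real_of_int (e j $ i)\<bar>) ^ 2))"
proof (rule summableI_nonneg_bounded)
  fix m
  have "(\<Sum>j<m. \<Prod>i\<in>UNIV. inverse ((1 + \<bar>real_of_int (e j $ i)\<bar>) ^ 2))
    = (\<Sum>k\<in>e ` {..<m}. \<Prod>i\<in>UNIV. inverse ((1 + \<bar>real_of_int (k $ i)\<bar>) ^ 2))"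
    using assms by (subst sum.reindex) (auto intro: inj_on_subset)
  also have "\<dots> \<le> (2 * (\<Sum>m. inverse (real (Suc m) ^ 2))) ^ CARD('n)"
    by (rule lattice_weight_bounded) simp
  finally show "(\<Sum>j<m. \<Prod>i\<in>UNIV. inverse ((1 + \<bar>real_of_int (e j $ i)\<bar>) ^ 2)) \<le> (2 * (\<Sum>m. inverse (real (Suc m) ^ 2))) ^ CARD('n)" .
qed (auto intro!: prod_nonneg)

text \<open>Every coordinate is bounded by the norm, so the power \<open>2 * CARD('n)\<close> of the
  norm dominates the product of the squared one-dimensional factors. This is how the dimension
  enters the decay exponents.\<close>

lemma freq_weight:
  fixes k :: "int ^ 'n"
  shows "inverse ((1 + norm (freq k)) ^ (2 * CARD('n))) \<le> (\<Prod>i\<in>UNIV. inverse ((1 + \<bar>real_of_int (k $ i)\<bar>) ^ 2))"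
proof -
  have "\<bar>real_of_int (k $ i)\<bar> \<le> norm (freq k)" for i
  proof -
    have "1 * \<bar>real_of_int (k $ i)\<bar> \<le> (2 * pi) * \<bar>real_of_int (k $ i)\<bar>"
      using pi_gt3 by (intro mult_right_mono) auto
    also have "\<dots> = \<bar>freq k $ i\<bar>" by (simp add: freq_def abs_mult)
    also have "\<dots> \<le> norm (freq k)" by (rule component_le_norm_cart)
    finally show ?thesis by simp
  qed
  then have "(\<Prod>i\<in>UNIV. (1 + \<bar>real_of_int (k $ i)\<bar>) ^ 2) \<le> (\<Prod>i\<in>(UNIV::'n set). (1 + norm (freq k)) ^ 2)"
    by (intro prod_mono conjI power_mono) auto
  also have "\<dots> = (1 + norm (freq k)) ^ (2 * CARD('n))" by (simp add: power_mult)
  finally have "inverse ((1 + norm (freq k)) ^ (2 * CARD('n))) \<le> inverse (\<Prod>i\<in>UNIV. (1 + \<bar>real_of_int (k $ i)\<bar>) ^ 2)"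
    by (intro le_imp_inverse_le prod_pos) (auto simp: add_pos_nonneg)
  also have "\<dots> = (\<Prod>i\<in>UNIV. inverse ((1 + \<bar>real_of_int (k $ i)\<bar>) ^ 2))"
    by (simp add: prod_inversef[unfolded o_def])
  finally show ?thesis .
qed

text \<open>Of the decay exponent, \<open>2 * CARD('n)\<close> makes the coefficients summable over
  the lattice and \<open>2\<close> pays for two derivatives. The Fourier series is then a C2
  function with the same coefficients as \<open>U\<close>, and uniqueness identifies the two on the
  small ball.\<close>

theorem fourier_decay_imp_C2:
  fixes U :: "real ^ 'n \<Rightarrow> real"
  assumes [measurable]: "U \<in> borel_measurable borel" and B: "\<And>x. \<bar>U x\<bar> \<le> B"
    and supp: "\<And>x. x \<notin> ball 0 (1/8) \<Longrightarrow> U x = 0"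
    and decay: "\<And>k d. \<bar>\<integral>x. U x * cos (freq k \<bullet> x + d) \<partial>lborel\<bar> * (1 + norm (freq k)) ^ (2 * CARD('n) + 2) \<le> C"
  obtains F where "Ck_on 2 UNIV F" "AE x in lborel. x \<in> ball 0 (1/8) \<longrightarrow> U x = F x"
proof -
  have "infinite (UNIV :: (int ^ 'n) set)"
  proof
    assume "finite (UNIV :: (int ^ 'n) set)"
    then have "finite (range (\<lambda>m::int. (\<chi> i. m) :: int ^ 'n))" by (rule finite_subset[rotated]) auto
    then have "finite (UNIV :: int set)" by (rule finite_imageD) (auto simp: inj_on_def vec_eq_iff)
    then show False by (simp add: infinite_UNIV_int)
  qed
  then obtain e :: "nat \<Rightarrow> int ^ 'n" where e: "bij e"
    using bij_betw_from_nat_into[of "UNIV :: (int ^ 'n) set"] by auto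
  define \<xi> where "\<xi> j = freq (e j)" for j
  define I where "I k d = (\<integral>x. U x * cos (freq k \<bullet> x + d) \<partial>lborel)" for k d
  \<comment> \<open>\<open>r\<close> and \<open>s\<close> are the cosine and sine coefficients, a
    sine being a cosine with phase \<open>- pi/2\<close>. The series carries no factor
    \<open>2\<close> because \<open>k\<close> and \<open>- k\<close> are both enumerated.\<close>
  define r where "r j = I (e j) 0" for j
  define s where "s j = I (e j) (- pi/2)" for j
  define W where "W j = (\<Prod>i\<in>UNIV. inverse ((1 + \<bar>real_of_int (e j $ i)\<bar>) ^ 2))" for j
  have W: "summable W" unfolding W_def using e by (intro summable_lattice_weight) (simp add: bij_def)
  have Ib: "\<bar>I (e j) d\<bar> * (1 + norm (\<xi> j)) ^ 2 \<le> C * W j" for j d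
  proof -
    define w where "w = 1 + norm (\<xi> j)"
    have w: "w > 0" unfolding w_def by (simp add: add_pos_nonneg)
    have C: "\<bar>I (e j) d\<bar> * w ^ (2 * CARD('n) + 2) \<le> C"
      using decay[of "e j" d] by (simp add: I_def \<xi>_def w_def)
    then have "(\<bar>I (e j) d\<bar> * w ^ 2) * w ^ (2 * CARD('n)) \<le> C"
      by (simp only: power_add mult_ac)
    then have "\<bar>I (e j) d\<bar> * w ^ 2 \<le> C * inverse (w ^ (2 * CARD('n)))"
      using w by (metis divide_inverse pos_le_divide_eq zero_less_power)
    also have "\<dots> \<le> C * W j"
    proof (rule mult_left_mono)
      show "inverse (w ^ (2 * CARD('n))) \<le> W j" unfolding w_def W_def \<xi>_def by (rule freq_weight)
      show "0 \<le> C" by (rule order_trans[OF _ C]) (use w in auto)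
    qed
    finally show ?thesis by (simp add: w_def)
  qed
  have sm: "summable (\<lambda>j. \<bar>I (e j) d\<bar> * (1 + norm (\<xi> j)) ^ 2)" for d
    by (rule summable_comparison_test'[OF summable_mult[OF W, of C], of 0]) (use Ib in auto)
  define F1 where "F1 x = (\<Sum>j. r j * cos (\<xi> j \<bullet> x + 0))" for x
  define F2 where "F2 x = (\<Sum>j. s j * cos (\<xi> j \<bullet> x + (- pi/2)))" for x
  define F where "F x = F1 x + F2 x" for x
  have F12: "Ck_on 2 UNIV F1" "Ck_on 2 UNIV F2"
    unfolding F1_def F2_def r_def s_def by (intro Ck_on_cos_series sm)+
  have F: "Ck_on 2 UNIV F" unfolding F_def by (intro Ck_on_add F12) simp
  have sabs: "summable (\<lambda>j. \<bar>I (e j) d\<bar>)" for d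
  proof (rule summable_comparison_test'[OF sm[of d], of 0])
    fix j
    have "1 \<le> (1 + norm (\<xi> j)) ^ 2" by (rule one_le_power) simp
    from mult_left_mono[OF this, of "\<bar>I (e j) d\<bar>"]
    show "norm \<bar>I (e j) d\<bar> \<le> \<bar>I (e j) d\<bar> * (1 + norm (\<xi> j)) ^ 2" by simp
  qed
  have meas [measurable]: "F1 \<in> borel_measurable borel" "F2 \<in> borel_measurable borel"
    using F12 Ck_on_imp_continuous_on by (blast intro: borel_measurable_continuous_onI)+
  have bound: "\<bar>\<Sum>j. I (e j) d * cos (\<xi> j \<bullet> x + d)\<bar> \<le> (\<Sum>j. \<bar>I (e j) d\<bar>)" for x d
    using norm_suminf_le[of "\<lambda>j. I (e j) d * cos (\<xi> j \<bullet> x + d)" "\<lambda>j. \<bar>I (e j) d\<bar>", OF _ sabs]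
    by (simp add: abs_mult mult_left_le)
  define D where "D = B + (\<Sum>j. \<bar>I (e j) 0\<bar>) + (\<Sum>j. \<bar>I (e j) (- pi/2)\<bar>)"
  have Gb: "\<bar>U x - F x\<bar> \<le> D" for x
    using B[of x] bound[of 0 x] bound[of "- pi/2" x] unfolding F_def F1_def F2_def r_def s_def D_def by linarith
  interpret cm: finite_measure "cube_measure :: (real ^ 'n) measure" by (rule finite_cube_measure)
  \<comment> \<open>Cosines at opposite frequencies are not orthogonal either, so two index values
    contribute whenever the series is tested at frequency \<open>l\<close>.\<close>
  have prodint: "(\<integral>x. cos (freq k \<bullet> x + a) * cos (freq l \<bullet> x + d) \<partial>cube_measure)
      = ((if k = l then cos (a - d) else 0) + (if k = - l then cos (a + d) else 0)) / 2" for k l :: "int ^ 'n" and a d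
  proof -
    have *: "cos (freq k \<bullet> x + a) * cos (freq l \<bullet> x + d)
      = (cos (freq (k - l) \<bullet> x + (a - d)) + cos (freq (k + l) \<bullet> x + (a + d))) / 2" for x
      by (simp add: cos_times_cos freq_add freq_diff inner_add_left inner_diff_left algebra_simps)
    have "k - l = 0 \<longleftrightarrow> k = l" "k + l = 0 \<longleftrightarrow> k = - l" by (auto simp: eq_neg_iff_add_eq_0)
    moreover have "integrable cube_measure (\<lambda>x. cos (freq m \<bullet> x + b))" for m :: "int ^ 'n" and b
      by (rule integrable_cube_bounded[of _ 1]) auto
    ultimately show ?thesis
      unfolding * by (simp add: integral_cube_cos)
  qed
  have series: "(\<lambda>j. I (e j) a * ((if e j = l then cos (a - d) else 0) + (if e j = - l then cos (a + d) else 0)) / 2)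
      sums (\<integral>x. (\<Sum>j. I (e j) a * cos (\<xi> j \<bullet> x + a)) * cos (freq l \<bullet> x + d) \<partial>cube_measure)" for a d l
  proof -
    let ?f = "\<lambda>j x. I (e j) a * cos (\<xi> j \<bullet> x + a) * cos (freq l \<bullet> x + d)"
    have fb: "\<bar>?f j x\<bar> \<le> \<bar>I (e j) a\<bar>" for j x
    proof -
      have "\<bar>cos (\<xi> j \<bullet> x + a) * cos (freq l \<bullet> x + d)\<bar> \<le> 1 * 1" unfolding abs_mult by (intro mult_mono) auto
      from mult_left_mono[OF this, of "\<bar>I (e j) a\<bar>"] show ?thesis by (simp add: abs_mult mult.assoc)
    qed
    have 1: "integrable cube_measure (?f j)" for j
      by (rule integrable_cube_bounded[OF _ fb]) simp
    have "(\<lambda>j. integral\<^sup>L cube_measure (?f j)) sums (\<integral>x. (\<Sum>j. ?f j x) \<partial>cube_measure)"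
    proof (rule sums_integral[OF 1])
      show "AE x in cube_measure. summable (\<lambda>j. norm (?f j x))"
        by (intro AE_I2 summable_comparison_test'[OF sabs[of a], of 0]) (use fb in auto)
      show "summable (\<lambda>j. \<integral>x. norm (?f j x) \<partial>cube_measure)"
      proof (rule summable_comparison_test'[OF summable_mult2[OF sabs[of a], of "measure (cube_measure :: (real ^ 'n) measure) UNIV"], of 0])
        fix j
        have "(\<integral>x. norm (?f j x) \<partial>cube_measure) \<le> (\<integral>x. \<bar>I (e j) a\<bar> \<partial>(cube_measure :: (real ^ 'n) measure))"
          using 1 fb by (intro integral_mono) auto
        then show "norm (\<integral>x. norm (?f j x) \<partial>cube_measure) \<le> \<bar>I (e j) a\<bar> * measure (cube_measure :: (real ^ 'n) measure) UNIV"
          by (simp add: mult.commute)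
      qed
    qed
    moreover have "integral\<^sup>L cube_measure (?f j) = I (e j) a * ((if e j = l then cos (a - d) else 0) + (if e j = - l then cos (a + d) else 0)) / 2" for j
      unfolding mult.assoc \<xi>_def by (simp add: prodint)
    moreover have "(\<Sum>j. ?f j x) = (\<Sum>j. I (e j) a * cos (\<xi> j \<bullet> x + a)) * cos (freq l \<bullet> x + d)" for x
    proof (rule suminf_mult2[symmetric], rule summable_comparison_test'[OF sabs[of a], of 0])
      fix j
      have "\<bar>I (e j) a\<bar> * \<bar>cos (\<xi> j \<bullet> x + a)\<bar> \<le> \<bar>I (e j) a\<bar>" by (rule mult_left_le) auto
      then show "norm (I (e j) a * cos (\<xi> j \<bullet> x + a)) \<le> \<bar>I (e j) a\<bar>" by (simp add: abs_mult)
    qed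
    ultimately show ?thesis by simp
  qed
  have single: "(\<lambda>j. if e j = l then c j else 0) sums c (inv e l)" for l and c :: "nat \<Rightarrow> real"
  proof -
    have "(e j = l) \<longleftrightarrow> (j = inv e l)" for j
      using e by (metis bij_inv_eq_iff)
    then show ?thesis using sums_single[of "inv e l" c] by (simp add: if_distrib)
  qed
  have Fint: "(\<integral>x. (\<Sum>j. I (e j) a * cos (\<xi> j \<bullet> x + a)) * cos (freq l \<bullet> x + d) \<partial>cube_measure)
    = (I l a * cos (a - d) + I (- l) a * cos (a + d)) / 2" for a d l
  proof -
    have einv: "e (inv e k) = k" for k using e by (simp add: bij_is_surj surj_f_inv_f)
    have "(\<lambda>j. ((if e j = l then I (e j) a * cos (a - d) else 0) + (if e j = - l then I (e j) a * cos (a + d) else 0)) / 2)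
      sums ((I l a * cos (a - d) + I (- l) a * cos (a + d)) / 2)"
      using sums_divide[OF sums_add[OF single[of l "\<lambda>j. I (e j) a * cos (a - d)"] single[of "- l" "\<lambda>j. I (e j) a * cos (a + d)"]], of 2]
      by (simp add: einv)
    moreover have "((if e j = l then I (e j) a * cos (a - d) else 0) + (if e j = - l then I (e j) a * cos (a + d) else 0)) / 2
       = I (e j) a * ((if e j = l then cos (a - d) else 0) + (if e j = - l then cos (a + d) else 0)) / 2" for j
      by (simp only: distrib_left mult_zero_right if_distrib[of "\<lambda>z. I (e j) a * z"])
    ultimately have "(\<lambda>j. I (e j) a * ((if e j = l then cos (a - d) else 0) + (if e j = - l then cos (a + d) else 0)) / 2)
      sums ((I l a * cos (a - d) + I (- l) a * cos (a + d)) / 2)" by simp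
    with series[of a l d] show ?thesis by (rule sums_unique2)
  qed
  have Uint: "integrable lborel (\<lambda>x. U x * cos (freq k \<bullet> x + d))" for k d
  proof (rule integrableI_bounded_set[of "ball 0 (1/8)" _ _ B])
    show "emeasure lborel (ball (0::real ^ 'n) (1/8)) < \<infinity>" by (rule emeasure_bounded_finite) simp
    show "AE x in lborel. x \<in> ball 0 (1/8) \<longrightarrow> norm (U x * cos (freq k \<bullet> x + d)) \<le> B"
    proof (intro AE_I2 impI)
      fix x
      have "\<bar>U x\<bar> * \<bar>cos (freq k \<bullet> x + d)\<bar> \<le> \<bar>U x\<bar>" by (rule mult_left_le) auto
      then show "norm (U x * cos (freq k \<bullet> x + d)) \<le> B" using B[of x] by (simp add: abs_mult)
    qed
  qed (use supp in auto)
  \<comment> \<open>A coefficient with arbitrary phase is a combination of the two stored ones.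
    Together with the symmetry under \<open>- l\<close> below, this makes the coefficients of
    \<open>U - F\<close> cancel.\<close>
  have Isplit: "I l d = I l 0 * cos d + I l (- pi/2) * (- sin d)" for l d
  proof -
    have eq: "U x * cos (freq l \<bullet> x + d) = U x * cos (freq l \<bullet> x + 0) * cos d + U x * cos (freq l \<bullet> x + (- pi/2)) * (- sin d)" for x
      by (simp add: cos_add cos_diff algebra_simps)
    have "I l d = (\<integral>x. U x * cos (freq l \<bullet> x + 0) * cos d + U x * cos (freq l \<bullet> x + (- pi/2)) * (- sin d) \<partial>lborel)"
      unfolding I_def by (rule Bochner_Integration.integral_cong[OF refl eq])
    also have "(\<integral>x. U x * cos (freq l \<bullet> x + 0) * cos d + U x * cos (freq l \<bullet> x + (- pi/2)) * (- sin d) \<partial>lborel)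
      = I l 0 * cos d + I l (- pi/2) * (- sin d)"
      unfolding I_def
      by (subst Bochner_Integration.integral_add)
        (auto simp only: integral_mult_left_zero intro!: integrable_mult_left Uint)
    finally show ?thesis .
  qed
  have Ineg: "I (- l) 0 = I l 0" "I (- l) (- pi/2) = - I l (- pi/2)" for l
  proof -
    have fm: "freq (- l) = - freq l" using freq_diff[of 0 l] by simp
    show "I (- l) 0 = I l 0" unfolding I_def fm by simp
    have "cos (- freq l \<bullet> x + - pi/2) = - cos (freq l \<bullet> x + - pi/2)" for x
      by (simp add: cos_diff)
    then show "I (- l) (- pi/2) = - I l (- pi/2)" unfolding I_def fm by simp
  qed
  have "AE x in lborel. x \<in> ball 0 (1/8) \<longrightarrow> U x - F x = 0"
  proof (rule fourier_uniqueness[OF _ Gb])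
    show "(\<lambda>x. U x - F x) \<in> borel_measurable borel" unfolding F_def by measurable
    fix l :: "int ^ 'n" and d
    let ?c = "\<lambda>x. cos (freq l \<bullet> x + d)"
    have cb: "\<bar>f x * ?c x\<bar> \<le> E" if "\<bar>f x\<bar> \<le> E" for f :: "real ^ 'n \<Rightarrow> real" and E x
      unfolding abs_mult by (rule order_trans[OF mult_left_le that]) auto
    have UI: "integrable cube_measure (\<lambda>x. U x * ?c x)"
      by (rule integrable_cube_bounded[OF _ cb[OF B]]) simp
    have F1I: "integrable cube_measure (\<lambda>x. F1 x * ?c x)"
      using bound[of 0] by (intro integrable_cube_bounded[OF _ cb[of F1]]) (simp_all add: F1_def r_def)
    have F2I: "integrable cube_measure (\<lambda>x. F2 x * ?c x)"
      using bound[of "- pi/2"] by (intro integrable_cube_bounded[OF _ cb[of F2]]) (simp_all add: F2_def s_def)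
    have "(\<integral>x. (U x - F x) * ?c x \<partial>cube_measure) = (\<integral>x. U x * ?c x - (F1 x * ?c x + F2 x * ?c x) \<partial>cube_measure)"
      by (simp add: F_def algebra_simps)
    also have "\<dots> = (\<integral>x. U x * ?c x \<partial>cube_measure) - ((\<integral>x. F1 x * ?c x \<partial>cube_measure) + (\<integral>x. F2 x * ?c x \<partial>cube_measure))"
      using UI F1I F2I by simp
    also have "(\<integral>x. U x * ?c x \<partial>cube_measure) = (\<integral>x. indicator unit_cube x * (U x * ?c x) \<partial>lborel)"
      by (rule integral_cube) simp
    also have "\<dots> = I l d"
      unfolding I_def
    proof (rule Bochner_Integration.integral_cong[OF refl])
      fix x :: "real ^ 'n"
      have "x \<in> unit_cube" if "x \<in> ball 0 (1/8)"
      proof -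
        have "norm x < 1/8" using that by simp
        then have "\<bar>x $ i\<bar> \<le> 1/2" for i using component_le_norm_cart[of x i] by linarith
        then show "x \<in> unit_cube" by (simp add: mem_unit_cube)
      qed
      then show "indicator unit_cube x * (U x * ?c x) = U x * ?c x"
        using supp[of x] by (auto simp: indicator_def)
    qed
    also have "(\<integral>x. F1 x * ?c x \<partial>cube_measure) = (I l 0 * cos (0 - d) + I (- l) 0 * cos (0 + d)) / 2"
      unfolding F1_def r_def by (rule Fint)
    also have "(\<integral>x. F2 x * ?c x \<partial>cube_measure) = (I l (- pi/2) * cos (- pi/2 - d) + I (- l) (- pi/2) * cos (- pi/2 + d)) / 2"
      unfolding F2_def s_def by (rule Fint)
    finally show "(\<integral>x. (U x - F x) * ?c x \<partial>cube_measure) = 0"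
      unfolding Isplit[of l d] Ineg by (simp add: cos_add cos_diff)
  qed
  then have "AE x in lborel. x \<in> ball 0 (1/8) \<longrightarrow> U x = F x" by eventually_elim auto
  with F show thesis by (rule that)
qed

subsection \<open>Interior regularity\<close>

definition pd :: "'n \<Rightarrow> (real ^ 'n \<Rightarrow> real) \<Rightarrow> real ^ 'n \<Rightarrow> real" where
  "pd i f x = frechet_derivative f (at x) (axis i 1)"

lemma pd_eq: "(f has_derivative D) (at x) \<Longrightarrow> pd i f x = D (axis i 1)"
  unfolding pd_def using frechet_derivative_at by metis

lemma pd_cong_open:
  assumes "open S" "x \<in> S" "\<And>y. y \<in> S \<Longrightarrow> f y = g y" shows "pd i f x = pd i g x"
  unfolding pd_def using frechet_derivative_cong_open[OF assms] by simp

lemma pd_const [simp]: "pd i (\<lambda>x. c) x = 0"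
  by (simp add: pd_def frechet_derivative_const)

lemma pd_add:
  assumes "f differentiable (at x)" "g differentiable (at x)"
  shows "pd i (\<lambda>x. f x + g x) x = pd i f x + pd i g x"
  using pd_eq[OF has_derivative_add[OF assms[unfolded frechet_derivative_works]], where i = i] by (simp add: pd_def)

lemma pd_mult:
  assumes "f differentiable (at x)" "g differentiable (at x)"
  shows "pd i (\<lambda>x. f x * g x) x = pd i f x * g x + f x * pd i g x"
  using pd_eq[OF has_derivative_mult[OF assms[unfolded frechet_derivative_works]], where i = i] by (simp add: pd_def)

lemma pd_cos: "pd i (\<lambda>x. cos (\<xi> \<bullet> x + d)) x = \<xi> $ i * cos (\<xi> \<bullet> x + (d + pi/2))"
proof -
  have "- sin (\<xi> \<bullet> x + d) = cos (\<xi> \<bullet> x + (d + pi/2))"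
    using cos_add[of "\<xi> \<bullet> x + d" "pi/2"] by (simp add: add.assoc)
  moreover have "((\<lambda>x. cos (\<xi> \<bullet> x + d)) has_derivative (\<lambda>v. - sin (\<xi> \<bullet> x + d) * (\<xi> \<bullet> v))) (at x)"
    by (auto intro!: derivative_eq_intros)
  ultimately show ?thesis by (simp add: pd_eq inner_axis)
qed

lemma Ck_on_pd: "Ck_on (Suc k) S f \<Longrightarrow> Ck_on k S (pd i f)"
  unfolding pd_def[abs_def] by simp

lemma pd_zero_outside:
  assumes "closed K" "\<And>x. x \<notin> K \<Longrightarrow> f x = 0" "x \<notin> K" shows "pd i f x = 0"
proof -
  have "pd i f x = pd i (\<lambda>_. 0) x"
    by (rule pd_cong_open[of "- K"]) (use assms in auto)
  then show ?thesis by simp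
qed

section \<open>Divergence-form operators and oscillating test functions\<close>

definition div_op :: "('n \<Rightarrow> 'n \<Rightarrow> real ^ 'n \<Rightarrow> real) \<Rightarrow> (real ^ 'n \<Rightarrow> real) \<Rightarrow> real ^ 'n \<Rightarrow> real" where
  "div_op \<alpha> w x = (\<Sum>i\<in>UNIV. pd i (\<lambda>y. \<Sum>j\<in>UNIV. \<alpha> i j y * pd j w y) x)"

text \<open>The derivative in the position variable of a function of position and direction. It is
  taken on the product space so that joint smoothness is inherited.\<close>

definition dx :: "'n \<Rightarrow> ((real ^ 'n) \<times> (real ^ 'n) \<Rightarrow> real) \<Rightarrow> (real ^ 'n) \<times> (real ^ 'n) \<Rightarrow> real" where
  "dx i \<sigma> z = frechet_derivative \<sigma> (at z) (axis i 1, 0)"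

lemma smooth_on_dx: "smooth_on S f \<Longrightarrow> smooth_on S (dx i f)"
  unfolding dx_def[abs_def] by (rule smooth_on_frechet)

lemma dx_slice:
  assumes "smooth_on S \<sigma>" "(x, \<theta>) \<in> S"
  shows "(\<lambda>y. \<sigma> (y, \<theta>)) differentiable (at x)" "pd i (\<lambda>y. \<sigma> (y, \<theta>)) x = dx i \<sigma> (x, \<theta>)"
proof -
  have d: "((\<lambda>y. \<sigma> (y, \<theta>)) has_derivative (\<lambda>v. frechet_derivative \<sigma> (at (x, \<theta>)) (v, 0))) (at x)"
    by (rule has_derivative_compose[where f = "\<lambda>y. (y, \<theta>)" and f' = "\<lambda>v. (v, 0)", OF _ smooth_on_has_derivative[OF assms]])
      (auto intro!: derivative_eq_intros)
  then show "(\<lambda>y. \<sigma> (y, \<theta>)) differentiable (at x)" by (rule differentiableI)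
  show "pd i (\<lambda>y. \<sigma> (y, \<theta>)) x = dx i \<sigma> (x, \<theta>)"
    using pd_eq[OF d] by (simp add: dx_def)
qed

lemma dx_zero_outside:
  assumes "closed K" "\<And>x \<theta>. x \<notin> K \<Longrightarrow> f (x, \<theta>) = 0" "x \<notin> K" shows "dx i f (x, \<theta>) = 0"
proof -
  have "frechet_derivative f (at (x, \<theta>)) = frechet_derivative (\<lambda>_. 0) (at (x, \<theta>))"
    by (rule frechet_derivative_cong_open[of "(- K) \<times> UNIV"])
      (use assms in \<open>auto intro!: open_Times\<close>)
  then show ?thesis by (simp add: dx_def frechet_derivative_const)
qed

lemma euclidean_bump:
  fixes x0 :: "'a::euclidean_space"
  assumes "r > 0"
  shows "\<exists>b :: 'a \<Rightarrow> real. smooth_on UNIV b \<and> (\<forall>x. 0 \<le> b x) \<and> (\<forall>x. b x \<le> 1) \<and>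
    (\<forall>x. x \<in> ball x0 r \<longrightarrow> b x > 0) \<and> (\<forall>x. x \<notin> ball x0 r \<longrightarrow> b x = 0)"
proof -
  define b where "b x = flat_exp (r\<^sup>2 - (x - x0) \<bullet> (x - x0))" for x
  have "smooth_on UNIV (\<lambda>x. x - x0)"
    by (rule smooth_on_diff[OF open_UNIV smooth_on_bounded_linear[OF bounded_linear_ident open_UNIV] smooth_on_const])
  then have "smooth_on UNIV (\<lambda>x. r\<^sup>2 - (x - x0) \<bullet> (x - x0))"
    by (intro smooth_on_diff[of UNIV "\<lambda>x. r\<^sup>2"] smooth_on_inner smooth_on_const) auto
  then have s: "smooth_on UNIV b"
    unfolding b_def
    by (rule smooth_on_compose[where T = UNIV and g = flat_exp, OF open_UNIV open_UNIV subset_UNIV _ smooth_on_flat_exp])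
  have ball: "x \<in> ball x0 r \<longleftrightarrow> r\<^sup>2 - (x - x0) \<bullet> (x - x0) > 0" for x
  proof -
    have "norm (x - x0) < r \<longleftrightarrow> (norm (x - x0))\<^sup>2 < r\<^sup>2"
      using assms by (metis abs_le_square_iff abs_norm_cancel abs_of_pos linorder_not_less)
    then show ?thesis by (simp add: dist_norm norm_minus_commute[of x0] flip: power2_norm_eq_inner)
  qed
  show ?thesis
    by (rule exI[of _ b]) (use s in \<open>auto simp: b_def flat_exp_def ball simp del: mem_ball\<close>)
qed

text \<open>All derivatives fall on the test function, so \<open>s\<close> is merely bounded and
  measurable. Test functions have compact support inside \<open>V\<close>, which gives the integral
  over the whole space its meaning.\<close>

locale elliptic_weak =
  fixes V :: "(real ^ 'n) set" and \<alpha> :: "'n \<Rightarrow> 'n \<Rightarrow> real ^ 'n \<Rightarrow> real" and \<beta> s :: "real ^ 'n \<Rightarrow> real" and B :: real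
  assumes V: "open V" and \<alpha>: "\<And>i j. smooth_on V (\<alpha> i j)" and \<beta>: "smooth_on V \<beta>"
    and pos: "\<And>x \<theta>. x \<in> V \<Longrightarrow> \<theta> \<noteq> 0 \<Longrightarrow> (\<Sum>i\<in>UNIV. \<Sum>j\<in>UNIV. \<alpha> i j x * \<theta> $ j * \<theta> $ i) > 0"
    and sm [measurable]: "s \<in> borel_measurable borel" and sb: "\<And>x. \<bar>s x\<bar> \<le> B"
    and weak: "\<And>w K. smooth_on V w \<Longrightarrow> compact K \<Longrightarrow> K \<subseteq> V \<Longrightarrow> (\<And>x. x \<notin> K \<Longrightarrow> w x = 0) \<Longrightarrow>
      (\<integral>x. s x * (div_op \<alpha> w x - \<beta> x * w x) \<partial>lborel) = 0"
begin

abbreviation "D \<equiv> V \<times> (- {0 :: real ^ 'n})"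

lemma D: "open D" using V by (intro open_Times) auto

text \<open>The second variable is a direction. Smoothness is asked for nonzero directions because
  \<open>tau\<close> divides by a quadratic form in the direction; the estimates insert unit
  vectors.\<close>

definition amplitude :: "(real ^ 'n) set \<Rightarrow> ((real ^ 'n) \<times> (real ^ 'n) \<Rightarrow> real) \<Rightarrow> bool" where
  "amplitude K \<sigma> \<longleftrightarrow> smooth_on D \<sigma> \<and> (\<forall>x \<theta>. x \<notin> K \<longrightarrow> \<sigma> (x, \<theta>) = 0)"

text \<open>The operator sends \<open>tau \<sigma> * cos\<close> to \<open>- \<rho>\<^sup>2 \<sigma> * cos\<close> plus terms of order one and zero in
  \<open>\<rho>\<close> with the amplitudes \<open>X1 \<sigma>\<close> and \<open>Y1 \<sigma>\<close>.\<close>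

definition quad :: "(real ^ 'n) \<times> (real ^ 'n) \<Rightarrow> real" where
  "quad z = (\<Sum>i\<in>UNIV. \<Sum>j\<in>UNIV. \<alpha> i j (fst z) * snd z $ j * snd z $ i)"

definition tau where "tau \<sigma> z = inverse (quad z) * \<sigma> z"
definition flux1 where "flux1 i \<sigma> z = (\<Sum>j\<in>UNIV. \<alpha> i j (fst z) * dx j \<sigma> z)"
definition flux2 where "flux2 i \<sigma> z = \<sigma> z * (\<Sum>j\<in>UNIV. \<alpha> i j (fst z) * snd z $ j)"
definition X1 where
  "X1 \<sigma> z = (\<Sum>i\<in>UNIV. snd z $ i * flux1 i (tau \<sigma>) z + dx i (flux2 i (tau \<sigma>)) z)"
definition Y1 where
  "Y1 \<sigma> z = (\<Sum>i\<in>UNIV. dx i (flux1 i (tau \<sigma>)) z) - \<beta> (fst z) * tau \<sigma> z"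

lemma smooth_fst: "smooth_on D (\<lambda>z. f (fst z))" if "smooth_on V f" for f :: "real ^ 'n \<Rightarrow> real"
  by (rule smooth_on_compose[OF D V _ _ that]) (auto intro!: smooth_on_bounded_linear bounded_linear_fst D)

lemma smooth_snd: "smooth_on D (\<lambda>z. snd z $ i)"
  by (intro smooth_on_vec D smooth_on_bounded_linear bounded_linear_snd)

lemma smooth_quad: "smooth_on D quad"
  unfolding quad_def[abs_def] by (intro smooth_on_sum smooth_on_mult D smooth_fst smooth_snd \<alpha>)

lemma smooth_tau: "smooth_on D \<sigma> \<Longrightarrow> smooth_on D (tau \<sigma>)"
  unfolding tau_def[abs_def] using pos
  by (intro smooth_on_mult smooth_on_inverse D smooth_quad) (force simp: quad_def)+

lemma smooth_flux: "smooth_on D \<sigma> \<Longrightarrow> smooth_on D (flux1 i \<sigma>)" "smooth_on D \<sigma> \<Longrightarrow> smooth_on D (flux2 i \<sigma>)"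
  unfolding flux1_def[abs_def] flux2_def[abs_def]
  by (intro smooth_on_sum smooth_on_mult D smooth_fst smooth_snd \<alpha> smooth_on_dx; assumption)+

lemma amplitude_X1_Y1:
  assumes "amplitude K \<sigma>" "compact K" shows "amplitude K (X1 \<sigma>)" "amplitude K (Y1 \<sigma>)"
proof -
  have cl: "closed K" using assms(2) by (rule compact_imp_closed)
  have s: "smooth_on D \<sigma>" and z: "\<And>x \<theta>. x \<notin> K \<Longrightarrow> \<sigma> (x, \<theta>) = 0" using assms by (auto simp: amplitude_def)
  have zt: "\<And>x \<theta>. x \<notin> K \<Longrightarrow> tau \<sigma> (x, \<theta>) = 0" using z by (simp add: tau_def)
  have z1: "\<And>x \<theta> i. x \<notin> K \<Longrightarrow> flux1 i (tau \<sigma>) (x, \<theta>) = 0"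
    using dx_zero_outside[OF cl, of "tau \<sigma>"] zt by (simp add: flux1_def)
  have z2: "\<And>x \<theta> i. x \<notin> K \<Longrightarrow> flux2 i (tau \<sigma>) (x, \<theta>) = 0"
    using zt by (simp add: flux2_def)
  show "amplitude K (X1 \<sigma>)"
    unfolding amplitude_def
  proof (intro conjI allI impI)
    show "smooth_on D (X1 \<sigma>)"
      unfolding X1_def[abs_def]
      by (intro smooth_on_sum smooth_on_add smooth_on_mult D smooth_snd smooth_on_dx smooth_flux smooth_tau s)
    show "X1 \<sigma> (x, \<theta>) = 0" if "x \<notin> K" for x \<theta>
      using that z1 dx_zero_outside[where f = "flux2 _ (tau \<sigma>)", OF cl z2] by (simp add: X1_def)
  qed
  show "amplitude K (Y1 \<sigma>)"
    unfolding amplitude_def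
  proof (intro conjI allI impI)
    show "smooth_on D (Y1 \<sigma>)"
      unfolding Y1_def[abs_def]
      by (intro smooth_on_sum smooth_on_diff smooth_on_mult D smooth_fst smooth_on_dx smooth_flux smooth_tau s \<beta>)
    show "Y1 \<sigma> (x, \<theta>) = 0" if "x \<notin> K" for x \<theta>
      using that zt dx_zero_outside[where f = "flux1 _ (tau \<sigma>)", OF cl z1] by (simp add: Y1_def)
  qed
qed

text \<open>Where both derivatives hit the cosine the phase moves by \<open>pi\<close>, which gives
  the minus sign, and the quadratic form cancels against the reciprocal in \<open>tau\<close>. Terms
  with one derivative on the cosine make up \<open>X1\<close>; those with none, and the zero order
  term, make up \<open>Y1\<close>.\<close>

lemma div_op_wave:
  assumes \<sigma>: "smooth_on D \<sigma>" and x: "x \<in> V" and \<theta>: "\<theta> \<noteq> 0"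
  defines "w \<equiv> \<lambda>\<rho> d x. tau \<sigma> (x, \<theta>) * cos ((\<rho> *\<^sub>R \<theta>) \<bullet> x + d)"
  shows "div_op \<alpha> (w \<rho> d) x - \<beta> x * w \<rho> d x = - (\<rho>\<^sup>2) * (\<sigma> (x, \<theta>) * cos ((\<rho> *\<^sub>R \<theta>) \<bullet> x + d))
    + \<rho> * (X1 \<sigma> (x, \<theta>) * cos ((\<rho> *\<^sub>R \<theta>) \<bullet> x + (d + pi/2))) + Y1 \<sigma> (x, \<theta>) * cos ((\<rho> *\<^sub>R \<theta>) \<bullet> x + d)"
proof -
  define c where "c e x = cos ((\<rho> *\<^sub>R \<theta>) \<bullet> x + e)" for e x
  have cd: "c e differentiable (at y)" for e y
  proof -
    have "(c e has_derivative (\<lambda>v. - sin ((\<rho> *\<^sub>R \<theta>) \<bullet> y + e) * ((\<rho> *\<^sub>R \<theta>) \<bullet> v))) (at y)"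
      unfolding c_def[abs_def] by (auto intro!: derivative_eq_intros)
    then show ?thesis by (rule differentiableI)
  qed
  have cpi: "c (d + pi/2 + pi/2) y = - c d y" for y
    using cos_add[of "(\<rho> *\<^sub>R \<theta>) \<bullet> y + d" pi] by (simp add: c_def add.assoc)
  have pc: "pd i (c e) y = \<rho> * \<theta> $ i * c (e + pi/2) y" for i e y
    using pd_cos[of i "\<rho> *\<^sub>R \<theta>" e y] unfolding c_def[abs_def] by simp
  have mem: "(y, \<theta>) \<in> D" if "y \<in> V" for y using that \<theta> by simp
  note st = smooth_tau[OF \<sigma>]
  have flux: "(\<Sum>j\<in>UNIV. \<alpha> i j y * pd j (w \<rho> d) y)
      = flux1 i (tau \<sigma>) (y, \<theta>) * c d y + \<rho> * (flux2 i (tau \<sigma>) (y, \<theta>) * c (d + pi/2) y)" if y: "y \<in> V" for i y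
  proof -
    have "pd j (w \<rho> d) y = dx j (tau \<sigma>) (y, \<theta>) * c d y + tau \<sigma> (y, \<theta>) * (\<rho> * \<theta> $ j * c (d + pi/2) y)" for j
      using pd_mult[OF dx_slice(1)[OF st mem[OF y]] cd, of j d] dx_slice(2)[OF st mem[OF y]]
      unfolding w_def c_def[symmetric] by (simp add: pc)
    then show ?thesis
      by (simp add: flux1_def flux2_def sum.distrib sum_distrib_left sum_distrib_right algebra_simps)
  qed
  have pdf: "pd i (\<lambda>y. \<Sum>j\<in>UNIV. \<alpha> i j y * pd j (w \<rho> d) y) x
     = dx i (flux1 i (tau \<sigma>)) (x, \<theta>) * c d x + flux1 i (tau \<sigma>) (x, \<theta>) * (\<rho> * \<theta> $ i * c (d + pi/2) x)
      + \<rho> * (dx i (flux2 i (tau \<sigma>)) (x, \<theta>) * c (d + pi/2) x) - \<rho>\<^sup>2 * (flux2 i (tau \<sigma>) (x, \<theta>) * \<theta> $ i * c d x)" for i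
  proof -
    note d1 = dx_slice[OF smooth_flux(1)[OF st, of i] mem[OF x]]
    note d2 = dx_slice[OF smooth_flux(2)[OF st, of i] mem[OF x]]
    have "pd i (\<lambda>y. \<Sum>j\<in>UNIV. \<alpha> i j y * pd j (w \<rho> d) y) x
      = pd i (\<lambda>y. flux1 i (tau \<sigma>) (y, \<theta>) * c d y + \<rho> * (flux2 i (tau \<sigma>) (y, \<theta>) * c (d + pi/2) y)) x"
      by (rule pd_cong_open[OF V x flux])
    also have "\<dots> = pd i (\<lambda>y. flux1 i (tau \<sigma>) (y, \<theta>) * c d y) x
        + pd i (\<lambda>y. \<rho> * (flux2 i (tau \<sigma>) (y, \<theta>) * c (d + pi/2) y)) x"
      using d1(1) d2(1) cd by (intro pd_add) (auto intro!: derivative_intros)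
    also have "pd i (\<lambda>y. \<rho> * (flux2 i (tau \<sigma>) (y, \<theta>) * c (d + pi/2) y)) x
       = \<rho> * pd i (\<lambda>y. flux2 i (tau \<sigma>) (y, \<theta>) * c (d + pi/2) y) x"
      using d2(1) cd by (subst pd_mult) (auto intro!: derivative_intros)
    finally show ?thesis
      unfolding pd_mult[OF d1(1) cd] pd_mult[OF d2(1) cd] d1(2) d2(2) pc cpi
      by (simp add: algebra_simps power2_eq_square)
  qed
  have q: "(\<Sum>i\<in>UNIV. flux2 i (tau \<sigma>) (x, \<theta>) * \<theta> $ i) = \<sigma> (x, \<theta>)"
  proof -
    have "quad (x, \<theta>) \<noteq> 0" using pos[OF x \<theta>] by (simp add: quad_def)
    moreover have "(\<Sum>i\<in>UNIV. flux2 i (tau \<sigma>) (x, \<theta>) * \<theta> $ i) = tau \<sigma> (x, \<theta>) * quad (x, \<theta>)"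
      by (simp add: flux2_def quad_def sum_distrib_left sum_distrib_right mult.assoc)
    ultimately show ?thesis by (simp add: tau_def)
  qed
  have "div_op \<alpha> (w \<rho> d) x = (\<Sum>i\<in>UNIV. dx i (flux1 i (tau \<sigma>)) (x, \<theta>)) * c d x
     + \<rho> * (\<Sum>i\<in>UNIV. \<theta> $ i * flux1 i (tau \<sigma>) (x, \<theta>) + dx i (flux2 i (tau \<sigma>)) (x, \<theta>)) * c (d + pi/2) x
     - \<rho>\<^sup>2 * (\<Sum>i\<in>UNIV. flux2 i (tau \<sigma>) (x, \<theta>) * \<theta> $ i) * c d x"
    unfolding div_op_def pdf
    by (simp add: sum.distrib sum_subtractf sum_distrib_left sum_distrib_right algebra_simps)
  then show ?thesis
    unfolding q by (simp add: X1_def Y1_def w_def c_def algebra_simps)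
qed

text \<open>The direction of the amplitude is tied to the frequency. For an amplitude that does not
  depend on direction this is a Fourier coefficient of the amplitude times \<open>s\<close>.\<close>

definition osc where
  "osc \<sigma> \<xi> d = (\<integral>x. s x * (\<sigma> (x, \<xi> /\<^sub>R norm \<xi>) * cos (\<xi> \<bullet> x + d)) \<partial>lborel)"

lemma amplitude_integrable:
  assumes "amplitude K \<sigma>" "compact K" "K \<subseteq> V" "\<theta> \<noteq> 0"
  shows "integrable lborel (\<lambda>x. s x * (\<sigma> (x, \<theta>) * cos (\<xi> \<bullet> x + d)))"
proof -
  have s: "smooth_on D \<sigma>" and z: "\<And>x \<theta>. x \<notin> K \<Longrightarrow> \<sigma> (x, \<theta>) = 0" using assms by (auto simp: amplitude_def)
  have "continuous_on K (\<lambda>x. \<sigma> (x, \<theta>))"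
    by (rule continuous_on_compose2[OF smooth_on_imp_continuous_on[OF s]])
      (use assms in \<open>auto intro!: continuous_intros\<close>)
  then have "continuous_on K (\<lambda>x. \<sigma> (x, \<theta>) * cos (\<xi> \<bullet> x + d))" by (intro continuous_intros)
  then have "integrable lborel (\<lambda>x. indicator K x *\<^sub>R (\<sigma> (x, \<theta>) * cos (\<xi> \<bullet> x + d)))"
    by (rule borel_integrable_compact[OF assms(2)])
  moreover have "(\<lambda>x. indicator K x *\<^sub>R (\<sigma> (x, \<theta>) * cos (\<xi> \<bullet> x + d))) = (\<lambda>x. \<sigma> (x, \<theta>) * cos (\<xi> \<bullet> x + d))"
    using z by (intro ext) (auto simp: indicator_def)
  ultimately have i: "integrable lborel (\<lambda>x. \<sigma> (x, \<theta>) * cos (\<xi> \<bullet> x + d))" by simp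
  show ?thesis
  proof (rule Bochner_Integration.integrable_bound[OF integrable_mult_right[OF i, of B]])
    show "(\<lambda>x. s x * (\<sigma> (x, \<theta>) * cos (\<xi> \<bullet> x + d))) \<in> borel_measurable lborel"
      using borel_measurable_integrable[OF i] by measurable
    show "AE x in lborel. norm (s x * (\<sigma> (x, \<theta>) * cos (\<xi> \<bullet> x + d))) \<le> norm (B * (\<sigma> (x, \<theta>) * cos (\<xi> \<bullet> x + d)))"
    proof (rule AE_I2)
      fix x
      have "\<bar>s x\<bar> \<le> \<bar>B\<bar>" using sb[of x] by simp
      then show "norm (s x * (\<sigma> (x, \<theta>) * cos (\<xi> \<bullet> x + d))) \<le> norm (B * (\<sigma> (x, \<theta>) * cos (\<xi> \<bullet> x + d)))"
        by (simp add: abs_mult mult_right_mono)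
    qed
  qed
qed

text \<open>Only unit directions occur, and the amplitude is continuous on the compact set
  \<open>K \<times> sphere 0 1\<close>; hence the bound does not depend on the frequency.\<close>

lemma osc_bounded:
  assumes "amplitude K \<sigma>" "compact K" "K \<subseteq> V"
  obtains C where "\<And>\<xi> d. \<xi> \<noteq> 0 \<Longrightarrow> \<bar>osc \<sigma> \<xi> d\<bar> \<le> C"
proof -
  have s: "smooth_on D \<sigma>" and z: "\<And>x \<theta>. x \<notin> K \<Longrightarrow> \<sigma> (x, \<theta>) = 0" using assms by (auto simp: amplitude_def)
  have "continuous_on (K \<times> sphere 0 1) \<sigma>"
    by (rule continuous_on_subset[OF smooth_on_imp_continuous_on[OF s]]) (use assms in auto)
  then have "compact (\<sigma> ` (K \<times> sphere 0 1))"
    by (rule compact_continuous_image) (intro compact_Times assms compact_sphere)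
  from compact_imp_bounded[OF this] obtain M0 where M0: "\<And>z. z \<in> K \<times> sphere 0 1 \<Longrightarrow> \<bar>\<sigma> z\<bar> \<le> M0"
    unfolding bounded_iff by (metis image_eqI real_norm_def)
  define M where "M = max M0 0"
  have M: "\<bar>\<sigma> (x, \<theta>)\<bar> \<le> M * indicator K x" if "norm \<theta> = 1" for x \<theta>
    using M0[of "(x, \<theta>)"] z[of x \<theta>] that by (auto simp: M_def indicator_def)
  have B0: "B \<ge> 0" using sb[of 0] by simp
  have iK: "integrable lborel (\<lambda>x. B * (M * indicator K x))"
    using assms(2) emeasure_bounded_finite[OF compact_imp_bounded[OF assms(2)]] compact_imp_closed[OF assms(2)]
    by (intro integrable_mult_right integrable_real_indicator) auto
  show thesis
  proof (rule that[of "\<integral>x. B * (M * indicator K x) \<partial>lborel"])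
    fix \<xi> :: "real ^ 'n" and d assume \<xi>: "\<xi> \<noteq> 0"
    have n1: "norm (\<xi> /\<^sub>R norm \<xi>) = 1" "\<xi> /\<^sub>R norm \<xi> \<noteq> 0" using \<xi> by auto
    note i = amplitude_integrable[OF assms n1(2), of \<xi> d]
    have "\<bar>osc \<sigma> \<xi> d\<bar> \<le> (\<integral>x. \<bar>s x * (\<sigma> (x, \<xi> /\<^sub>R norm \<xi>) * cos (\<xi> \<bullet> x + d))\<bar> \<partial>lborel)"
      unfolding osc_def by (rule integral_abs_bound)
    also have "\<dots> \<le> (\<integral>x. B * (M * indicator K x) \<partial>lborel)"
    proof (rule integral_mono[OF integrable_abs[OF i] iK])
      fix x
      have "\<bar>\<sigma> (x, \<xi> /\<^sub>R norm \<xi>)\<bar> * \<bar>cos (\<xi> \<bullet> x + d)\<bar> \<le> M * indicator K x * 1"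
        by (rule mult_mono) (use M[OF n1(1), of x] in auto)
      then have "\<bar>\<sigma> (x, \<xi> /\<^sub>R norm \<xi>) * cos (\<xi> \<bullet> x + d)\<bar> \<le> M * indicator K x" by (simp add: abs_mult)
      then have "\<bar>s x\<bar> * \<bar>\<sigma> (x, \<xi> /\<^sub>R norm \<xi>) * cos (\<xi> \<bullet> x + d)\<bar> \<le> B * (M * indicator K x)"
        by (rule mult_mono[OF sb]) (use B0 in auto)
      then show "\<bar>s x * (\<sigma> (x, \<xi> /\<^sub>R norm \<xi>) * cos (\<xi> \<bullet> x + d))\<bar> \<le> B * (M * indicator K x)"
        by (simp only: abs_mult)
    qed
    finally show "\<bar>osc \<sigma> \<xi> d\<bar> \<le> (\<integral>x. B * (M * indicator K x) \<partial>lborel)" .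
  qed
qed

text \<open>Tested with \<open>tau \<sigma>\<close> times a cosine of frequency
  \<open>\<xi>\<close>, the weak equation makes the three terms of \<open>div_op_wave\<close> sum to
  zero after integration against \<open>s\<close>.\<close>

lemma osc_step:
  assumes "amplitude K \<sigma>" "compact K" "K \<subseteq> V" "\<xi> \<noteq> 0"
  shows "(norm \<xi>)\<^sup>2 * osc \<sigma> \<xi> d = norm \<xi> * osc (X1 \<sigma>) \<xi> (d + pi/2) + osc (Y1 \<sigma>) \<xi> d"
proof -
  define \<theta> where "\<theta> = \<xi> /\<^sub>R norm \<xi>"
  define \<rho> where "\<rho> = norm \<xi>"
  have \<theta>: "\<theta> \<noteq> 0" "\<rho> *\<^sub>R \<theta> = \<xi>" using assms(4) by (auto simp: \<theta>_def \<rho>_def)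
  have s: "smooth_on D \<sigma>" and z: "\<And>x \<theta>. x \<notin> K \<Longrightarrow> \<sigma> (x, \<theta>) = 0" using assms by (auto simp: amplitude_def)
  define w where "w x = tau \<sigma> (x, \<theta>) * cos (\<xi> \<bullet> x + d)" for x
  have wz: "w x = 0" if "x \<notin> K" for x using z that by (simp add: w_def tau_def)
  have "smooth_on V (\<lambda>x. tau \<sigma> (x, \<theta>))"
  proof (rule smooth_on_compose[OF V D _ _ smooth_tau[OF s]])
    have "(\<lambda>x. (x, \<theta>)) = (\<lambda>x. (x, 0 :: real ^ 'n) + (0 :: real ^ 'n, \<theta>))" by auto
    moreover have "smooth_on V (\<lambda>x. (x, 0 :: real ^ 'n) + (0 :: real ^ 'n, \<theta>))"
      by (intro smooth_on_add V smooth_on_const smooth_on_bounded_linear bounded_linear_Pair bounded_linear_ident bounded_linear_zero)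
    ultimately show "smooth_on V (\<lambda>x. (x, \<theta>))" by simp
  qed (use \<theta> in auto)
  moreover have "smooth_on V ((\<bullet>) \<xi>)"
    by (rule smooth_on_bounded_linear[OF bounded_linear_inner_right V])
  ultimately have ws: "smooth_on V w"
    unfolding w_def[abs_def] by (intro smooth_on_mult smooth_on_cos V)
  have cl: "closed K" using assms(2) by (rule compact_imp_closed)
  note X = amplitude_X1_Y1(1)[OF assms(1,2)] and Y = amplitude_X1_Y1(2)[OF assms(1,2)]
  have pw: "div_op \<alpha> w x - \<beta> x * w x = - (\<rho>\<^sup>2) * (\<sigma> (x, \<theta>) * cos (\<xi> \<bullet> x + d))
    + \<rho> * (X1 \<sigma> (x, \<theta>) * cos (\<xi> \<bullet> x + (d + pi/2))) + Y1 \<sigma> (x, \<theta>) * cos (\<xi> \<bullet> x + d)" for x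
  proof (cases "x \<in> V")
    case True
    show ?thesis using div_op_wave[OF s True \<theta>(1), of \<rho> d] unfolding \<theta>(2) w_def[symmetric] .
  next
    \<comment> \<open>Outside \<open>V\<close> all terms vanish because \<open>K\<close> is a closed
      set inside \<open>V\<close>; thus the identity may be used under the integral over the whole
      space.\<close>
    case False
    then have xK: "x \<notin> K" using assms by auto
    have 1: "(\<Sum>j\<in>UNIV. \<alpha> i j y * pd j w y) = 0" if "y \<notin> K" for i y
      using pd_zero_outside[OF cl wz that] by simp
    have "div_op \<alpha> w x = 0"
      unfolding div_op_def using pd_zero_outside[OF cl 1 xK] by simp
    then show ?thesis using xK wz z X Y by (simp add: amplitude_def)
  qed
  have "0 = (\<integral>x. s x * (div_op \<alpha> w x - \<beta> x * w x) \<partial>lborel)"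
    using weak[OF ws assms(2,3) wz] by simp
  also have "\<dots> = (\<integral>x. (- (\<rho>\<^sup>2)) * (s x * (\<sigma> (x, \<theta>) * cos (\<xi> \<bullet> x + d)))
    + \<rho> * (s x * (X1 \<sigma> (x, \<theta>) * cos (\<xi> \<bullet> x + (d + pi/2)))) + s x * (Y1 \<sigma> (x, \<theta>) * cos (\<xi> \<bullet> x + d)) \<partial>lborel)"
    unfolding pw by (intro Bochner_Integration.integral_cong) (auto simp: algebra_simps)
  also have "\<dots> = - (\<rho>\<^sup>2) * osc \<sigma> \<xi> d + \<rho> * osc (X1 \<sigma>) \<xi> (d + pi/2) + osc (Y1 \<sigma>) \<xi> d"
  proof -
    have lin: "(\<integral>x. a * f x + b * h x + k x \<partial>lborel) = a * (\<integral>x. f x \<partial>lborel) + b * (\<integral>x. h x \<partial>lborel) + (\<integral>x. k x \<partial>lborel)"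
      if "integrable lborel f" "integrable lborel h" "integrable lborel k"
      for a b :: real and f h k :: "real ^ 'n \<Rightarrow> real"
      using that by simp
    show ?thesis
      unfolding osc_def \<theta>_def[symmetric]
      by (rule lin[OF amplitude_integrable[OF assms(1-3) \<theta>(1)] amplitude_integrable[OF X assms(2-3) \<theta>(1)]
            amplitude_integrable[OF Y assms(2-3) \<theta>(1)]])
  qed
  finally show ?thesis by (simp add: \<rho>_def)
qed

text \<open>The step identity, divided by the squared norm, bounds \<open>osc \<sigma>\<close> by
  \<open>1 / norm \<xi>\<close> times quantities of the same kind, whose amplitudes
  \<open>X1 \<sigma>\<close> and \<open>Y1 \<sigma>\<close> vanish off the same \<open>K\<close>.
  Each round gains one power; a norm of at least \<open>1\<close> absorbs the term of lower
  order.\<close>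

lemma osc_decay:
  assumes "amplitude K \<sigma>" "compact K" "K \<subseteq> V"
  shows "\<exists>C. \<forall>\<xi> d. norm \<xi> \<ge> 1 \<longrightarrow> \<bar>osc \<sigma> \<xi> d\<bar> * norm \<xi> ^ m \<le> C"
  using assms(1)
proof (induction m arbitrary: \<sigma>)
  case 0
  from osc_bounded[OF 0 assms(2,3)] obtain C where "\<And>\<xi> d. \<xi> \<noteq> 0 \<Longrightarrow> \<bar>osc \<sigma> \<xi> d\<bar> \<le> C" by metis
  then have "\<bar>osc \<sigma> \<xi> d\<bar> * norm \<xi> ^ 0 \<le> C" if "norm \<xi> \<ge> 1" for \<xi> d
    using that by (cases "\<xi> = 0") auto
  then have "\<forall>\<xi> d. norm \<xi> \<ge> 1 \<longrightarrow> \<bar>osc \<sigma> \<xi> d\<bar> * norm \<xi> ^ 0 \<le> C" by blast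
  then show ?case ..
next
  case (Suc m)
  obtain C1 where C1: "\<And>\<xi> d. norm \<xi> \<ge> 1 \<Longrightarrow> \<bar>osc (X1 \<sigma>) \<xi> d\<bar> * norm \<xi> ^ m \<le> C1"
    using Suc.IH[OF amplitude_X1_Y1(1)[OF Suc.prems assms(2)]] by blast
  obtain C2 where C2: "\<And>\<xi> d. norm \<xi> \<ge> 1 \<Longrightarrow> \<bar>osc (Y1 \<sigma>) \<xi> d\<bar> * norm \<xi> ^ m \<le> C2"
    using Suc.IH[OF amplitude_X1_Y1(2)[OF Suc.prems assms(2)]] by blast
  have "\<bar>osc \<sigma> \<xi> d\<bar> * norm \<xi> ^ Suc m \<le> C1 + C2" if \<xi>: "norm \<xi> \<ge> 1" for \<xi> d
  proof -
    define \<rho> where "\<rho> = norm \<xi>"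
    have \<rho>: "\<rho> \<ge> 1" using \<xi> by (simp add: \<rho>_def)
    have "\<rho>\<^sup>2 * \<bar>osc \<sigma> \<xi> d\<bar> = \<bar>\<rho>\<^sup>2 * osc \<sigma> \<xi> d\<bar>" by (simp add: abs_mult)
    also have "\<dots> = \<bar>\<rho> * osc (X1 \<sigma>) \<xi> (d + pi/2) + osc (Y1 \<sigma>) \<xi> d\<bar>"
      using osc_step[OF Suc.prems assms(2,3), of \<xi> d] \<xi> unfolding \<rho>_def by force
    also have "\<dots> \<le> \<rho> * \<bar>osc (X1 \<sigma>) \<xi> (d + pi/2)\<bar> + \<rho> * \<bar>osc (Y1 \<sigma>) \<xi> d\<bar>"
    proof -
      have "1 * \<bar>osc (Y1 \<sigma>) \<xi> d\<bar> \<le> \<rho> * \<bar>osc (Y1 \<sigma>) \<xi> d\<bar>" using \<rho> by (intro mult_right_mono) auto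
      then show ?thesis using \<rho> abs_triangle_ineq[of "\<rho> * osc (X1 \<sigma>) \<xi> (d + pi/2)" "osc (Y1 \<sigma>) \<xi> d"]
        by (simp add: abs_mult)
    qed
    finally have "\<rho> * (\<rho> * \<bar>osc \<sigma> \<xi> d\<bar>) \<le> \<rho> * (\<bar>osc (X1 \<sigma>) \<xi> (d + pi/2)\<bar> + \<bar>osc (Y1 \<sigma>) \<xi> d\<bar>)"
      by (simp add: power2_eq_square algebra_simps)
    then have "\<rho> * \<bar>osc \<sigma> \<xi> d\<bar> \<le> \<bar>osc (X1 \<sigma>) \<xi> (d + pi/2)\<bar> + \<bar>osc (Y1 \<sigma>) \<xi> d\<bar>"
      using \<rho> by (subst (asm) mult_le_cancel_left_pos) auto
    then have "(\<rho> * \<bar>osc \<sigma> \<xi> d\<bar>) * \<rho> ^ m \<le> (\<bar>osc (X1 \<sigma>) \<xi> (d + pi/2)\<bar> + \<bar>osc (Y1 \<sigma>) \<xi> d\<bar>) * \<rho> ^ m"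
      using \<rho> by (intro mult_right_mono) auto
    also have "\<dots> \<le> C1 + C2"
      using C1[OF \<xi>, of "d + pi/2"] C2[OF \<xi>, of d] by (simp add: \<rho>_def algebra_simps)
    finally show ?thesis by (simp add: \<rho>_def algebra_simps)
  qed
  then show ?case by blast
qed

theorem regularity:
  assumes x0: "x0 \<in> V"
  obtains r F where "r > 0" "ball x0 r \<subseteq> V" "Ck_on 2 (ball x0 r) F" "AE x in lborel. x \<in> ball x0 r \<longrightarrow> s x = F x"
proof -
  obtain r0 where r0: "r0 > 0" "cball x0 r0 \<subseteq> V" using V x0 open_contains_cball by metis
  \<comment> \<open>The bound \<open>1/8\<close> is the radius on which Fourier uniqueness is
    available.\<close>
  define r where "r = min r0 (1/8)"
  have r: "r > 0" "r \<le> 1/8" "cball x0 r \<subseteq> V" using r0 by (auto simp: r_def)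
  define K where "K = cball x0 r"
  have K: "compact K" "K \<subseteq> V" using r by (auto simp: K_def)
  obtain bmp :: "real ^ 'n \<Rightarrow> real" where bmp_s: "smooth_on UNIV bmp" and bmp_1: "\<And>x. 0 \<le> bmp x" "\<And>x. bmp x \<le> 1"
    and bmp_pos: "\<And>x. x \<in> ball x0 r \<Longrightarrow> bmp x > 0" and bmp_0: "\<And>x. x \<notin> ball x0 r \<Longrightarrow> bmp x = 0"
    using euclidean_bump[OF r(1), of x0] by blast
  have bmp_m [measurable]: "bmp \<in> borel_measurable borel"
    using smooth_on_imp_continuous_on[OF bmp_s] by (rule borel_measurable_continuous_onI)
  define \<sigma> where "\<sigma> z = bmp (fst z)" for z :: "(real ^ 'n) \<times> (real ^ 'n)"
  have amplitude: "amplitude K \<sigma>"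
    unfolding amplitude_def \<sigma>_def
  proof (intro conjI allI impI)
    show "smooth_on D (\<lambda>z. bmp (fst z))" by (rule smooth_fst) (rule smooth_on_subset[OF bmp_s], simp)
    show "bmp (fst (x, \<theta>)) = 0" if "x \<notin> K" for x \<theta> using bmp_0[of x] that by (auto simp: K_def)
  qed
  define N where "N = 2 * CARD('n) + 2"
  obtain C where C: "\<And>\<xi> d. norm \<xi> \<ge> 1 \<Longrightarrow> \<bar>osc \<sigma> \<xi> d\<bar> * norm \<xi> ^ N \<le> C"
    using osc_decay[OF amplitude K] by blast
  \<comment> \<open>The bump times \<open>s\<close> is moved to the origin, where the Fourier result
    applies. The translation is absorbed into the phase.\<close>
  define U where "U x = s (x + x0) * bmp (x + x0)" for x
  have Um [measurable]: "U \<in> borel_measurable borel" unfolding U_def by measurable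
  have Ub: "\<bar>U x\<bar> \<le> B" for x
    unfolding U_def abs_mult using sb[of "x + x0"] bmp_1(1)[of "x + x0"] bmp_1(2)[of "x + x0"]
    by (intro order_trans[OF mult_left_le]) auto
  have U0: "U x = 0" if "x \<notin> ball 0 (1/8)" for x
    using that r bmp_0[of "x + x0"] by (auto simp: U_def dist_norm)
  have Uint: "(\<integral>x. U x * cos (\<xi> \<bullet> x + d) \<partial>lborel) = (\<integral>x. s x * (bmp x * cos (\<xi> \<bullet> x + (d - \<xi> \<bullet> x0))) \<partial>lborel)" for \<xi> d
    using integral_translation(1)[of "\<lambda>x. s x * (bmp x * cos (\<xi> \<bullet> x + (d - \<xi> \<bullet> x0)))" x0]
    by (simp add: U_def inner_add_right mult.assoc)
  define C0 where "C0 = (\<integral>x. \<bar>U x\<bar> \<partial>lborel)"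
  have C0: "\<bar>\<integral>x. U x * cos d \<partial>lborel\<bar> \<le> C0" for d
  proof -
    have "\<bar>\<integral>x. U x * cos d \<partial>lborel\<bar> = \<bar>\<integral>x. U x \<partial>lborel\<bar> * \<bar>cos d\<bar>" by (simp add: abs_mult)
    also have "\<dots> \<le> \<bar>\<integral>x. U x \<partial>lborel\<bar>" by (rule mult_left_le) auto
    also have "\<dots> \<le> C0" unfolding C0_def by (rule integral_abs_bound)
    finally show ?thesis .
  qed
  obtain F where F: "Ck_on 2 UNIV F" "AE x in lborel. x \<in> ball 0 (1/8) \<longrightarrow> U x = F x"
  proof (rule fourier_decay_imp_C2[OF Um Ub U0])
    fix k :: "int ^ 'n" and d
    \<comment> \<open>Frequency zero is bounded by \<open>C0\<close>. Every other lattice frequency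
      has norm at least \<open>1\<close>, so the decay estimate applies and
      \<open>1 + norm (freq k)\<close> is at most twice the norm, whence
      \<open>2 ^ N\<close>.\<close>
    show "\<bar>\<integral>x. U x * cos (freq k \<bullet> x + d) \<partial>lborel\<bar> * (1 + norm (freq k)) ^ (2 * CARD('n) + 2) \<le> max C0 (2 ^ N * C)"
    proof (cases "k = 0")
      case True
      then show ?thesis using C0[of d] by simp
    next
      case False
      then obtain i where "k $ i \<noteq> 0" by (auto simp: vec_eq_iff)
      then have "1 \<le> \<bar>real_of_int (k $ i)\<bar>" by linarith
      then have "1 * 1 \<le> (2 * pi) * \<bar>real_of_int (k $ i)\<bar>" using pi_gt3 by (intro mult_mono) auto
      also have "\<dots> = \<bar>freq k $ i\<bar>" by (simp add: freq_def abs_mult)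
      also have "\<dots> \<le> norm (freq k)" by (rule component_le_norm_cart)
      finally have n: "norm (freq k) \<ge> 1" by simp
      have "(\<integral>x. U x * cos (freq k \<bullet> x + d) \<partial>lborel) = osc \<sigma> (freq k) (d - freq k \<bullet> x0)"
        unfolding Uint osc_def \<sigma>_def by simp
      moreover have "(1 + norm (freq k)) ^ N \<le> (2 * norm (freq k)) ^ N"
        using n by (intro power_mono) auto
      ultimately have "\<bar>\<integral>x. U x * cos (freq k \<bullet> x + d) \<partial>lborel\<bar> * (1 + norm (freq k)) ^ N
        \<le> \<bar>osc \<sigma> (freq k) (d - freq k \<bullet> x0)\<bar> * (2 * norm (freq k)) ^ N"
        by (simp only: mult_left_mono abs_ge_zero)
      also have "\<dots> = 2 ^ N * (\<bar>osc \<sigma> (freq k) (d - freq k \<bullet> x0)\<bar> * norm (freq k) ^ N)"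
        by (simp add: power_mult_distrib)
      also have "\<dots> \<le> 2 ^ N * C" using C[OF n] by (intro mult_left_mono) auto
      finally show ?thesis by (simp add: N_def)
    qed
  qed auto
  show thesis
  \<comment> \<open>The bump is positive on the whole open ball, so dividing by it recovers
    \<open>s\<close> there.\<close>
  proof (rule that[of r "\<lambda>x. F (x - x0) * inverse (bmp x)"])
    show "r > 0" "ball x0 r \<subseteq> V" using r by auto
    show "Ck_on 2 (ball x0 r) (\<lambda>x. F (x - x0) * inverse (bmp x))"
    proof (rule Ck_on_mult)
      have "Ck_on 2 (ball x0 r) (\<lambda>x. x + (- x0))"
        by (intro Ck_on_add Ck_on_const Ck_on_bounded_linear bounded_linear_ident) auto
      then show "Ck_on 2 (ball x0 r) (\<lambda>x. F (x - x0))"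
        by (intro Ck_on_compose[OF _ open_UNIV _ _ F(1)]) auto
      show "Ck_on 2 (ball x0 r) (\<lambda>x. inverse (bmp x))"
        by (intro smooth_onD smooth_on_inverse smooth_on_subset[OF bmp_s]) (use bmp_pos in force)+
    qed simp
    have "AE x in distr lborel borel ((+) (- x0)). x \<in> ball 0 (1/8) \<longrightarrow> U x = F x"
      unfolding lborel_distr_plus by (rule F(2))
    then have "AE x in lborel. - x0 + x \<in> ball 0 (1/8) \<longrightarrow> U (- x0 + x) = F (- x0 + x)"
      by (rule AE_distrD[rotated]) simp
    then have "AE x in lborel. x \<in> ball x0 r \<longrightarrow> U (x - x0) = F (x - x0)"
      by eventually_elim (use r in \<open>auto simp: dist_norm norm_minus_commute\<close>)
    then show "AE x in lborel. x \<in> ball x0 r \<longrightarrow> s x = F (x - x0) * inverse (bmp x)"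
    proof eventually_elim
      case (elim x)
      then show ?case using bmp_pos[of x] by (auto simp: U_def field_simps)
    qed
  qed
qed

end

subsection \<open>Change of variables for an arbitrary finite index type\<close>

text \<open>The library states the change of variables formula for vectors indexed by a well-ordered type.
  The copy \<open>'a wo\<close> of a finite type carries such an order.\<close>

typedef 'a wo = "UNIV :: 'a set" by simp

instantiation wo :: (finite) wellorder
begin

definition idx_wo :: "'a wo \<Rightarrow> nat" where
  "idx_wo x = (SOME f :: 'a \<Rightarrow> nat. inj f) (Rep_wo x)"

definition less_eq_wo :: "'a wo \<Rightarrow> 'a wo \<Rightarrow> bool" where
  "less_eq_wo x y \<longleftrightarrow> idx_wo x \<le> idx_wo y"

definition less_wo :: "'a wo \<Rightarrow> 'a wo \<Rightarrow> bool" where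
  "less_wo x y \<longleftrightarrow> idx_wo x < idx_wo y"

lemma inj_idx_wo: "inj (idx_wo :: 'a wo \<Rightarrow> nat)"
proof -
  have "\<exists>f :: 'a \<Rightarrow> nat. inj f" using finite_imp_inj_to_nat_seg[of "UNIV :: 'a set"] by blast
  then have *: "inj (SOME f :: 'a \<Rightarrow> nat. inj f)" by (rule someI_ex)
  show ?thesis
  proof (rule injI)
    fix x y :: "'a wo" assume "idx_wo x = idx_wo y"
    then show "x = y" unfolding idx_wo_def inj_eq[OF *] Rep_wo_inject .
  qed
qed

instance
proof
  fix x y z :: "'a wo" and P
  show "x \<le> x" by (simp add: less_eq_wo_def)
  show "x \<le> y \<Longrightarrow> y \<le> z \<Longrightarrow> x \<le> z" by (simp add: less_eq_wo_def)
  show "x < y \<longleftrightarrow> x \<le> y \<and> \<not> y \<le> x" by (auto simp: less_eq_wo_def less_wo_def)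
  show "x \<le> y \<Longrightarrow> y \<le> x \<Longrightarrow> x = y"
    using inj_idx_wo by (auto simp: less_eq_wo_def inj_on_def)
  show "x \<le> y \<or> y \<le> x" by (auto simp: less_eq_wo_def)
  show "P x" if "\<And>x. (\<And>y. y < x \<Longrightarrow> P y) \<Longrightarrow> P x"
    using that
  proof (induction "idx_wo x" arbitrary: x rule: less_induct)
    case less
    then show ?case by (metis less_wo_def)
  qed
qed

end

instance wo :: (finite) finite
proof
  have "(UNIV :: 'a wo set) = Abs_wo ` UNIV" by (metis Rep_wo_inverse surj_def)
  then show "finite (UNIV :: 'a wo set)" by (metis finite finite_imageI)
qed

lemma bij_Rep_wo: "bij (Rep_wo :: 'a wo \<Rightarrow> 'a)"
  by (metis Abs_wo_inverse Rep_wo_inverse UNIV_I bijI')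

definition to_wo :: "real ^ 'n \<Rightarrow> real ^ ('n wo)" where "to_wo x = (\<chi> i. x $ Rep_wo i)"
definition of_wo :: "real ^ ('n wo) \<Rightarrow> real ^ 'n" where "of_wo x = (\<chi> i. x $ Abs_wo i)"

lemma to_of_wo [simp]: "to_wo (of_wo x) = x" "of_wo (to_wo y) = y"
  by (auto simp: to_wo_def of_wo_def vec_eq_iff Rep_wo_inverse Abs_wo_inverse)

lemma to_wo_eq_iff: "to_wo x = to_wo y \<longleftrightarrow> x = y"
  by (metis to_of_wo(2))

lemma linear_to_wo: "linear to_wo" and linear_of_wo: "linear of_wo"
  by (auto intro!: linearI simp: to_wo_def of_wo_def vec_eq_iff)

lemma measurable_to_wo [measurable]: "to_wo \<in> borel_measurable borel"
  and measurable_of_wo [measurable]: "of_wo \<in> borel_measurable borel"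
  using linear_continuous_on[OF linear_conv_bounded_linear[THEN iffD1, OF linear_to_wo]]
    linear_continuous_on[OF linear_conv_bounded_linear[THEN iffD1, OF linear_of_wo]]
  by (auto intro: borel_measurable_continuous_onI)

lemma prod_Basis_cart: "(\<Prod>b\<in>(Basis :: (real ^ 'n) set). x \<bullet> b) = (\<Prod>i\<in>UNIV. x $ i)"
  unfolding Basis_vec_def
  by (simp add: UNION_singleton_eq_range prod.reindex inj_on_def axis_eq_axis inner_axis)

text \<open>Lebesgue measure is determined by its values on boxes, and relabelling the coordinates
  maps boxes to boxes with the same side lengths.\<close>

lemma lborel_to_wo: "distr lborel borel (to_wo :: real ^ 'n \<Rightarrow> _) = lborel"
proof (rule lborel_eqI[symmetric])
  fix l u :: "real ^ ('n wo)" assume le: "\<And>b. b \<in> Basis \<Longrightarrow> l \<bullet> b \<le> u \<bullet> b"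
  have "l $ i \<le> u $ i" for i using le[of "axis i 1"] by (simp add: axis_in_Basis_iff inner_axis)
  then have le': "of_wo l \<bullet> b \<le> of_wo u \<bullet> b" if "b \<in> Basis" for b
    using that by (auto simp: Basis_vec_def inner_axis of_wo_def)
  have "to_wo -` box l u = box (of_wo l) (of_wo u)"
  proof (rule set_eqI)
    fix x
    show "x \<in> to_wo -` box l u \<longleftrightarrow> x \<in> box (of_wo l) (of_wo u)"
      by (auto simp: mem_box_cart to_wo_def of_wo_def) (metis Rep_wo_inverse Abs_wo_inverse UNIV_I)+
  qed
  then have "emeasure (distr lborel borel (to_wo :: real ^ 'n \<Rightarrow> _)) (box l u) = (\<Prod>b\<in>Basis. (of_wo u - of_wo l) \<bullet> b)"
    using le' by (subst emeasure_distr) auto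
  also have "(\<Prod>b\<in>Basis. (of_wo u - of_wo l) \<bullet> b) = (\<Prod>b\<in>Basis. (u - l) \<bullet> b)"
    unfolding prod_Basis_cart
    by (rule prod.reindex_bij_witness[where i = Rep_wo and j = Abs_wo])
      (auto simp: of_wo_def Rep_wo_inverse Abs_wo_inverse)
  finally show "emeasure (distr lborel borel (to_wo :: real ^ 'n \<Rightarrow> _)) (box l u) = (\<Prod>b\<in>Basis. (u - l) \<bullet> b)" .
qed simp

text \<open>Conjugation by the relabelling matches the permutations of the two index types, with
  equal signs and equal products of entries.\<close>

lemma det_wo:
  fixes A :: "real ^ 'n ^ 'n"
  shows "det (\<chi> i j. A $ Rep_wo i $ Rep_wo j) = det A"
  unfolding det_def
proof (rule sum.reindex_bij_witness[where i = "map_permutation UNIV Abs_wo" and j = "map_permutation UNIV Rep_wo"])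
  have bR: "bij_betw (Rep_wo :: _ \<Rightarrow> 'n) UNIV UNIV" by (rule bij_Rep_wo)
  fix p :: "'n wo \<Rightarrow> 'n wo" assume p: "p \<in> {p. p permutes UNIV}"
  show "map_permutation UNIV Abs_wo (map_permutation UNIV Rep_wo p) = p"
    using p bR by (intro map_permutation_compose_inv[where B = UNIV]) (auto simp: Rep_wo_inverse)
  show "map_permutation UNIV Rep_wo p \<in> {p. p permutes UNIV}"
    using p bR by (auto intro: map_permutation_permutes)
  have s: "sign (map_permutation UNIV Rep_wo p) = sign p"
    using p bR by (intro sign_map_permutation) (auto simp: bij_betw_def)
  have "map_permutation UNIV Rep_wo p (Rep_wo i) = Rep_wo (p i)" for i :: "'n wo"
    using bR by (intro map_permutation_apply) (auto simp: bij_betw_def)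
  then have "(\<Prod>i\<in>UNIV. A $ i $ map_permutation UNIV Rep_wo p i) = (\<Prod>i\<in>UNIV. A $ Rep_wo i $ Rep_wo (p i))"
    by (subst prod.reindex_bij_betw[OF bR, symmetric]) simp
  then show "of_int (sign (map_permutation UNIV Rep_wo p)) * (\<Prod>i\<in>UNIV. A $ i $ map_permutation UNIV Rep_wo p i)
     = of_int (sign p) * (\<Prod>i\<in>UNIV. (\<chi> i j. A $ Rep_wo i $ Rep_wo j) $ i $ p i)"
    using s by simp
next
  have bA: "bij_betw (Abs_wo :: 'n \<Rightarrow> _) UNIV UNIV"
    by (metis Abs_wo_inverse Rep_wo_inverse UNIV_I bijI')
  fix q :: "'n \<Rightarrow> 'n" assume q: "q \<in> {p. p permutes UNIV}"
  show "map_permutation UNIV Rep_wo (map_permutation UNIV Abs_wo q) = q"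
    using q bA by (intro map_permutation_compose_inv[where B = UNIV]) (auto simp: Abs_wo_inverse)
  show "map_permutation UNIV Abs_wo q \<in> {p. p permutes UNIV}"
    using q bA by (auto intro: map_permutation_permutes)
qed

text \<open>The finiteness hypothesis supplies absolute integrability of \<open>f\<close> on the
  image, under which the vector-valued formula is applied; \<open>f\<close> is wrapped into a
  one-dimensional vector for this.\<close>

lemma nn_change_of_variables_wo:
  fixes T :: "real ^ 'm::{finite,wellorder} \<Rightarrow> real ^ 'm::_" and f :: "real ^ 'm::_ \<Rightarrow> real"
  assumes S: "S \<in> sets borel" "T ` S \<in> sets borel" and T: "\<And>x. x \<in> S \<Longrightarrow> (T has_derivative T' x) (at x)"
    and inj: "inj_on T S" and f [measurable]: "f \<in> borel_measurable borel" and f0: "\<And>y. f y \<ge> 0"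
    and fin: "(\<integral>\<^sup>+y. ennreal (f y) * indicator (T ` S) y \<partial>lborel) < \<infinity>"
  shows "(\<integral>\<^sup>+x. ennreal (\<bar>det (matrix (T' x))\<bar> * f (T x)) * indicator S x \<partial>lborel)
    = (\<integral>\<^sup>+y. ennreal (f y) * indicator (T ` S) y \<partial>lborel)"
proof -
  define F where "F y = (vec (f y) :: real ^ 1)" for y
  have "integrable lborel (\<lambda>y. indicator (T ` S) y *\<^sub>R f y)"
    using S fin f0 by (intro integrableI_nonneg)
      (auto simp: ennreal_mult' mult.commute ennreal_indicator)
  then have "set_integrable lebesgue (T ` S) f"
    unfolding set_integrable_def by (rule integrable_completion[THEN iffD2, rotated]) (use S in measurable)
  then have "f absolutely_integrable_on (T ` S)" .
  then have "F absolutely_integrable_on (T ` S)"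
    unfolding F_def by (simp add: absolutely_integrable_on_1_iff)
  then have "(\<lambda>x. \<bar>det (matrix (T' x))\<bar> *\<^sub>R F (T x)) absolutely_integrable_on S \<and>
      integral S (\<lambda>x. \<bar>det (matrix (T' x))\<bar> *\<^sub>R F (T x)) = integral (T ` S) F"
  proof (subst has_absolute_integral_change_of_variables)
    show "S \<in> sets lebesgue" using S by simp
    show "(T has_derivative T' x) (at x within S)" if "x \<in> S" for x
      by (rule has_derivative_at_withinI[OF T[OF that]])
  qed (use inj in simp_all)
  then have *: "((\<lambda>x. \<bar>det (matrix (T' x))\<bar> *\<^sub>R F (T x)) has_integral integral (T ` S) F) S"
    using integrable_integral[OF set_lebesgue_integral_eq_integral(1)] by fastforce
  have **: "(F has_integral integral (T ` S) F) (T ` S)"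
    by (rule integrable_integral[OF set_lebesgue_integral_eq_integral(1)]) fact
  define I where "I = integral (T ` S) F $ 1"
  have "((\<lambda>x. \<bar>det (matrix (T' x))\<bar> * f (T x)) has_integral I) S"
    using has_integral_linear[OF * bounded_linear_vec_nth[of 1]] by (simp add: I_def o_def F_def)
  from nn_integral_has_integral_lebesgue'[OF _ this]
  have "(\<integral>\<^sup>+x. ennreal (\<bar>det (matrix (T' x))\<bar> * f (T x)) * indicator S x \<partial>lborel) = ennreal I"
    using f0 by simp
  moreover have "(f has_integral I) (T ` S)"
    using has_integral_linear[OF ** bounded_linear_vec_nth[of 1]] by (simp add: I_def o_def F_def)
  from nn_integral_has_integral_lebesgue'[OF _ this]
  have "(\<integral>\<^sup>+y. ennreal (f y) * indicator (T ` S) y \<partial>lborel) = ennreal I" using f0 by simp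
  ultimately show ?thesis by simp
qed

text \<open>Relabelling preserves Lebesgue measure and determinants. The integrand \<open>h\<close>
  is tied to the Jacobian on \<open>S\<close> alone, so that functions extended from a chart by zero
  can be inserted.\<close>

lemma nn_change_of_variables:
  fixes T :: "real ^ 'n \<Rightarrow> real ^ 'n" and f h :: "real ^ 'n \<Rightarrow> real"
  assumes S [measurable]: "S \<in> sets borel" and TS [measurable]: "T ` S \<in> sets borel"
    and T: "\<And>x. x \<in> S \<Longrightarrow> (T has_derivative T' x) (at x)"
    and inj: "inj_on T S" and f [measurable]: "f \<in> borel_measurable borel" and f0: "\<And>y. f y \<ge> 0"
    and fin: "(\<integral>\<^sup>+y. ennreal (f y) * indicator (T ` S) y \<partial>lborel) < \<infinity>"
    and h [measurable]: "h \<in> borel_measurable borel"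
    and hf: "\<And>x. x \<in> S \<Longrightarrow> h x = \<bar>det (matrix (T' x))\<bar> * f (T x)"
  shows "(\<integral>\<^sup>+x. ennreal (h x) * indicator S x \<partial>lborel) = (\<integral>\<^sup>+y. ennreal (f y) * indicator (T ` S) y \<partial>lborel)"
proof -
  have tr: "(\<integral>\<^sup>+x. k (of_wo x) \<partial>lborel) = (\<integral>\<^sup>+x. k x \<partial>lborel)"
    if [measurable]: "k \<in> borel_measurable borel" for k :: "real ^ 'n \<Rightarrow> ennreal"
    by (subst lborel_to_wo[symmetric], subst nn_integral_distr) auto
  define T2 where "T2 = to_wo \<circ> T \<circ> of_wo"
  define T2' where "T2' x = to_wo \<circ> T' (of_wo x) \<circ> of_wo" for x
  define S2 where "S2 = of_wo -` S"
  have im: "T2 ` S2 = of_wo -` (T ` S)"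
  proof (rule set_eqI)
    fix y
    show "y \<in> T2 ` S2 \<longleftrightarrow> y \<in> of_wo -` (T ` S)"
    proof
      assume "y \<in> of_wo -` (T ` S)"
      then obtain x where "x \<in> S" "of_wo y = T x" by auto
      then have "y = T2 (to_wo x)" "to_wo x \<in> S2" by (auto simp: T2_def S2_def) (metis to_of_wo(1))
      then show "y \<in> T2 ` S2" by blast
    qed (auto simp: T2_def S2_def)
  qed
  have S2 [measurable]: "S2 \<in> sets borel" and TS2 [measurable]: "T2 ` S2 \<in> sets borel"
    using measurable_sets_borel[OF measurable_of_wo S] measurable_sets_borel[OF measurable_of_wo TS]
    unfolding im by (auto simp: S2_def)
  have det2: "det (matrix (T2' x)) = det (matrix (T' (of_wo x)))" if "of_wo x \<in> S" for x
  proof -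
    have "of_wo (axis j 1) = axis (Rep_wo j) 1" for j :: "'n wo"
      by (auto simp: of_wo_def axis_def vec_eq_iff Abs_wo_inverse Rep_wo_inverse)
    then have "matrix (T2' x) = (\<chi> i j. matrix (T' (of_wo x)) $ Rep_wo i $ Rep_wo j)"
      by (intro vec_eq_iff[THEN iffD2] allI) (simp add: T2'_def matrix_def to_wo_def)
    then show ?thesis by (simp add: det_wo)
  qed
  have "(\<integral>\<^sup>+x. ennreal (h x) * indicator S x \<partial>lborel) = (\<integral>\<^sup>+x. ennreal (h (of_wo x)) * indicator S (of_wo x) \<partial>lborel)"
    by (rule tr[symmetric]) measurable
  also have "\<dots> = (\<integral>\<^sup>+x. ennreal (\<bar>det (matrix (T2' x))\<bar> * f (of_wo (T2 x))) * indicator S2 x \<partial>lborel)"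
    by (intro nn_integral_cong) (auto simp: S2_def indicator_def hf det2 T2_def)
  also have "\<dots> = (\<integral>\<^sup>+y. ennreal (f (of_wo y)) * indicator (T2 ` S2) y \<partial>lborel)"
  proof (rule nn_change_of_variables_wo[OF S2 TS2])
    show "(T2 has_derivative T2' x) (at x)" if "x \<in> S2" for x
      unfolding T2_def T2'_def using that T[of "of_wo x"]
      by (auto intro!: diff_chain_at linear_imp_has_derivative linear_to_wo linear_of_wo simp: S2_def)
    show "inj_on T2 S2"
      using inj by (auto simp: inj_on_def T2_def S2_def to_wo_eq_iff) (metis to_of_wo(1))
    have "(\<integral>\<^sup>+y. ennreal (f (of_wo y)) * indicator (T2 ` S2) y \<partial>lborel) = (\<integral>\<^sup>+y. ennreal (f y) * indicator (T ` S) y \<partial>lborel)"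
      unfolding im using tr[of "\<lambda>y. ennreal (f y) * indicator (T ` S) y"] by (simp add: indicator_def)
    then show "(\<integral>\<^sup>+y. ennreal (f (of_wo y)) * indicator (T2 ` S2) y \<partial>lborel) < \<infinity>" using fin by simp
  qed (use f0 in auto)
  also have "\<dots> = (\<integral>\<^sup>+y. ennreal (f y) * indicator (T ` S) y \<partial>lborel)"
    unfolding im using tr[of "\<lambda>y. ennreal (f y) * indicator (T ` S) y"] by (simp add: indicator_def)
  finally show ?thesis .
qed

subsection \<open>Linear algebra of metrics\<close>

definition pos_def :: "real ^ 'n ^ 'n \<Rightarrow> bool" where
  "pos_def G \<longleftrightarrow> transpose G = G \<and> (\<forall>v. v \<noteq> 0 \<longrightarrow> v \<bullet> (G *v v) > 0)"

text \<open>Along the segment from the identity to \<open>G\<close> the determinant starts at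
  \<open>1\<close>. A zero would give a kernel vector of a convex combination of two positive
  definite matrices.\<close>

lemma pos_def_det: 
  assumes "pos_def G" shows "det G > 0"
proof (rule ccontr)
  assume "\<not> det G > 0"
  define f where "f t = det (t *\<^sub>R G + (1 - t) *\<^sub>R mat 1)" for t :: real
  have "continuous_on {0..1} f"
    unfolding f_def det_def by (intro continuous_intros)
  moreover have "f 0 = 1" "f 1 \<le> 0" using \<open>\<not> det G > 0\<close> by (auto simp: f_def)
  ultimately obtain t where t: "0 \<le> t" "t \<le> 1" "f t = 0"
    using IVT2'[of f 1 0 0] by auto
  then have "\<not> invertible (t *\<^sub>R G + (1 - t) *\<^sub>R mat 1)" unfolding invertible_det_nz f_def by simp
  then obtain v where v: "v \<noteq> 0" "(t *\<^sub>R G + (1 - t) *\<^sub>R mat 1) *v v = 0"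
    using invertible_left_inverse matrix_left_invertible_ker by metis
  then have "0 = v \<bullet> ((t *\<^sub>R G + (1 - t) *\<^sub>R mat 1) *v v)" by simp
  also have "\<dots> = t * (v \<bullet> (G *v v)) + (1 - t) * (v \<bullet> v)"
    by (simp add: matrix_vector_mult_add_rdistrib inner_add_right scaleR_matrix_vector_assoc[symmetric])
  finally have "t * (v \<bullet> (G *v v)) + (1 - t) * (v \<bullet> v) = 0" by simp
  moreover have "v \<bullet> (G *v v) > 0" "v \<bullet> v > 0" using assms v by (auto simp: pos_def_def)
  ultimately show False using t
    by (smt (verit, best) mult_nonneg_nonneg mult_pos_pos)
qed

lemma matrix_inv_works:
  assumes "invertible (G :: real ^ 'n ^ 'n)"
  shows "G ** matrix_inv G = mat 1" "matrix_inv G ** G = mat 1"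
proof -
  have "\<exists>A'. G ** A' = mat 1 \<and> A' ** G = mat 1" using assms by (auto simp: invertible_def)
  from someI_ex[OF this] show "G ** matrix_inv G = mat 1" "matrix_inv G ** G = mat 1"
    by (auto simp: matrix_inv_def)
qed

lemma matrix_inv_eqI:
  assumes "G ** B = mat 1" shows "matrix_inv G = (B :: real ^ 'n ^ 'n)"
proof -
  have BG: "B ** G = mat 1" using assms matrix_left_right_inverse by blast
  then have "invertible G" using assms by (auto simp: invertible_def)
  then have "matrix_inv G = matrix_inv G ** (G ** B)" using assms by simp
  also have "\<dots> = B" using matrix_inv_works[OF \<open>invertible G\<close>] by (simp add: matrix_mul_assoc)
  finally show ?thesis .
qed

lemma pos_def_inv:
  assumes "pos_def G"
  shows "invertible G" "transpose (matrix_inv G) = matrix_inv G" "v \<noteq> 0 \<Longrightarrow> v \<bullet> (matrix_inv G *v v) > 0"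
proof -
  show i: "invertible G" using pos_def_det[OF assms] by (simp add: invertible_det_nz)
  note w = matrix_inv_works[OF i]
  have t: "transpose G = G" using assms by (simp add: pos_def_def)
  have "G ** transpose (matrix_inv G) = transpose (matrix_inv G ** G)"
    by (simp add: matrix_transpose_mul t)
  also have "\<dots> = mat 1" by (simp add: w transpose_mat)
  finally show "transpose (matrix_inv G) = matrix_inv G" by (rule matrix_inv_eqI[symmetric])
  assume v: "v \<noteq> 0"
  define u where "u = matrix_inv G *v v"
  have vu: "v = G *v u" unfolding u_def by (simp add: matrix_vector_mul_assoc w)
  then have "u \<noteq> 0" using v by auto
  then have "u \<bullet> (G *v u) > 0" using assms by (simp add: pos_def_def)
  then show "v \<bullet> (matrix_inv G *v v) > 0" unfolding u_def[symmetric] using vu by (simp add: inner_commute)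
qed

text \<open>This is the transformation law of the dual metric, the one induced on covectors, for a
  coordinate change with Jacobian \<open>J\<close>.\<close>

lemma matrix_inv_congruence:
  fixes G J :: "real ^ 'n ^ 'n"
  assumes "invertible G" "invertible J"
  shows "J ** matrix_inv (transpose J ** G ** J) ** transpose J = matrix_inv G"
proof (rule matrix_inv_eqI[symmetric])
  have Jt: "invertible (transpose J)" using assms(2) by (simp add: invertible_det_nz det_transpose)
  define M where "M = transpose J ** G ** J"
  have M: "invertible M" unfolding M_def using assms Jt by (intro invertible_mult)
  have "transpose J ** (G ** (J ** matrix_inv M ** transpose J)) = (M ** matrix_inv M) ** transpose J"
    by (simp add: M_def matrix_mul_assoc)
  also have "\<dots> = transpose J ** mat 1" by (simp add: matrix_inv_works[OF M])
  finally have "matrix_inv (transpose J) ** (transpose J ** (G ** (J ** matrix_inv M ** transpose J))) = matrix_inv (transpose J) ** (transpose J ** mat 1)"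
    by simp
  then show "G ** (J ** matrix_inv (transpose J ** G ** J) ** transpose J) = mat 1"
    using matrix_inv_works[OF Jt] unfolding M_def[symmetric] by (simp add: matrix_mul_assoc)
qed

text \<open>Cramer's rule writes each entry of the inverse as a quotient of determinants whose
  entries are smooth.\<close>

lemma smooth_on_matrix_inv:
  fixes f :: "'a::real_normed_vector \<Rightarrow> real ^ 'n ^ 'n"
  assumes S: "open S" and f: "\<And>i j. smooth_on S (\<lambda>x. f x $ i $ j)" and inv: "\<And>x. x \<in> S \<Longrightarrow> det (f x) \<noteq> 0"
  shows "smooth_on S (\<lambda>x. matrix_inv (f x) $ i $ j)"
proof (rule smooth_on_cong[OF S])
  let ?M = "\<lambda>x. (\<chi> k l. if l = i then axis j 1 $ k else f x $ k $ l) :: real ^ 'n ^ 'n"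
  show "smooth_on S (\<lambda>x. det (?M x) / det (f x))"
  proof (intro smooth_on_divide S smooth_on_det f inv)
    fix k l
    show "smooth_on S (\<lambda>x. ?M x $ k $ l)" using f[of k l] by (cases "l = i") auto
  qed
  fix x assume x: "x \<in> S"
  have "f x *v (matrix_inv (f x) *v axis j 1) = axis j 1"
    using matrix_inv_works[of "f x"] inv[OF x] by (simp add: matrix_vector_mul_assoc invertible_det_nz)
  then have "matrix_inv (f x) *v axis j 1 = (\<chi> k. det (\<chi> i l. if l = k then axis j 1 $ i else f x $ i $ l) / det (f x))"
    using cramer[OF inv[OF x]] by blast
  moreover have "(matrix_inv (f x) *v axis j 1) $ i = matrix_inv (f x) $ i $ j"
    by (simp add: matrix_vector_mult_basis column_def)
  ultimately have "matrix_inv (f x) $ i $ j = (\<chi> k. det (\<chi> i l. if l = k then axis j 1 $ i else f x $ i $ l) / det (f x)) $ i"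
    by (simp only:)
  then show "det (?M x) / det (f x) = matrix_inv (f x) $ i $ j" by simp
qed

subsection \<open>Measures determined locally\<close>

text \<open>The Lindelof property reduces the neighbourhoods to countably many. \<open>B\<close>
  then splits into countably many disjoint pieces, each inside one of them.\<close>

lemma measures_eq_local:
  fixes M N :: "'a::second_countable_topology measure"
  assumes [simp]: "sets M = sets borel" "sets N = sets borel"
    and loc: "\<And>p. p \<in> W \<Longrightarrow> \<exists>Q. open Q \<and> p \<in> Q \<and> (\<forall>B\<in>sets borel. B \<subseteq> Q \<longrightarrow> emeasure M B = emeasure N B)"
    and B: "B \<in> sets borel" "B \<subseteq> W"
  shows "emeasure M B = emeasure N B"
proof (cases "B = {}")
  case False
  obtain U where U: "\<And>p. p \<in> W \<Longrightarrow> open (U p) \<and> p \<in> U p \<and> (\<forall>B\<in>sets borel. B \<subseteq> U p \<longrightarrow> emeasure M B = emeasure N B)"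
    using loc by metis
  obtain F where F: "F \<subseteq> U ` B" "countable F" "\<Union>F = \<Union>(U ` B)"
    by (rule Lindelof_openin[of "U ` B" UNIV]) (use U B in auto)
  have "F \<noteq> {}" using F(3) False U B by fastforce
  define C where "C = from_nat_into F"
  have C: "C n \<in> F" for n unfolding C_def using \<open>F \<noteq> {}\<close> by (rule from_nat_into)
  have CU: "\<exists>p\<in>W. C n = U p" for n using subsetD[OF F(1) C[of n]] B(2) by blast
  have Cb: "C n \<in> sets borel" for n using CU[of n] U by auto
  define D where "D n = B \<inter> disjointed C n" for n
  have Db: "D n \<in> sets borel" for n
    unfolding D_def using B(1) Cb sets.range_disjointed_sets[of C borel] by auto
  have "B \<subseteq> \<Union>(range C)"
  proof -
    have "range C = F" unfolding C_def by (rule range_from_nat_into[OF \<open>F \<noteq> {}\<close> F(2)])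
    then show ?thesis using F(3) U B by fastforce
  qed
  then have BD: "B = (\<Union>n. D n)" unfolding D_def using UN_disjointed_eq[of C] by blast
  have dj: "disjoint_family D"
    unfolding D_def using disjoint_family_disjointed[of C] by (auto simp: disjoint_family_on_def)
  have "emeasure M (D n) = emeasure N (D n)" for n
    using CU[of n] U Db[of n] disjointed_subset[of C n] unfolding D_def by blast
  moreover have "emeasure M B = (\<Sum>n. emeasure M (D n))" "emeasure N B = (\<Sum>n. emeasure N (D n))"
    using Db dj unfolding BD by (intro suminf_emeasure[symmetric]; auto)+
  ultimately show ?thesis by simp
qed simp

lemma ennreal_suminf_commute: "(\<Sum>i. \<Sum>j. f i j) = (\<Sum>j. \<Sum>i. f i j :: ennreal)" for f :: "nat \<Rightarrow> nat \<Rightarrow> ennreal"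
proof -
  have "(\<Sum>i. \<Sum>j. f i j) = (\<integral>\<^sup>+i. (\<Sum>j. f i j) \<partial>count_space UNIV)" by (simp add: nn_integral_count_space_nat)
  also have "\<dots> = (\<Sum>j. \<integral>\<^sup>+i. f i j \<partial>count_space UNIV)" by (rule nn_integral_suminf) simp
  finally show ?thesis by (simp add: nn_integral_count_space_nat)
qed

subsection \<open>Charts and the volume measure\<close>

locale mwd =
  fixes A :: "('a::{t2_space, second_countable_topology}, 'n::finite) chart set"
    and g :: "('a, 'n) metric_tensor" and \<phi> :: "'a \<Rightarrow> real"
  assumes mwd: "manifold_with_density A g \<phi>"
begin

abbreviation V :: "('a, 'n) chart \<Rightarrow> (real ^ 'n) set" where "V c \<equiv> snd c ` fst c"
abbreviation ci :: "('a, 'n) chart \<Rightarrow> real ^ 'n \<Rightarrow> 'a" where "ci c \<equiv> inv_into (fst c) (snd c)"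

lemma atlas: "smooth_atlas A" and metric: "riemannian_metric A g" and phi: "smooth_fun_on A UNIV \<phi>"
  and conn: "connected (UNIV :: 'a set)"
  using mwd by (auto simp: manifold_with_density_def)

lemma chart:
  assumes "c \<in> A"
  shows "open (fst c)" "open (V c)" "continuous_on (fst c) (snd c)" "continuous_on (V c) (ci c)"
    "p \<in> fst c \<Longrightarrow> ci c (snd c p) = p" "y \<in> V c \<Longrightarrow> snd c (ci c y) = y" "y \<in> V c \<Longrightarrow> ci c y \<in> fst c"
    "inj_on (snd c) (fst c)"
proof -
  have "is_chart c" using assms atlas by (auto simp: smooth_atlas_def)
  then have h: "open (fst c)" "open (V c)" "homeomorphism (fst c) (V c) (snd c) (ci c)" by (auto simp: is_chart_def)
  then show "open (fst c)" "open (V c)" "continuous_on (fst c) (snd c)" "continuous_on (V c) (ci c)"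
    "p \<in> fst c \<Longrightarrow> ci c (snd c p) = p" "y \<in> V c \<Longrightarrow> snd c (ci c y) = y" "y \<in> V c \<Longrightarrow> ci c y \<in> fst c"
    by (auto simp: homeomorphism_def)
  show "inj_on (snd c) (fst c)"
    by (rule inj_on_inverseI[of _ "ci c"]) (use h(3) in \<open>auto simp: homeomorphism_def\<close>)
qed

lemma ex_chart: "\<exists>c\<in>A. p \<in> fst c"
  using atlas by (auto simp: smooth_atlas_def)

lemma chart_at: "chart_at A p \<in> A" "p \<in> fst (chart_at A p)"
proof -
  have "\<exists>c. c \<in> A \<and> p \<in> fst c" using ex_chart[of p] by blast
  from someI_ex[OF this] show "chart_at A p \<in> A" "p \<in> fst (chart_at A p)" by (auto simp: chart_at_def)
qed

lemma open_chart_image: 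
  assumes "c \<in> A" "open W" shows "open (snd c ` (fst c \<inter> W))"
proof -
  have "snd c ` (fst c \<inter> W) = V c \<inter> ci c -` W"
    using chart(5,6,7)[OF assms(1)] by (auto simp: image_iff)
  then show ?thesis
    using continuous_open_preimage[OF chart(4)[OF assms(1)] chart(2)[OF assms(1)] assms(2)] by simp
qed

lemma open_chart_preimage:
  assumes "c \<in> A" "open S" shows "open {p \<in> fst c. snd c p \<in> S}"
  using continuous_open_preimage[OF chart(3)[OF assms(1)] chart(1)[OF assms(1)] assms(2)]
  by (simp add: vimage_def Int_def)

lemma transition_smooth:
  assumes "c \<in> A" "c' \<in> A" shows "smooth_on (snd c ` (fst c \<inter> fst c')) (transition c c')"
  using assms atlas by (auto simp: smooth_atlas_def smoothly_compatible_def)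

lemma transition_eq: "c \<in> A \<Longrightarrow> p \<in> fst c \<Longrightarrow> transition c c' (snd c p) = snd c' p"
  by (simp add: transition_def chart)

lemma transition_deriv:
  assumes "c \<in> A" "c' \<in> A" "p \<in> fst c" "p \<in> fst c'"
  shows "(transition c c' has_derivative (*v) (transition_jacobian c c' p)) (at (snd c p))"
proof -
  have "(transition c c' has_derivative frechet_derivative (transition c c') (at (snd c p))) (at (snd c p))"
    by (rule smooth_on_has_derivative[OF transition_smooth[OF assms(1,2)]]) (use assms in auto)
  moreover from has_derivative_linear[OF this] have "frechet_derivative (transition c c') (at (snd c p)) = (*v) (transition_jacobian c c' p)"
    by (simp add: transition_jacobian_def matrix_works fun_eq_iff)
  ultimately show ?thesis by simp
qed

lemma transition_jacobian_inverse:
  assumes "c \<in> A" "c' \<in> A" "p \<in> fst c" "p \<in> fst c'"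
  shows "transition_jacobian c' c p ** transition_jacobian c c' p = mat 1"
proof -
  have 1: "((\<lambda>y. transition c' c (transition c c' y)) has_derivative
      (\<lambda>v. transition_jacobian c' c p *v (transition_jacobian c c' p *v v))) (at (snd c p))"
    by (rule has_derivative_compose[OF transition_deriv[OF assms]])
      (use transition_deriv[OF assms(2,1,4,3)] transition_eq[OF assms(1,3)] in simp)
  have "((\<lambda>y. y) has_derivative (\<lambda>v. transition_jacobian c' c p *v (transition_jacobian c c' p *v v))) (at (snd c p))"
  proof (rule has_derivative_transform_within_open[OF 1])
    show "open (snd c ` (fst c \<inter> fst c'))" by (rule open_chart_image) (use assms chart in auto)
    show "transition c' c (transition c c' y) = y" if "y \<in> snd c ` (fst c \<inter> fst c')" for y
      using that assms by (auto simp: transition_eq)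
  qed (use assms in auto)
  from has_derivative_unique[OF this has_derivative_ident]
  have "(transition_jacobian c' c p ** transition_jacobian c c' p) *v v = mat 1 *v v" for v
    by (metis matrix_vector_mul_assoc matrix_vector_mul_lid)
  then show ?thesis by (simp add: matrix_eq)
qed

lemma transition_jacobian_invertible:
  assumes "c \<in> A" "c' \<in> A" "p \<in> fst c" "p \<in> fst c'"
  shows "invertible (transition_jacobian c c' p)"
  using transition_jacobian_inverse[OF assms] by (metis invertible_left_inverse)

lemma metric_pos_def: "c \<in> A \<Longrightarrow> p \<in> fst c \<Longrightarrow> pos_def (g c p)"
  using metric unfolding riemannian_metric_def pos_def_def by blast

lemma metric_transform:
  "c \<in> A \<Longrightarrow> c' \<in> A \<Longrightarrow> p \<in> fst c \<Longrightarrow> p \<in> fst c' \<Longrightarrow>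
    g c p = transpose (transition_jacobian c c' p) ** g c' p ** transition_jacobian c c' p"
  using metric unfolding riemannian_metric_def by blast

lemma volume_density_pos: "c \<in> A \<Longrightarrow> p \<in> fst c \<Longrightarrow> volume_density g c p > 0"
  using pos_def_det[OF metric_pos_def] by (simp add: volume_density_def)

lemma volume_density_transform:
  assumes "c \<in> A" "c' \<in> A" "p \<in> fst c" "p \<in> fst c'"
  shows "volume_density g c p = \<bar>det (transition_jacobian c c' p)\<bar> * volume_density g c' p"
proof -
  have "det (g c p) = (det (transition_jacobian c c' p))\<^sup>2 * det (g c' p)"
    unfolding metric_transform[OF assms] by (simp add: det_mul det_transpose power2_eq_square)
  then show ?thesis by (simp add: volume_density_def real_sqrt_mult)
qed

section \<open>Coordinate densities and the measures of single charts\<close>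

definition vdens :: "('a, 'n) chart \<Rightarrow> real ^ 'n \<Rightarrow> real" where "vdens c = in_chart c (volume_density g c)"

lemma vdens_eq: "vdens c y = volume_density g c (ci c y)"
  by (simp add: vdens_def in_chart_def)

lemma smooth_metric:
  assumes "c \<in> A" shows "smooth_on (V c) (\<lambda>y. g c (ci c y) $ i $ j)"
proof -
  have "smooth_on (V c) (in_chart c (g c))" using metric assms unfolding riemannian_metric_def by blast
  then have "smooth_on (V c) (\<lambda>y. g c (ci c y))" by (simp add: in_chart_def o_def)
  then show ?thesis by (intro smooth_on_vec chart(2)[OF assms])
qed

lemma smooth_vdens: assumes "c \<in> A" shows "smooth_on (V c) (vdens c)"
proof -
  have "smooth_on (V c) (\<lambda>y. sqrt (det (g c (ci c y))))"
  proof (intro smooth_on_sqrt smooth_on_det chart(2)[OF assms] smooth_metric[OF assms])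
    show "det (g c (ci c y)) > 0" if "y \<in> V c" for y
      by (rule pos_def_det[OF metric_pos_def[OF assms chart(7)[OF assms that]]])
  qed
  then show ?thesis by (simp add: vdens_def in_chart_def volume_density_def o_def)
qed

lemma vdens_pos: "c \<in> A \<Longrightarrow> y \<in> V c \<Longrightarrow> vdens c y > 0"
  unfolding vdens_eq by (rule volume_density_pos[OF _ chart(7)])

text \<open>Coordinate expressions are meaningful on the image of the chart; extension by zero turns
  them into Borel functions on the whole space.\<close>

definition ext :: "('a, 'n) chart \<Rightarrow> (real ^ 'n \<Rightarrow> real) \<Rightarrow> real ^ 'n \<Rightarrow> real" where
  "ext c f y = (if y \<in> V c then f y else 0)"

lemma ext_borel: 
  assumes "c \<in> A" "continuous_on (V c) f" shows "ext c f \<in> borel_measurable borel"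
  unfolding ext_def[abs_def] using assms chart(2)[OF assms(1)]
  by (intro borel_measurable_continuous_on_if) auto

text \<open>\<open>inv_into\<close> is unspecified off the image of the chart and need not be
  measurable there. One fixed value off the image makes the inverse chart Borel.\<close>

definition ci' :: "('a, 'n) chart \<Rightarrow> real ^ 'n \<Rightarrow> 'a" where
  "ci' c y = (if y \<in> V c then ci c y else undefined)"

lemma ci'_borel: "c \<in> A \<Longrightarrow> ci' c \<in> borel_measurable borel"
  unfolding ci'_def[abs_def] using chart(2,4) by (intro borel_measurable_continuous_on_if) auto

lemma borel_V: "c \<in> A \<Longrightarrow> V c \<in> sets borel" "c \<in> A \<Longrightarrow> fst c \<in> sets borel"
  using chart by auto

lemma mem_chart_image:
  assumes "c \<in> A" "B \<subseteq> fst c" shows "y \<in> snd c ` B \<longleftrightarrow> y \<in> V c \<and> ci' c y \<in> B"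
proof
  assume "y \<in> snd c ` B"
  then obtain q where q: "q \<in> B" "y = snd c q" by blast
  then have "q \<in> fst c" using assms(2) by blast
  then have "ci c y = q" "y \<in> V c" using q(2) chart(5)[OF assms(1)] by auto
  then show "y \<in> V c \<and> ci' c y \<in> B" using q(1) by (simp add: ci'_def)
next
  assume "y \<in> V c \<and> ci' c y \<in> B"
  then show "y \<in> snd c ` B"
    using chart(6)[OF assms(1), of y] by (metis ci'_def image_eqI)
qed

lemma chart_image_borel:
  assumes "c \<in> A" "B \<in> sets borel" "B \<subseteq> fst c" shows "snd c ` B \<in> sets borel"
proof -
  have "snd c ` B = V c \<inter> ci' c -` B"
    using mem_chart_image[OF assms(1,3)] by blast
  then show ?thesis
    using measurable_sets_borel[OF ci'_borel[OF assms(1)] assms(2)] borel_V[OF assms(1)] by simp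
qed

definition chart_measure :: "('a, 'n) chart \<Rightarrow> 'a measure" where
  "chart_measure c = distr (density lborel (\<lambda>y. ennreal (ext c (vdens c) y))) borel (ci' c)"

lemma ext_vdens_borel: "c \<in> A \<Longrightarrow> ext c (vdens c) \<in> borel_measurable borel"
  by (intro ext_borel smooth_on_imp_continuous_on smooth_vdens)

lemma sets_chart_measure [simp]: "sets (chart_measure c) = sets borel" by (simp add: chart_measure_def)

lemma emeasure_chart_measure:
  assumes c: "c \<in> A" and B: "B \<in> sets borel" "B \<subseteq> fst c"
  shows "emeasure (chart_measure c) B = (\<integral>\<^sup>+y. ennreal (vdens c y) * indicator (snd c ` B) y \<partial>lborel)"
proof -
  note [measurable] = ci'_borel[OF c] ext_vdens_borel[OF c] B(1)
  have "emeasure (chart_measure c) B = (\<integral>\<^sup>+y. ennreal (ext c (vdens c) y) * indicator (ci' c -` B) y \<partial>lborel)"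
    unfolding chart_measure_def using measurable_sets_borel[OF ci'_borel[OF c] B(1)]
    by (subst emeasure_distr, simp, simp, subst emeasure_density) auto
  also have "\<dots> = (\<integral>\<^sup>+y. ennreal (vdens c y) * indicator (snd c ` B) y \<partial>lborel)"
  proof (rule nn_integral_cong)
    fix y
    note mem_chart_image[OF c B(2), of y]
    then show "ennreal (ext c (vdens c) y) * indicator (ci' c -` B) y = ennreal (vdens c y) * indicator (snd c ` B) y"
      by (auto simp: ext_def indicator_def)
  qed
  finally show ?thesis .
qed

lemma emeasure_chart_measure_outside:
  assumes c: "c \<in> A" and B: "B \<in> sets borel"
  shows "emeasure (chart_measure c) B = emeasure (chart_measure c) (B \<inter> fst c)"
proof -
  note [measurable] = ci'_borel[OF c] ext_vdens_borel[OF c] B(1) borel_V[OF c]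
  have *: "emeasure (chart_measure c) C = (\<integral>\<^sup>+y. ennreal (ext c (vdens c) y) * indicator (ci' c -` C) y \<partial>lborel)" if "C \<in> sets borel" for C
    unfolding chart_measure_def using that measurable_sets_borel[OF ci'_borel[OF c] that]
    by (subst emeasure_distr, simp, simp, subst emeasure_density) auto
  have BC: "B \<inter> fst c \<in> sets borel" by measurable
  show ?thesis
    unfolding *[OF B] *[OF BC]
    by (intro nn_integral_cong) (use chart(7)[OF c] in \<open>auto simp: ext_def indicator_def ci'_def\<close>)
qed

text \<open>The density transforms with the absolute Jacobian determinant, so change of variables
  applies. It is used near one point at a time, where a bounded density on a ball gives the required
  finiteness; local equality then extends to the whole overlap.\<close>

lemma chart_measure_compatible:
  assumes c: "c \<in> A" and c': "c' \<in> A" and B: "B \<in> sets borel" "B \<subseteq> fst c \<inter> fst c'"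
  shows "emeasure (chart_measure c) B = emeasure (chart_measure c') B"
proof (rule measures_eq_local[OF _ _ _ B])
  fix p assume p: "p \<in> fst c \<inter> fst c'"
  have op: "open (snd c' ` (fst c' \<inter> fst c))" by (rule open_chart_image[OF c' chart(1)[OF c]])
  then obtain r where r: "r > 0" "cball (snd c' p) r \<subseteq> snd c' ` (fst c' \<inter> fst c)"
    using p open_contains_cball by (metis IntI Int_commute imageI)
  define U where "U = {q \<in> fst c'. snd c' q \<in> ball (snd c' p) r}"
  have Uo: "open U" unfolding U_def by (rule open_chart_preimage[OF c']) simp
  have Usub: "U \<subseteq> fst c \<inter> fst c'"
  proof
    fix q assume q: "q \<in> U"
    then have "snd c' q \<in> snd c' ` (fst c' \<inter> fst c)" using r(2) unfolding U_def by auto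
    then show "q \<in> fst c \<inter> fst c'" using q chart(5)[OF c'] by (auto simp: U_def) metis
  qed
  have "continuous_on (cball (snd c' p) r) (vdens c')"
    by (rule continuous_on_subset[OF smooth_on_imp_continuous_on[OF smooth_vdens[OF c']]]) (use r in auto)
  then have "bounded (vdens c' ` cball (snd c' p) r)"
    by (intro compact_imp_bounded compact_continuous_image) auto
  then obtain K where K: "\<And>y. y \<in> cball (snd c' p) r \<Longrightarrow> \<bar>vdens c' y\<bar> \<le> K"
    unfolding bounded_iff by (metis image_eqI real_norm_def)
  show "\<exists>Q. open Q \<and> p \<in> Q \<and> (\<forall>B\<in>sets borel. B \<subseteq> Q \<longrightarrow> emeasure (chart_measure c) B = emeasure (chart_measure c') B)"
  proof (intro exI[of _ U] conjI ballI impI)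
    show "p \<in> U" using p r by (simp add: U_def)
    fix B assume B: "B \<in> sets borel" "B \<subseteq> U"
    then have Bc: "B \<subseteq> fst c" "B \<subseteq> fst c'" using Usub by auto
    have im: "transition c c' ` snd c ` B = snd c' ` B"
      unfolding image_image by (rule image_cong[OF refl]) (use Bc transition_eq[OF c] in blast)
    have Bim: "snd c' ` B \<subseteq> cball (snd c' p) r" using B(2) by (auto simp: U_def)
    have *: "(\<integral>\<^sup>+y. ennreal (ext c (vdens c) y) * indicator (snd c ` B) y \<partial>lborel)
      = (\<integral>\<^sup>+y. ennreal (ext c' (vdens c') y) * indicator (transition c c' ` snd c ` B) y \<partial>lborel)"
    proof (rule nn_change_of_variables[where T' = "\<lambda>y. (*v) (transition_jacobian c c' (ci c y))"])
      show "snd c ` B \<in> sets borel" by (rule chart_image_borel[OF c B(1) Bc(1)])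
      show "transition c c' ` snd c ` B \<in> sets borel" unfolding im by (rule chart_image_borel[OF c' B(1) Bc(2)])
      show "(transition c c' has_derivative (*v) (transition_jacobian c c' (ci c y))) (at y)" if yB: "y \<in> snd c ` B" for y
      proof -
        obtain q where q: "q \<in> B" "y = snd c q" using yB by blast
        then have "q \<in> fst c" "q \<in> fst c'" using Bc by blast+
        then show ?thesis using transition_deriv[OF c c', of q] chart(5)[OF c, of q] q(2) by simp
      qed
      show "inj_on (transition c c') (snd c ` B)"
      proof (rule inj_onI)
        fix y z assume y: "y \<in> snd c ` B" and z: "z \<in> snd c ` B" and e: "transition c c' y = transition c c' z"
        obtain p where p: "p \<in> B" "y = snd c p" using y by blast
        obtain q where q: "q \<in> B" "z = snd c q" using z by blast
        have "snd c' p = snd c' q" using e p q transition_eq[OF c subsetD[OF Bc(1) p(1)], of c'] transition_eq[OF c subsetD[OF Bc(1) q(1)], of c'] by simp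
        then have "p = q" using inj_onD[OF chart(8)[OF c']] p q Bc(2) by blast
        then show "y = z" using p q by simp
      qed
      show "ext c' (vdens c') y \<ge> 0" for y using vdens_pos[OF c', of y] by (auto simp: ext_def)
      have "(\<integral>\<^sup>+y. ennreal (ext c' (vdens c') y) * indicator (transition c c' ` snd c ` B) y \<partial>lborel)
        \<le> (\<integral>\<^sup>+y. ennreal K * indicator (cball (snd c' p) r) y \<partial>lborel)"
      proof (intro nn_integral_mono)
        fix y
        show "ennreal (ext c' (vdens c') y) * indicator (transition c c' ` snd c ` B) y \<le> ennreal K * indicator (cball (snd c' p) r) y"
          unfolding im using Bim K[of y] by (auto simp: indicator_def ext_def intro!: ennreal_leI)
      qed
      also have "\<dots> = ennreal K * emeasure lborel (cball (snd c' p) r)" by (rule nn_integral_cmult_indicator) simp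
      also have "\<dots> < \<infinity>" using emeasure_bounded_finite[of "cball (snd c' p) r"] by (simp add: ennreal_mult_less_top)
      finally show "(\<integral>\<^sup>+y. ennreal (ext c' (vdens c') y) * indicator (transition c c' ` snd c ` B) y \<partial>lborel) < \<infinity>" .
      show "ext c (vdens c) y = \<bar>det (matrix ((*v) (transition_jacobian c c' (ci c y))))\<bar> * ext c' (vdens c') (transition c c' y)"
        if y: "y \<in> snd c ` B" for y
      proof -
        obtain q where q: "q \<in> B" "y = snd c q" using y by auto
        then have qc: "q \<in> fst c" "q \<in> fst c'" using Bc by auto
        then show ?thesis
          using volume_density_transform[OF c c' qc] transition_eq[OF c qc(1)] chart(5)[OF c qc(1)] chart(5)[OF c' qc(2)]
          by (simp add: q ext_def vdens_eq matrix_of_matrix_vector_mul)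
      qed
    qed (use ext_vdens_borel c c' in auto)
    have "emeasure (chart_measure c) B = (\<integral>\<^sup>+y. ennreal (ext c (vdens c) y) * indicator (snd c ` B) y \<partial>lborel)"
      unfolding emeasure_chart_measure[OF c B(1) Bc(1)] by (intro nn_integral_cong) (use Bc in \<open>auto simp: ext_def indicator_def\<close>)
    also have "\<dots> = emeasure (chart_measure c') B"
      unfolding * im emeasure_chart_measure[OF c' B(1) Bc(2)] by (intro nn_integral_cong) (use Bc in \<open>auto simp: ext_def indicator_def\<close>)
    finally show "emeasure (chart_measure c) B = emeasure (chart_measure c') B" .
  qed (rule Uo)
qed auto

text \<open>A countable family of charts that still covers the manifold. It makes the gluing of
  measures and the patching of null sets countable.\<close>

definition cseq :: "nat \<Rightarrow> ('a, 'n) chart" where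
  "cseq = (SOME s. range s \<subseteq> A \<and> (\<Union>n. fst (s n)) = UNIV)"

lemma cseq: "cseq n \<in> A" "(\<Union>n. fst (cseq n)) = UNIV"
proof -
  obtain F where F: "F \<subseteq> fst ` A" "countable F" "\<Union>F = \<Union>(fst ` A)"
    by (rule Lindelof_openin[of "fst ` A" UNIV]) (use chart in auto)
  have cov: "\<Union>F = UNIV" using F(3) atlas by (auto simp: smooth_atlas_def)
  then have ne: "F \<noteq> {}" by auto
  have "\<exists>c\<in>A. from_nat_into F n = fst c" for n using from_nat_into[OF ne, of n] F(1) by auto
  then obtain s where s: "\<And>n. s n \<in> A \<and> from_nat_into F n = fst (s n)" by metis
  have "(\<Union>n. fst (s n)) = \<Union>(range (from_nat_into F))" using s by auto
  also have "\<dots> = UNIV" using range_from_nat_into[OF ne F(2)] cov by simp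
  finally have *: "(\<Union>n. fst (s n)) = UNIV" .
  have "range s \<subseteq> A" using s by blast
  from conjI[OF this *] have "\<exists>s::nat \<Rightarrow> _. range s \<subseteq> A \<and> (\<Union>n. fst (s n)) = UNIV" by (rule exI[where x = s])
  from someI_ex[OF this] have "range cseq \<subseteq> A \<and> (\<Union>n. fst (cseq n)) = UNIV" by (simp only: cseq_def)
  then show "cseq n \<in> A" "(\<Union>n. fst (cseq n)) = UNIV" by auto
qed

definition piece :: "nat \<Rightarrow> 'a set" where "piece = disjointed (\<lambda>n. fst (cseq n))"

lemma piece: "piece n \<in> sets borel" "piece n \<subseteq> fst (cseq n)" "disjoint_family piece" "(\<Union>n. piece n) = UNIV"
  using sets.range_disjointed_sets[of "\<lambda>n. fst (cseq n)" borel] borel_V(2)[OF cseq(1)]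
    disjointed_subset[of "\<lambda>n. fst (cseq n)" n] disjoint_family_disjointed UN_disjointed_eq[of "\<lambda>n. fst (cseq n)"] cseq(2)
  unfolding piece_def by auto

definition is_volume :: "'a measure \<Rightarrow> bool" where
  "is_volume M \<longleftrightarrow> sets M = sets borel \<and> (\<forall>c\<in>A. \<forall>B\<in>sets borel. B \<subseteq> fst c \<longrightarrow>
        emeasure M B = (\<integral>\<^sup>+y\<in>snd c ` B. ennreal (in_chart c (volume_density g c) y) \<partial>lborel))"

lemma is_volume_chart_measure: "is_volume M \<longleftrightarrow> sets M = sets borel \<and> (\<forall>c\<in>A. \<forall>B\<in>sets borel. B \<subseteq> fst c \<longrightarrow>
        emeasure M B = emeasure (chart_measure c) B)"
  unfolding is_volume_def by (auto simp: emeasure_chart_measure vdens_def)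

text \<open>Summing the chart measures over the disjoint Borel pieces of a countable cover counts
  every point once. Compatibility on overlaps lets each piece be measured in any chart containing
  it.\<close>

lemma ex_volume: "\<exists>M. is_volume M"
proof -
  define m where "m B = (\<Sum>n. emeasure (chart_measure (cseq n)) (B \<inter> piece n))" for B
  define M where "M = measure_of UNIV (sets borel) m"
  have sM [simp]: "sets M = sets borel" unfolding M_def by (subst sets_measure_of) (auto simp: sets.sigma_sets_eq[of borel, simplified])
  have M: "emeasure M B = m B" if "B \<in> sets borel" for B
    unfolding M_def
  proof (rule emeasure_measure_of_sigma)
    show "sigma_algebra UNIV (sets (borel :: 'a measure))" by (metis sets.sigma_algebra_axioms space_borel)
    show "positive (sets borel) m" by (simp add: positive_def m_def)
    show "countably_additive (sets borel) m"
    proof (rule countably_additiveI)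
      fix C :: "nat \<Rightarrow> 'a set" assume C: "range C \<subseteq> sets borel" "disjoint_family C"
      have e: "(\<Sum>i. emeasure (chart_measure (cseq n)) (C i \<inter> piece n)) = emeasure (chart_measure (cseq n)) ((\<Union>i. C i) \<inter> piece n)" for n
      proof -
        have "(\<Sum>i. emeasure (chart_measure (cseq n)) (C i \<inter> piece n)) = emeasure (chart_measure (cseq n)) (\<Union>i. C i \<inter> piece n)"
          using C piece(1) by (intro suminf_emeasure) (auto simp: disjoint_family_on_def)
        then show ?thesis by simp
      qed
      show "(\<Sum>i. m (C i)) = m (\<Union>i. C i)"
        unfolding m_def e[symmetric] by (rule ennreal_suminf_commute)
    qed
  qed fact
  have "emeasure M B = emeasure (chart_measure c) B" if c: "c \<in> A" and B: "B \<in> sets borel" "B \<subseteq> fst c" for c B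
  proof -
    have "emeasure (chart_measure (cseq n)) (B \<inter> piece n) = emeasure (chart_measure c) (B \<inter> piece n)" for n
      using piece(1,2)[of n] B by (intro chart_measure_compatible cseq(1) c) auto
    then have "emeasure M B = (\<Sum>n. emeasure (chart_measure c) (B \<inter> piece n))" unfolding M[OF B(1)] m_def by simp
    also have "\<dots> = emeasure (chart_measure c) (\<Union>n. B \<inter> piece n)"
    proof (rule suminf_emeasure)
      show "disjoint_family (\<lambda>n. B \<inter> piece n)"
        using piece(3) unfolding disjoint_family_on_def by blast
    qed (use piece(1) B in auto)
    also have "(\<Union>n. B \<inter> piece n) = B" using piece(4) by auto
    finally show ?thesis .
  qed
  then have "is_volume M" unfolding is_volume_chart_measure by simp
  then show ?thesis ..
qed

lemma volume_unique:
  assumes "is_volume M" "is_volume N" shows "M = N"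
proof (rule measure_eqI)
  show "sets M = sets N" using assms by (simp add: is_volume_def)
  fix B assume "B \<in> sets M"
  then have B: "B \<in> sets borel" using assms by (simp add: is_volume_def)
  show "emeasure M B = emeasure N B"
  proof (rule measures_eq_local[of M N UNIV B])
    fix p
    obtain c where c: "c \<in> A" "p \<in> fst c" using ex_chart by blast
    show "\<exists>Q. open Q \<and> p \<in> Q \<and> (\<forall>B\<in>sets borel. B \<subseteq> Q \<longrightarrow> emeasure M B = emeasure N B)"
      using assms c chart(1)[OF c(1)] by (intro exI[of _ "fst c"]) (auto simp: is_volume_chart_measure)
  qed (use assms B in \<open>auto simp: is_volume_def\<close>)
qed

text \<open>Existence and uniqueness together justify the definite description behind
  \<open>volume_measure\<close>; only from here on is anything known about it.\<close>

lemma volume_measure: "is_volume (volume_measure A g)"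
proof -
  obtain M where "is_volume M" using ex_volume by blast
  then have "is_volume (THE M. is_volume M)" by (rule theI[where P = is_volume]) (rule volume_unique[OF _ \<open>is_volume M\<close>])
  then show ?thesis unfolding volume_measure_def is_volume_def .
qed


subsection \<open>The weighted measure in charts\<close>

lemma continuous_chartsI:
  fixes f :: "'a \<Rightarrow> 'b::topological_space"
  assumes "\<And>c. c \<in> A \<Longrightarrow> continuous_on (V c) (in_chart c f)"
  shows "continuous_on UNIV f"
proof (rule continuous_at_imp_continuous_on, rule ballI)
  fix p :: 'a
  obtain c where c: "c \<in> A" "p \<in> fst c" using ex_chart by blast
  have "continuous_on (fst c) (\<lambda>q. in_chart c f (snd c q))"
    by (rule continuous_on_compose2[OF assms[OF c(1)] chart(3)[OF c(1)]]) simp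
  then have "continuous_on (fst c) f"
    by (rule continuous_on_eq) (simp add: in_chart_def chart(5)[OF c(1)])
  then show "isCont f p" using c chart(1) continuous_on_eq_continuous_at by blast
qed

lemma continuous_in_chart:
  assumes "continuous_on UNIV f" "c \<in> A" shows "continuous_on (V c) (in_chart c f)"
  unfolding in_chart_def
  by (rule continuous_on_compose[OF chart(4)[OF assms(2)]]) (rule continuous_on_subset[OF assms(1)], simp)

lemma smooth_phi: "c \<in> A \<Longrightarrow> smooth_on (V c) (in_chart c \<phi>)"
  using phi by (simp add: smooth_fun_on_def)

lemma continuous_phi: "continuous_on UNIV \<phi>"
  by (rule continuous_chartsI) (rule smooth_on_imp_continuous_on[OF smooth_phi])

lemma borel_phi [measurable]: "\<phi> \<in> borel_measurable borel"
  using continuous_phi by (rule borel_measurable_continuous_onI)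

text \<open>The coordinate density of the weighted measure \<open>mu\<close>. With it the weighted
  Laplacian takes pure divergence form.\<close>

definition wdens :: "('a, 'n) chart \<Rightarrow> real ^ 'n \<Rightarrow> real" where
  "wdens c y = vdens c y * exp (in_chart c \<phi> y)"

lemma smooth_wdens: "c \<in> A \<Longrightarrow> smooth_on (V c) (wdens c)"
  unfolding wdens_def[abs_def] by (intro smooth_on_mult smooth_on_exp smooth_vdens smooth_phi chart(2))

lemma wdens_pos: "c \<in> A \<Longrightarrow> y \<in> V c \<Longrightarrow> wdens c y > 0"
  unfolding wdens_def using vdens_pos by simp

lemma ext_wdens_borel: "c \<in> A \<Longrightarrow> ext c (wdens c) \<in> borel_measurable borel"
  by (intro ext_borel smooth_on_imp_continuous_on smooth_wdens)

lemma ext_wdens_nonneg: "c \<in> A \<Longrightarrow> ext c (wdens c) y \<ge> 0"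
  using wdens_pos[of c y] by (auto simp: ext_def intro: less_imp_le)

abbreviation vol :: "'a measure" where "vol \<equiv> volume_measure A g"

lemma sets_vol [simp, measurable_cong]: "sets vol = sets borel"
  using volume_measure by (simp add: is_volume_def)

lemma space_vol [simp]: "space vol = UNIV"
  using sets_eq_imp_space_eq[OF sets_vol] by simp

lemma vol_chart: "c \<in> A \<Longrightarrow> density vol (indicator (fst c)) = chart_measure c"
proof (rule measure_eqI)
  assume c: "c \<in> A"
  show "sets (density vol (indicator (fst c))) = sets (chart_measure c)" by simp
  fix B assume "B \<in> sets (density vol (indicator (fst c)))"
  then have B: "B \<in> sets borel" by simp
  then have B': "B \<inter> fst c \<in> sets borel" using borel_V(2)[OF c] by auto
  have "emeasure (density vol (indicator (fst c))) B = emeasure vol (B \<inter> fst c)"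
    using B borel_V(2)[OF c] by (subst emeasure_density) (auto simp: indicator_inter_arith[symmetric] Int_commute)
  also have "\<dots> = emeasure (chart_measure c) (B \<inter> fst c)"
    using volume_measure c B' by (auto simp: is_volume_chart_measure)
  also have "\<dots> = emeasure (chart_measure c) B" by (rule emeasure_chart_measure_outside[OF c B, symmetric])
  finally show "emeasure (density vol (indicator (fst c))) B = emeasure (chart_measure c) B" .
qed

definition mu :: "'a measure" where "mu = density vol (\<lambda>p. ennreal (exp (\<phi> p)))"

lemma sets_mu [simp, measurable_cong]: "sets mu = sets borel"
  by (simp add: mu_def)

lemma space_mu [simp]: "space mu = UNIV" by (simp add: mu_def)

lemma measurable_mu_eq [simp]: "f \<in> borel_measurable mu \<longleftrightarrow> f \<in> borel_measurable borel"
  using measurable_cong_sets[OF sets_mu refl] by blast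

lemma nn_mu: "f \<in> borel_measurable borel \<Longrightarrow> (\<integral>\<^sup>+p. f p \<partial>mu) = (\<integral>\<^sup>+p. ennreal (exp (\<phi> p)) * f p \<partial>vol)"
  unfolding mu_def by (subst nn_integral_density) auto

lemma nn_chart:
  assumes c: "c \<in> A" and F [measurable]: "F \<in> borel_measurable borel" and F0: "\<And>p. p \<notin> fst c \<Longrightarrow> F p = 0"
  shows "(\<integral>\<^sup>+p. F p \<partial>mu) = (\<integral>\<^sup>+y. ennreal (ext c (wdens c) y) * F (ci' c y) \<partial>lborel)"
proof -
  note [measurable] = ext_wdens_borel[OF c] ext_vdens_borel[OF c] ci'_borel[OF c] borel_V(2)[OF c]
  have "(\<integral>\<^sup>+p. F p \<partial>mu) = (\<integral>\<^sup>+p. ennreal (exp (\<phi> p)) * F p \<partial>vol)" by (rule nn_mu) fact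
  also have "\<dots> = (\<integral>\<^sup>+p. indicator (fst c) p * (ennreal (exp (\<phi> p)) * F p) \<partial>vol)"
    by (intro nn_integral_cong) (use F0 in \<open>auto simp: indicator_def\<close>)
  also have "\<dots> = (\<integral>\<^sup>+p. ennreal (exp (\<phi> p)) * F p \<partial>density vol (indicator (fst c)))"
    by (subst nn_integral_density) auto
  also have "\<dots> = (\<integral>\<^sup>+p. ennreal (exp (\<phi> p)) * F p \<partial>chart_measure c)" by (simp only: vol_chart[OF c])
  also have "\<dots> = (\<integral>\<^sup>+y. ennreal (ext c (vdens c) y) * (ennreal (exp (\<phi> (ci' c y))) * F (ci' c y)) \<partial>lborel)"
    unfolding chart_measure_def by (subst nn_integral_distr, simp, simp, subst nn_integral_density) auto
  also have "\<dots> = (\<integral>\<^sup>+y. ennreal (ext c (wdens c) y) * F (ci' c y) \<partial>lborel)"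
    using vdens_pos[OF c]
    by (intro nn_integral_cong)
      (auto simp: ext_def wdens_def in_chart_def ci'_def ennreal_mult mult.assoc less_imp_le)
  finally show ?thesis .
qed

lemma mu_chart: "c \<in> A \<Longrightarrow> density mu (indicator (fst c)) = distr (density lborel (\<lambda>y. ennreal (ext c (wdens c) y))) borel (ci' c)"
proof (rule measure_eqI)
  assume c: "c \<in> A"
  note [measurable] = ext_wdens_borel[OF c] ci'_borel[OF c] borel_V(2)[OF c]
  show "sets (density mu (indicator (fst c))) = sets (distr (density lborel (\<lambda>y. ennreal (ext c (wdens c) y))) borel (ci' c))" by simp
  fix B assume "B \<in> sets (density mu (indicator (fst c)))"
  then have B [measurable]: "B \<in> sets borel" by simp
  have "emeasure (density mu (indicator (fst c))) B = (\<integral>\<^sup>+p. indicator (fst c) p * indicator B p \<partial>mu)"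
    by (subst emeasure_density) auto
  also have "\<dots> = (\<integral>\<^sup>+y. ennreal (ext c (wdens c) y) * (indicator (fst c) (ci' c y) * indicator B (ci' c y)) \<partial>lborel)"
    by (rule nn_chart[OF c]) auto
  also have "\<dots> = (\<integral>\<^sup>+y. ennreal (ext c (wdens c) y) * indicator (ci' c -` B) y \<partial>lborel)"
    by (intro nn_integral_cong) (use chart(7)[OF c] in \<open>auto simp: ext_def ci'_def indicator_def\<close>)
  also have "\<dots> = emeasure (distr (density lborel (\<lambda>y. ennreal (ext c (wdens c) y))) borel (ci' c)) B"
    using measurable_sets_borel[OF ci'_borel[OF c] B]
    by (subst emeasure_distr, simp, simp, subst emeasure_density) auto
  finally show "emeasure (density mu (indicator (fst c))) B = emeasure (distr (density lborel (\<lambda>y. ennreal (ext c (wdens c) y))) borel (ci' c)) B" .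
qed

lemma int_chart:
  fixes F :: "'a \<Rightarrow> real"
  assumes c: "c \<in> A" and F [measurable]: "F \<in> borel_measurable borel" and F0: "\<And>p. p \<notin> fst c \<Longrightarrow> F p = 0"
  shows "integrable mu F \<longleftrightarrow> integrable lborel (ext c (\<lambda>y. wdens c y * F (ci c y)))" 
    "(\<integral>p. F p \<partial>mu) = (\<integral>y. ext c (\<lambda>y. wdens c y * F (ci c y)) y \<partial>lborel)"
proof -
  note [measurable] = ext_wdens_borel[OF c] ci'_borel[OF c] borel_V(2)[OF c]
  have 1: "(\<lambda>p. indicator (fst c) p *\<^sub>R F p) = F" using F0 by (intro ext) (auto simp: indicator_def)
  have 2: "(\<lambda>y. ext c (wdens c) y *\<^sub>R F (ci' c y)) = ext c (\<lambda>y. wdens c y * F (ci c y))"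
    by (auto simp: ext_def ci'_def fun_eq_iff)
  have ind: "(indicator (fst c) :: 'a \<Rightarrow> ennreal) = (\<lambda>p. ennreal (indicator (fst c) p))"
    by (simp add: ennreal_indicator)
  have "integrable mu F \<longleftrightarrow> integrable (density mu (indicator (fst c))) F"
    unfolding ind by (subst integrable_density) (auto simp: 1[unfolded real_scaleR_def])
  also have "\<dots> \<longleftrightarrow> integrable (density lborel (\<lambda>y. ennreal (ext c (wdens c) y))) (\<lambda>y. F (ci' c y))"
    unfolding mu_chart[OF c] by (rule integrable_distr_eq) auto
  also have "\<dots> \<longleftrightarrow> integrable lborel (\<lambda>y. ext c (wdens c) y *\<^sub>R F (ci' c y))"
    using ext_wdens_nonneg[OF c] by (subst integrable_density) auto
  finally show "integrable mu F \<longleftrightarrow> integrable lborel (ext c (\<lambda>y. wdens c y * F (ci c y)))"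
    unfolding 2 .
  have "(\<integral>p. F p \<partial>mu) = (\<integral>p. F p \<partial>density mu (indicator (fst c)))"
    unfolding ind by (subst integral_density) (auto simp: 1[unfolded real_scaleR_def])
  also have "\<dots> = (\<integral>y. F (ci' c y) \<partial>density lborel (\<lambda>y. ennreal (ext c (wdens c) y)))"
    unfolding mu_chart[OF c] by (rule integral_distr) auto
  also have "\<dots> = (\<integral>y. ext c (wdens c) y *\<^sub>R F (ci' c y) \<partial>lborel)"
    using ext_wdens_nonneg[OF c] by (subst integral_density) auto
  finally show "(\<integral>p. F p \<partial>mu) = (\<integral>y. ext c (\<lambda>y. wdens c y * F (ci c y)) y \<partial>lborel)" unfolding 2 .
qed

definition coord0 :: "('a, 'n) chart \<Rightarrow> 'a \<Rightarrow> real ^ 'n" where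
  "coord0 c p = (if p \<in> fst c then snd c p else 0)"

lemma coord0_borel: "c \<in> A \<Longrightarrow> coord0 c \<in> borel_measurable borel"
  unfolding coord0_def[abs_def] using chart(1,3) by (intro borel_measurable_continuous_on_if) auto

text \<open>A coordinate null set pulls back to a null set of \<open>mu\<close> by the chart
  formula, and positivity of the density gives the converse.\<close>

lemma AE_mu_chart:
  assumes c: "c \<in> A"
  shows "(AE p in mu. p \<in> fst c \<longrightarrow> P p) \<longleftrightarrow> (AE y in lborel. y \<in> V c \<longrightarrow> P (ci c y))"
proof
  note [measurable] = ext_wdens_borel[OF c] ci'_borel[OF c] borel_V(2)[OF c] coord0_borel[OF c]
  {
    assume "AE p in mu. p \<in> fst c \<longrightarrow> P p"
    then have "AE p in density mu (indicator (fst c)). P p"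
      by (subst AE_density) (auto simp: indicator_def)
    then have "AE y in density lborel (\<lambda>y. ennreal (ext c (wdens c) y)). P (ci' c y)"
      unfolding mu_chart[OF c] by (rule AE_distrD[rotated]) simp
    then have "AE y in lborel. 0 < ennreal (ext c (wdens c) y) \<longrightarrow> P (ci' c y)"
      by (subst (asm) AE_density) auto
    then show "AE y in lborel. y \<in> V c \<longrightarrow> P (ci c y)"
      by eventually_elim (use wdens_pos[OF c] in \<open>auto simp: ext_def ci'_def\<close>)
  next
    assume "AE y in lborel. y \<in> V c \<longrightarrow> P (ci c y)"
    then obtain N where N: "N \<in> null_sets lborel" "{y. \<not> (y \<in> V c \<longrightarrow> P (ci c y))} \<subseteq> N"
      unfolding eventually_ae_filter by auto
    have [measurable]: "N \<in> sets borel" using N(1) by auto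
    have "AE y in lborel. y \<notin> N" using N(1) by (rule AE_not_in)
    define S where "S = fst c \<inter> coord0 c -` N"
    have S [measurable]: "S \<in> sets borel"
      unfolding S_def using measurable_sets_borel[OF coord0_borel[OF c], of N] by auto
    have "emeasure mu S = (\<integral>\<^sup>+p. indicator S p \<partial>mu)" by simp
    also have "\<dots> = (\<integral>\<^sup>+y. ennreal (ext c (wdens c) y) * indicator S (ci' c y) \<partial>lborel)"
      by (rule nn_chart[OF c]) (auto simp: S_def)
    also have "\<dots> = (\<integral>\<^sup>+y. 0 \<partial>(lborel :: (real ^ 'n) measure))"
    proof (rule nn_integral_cong_AE)
      show "AE y in lborel. ennreal (ext c (wdens c) y) * indicator S (ci' c y) = 0"
        using \<open>AE y in lborel. y \<notin> N\<close>
        by eventually_elim (use chart(6,7)[OF c] in \<open>auto simp: ext_def S_def ci'_def indicator_def coord0_def\<close>)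
    qed
    finally have "emeasure mu S = 0" by simp
    then have "AE p in mu. p \<notin> S" using S by (intro AE_not_in) (auto simp: null_sets_def)
    then show "AE p in mu. p \<in> fst c \<longrightarrow> P p"
    proof eventually_elim
      case (elim p)
      show ?case
      proof
        assume p: "p \<in> fst c"
        then have "snd c p \<notin> N" using elim by (simp add: S_def coord0_def)
        then have "\<not> \<not> (snd c p \<in> V c \<longrightarrow> P (ci c (snd c p)))" using N(2) by blast
        then show "P p" using p chart(5)[OF c p] by auto
      qed
    qed
  }
qed

lemma AE_mu_charts: "(AE p in mu. P p) \<longleftrightarrow> (\<forall>c\<in>A. AE y in lborel. y \<in> V c \<longrightarrow> P (ci c y))"
proof
  assume "AE p in mu. P p"
  then show "\<forall>c\<in>A. AE y in lborel. y \<in> V c \<longrightarrow> P (ci c y)"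
    unfolding AE_mu_chart[symmetric] by (auto elim: eventually_mono simp: AE_mu_chart[symmetric])
next
  assume "\<forall>c\<in>A. AE y in lborel. y \<in> V c \<longrightarrow> P (ci c y)"
  then have "AE p in mu. p \<in> fst (cseq n) \<longrightarrow> P p" for n
    using AE_mu_chart[OF cseq(1)] cseq(1) by blast
  then have "AE p in mu. \<forall>n. p \<in> fst (cseq n) \<longrightarrow> P p" by (subst AE_all_countable) simp
  then show "AE p in mu. P p" by eventually_elim (use cseq(2) in blast)
qed

text \<open>Nonempty open sets have positive Lebesgue measure in a chart, and the density is
  positive. This upgrades almost everywhere relations between continuous functions to relations at
  every point.\<close>

lemma mu_open_pos:
  assumes "open W" "p \<in> W" "AE q in mu. q \<in> W \<longrightarrow> P q"
  shows "\<exists>q\<in>W. P q"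
proof (rule ccontr)
  assume no: "\<not> (\<exists>q\<in>W. P q)"
  obtain c where c: "c \<in> A" "p \<in> fst c" using ex_chart by blast
  have "AE y in lborel. y \<in> V c \<longrightarrow> ci c y \<in> W \<longrightarrow> P (ci c y)"
    using assms(3) c unfolding AE_mu_charts by auto
  then have "AE y in lborel. y \<notin> snd c ` (fst c \<inter> W)"
    by eventually_elim (use no chart(5)[OF c(1)] in auto)
  moreover have o: "open (snd c ` (fst c \<inter> W))" by (rule open_chart_image[OF c(1) assms(1)])
  ultimately have "emeasure lborel (snd c ` (fst c \<inter> W)) = 0"
    using AE_iff_measurable[of "snd c ` (fst c \<inter> W)" lborel "\<lambda>y. y \<notin> snd c ` (fst c \<inter> W)"] by auto
  then have "negligible (snd c ` (fst c \<inter> W))"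
    using o by (auto simp: negligible_iff_null_sets null_sets_completion_iff null_sets_def)
  then have "snd c ` (fst c \<inter> W) = {}" using o open_not_negligible by blast
  then show False using c assms by auto
qed

lemma continuous_AE_eq:
  fixes f h :: "'a \<Rightarrow> real"
  assumes "open W" "continuous_on W f" "continuous_on W h" "AE q in mu. q \<in> W \<longrightarrow> f q = h q" "p \<in> W"
  shows "f p = h p"
proof (rule ccontr)
  assume ne: "f p \<noteq> h p"
  have "continuous_on W (\<lambda>q. f q - h q)" using assms by (intro continuous_intros)
  then have "open (W \<inter> (\<lambda>q. f q - h q) -` (- {0}))" 
    using assms(1) by (intro continuous_open_preimage) auto
  from mu_open_pos[OF this, of p "\<lambda>q. f q = h q"] ne assms show False
    by (auto elim: eventually_mono)
qed


subsection \<open>Gradients\<close>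

text \<open>All charts are quantified over so that invariance can be used directly; by smoothness of
  the transitions one chart is enough (\<open>dfaI\<close>).\<close>

definition diff_at :: "('a \<Rightarrow> real) \<Rightarrow> 'a \<Rightarrow> bool" where
  "diff_at f p \<longleftrightarrow> (\<forall>c\<in>A. p \<in> fst c \<longrightarrow> in_chart c f differentiable (at (snd c p)))"

definition cgrad :: "('a, 'n) chart \<Rightarrow> ('a \<Rightarrow> real) \<Rightarrow> 'a \<Rightarrow> real ^ 'n" where
  "cgrad c f p = (\<chi> i. partial_deriv c i f p)"

text \<open>The inner product of two differentials in the dual metric. It equals the inner product
  of the gradients, because raising the indices cancels one factor of the metric.\<close>

definition cgrad_ip :: "('a, 'n) chart \<Rightarrow> ('a \<Rightarrow> real) \<Rightarrow> ('a \<Rightarrow> real) \<Rightarrow> 'a \<Rightarrow> real" where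
  "cgrad_ip c f h p = cgrad c f p \<bullet> (matrix_inv (g c p) *v cgrad c h p)"

definition grad_ip :: "('a \<Rightarrow> real) \<Rightarrow> ('a \<Rightarrow> real) \<Rightarrow> 'a \<Rightarrow> real" where
  "grad_ip f h p = metric_inner A g (gradient g f) (gradient g h) p"

lemma partial_deriv_pd: "partial_deriv c i f p = pd i (in_chart c f) (snd c p)"
  by (simp add: partial_deriv_def pd_def)

lemma metric_sym: "transpose M = M \<Longrightarrow> (u :: real ^ 'n) \<bullet> (M *v w) = (M *v u) \<bullet> w"
  by (metis dot_lmul_matrix transpose_matrix_vector)

lemma grad_ip_cgrad_ip: "grad_ip f h p = cgrad_ip (chart_at A p) f h p"
proof -
  let ?c = "chart_at A p"
  note pdg = pos_def_inv[OF metric_pos_def[OF chart_at]]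
  have "grad_ip f h p = (matrix_inv (g ?c p) *v cgrad ?c f p) \<bullet> (g ?c p *v (matrix_inv (g ?c p) *v cgrad ?c h p))"
    by (simp add: grad_ip_def metric_inner_def gradient_def cgrad_def Let_def)
  also have "g ?c p *v (matrix_inv (g ?c p) *v cgrad ?c h p) = cgrad ?c h p"
    using matrix_inv_works[OF pdg(1)] by (simp add: matrix_vector_mul_assoc)
  also have "(matrix_inv (g ?c p) *v cgrad ?c f p) \<bullet> cgrad ?c h p = cgrad_ip ?c f h p"
    unfolding cgrad_ip_def using metric_sym[OF pdg(2)] by simp
  finally show ?thesis .
qed

lemma in_chart_transition:
  "c \<in> A \<Longrightarrow> c' \<in> A \<Longrightarrow> y \<in> snd c ` (fst c \<inter> fst c') \<Longrightarrow> in_chart c f y = in_chart c' f (transition c c' y)"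
  by (auto simp: in_chart_def transition_eq chart)

lemma open_overlap: "c \<in> A \<Longrightarrow> c' \<in> A \<Longrightarrow> open (snd c ` (fst c \<inter> fst c'))"
  by (intro open_chart_image chart(1))

lemma in_chart_derivative:
  assumes "c \<in> A" "c' \<in> A" "p \<in> fst c" "p \<in> fst c'"
    and D: "(in_chart c' f has_derivative D) (at (snd c' p))"
  shows "(in_chart c f has_derivative (\<lambda>v. D (transition_jacobian c c' p *v v))) (at (snd c p))"
proof (rule has_derivative_transform_within_open[OF _ open_overlap[OF assms(1,2)]])
  show "((\<lambda>y. in_chart c' f (transition c c' y)) has_derivative (\<lambda>v. D (transition_jacobian c c' p *v v))) (at (snd c p))"
    by (rule has_derivative_compose[OF transition_deriv[OF assms(1-4)]])
      (use D transition_eq[OF assms(1,3)] in simp)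
qed (use assms in_chart_transition[OF assms(1,2), symmetric] in auto)

lemma dfaI:
  assumes "c \<in> A" "p \<in> fst c" "in_chart c f differentiable (at (snd c p))" shows "diff_at f p"
  unfolding diff_at_def
proof (intro ballI impI)
  fix c' assume c': "c' \<in> A" "p \<in> fst c'"
  obtain D where "(in_chart c f has_derivative D) (at (snd c p))" using assms(3) by (auto simp: differentiable_def)
  from in_chart_derivative[OF c'(1) assms(1) c'(2) assms(2) this]
  show "in_chart c' f differentiable (at (snd c' p))" by (rule differentiableI)
qed

lemma dfaD: "diff_at f p \<Longrightarrow> c \<in> A \<Longrightarrow> p \<in> fst c \<Longrightarrow> in_chart c f differentiable (at (snd c p))"
  by (simp add: diff_at_def)

lemma cgrad_transform:
  assumes "c \<in> A" "c' \<in> A" "p \<in> fst c" "p \<in> fst c'" "diff_at f p"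
  shows "cgrad c f p = transpose (transition_jacobian c c' p) *v cgrad c' f p"
proof -
  let ?D = "frechet_derivative (in_chart c' f) (at (snd c' p))" and ?J = "transition_jacobian c c' p"
  have D: "(in_chart c' f has_derivative ?D) (at (snd c' p))"
    using dfaD[OF assms(5,2,4)] by (simp add: frechet_derivative_works)
  have lin: "linear ?D" using D has_derivative_linear by blast
  have "cgrad c f p $ i = (transpose ?J *v cgrad c' f p) $ i" for i
  proof -
    have "cgrad c f p $ i = ?D (?J *v axis i 1)"
      using pd_eq[OF in_chart_derivative[OF assms(1-4) D], of i] by (simp add: cgrad_def partial_deriv_pd)
    also have "?J *v axis i 1 = (\<Sum>k\<in>UNIV. ?J $ k $ i *\<^sub>R axis k 1)"
      using basis_expansion[of "column i ?J"]
      by (simp add: matrix_vector_mult_basis column_def scalar_mult_eq_scaleR)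
    also have "?D \<dots> = (\<Sum>k\<in>UNIV. ?J $ k $ i * ?D (axis k 1))"
      using lin by (simp add: linear_sum linear_cmul)
    also have "\<dots> = (transpose ?J *v cgrad c' f p) $ i"
      by (simp add: matrix_vector_mult_def transpose_def cgrad_def partial_deriv_def)
    finally show ?thesis .
  qed
  then show ?thesis by (simp add: vec_eq_iff)
qed

text \<open>Differentials put the transposed Jacobian on both sides of the dual metric, and
  \<open>matrix_inv_congruence\<close> absorbs these factors into the dual metric of the other
  chart.\<close>

lemma cgrad_ip_invariant:
  assumes "c \<in> A" "c' \<in> A" "p \<in> fst c" "p \<in> fst c'" "diff_at f p" "diff_at h p"
  shows "cgrad_ip c f h p = cgrad_ip c' f h p"
proof -
  let ?J = "transition_jacobian c c' p"
  have "cgrad_ip c f h p = (transpose ?J *v cgrad c' f p) \<bullet> (matrix_inv (g c p) *v (transpose ?J *v cgrad c' h p))"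
    unfolding cgrad_ip_def cgrad_transform[OF assms(1-5)] cgrad_transform[OF assms(1-4,6)] ..
  also have "\<dots> = cgrad c' f p \<bullet> ((?J ** matrix_inv (g c p) ** transpose ?J) *v cgrad c' h p)"
  proof -
    have "(transpose ?J *v a) \<bullet> w = a \<bullet> (?J *v w)" for a w
      by (simp only: transpose_matrix_vector dot_lmul_matrix)
    then show ?thesis by (simp only: matrix_vector_mul_assoc matrix_mul_assoc)
  qed
  also have "?J ** matrix_inv (g c p) ** transpose ?J = matrix_inv (g c' p)"
    unfolding metric_transform[OF assms(1-4)]
    by (intro matrix_inv_congruence transition_jacobian_invertible pos_def_inv(1) metric_pos_def assms)
  finally show ?thesis by (simp add: cgrad_ip_def)
qed

lemma grad_ip_chart: "c \<in> A \<Longrightarrow> p \<in> fst c \<Longrightarrow> diff_at f p \<Longrightarrow> diff_at h p \<Longrightarrow> grad_ip f h p = cgrad_ip c f h p"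
  unfolding grad_ip_cgrad_ip using cgrad_ip_invariant chart_at by blast

lemma grad_ip_nonneg: "grad_ip f f p \<ge> 0"
  unfolding grad_ip_cgrad_ip cgrad_ip_def
  using pos_def_inv(3)[OF metric_pos_def[OF chart_at, of p], of "cgrad (chart_at A p) f p"] by (cases "cgrad (chart_at A p) f p = 0") auto

lemma grad_ip_commute: "grad_ip f h p = grad_ip h f p"
  unfolding grad_ip_cgrad_ip cgrad_ip_def
  using metric_sym[OF pos_def_inv(2)[OF metric_pos_def[OF chart_at, of p]]] by (simp add: inner_commute)

text \<open>It serves twice: for the Cauchy-Schwarz inequality of gradients and for the first
  variation at a near-minimizer.\<close>

lemma quadratic_nonneg_discriminant:
  fixes a b c :: real assumes "\<And>t. a * t\<^sup>2 + 2 * b * t + c \<ge> 0" "a \<ge> 0" shows "b\<^sup>2 \<le> a * c"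
proof (cases "a = 0")
  case True
  have "b = 0"
  proof (rule ccontr)
    assume "b \<noteq> 0"
    \<comment> \<open>For \<open>a = 0\<close> the polynomial is linear, and this value of
      \<open>t\<close> gives it the value \<open>-1\<close>.\<close>
    then have "2 * b * (- (c + 1) / (2 * b)) + c = -1" by (simp add: field_simps)
    then show False using assms(1)[of "- (c + 1) / (2 * b)"] True by simp
  qed
  then show ?thesis using True by simp
next
  case False
  then have a: "a > 0" using assms(2) by simp
  have "a * (- b / a)\<^sup>2 + 2 * b * (- b / a) + c = c - b\<^sup>2 / a"
    using a by (simp add: power2_eq_square field_simps)
  then have "b\<^sup>2 / a \<le> c" using assms(1)[of "- b / a"] by simp
  then show ?thesis using a by (simp add: field_simps)
qed

lemma grad_ip_Cauchy: "(grad_ip f h p)\<^sup>2 \<le> grad_ip f f p * grad_ip h h p"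
proof -
  let ?c = "chart_at A p"
  let ?M = "matrix_inv (g ?c p)" and ?u = "cgrad ?c f p" and ?w = "cgrad ?c h p"
  note pdg = pos_def_inv[OF metric_pos_def[OF chart_at, of p]]
  have q: "x \<bullet> (?M *v x) \<ge> 0" for x using pdg(3)[of x] by (cases "x = 0") auto
  have s: "?w \<bullet> (?M *v ?u) = ?u \<bullet> (?M *v ?w)" using metric_sym[OF pdg(2)] by (simp add: inner_commute)
  have "(?u \<bullet> (?M *v ?u)) * t\<^sup>2 + 2 * (?u \<bullet> (?M *v ?w)) * t + ?w \<bullet> (?M *v ?w) = (t *\<^sub>R ?u + ?w) \<bullet> (?M *v (t *\<^sub>R ?u + ?w))" for t
    using s by (simp add: matrix_vector_right_distrib inner_add_left inner_add_right matrix_vector_mult_scaleR power2_eq_square algebra_simps)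
  then have "(?u \<bullet> (?M *v ?w))\<^sup>2 \<le> (?u \<bullet> (?M *v ?u)) * (?w \<bullet> (?M *v ?w))"
    by (intro quadratic_nonneg_discriminant) (use q in auto)
  then show ?thesis unfolding grad_ip_cgrad_ip cgrad_ip_def .
qed

lemma diff_at_const [simp]: "diff_at (\<lambda>p. c) p"
  by (simp add: diff_at_def in_chart_def o_def)

lemma in_chart_add: "in_chart c (\<lambda>p. f p + h p) = (\<lambda>y. in_chart c f y + in_chart c h y)"
  and in_chart_mult: "in_chart c (\<lambda>p. f p * h p :: real) = (\<lambda>y. in_chart c f y * in_chart c h y)"
  and in_chart_const: "in_chart c (\<lambda>p. k) = (\<lambda>y. k)"
  by (auto simp: in_chart_def o_def)

lemma diff_at_add: "diff_at f p \<Longrightarrow> diff_at h p \<Longrightarrow> diff_at (\<lambda>p. f p + h p) p"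
  by (simp add: diff_at_def in_chart_add)

lemma diff_at_mult: "diff_at f p \<Longrightarrow> diff_at h p \<Longrightarrow> diff_at (\<lambda>p. f p * h p) p"
  by (simp add: diff_at_def in_chart_mult)

lemma in_chart_at: "c \<in> A \<Longrightarrow> p \<in> fst c \<Longrightarrow> in_chart c f (snd c p) = f p"
  by (simp add: in_chart_def chart)

lemma cgrad_add: "c \<in> A \<Longrightarrow> p \<in> fst c \<Longrightarrow> diff_at f p \<Longrightarrow> diff_at h p \<Longrightarrow> cgrad c (\<lambda>p. f p + h p) p = cgrad c f p + cgrad c h p"
  by (simp add: cgrad_def vec_eq_iff partial_deriv_pd in_chart_add pd_add dfaD)

lemma cgrad_mult: "c \<in> A \<Longrightarrow> p \<in> fst c \<Longrightarrow> diff_at f p \<Longrightarrow> diff_at h p \<Longrightarrow> cgrad c (\<lambda>p. f p * h p) p = f p *\<^sub>R cgrad c h p + h p *\<^sub>R cgrad c f p"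
  by (simp add: cgrad_def vec_eq_iff partial_deriv_pd in_chart_mult pd_mult dfaD in_chart_at)

lemma cgrad_const: "cgrad c (\<lambda>p. k) p = 0"
  by (simp add: cgrad_def vec_eq_iff partial_deriv_pd in_chart_const)

lemma grad_ip_add: "diff_at f p \<Longrightarrow> diff_at h p \<Longrightarrow> grad_ip (\<lambda>p. f p + h p) k p = grad_ip f k p + grad_ip h k p"
  by (simp add: grad_ip_cgrad_ip cgrad_ip_def cgrad_add chart_at inner_add_left)

lemma grad_ip_mult: "diff_at f p \<Longrightarrow> diff_at h p \<Longrightarrow> grad_ip (\<lambda>p. f p * h p) k p = f p * grad_ip h k p + h p * grad_ip f k p"
  by (simp add: grad_ip_cgrad_ip cgrad_ip_def cgrad_mult chart_at inner_add_left)

lemma grad_ip_const: "grad_ip (\<lambda>p. c) k p = 0"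
  by (simp add: grad_ip_cgrad_ip cgrad_ip_def cgrad_const)

lemma grad_ip_scale: "diff_at f p \<Longrightarrow> grad_ip (\<lambda>p. c * f p) k p = c * grad_ip f k p"
  by (simp add: grad_ip_mult grad_ip_const)

lemma diff_at_cong:
  assumes "open W" "p \<in> W" "\<And>q. q \<in> W \<Longrightarrow> f q = h q" "diff_at f p" shows "diff_at h p"
proof -
  obtain c where c: "c \<in> A" "p \<in> fst c" using ex_chart by blast
  show ?thesis
    by (rule dfaI[OF c], rule differentiable_cong_open[OF open_chart_image[OF c(1) assms(1)] _ _ dfaD[OF assms(4) c]])
      (use c assms chart(5)[OF c(1)] in \<open>auto simp: in_chart_def\<close>)
qed

lemma cgrad_cong:
  assumes "open W" "p \<in> W" "\<And>q. q \<in> W \<Longrightarrow> f q = h q" "c \<in> A" "p \<in> fst c" shows "cgrad c f p = cgrad c h p"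
proof -
  have "pd i (in_chart c f) (snd c p) = pd i (in_chart c h) (snd c p)" for i
    by (rule pd_cong_open[OF open_chart_image[OF assms(4,1)]])
      (use assms chart(5)[OF assms(4)] in \<open>auto simp: in_chart_def\<close>)
  then show ?thesis by (simp add: cgrad_def partial_deriv_pd)
qed

lemma grad_ip_cong:
  assumes "open W" "p \<in> W" "\<And>q. q \<in> W \<Longrightarrow> f q = h q" shows "grad_ip f k p = grad_ip h k p"
  unfolding grad_ip_cgrad_ip cgrad_ip_def using cgrad_cong[OF assms chart_at] by simp

text \<open>It is applied to cutoffs where they equal \<open>1\<close> and to truncations where they
  are clipped: each such point is a global extremum, so the differential vanishes there as soon as
  it exists.\<close>

lemma cgrad_extremum:
  assumes p: "diff_at f p" and c: "c \<in> A" "p \<in> fst c" and m: "(\<forall>q. f q \<le> f p) \<or> (\<forall>q. f p \<le> f q)"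
  shows "cgrad c f p = 0"
proof -
  obtain D where D: "(in_chart c f has_derivative D) (at (snd c p))" using dfaD[OF p c] by (auto simp: differentiable_def)
  have fp: "in_chart c f (snd c p) = f p" using c by (simp add: in_chart_def chart)
  have "D = (\<lambda>h. 0)"
    by (rule differential_zero_maxmin[OF _ chart(2)[OF c(1)] D]) (use c m fp in \<open>auto simp: in_chart_def\<close>)
  then have "pd i (in_chart c f) (snd c p) = 0" for i using pd_eq[OF D, of i] by simp
  then show ?thesis by (simp add: cgrad_def partial_deriv_pd vec_eq_iff)
qed

lemma grad_ip_extremum:
  assumes "diff_at f p" "(\<forall>q. f q \<le> f p) \<or> (\<forall>q. f p \<le> f q)" shows "grad_ip f k p = 0" "grad_ip k f p = 0"
  using cgrad_extremum[OF assms(1) chart_at assms(2)] by (auto simp: grad_ip_cgrad_ip cgrad_ip_def)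

subsection \<open>A Borel measurable version of the gradient product\<close>

text \<open>\<open>bgrad_ip\<close> is Borel measurable and agrees with \<open>grad_ip\<close> where both functions are
  differentiable; \<open>grad_ip\<close> itself depends on unspecified values elsewhere.\<close>

definition bcgrad_ip :: "('a, 'n) chart \<Rightarrow> ('a \<Rightarrow> real) \<Rightarrow> ('a \<Rightarrow> real) \<Rightarrow> real ^ 'n \<Rightarrow> real" where
  "bcgrad_ip c f h y = (\<Sum>i\<in>UNIV. \<Sum>j\<in>UNIV. dird (ext c (in_chart c f)) (axis i 1) y *
     ext c (\<lambda>y. matrix_inv (g c (ci c y)) $ i $ j) y * dird (ext c (in_chart c h)) (axis j 1) y)"

text \<open>A Borel choice of a chart at each point; the choice made by \<open>chart_at\<close> is
  arbitrary and need not be measurable.\<close>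

definition idx :: "'a \<Rightarrow> nat" where "idx p = (LEAST n. p \<in> fst (cseq n))"

definition bgrad_ip :: "('a \<Rightarrow> real) \<Rightarrow> ('a \<Rightarrow> real) \<Rightarrow> 'a \<Rightarrow> real" where
  "bgrad_ip f h p = bcgrad_ip (cseq (idx p)) f h (coord0 (cseq (idx p)) p)"

lemma idx: "p \<in> fst (cseq (idx p))"
proof -
  have "\<exists>n. p \<in> fst (cseq n)" using cseq(2) by auto
  then show ?thesis unfolding idx_def by (rule LeastI_ex)
qed

lemma smooth_ginv:
  assumes c: "c \<in> A" shows "smooth_on (V c) (\<lambda>y. matrix_inv (g c (ci c y)) $ i $ j)"
proof (intro smooth_on_matrix_inv chart(2)[OF c] smooth_metric[OF c])
  show "det (g c (ci c y)) \<noteq> 0" if "y \<in> V c" for y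
    using pos_def_det[OF metric_pos_def[OF c chart(7)[OF c that]]] by simp
qed

lemma ext_in_chart_borel:
  assumes "c \<in> A" and [measurable]: "f \<in> borel_measurable borel"
  shows "ext c (in_chart c f) \<in> borel_measurable borel"
proof -
  note [measurable] = ci'_borel[OF assms(1)] borel_V(1)[OF assms(1)]
  have "ext c (in_chart c f) = (\<lambda>y. if y \<in> V c then f (ci' c y) else 0)"
    by (auto simp: ext_def in_chart_def ci'_def)
  then show ?thesis by simp
qed

lemma borel_bgrad_ip [measurable]:
  assumes [measurable]: "f \<in> borel_measurable borel" "h \<in> borel_measurable borel"
  shows "bgrad_ip f h \<in> borel_measurable borel"
proof -
  have "(\<lambda>p. bcgrad_ip (cseq n) f h (coord0 (cseq n) p)) \<in> borel_measurable borel" for n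
  proof -
    note [measurable] = coord0_borel[OF cseq(1)] ext_in_chart_borel[OF cseq(1)]
      ext_borel[OF cseq(1) smooth_on_imp_continuous_on[OF smooth_ginv[OF cseq(1)]]]
    show ?thesis unfolding bcgrad_ip_def by measurable
  qed
  moreover have "idx \<in> borel \<rightarrow>\<^sub>M count_space UNIV"
    unfolding idx_def using borel_V(2)[OF cseq(1)] by measurable
  ultimately show ?thesis
    unfolding bgrad_ip_def[abs_def] by (rule measurable_compose_countable)
qed

lemma dird_ext:
  assumes "c \<in> A" "p \<in> fst c" "diff_at f p"
  shows "dird (ext c (in_chart c f)) (axis i 1) (snd c p) = cgrad c f p $ i"
proof -
  obtain D where D: "(in_chart c f has_derivative D) (at (snd c p))"
    using dfaD[OF assms(3,1,2)] by (auto simp: differentiable_def)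
  have "(ext c (in_chart c f) has_derivative D) (at (snd c p))"
    by (rule has_derivative_transform_within_open[OF D chart(2)[OF assms(1)]]) (use assms in \<open>auto simp: ext_def\<close>)
  then show ?thesis using pd_eq[OF D, of i] by (simp add: dird_eq cgrad_def partial_deriv_pd)
qed

lemma bgrad_ip_eq: "diff_at f p \<Longrightarrow> diff_at h p \<Longrightarrow> bgrad_ip f h p = grad_ip f h p"
proof -
  assume d: "diff_at f p" "diff_at h p"
  let ?c = "cseq (idx p)"
  note c = cseq(1)[of "idx p"] idx[of p]
  have "bgrad_ip f h p = (\<Sum>i\<in>UNIV. \<Sum>j\<in>UNIV. cgrad ?c f p $ i * matrix_inv (g ?c p) $ i $ j * cgrad ?c h p $ j)"
    unfolding bgrad_ip_def bcgrad_ip_def using c d by (simp add: coord0_def dird_ext ext_def chart(5)[OF c])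
  also have "\<dots> = cgrad_ip ?c f h p"
    by (simp add: cgrad_ip_def inner_vec_def matrix_vector_mult_def sum_distrib_left mult.assoc)
  finally show ?thesis using grad_ip_chart[OF c d] by simp
qed

subsection \<open>Locally Lipschitz functions\<close>

text \<open>The class of test functions for integration by parts. It contains the C2 and the
  piecewise smooth functions and is closed under products, with almost everywhere differentiability
  built in.\<close>

definition loc_lip :: "('a \<Rightarrow> real) \<Rightarrow> bool" where
  "loc_lip f \<longleftrightarrow> (\<forall>c\<in>A. \<forall>y\<in>V c. lip_at (in_chart c f) y) \<and> (AE p in mu. diff_at f p)"

lemma loc_lip_continuous: "loc_lip f \<Longrightarrow> continuous_on UNIV f"
  by (rule continuous_chartsI) (auto simp: loc_lip_def intro!: continuous_at_imp_continuous_on lip_at_isCont)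

lemma loc_lip_borel: "loc_lip f \<Longrightarrow> f \<in> borel_measurable borel"
  by (rule borel_measurable_continuous_onI[OF loc_lip_continuous])

lemma loc_lip_AE: "loc_lip f \<Longrightarrow> AE p in mu. diff_at f p" by (simp add: loc_lip_def)

lemma loc_lip_const: "loc_lip (\<lambda>p. c)" by (simp add: loc_lip_def in_chart_const)

lemma loc_lip_comb:
  assumes f: "loc_lip f" and h: "loc_lip h"
    and lip: "\<And>(c :: ('a, 'n) chart) y. lip_at (in_chart c f) y \<Longrightarrow> lip_at (in_chart c h) y \<Longrightarrow> lip_at (in_chart c k) y"
    and diff_at: "\<And>p. diff_at f p \<Longrightarrow> diff_at h p \<Longrightarrow> diff_at k p"
  shows "loc_lip k"
  unfolding loc_lip_def
proof (intro conjI ballI)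
  show "lip_at (in_chart c k) y" if "c \<in> A" "y \<in> V c" for c y
  proof (rule lip)
    show "lip_at (in_chart c f) y" using f that unfolding loc_lip_def by blast
    show "lip_at (in_chart c h) y" using h that unfolding loc_lip_def by blast
  qed
  show "AE p in mu. diff_at k p"
    using loc_lip_AE[OF f] loc_lip_AE[OF h] by eventually_elim (rule diff_at)
qed

lemma loc_lip_add: "loc_lip f \<Longrightarrow> loc_lip h \<Longrightarrow> loc_lip (\<lambda>p. f p + h p)"
  by (rule loc_lip_comb[of f h]) (auto simp: in_chart_add intro: lip_at_add diff_at_add)

lemma loc_lip_mult: "loc_lip f \<Longrightarrow> loc_lip h \<Longrightarrow> loc_lip (\<lambda>p. f p * h p)"
  by (rule loc_lip_comb[of f h]) (auto simp: in_chart_mult intro: lip_at_mult diff_at_mult)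

lemma Ck_fun_diff_at: "Ck_fun A (Suc k) f \<Longrightarrow> diff_at f p"
proof -
  assume f: "Ck_fun A (Suc k) f"
  obtain c where c: "c \<in> A" "p \<in> fst c" using ex_chart by blast
  then show ?thesis
    using f by (intro dfaI[OF c]) (auto simp: Ck_fun_def)
qed

lemma Ck_fun_loc_lip: 
  assumes f: "Ck_fun A (Suc k) f" shows "loc_lip f"
  unfolding loc_lip_def
proof (intro conjI ballI)
  show "lip_at (in_chart c f) y" if "c \<in> A" "y \<in> V c" for c y
    by (rule lip_at_C1[OF chart(2)[OF that(1)] that(2), where k = k]) (use f that(1) in \<open>simp add: Ck_fun_def\<close>)
  show "AE p in mu. diff_at f p" using Ck_fun_diff_at[OF f] by simp
qed

lemma C2_diff_at: "Ck_fun A 2 f \<Longrightarrow> diff_at f p" and C2_loc_lip: "Ck_fun A 2 f \<Longrightarrow> loc_lip f"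
  using Ck_fun_diff_at[of 1] Ck_fun_loc_lip[of 1] by (simp_all add: numeral_2_eq_2)

lemma smooth_Ck_fun: "smooth_fun_on A UNIV f \<Longrightarrow> Ck_fun A k f"
  unfolding Ck_fun_def smooth_fun_on_def by (simp add: smooth_onD)

text \<open>In a chart a piecewise smooth function is locally a continuous selection from finitely
  many smooth ones, so both selection lemmas apply. The null sets of bad points patch together
  because negligibility is local.\<close>

lemma pws_loc_lip:
  assumes "piecewise_smooth_fun A f" shows "loc_lip f"
proof -
  have fc: "continuous_on UNIV f" and loc: "\<And>p. \<exists>W H. open W \<and> p \<in> W \<and> finite H \<and> (\<forall>h\<in>H. smooth_fun_on A W h) \<and> (\<forall>q\<in>W. \<exists>h\<in>H. f q = h q)"
    using assms by (auto simp: piecewise_smooth_fun_def)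
  have key: "\<exists>S. open S \<and> y \<in> S \<and> S \<subseteq> V c \<and> (\<forall>z\<in>S. lip_at (in_chart c f) z) \<and> negligible {z\<in>S. \<not> in_chart c f differentiable (at z)}"
    if c: "c \<in> A" and y: "y \<in> V c" for c y
  proof -
    obtain W H where W: "open W" "ci c y \<in> W" and H: "finite H" "\<And>h. h \<in> H \<Longrightarrow> smooth_fun_on A W h" "\<And>q. q \<in> W \<Longrightarrow> \<exists>h\<in>H. f q = h q"
      using loc[of "ci c y"] by blast
    define S where "S = snd c ` (fst c \<inter> W)"
    have S: "open S" unfolding S_def by (rule open_chart_image[OF c W(1)])
    have SV: "S \<subseteq> V c" unfolding S_def by auto
    have yS: "y \<in> S" unfolding S_def using W(2) chart(6,7)[OF c y] by (metis IntI image_eqI)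
    have cont: "continuous_on S (in_chart c f)"
      by (rule continuous_on_subset[OF continuous_in_chart[OF fc c] SV])
    have fin: "finite (in_chart c ` H)" using H(1) by simp
    have sel: "\<exists>h\<in>in_chart c ` H. in_chart c f z = h z" if "z \<in> S" for z
    proof -
      have "ci c z \<in> W" using that chart(5)[OF c] by (auto simp: S_def)
      then show ?thesis using H(3) by (auto simp: in_chart_def)
    qed
    have C1: "Ck_on 1 S h" if h: "h \<in> in_chart c ` H" for h
    proof -
      obtain k where "k \<in> H" "h = in_chart c k" using h by blast
      then have "smooth_on S h" using H(2) c by (simp add: smooth_fun_on_def S_def)
      then show ?thesis by (rule smooth_onD)
    qed
    show ?thesis
      using S SV yS selection_lip_at[OF S _ cont fin sel C1] selection_differentiable_AE[OF S cont fin sel C1]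
      by (intro exI[of _ S]) simp
  qed
  show ?thesis
    unfolding loc_lip_def
  proof (intro conjI ballI)
    show "lip_at (in_chart c f) y" if "c \<in> A" "y \<in> V c" for c y using key[OF that] by blast
    show "AE p in mu. diff_at f p"
      unfolding AE_mu_charts
    proof
      fix c assume c: "c \<in> A"
      define N where "N = {z\<in>V c. \<not> in_chart c f differentiable (at z)}"
      have "negligible N"
      proof (subst locally_negligible_alt, rule)
        fix y assume y: "y \<in> N"
        then obtain S where S: "open S" "y \<in> S" "S \<subseteq> V c" "negligible {z\<in>S. \<not> in_chart c f differentiable (at z)}"
          using key[OF c, of y] by (auto simp: N_def)
        show "\<exists>U. openin (top_of_set N) U \<and> y \<in> U \<and> negligible U"
          using S y by (intro exI[of _ "N \<inter> S"]) (auto simp: N_def elim!: negligible_subset)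
      qed
      then have "N \<in> null_sets lebesgue" by (simp add: negligible_iff_null_sets)
      then have "AE y in lebesgue. y \<notin> N" by (rule AE_not_in)
      then have "AE y in lborel. y \<notin> N" by (simp add: AE_completion_iff)
      then show "AE y in lborel. y \<in> V c \<longrightarrow> diff_at f (ci c y)"
      proof eventually_elim
        case (elim y)
        then show ?case using chart(6,7)[OF c, of y] by (auto simp: N_def intro!: dfaI[OF c])
      qed
    qed
  qed
qed


subsection \<open>Piecewise smooth functions, bumps and cutoffs\<close>

lemma smooth_fun_on_subset: "smooth_fun_on A W f \<Longrightarrow> W' \<subseteq> W \<Longrightarrow> smooth_fun_on A W' f"
  unfolding smooth_fun_on_def by (meson Int_mono image_mono order_refl smooth_on_subset)

lemma smooth_fun_on_add: "open W \<Longrightarrow> smooth_fun_on A W f \<Longrightarrow> smooth_fun_on A W h \<Longrightarrow> smooth_fun_on A W (\<lambda>p. f p + h p)"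
  unfolding smooth_fun_on_def in_chart_add by (auto intro!: smooth_on_add open_chart_image)

lemma smooth_fun_on_mult: "open W \<Longrightarrow> smooth_fun_on A W f \<Longrightarrow> smooth_fun_on A W h \<Longrightarrow> smooth_fun_on A W (\<lambda>p. f p * h p)"
  unfolding smooth_fun_on_def in_chart_mult by (auto intro!: smooth_on_mult open_chart_image)

lemma smooth_fun_on_const: "smooth_fun_on A W (\<lambda>p. c)"
  unfolding smooth_fun_on_def in_chart_const by simp

lemma smooth_fun_on_sum:
  assumes "open W" "finite T" "\<And>t. t \<in> T \<Longrightarrow> smooth_fun_on A W (f t)"
  shows "smooth_fun_on A W (\<lambda>p. \<Sum>t\<in>T. f t p)"
  using assms(2,3)
  by (induction T rule: finite_induct) (auto intro!: smooth_fun_on_add smooth_fun_on_const assms(1))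

abbreviation pws :: "('a \<Rightarrow> real) \<Rightarrow> bool" where "pws \<equiv> piecewise_smooth_fun A"

lemma pwsD: "pws f \<Longrightarrow> \<exists>W H. open W \<and> p \<in> W \<and> finite H \<and> (\<forall>h\<in>H. smooth_fun_on A W h) \<and> (\<forall>q\<in>W. \<exists>h\<in>H. f q = h q)"
  by (simp add: piecewise_smooth_fun_def)

lemma pws_continuous: "pws f \<Longrightarrow> continuous_on UNIV f"
  by (simp add: piecewise_smooth_fun_def)

lemma pws_smooth:
  assumes "smooth_fun_on A UNIV f" shows "pws f"
  unfolding piecewise_smooth_fun_def
proof
  have "Ck_fun A 0 f" by (rule smooth_Ck_fun[OF assms])
  then show "continuous_on UNIV f"
    by (intro continuous_chartsI) (simp add: Ck_fun_def)
  show "\<forall>p. \<exists>W H. open W \<and> p \<in> W \<and> finite H \<and> (\<forall>h\<in>H. smooth_fun_on A W h) \<and> (\<forall>q\<in>W. \<exists>h\<in>H. f q = h q)"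
    using assms by (intro allI exI[of _ UNIV] exI[of _ "{f}"]) auto
qed

lemma pws_const: "pws (\<lambda>p. c)"
  by (intro pws_smooth smooth_fun_on_const)

text \<open>\<open>G\<close> lists the candidates for the combined function: one for sums and
  products, two for maxima and minima. They are formed from every pair of candidates for
  \<open>f\<close> and \<open>h\<close>.\<close>

lemma pws_comb:
  assumes f: "pws f" and h: "pws h" and c: "continuous_on UNIV (\<lambda>p. F (f p) (h p))"
    and s: "\<And>W f h k. open W \<Longrightarrow> smooth_fun_on A W f \<Longrightarrow> smooth_fun_on A W h \<Longrightarrow> k \<in> G f h \<Longrightarrow> smooth_fun_on A W k"
    and fin: "\<And>f h. finite (G f h)" and G: "\<And>f h p. \<exists>k\<in>G f h. F (f p) (h p) = k p"
  shows "pws (\<lambda>p. F (f p) (h p))"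
  unfolding piecewise_smooth_fun_def
proof (intro conjI allI c)
  fix p
  from pwsD[OF f, of p] obtain W1 H1 where 1: "open W1" "p \<in> W1" "finite H1"
    and aa: "\<And>k. k \<in> H1 \<Longrightarrow> smooth_fun_on A W1 k" "\<And>q. q \<in> W1 \<Longrightarrow> \<exists>k\<in>H1. f q = k q" by blast
  from pwsD[OF h, of p] obtain W2 H2 where 2: "open W2" "p \<in> W2" "finite H2"
    and bb: "\<And>k. k \<in> H2 \<Longrightarrow> smooth_fun_on A W2 k" "\<And>q. q \<in> W2 \<Longrightarrow> \<exists>k\<in>H2. h q = k q" by blast
  define W where "W = W1 \<inter> W2"
  define H where "H = (\<Union>k1\<in>H1. \<Union>k2\<in>H2. G k1 k2)"
  have W: "open W" "p \<in> W" using 1 2 by (auto simp: W_def)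
  have "smooth_fun_on A W k" if k: "k \<in> H" for k
  proof -
    obtain k1 k2 where k: "k1 \<in> H1" "k2 \<in> H2" "k \<in> G k1 k2" using k by (auto simp: H_def)
    show ?thesis
      by (rule s[OF W(1) smooth_fun_on_subset[OF aa(1)[OF k(1)]] smooth_fun_on_subset[OF bb(1)[OF k(2)]] k(3)])
        (auto simp: W_def)
  qed
  moreover have "\<exists>k\<in>H. F (f q) (h q) = k q" if q: "q \<in> W" for q
  proof -
    obtain k1 where k1: "k1 \<in> H1" "f q = k1 q" using aa(2) q by (auto simp: W_def)
    obtain k2 where k2: "k2 \<in> H2" "h q = k2 q" using bb(2) q by (auto simp: W_def)
    obtain k where "k \<in> G k1 k2" "F (k1 q) (k2 q) = k q" using G by blast
    then show ?thesis using k1 k2 by (auto simp: H_def)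
  qed
  moreover have "finite H" using 1(3) 2(3) fin by (auto simp: H_def)
  ultimately show "\<exists>W H. open W \<and> p \<in> W \<and> finite H \<and> (\<forall>h\<in>H. smooth_fun_on A W h) \<and> (\<forall>q\<in>W. \<exists>k\<in>H. F (f q) (h q) = k q)"
    using W by (intro exI[of _ W] exI[of _ H]) auto
qed

lemma pws_add:
  assumes "pws f" "pws h" shows "pws (\<lambda>p. f p + h p)"
  by (rule pws_comb[where F = "\<lambda>x y. x + y" and G = "\<lambda>f h. {\<lambda>p. f p + h p}", OF assms
      continuous_on_add[OF assms[THEN pws_continuous]]])
    (auto intro: smooth_fun_on_add)

lemma pws_mult:
  assumes "pws f" "pws h" shows "pws (\<lambda>p. f p * h p)"
  by (rule pws_comb[where F = "\<lambda>x y. x * y" and G = "\<lambda>f h. {\<lambda>p. f p * h p}", OF assms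
      continuous_on_mult[OF assms[THEN pws_continuous]]])
    (auto intro: smooth_fun_on_mult)

lemma pws_max:
  assumes "pws f" "pws h" shows "pws (\<lambda>p. max (f p) (h p))"
  by (rule pws_comb[where F = max and G = "\<lambda>f h. {f, h}", OF assms
      continuous_on_max[OF assms[THEN pws_continuous]]])
    (auto simp: max_def)

lemma pws_min:
  assumes "pws f" "pws h" shows "pws (\<lambda>p. min (f p) (h p))"
  by (rule pws_comb[where F = min and G = "\<lambda>f h. {f, h}", OF assms
      continuous_on_min[OF assms[THEN pws_continuous]]])
    (auto simp: min_def)

lemma pws_scale: "pws f \<Longrightarrow> pws (\<lambda>p. c * f p)"
  by (rule pws_mult[OF pws_const])

definition cpws :: "('a \<Rightarrow> real) \<Rightarrow> bool" where "cpws f \<longleftrightarrow> f \<in> compact_piecewise_smooth A"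

lemma cpsI: "pws f \<Longrightarrow> compact K \<Longrightarrow> (\<And>p. p \<notin> K \<Longrightarrow> f p = 0) \<Longrightarrow> cpws f"
  unfolding cpws_def compact_piecewise_smooth_def
proof (rule CollectI, rule conjI)
  assume f: "pws f" and K: "compact K" "\<And>p. p \<notin> K \<Longrightarrow> f p = 0"
  show "pws f" by fact
  have "closure {p. f p \<noteq> 0} \<subseteq> K"
    by (rule closure_minimal) (use K compact_imp_closed in auto)
  then have "K \<inter> closure {p. f p \<noteq> 0} = closure {p. f p \<noteq> 0}" by blast
  then show "compact (closure {p. f p \<noteq> 0})"
    using compact_Int_closed[OF K(1) closed_closure[of "{p. f p \<noteq> 0}"]] by simp
qed

lemma cpws_support:
  assumes "cpws f" shows "\<exists>K. compact K \<and> (\<forall>p. p \<notin> K \<longrightarrow> f p = 0)"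
proof (intro exI conjI allI impI)
  show "compact (closure {p. f p \<noteq> 0})" using assms by (simp add: cpws_def compact_piecewise_smooth_def)
  show "f p = 0" if "p \<notin> closure {p. f p \<noteq> 0}" for p
    using that closure_subset[of "{p. f p \<noteq> 0}"] by blast
qed

lemma cpws_pws: "cpws f \<Longrightarrow> pws f" by (simp add: cpws_def compact_piecewise_smooth_def)

lemma cpws_loc_lip: "cpws f \<Longrightarrow> loc_lip f" by (intro pws_loc_lip cpws_pws)

lemma cpws_mult:
  assumes "pws f" "cpws h" shows "cpws (\<lambda>p. f p * h p)"
proof -
  obtain K where K: "compact K" "\<And>p. p \<notin> K \<Longrightarrow> h p = 0" using cpws_support[OF assms(2)] by blast
  show ?thesis by (rule cpsI[OF pws_mult[OF assms(1) cpws_pws[OF assms(2)]] K(1)]) (simp add: K(2))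
qed

lemma cpws_add:
  assumes "cpws f" "cpws h" shows "cpws (\<lambda>p. f p + h p)"
proof -
  obtain K where K: "compact K" "\<And>p. p \<notin> K \<Longrightarrow> f p = 0" using cpws_support[OF assms(1)] by blast
  obtain K' where K': "compact K'" "\<And>p. p \<notin> K' \<Longrightarrow> h p = 0" using cpws_support[OF assms(2)] by blast
  show ?thesis
    by (rule cpsI[OF pws_add[OF cpws_pws[OF assms(1)] cpws_pws[OF assms(2)]] compact_Un[OF K(1) K'(1)]]) (use K K' in auto)
qed

lemma cpws_scale: "cpws h \<Longrightarrow> cpws (\<lambda>p. c * h p)"
  by (rule cpws_mult[OF pws_const])

section \<open>Functions supported in a chart, bumps and cutoffs\<close>

definition chart_fun :: "('a, 'n) chart \<Rightarrow> (real ^ 'n \<Rightarrow> real) \<Rightarrow> 'a \<Rightarrow> real" where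
  "chart_fun c w p = (if p \<in> fst c then w (snd c p) else 0)"

lemma compact_chart_preimage:
  assumes "c \<in> A" "compact K" "K \<subseteq> V c" shows "compact (ci c ` K)" "ci c ` K \<subseteq> fst c"
  using assms chart(7)[OF assms(1)]
  by (auto intro!: compact_continuous_image continuous_on_subset[OF chart(4)[OF assms(1)]])

lemma chart_fun_zero:
  assumes "c \<in> A" "\<And>y. y \<in> V c \<Longrightarrow> y \<notin> K \<Longrightarrow> w y = 0" "p \<notin> ci c ` K" shows "chart_fun c w p = 0"
proof (cases "p \<in> fst c")
  case True
  then have "snd c p \<notin> K" using assms(3) chart(5)[OF assms(1) True] by (metis image_eqI)
  then show ?thesis using True assms(2)[of "snd c p"] by (simp add: chart_fun_def)
qed (simp add: chart_fun_def)

text \<open>Two open sets cover the manifold: the chart domain, where the function is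
  \<open>w\<close> composed with a transition, and the complement of the compact image of
  \<open>K\<close>, where it vanishes. The latter is open because the space is Hausdorff.\<close>

lemma smooth_chart_fun:
  assumes c: "c \<in> A" and w: "smooth_on (V c) w" and K: "compact K" "K \<subseteq> V c" and w0: "\<And>y. y \<in> V c \<Longrightarrow> y \<notin> K \<Longrightarrow> w y = 0"
  shows "smooth_fun_on A UNIV (chart_fun c w)"
  unfolding smooth_fun_on_def
proof (intro ballI smooth_on_local)
  fix c' y assume c': "c' \<in> A" and "y \<in> snd c' ` (fst c' \<inter> UNIV)"
  then obtain q where q: "q \<in> fst c'" "y = snd c' q" by auto
  note KM = compact_chart_preimage[OF c K]
  show "\<exists>T. open T \<and> y \<in> T \<and> smooth_on T (in_chart c' (chart_fun c w))"
  proof (cases "q \<in> fst c")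
    case True
    define T where "T = snd c' ` (fst c' \<inter> fst c)"
    have T: "open T" "y \<in> T" unfolding T_def using open_overlap[OF c' c] q True by auto
    have "smooth_on T (\<lambda>z. w (transition c' c z))"
    proof (rule smooth_on_compose[OF T(1) chart(2)[OF c] _ _ w])
      show "transition c' c ` T \<subseteq> V c"
        unfolding T_def by (auto simp: transition_eq[OF c', of _ c])
      show "smooth_on T (transition c' c)" unfolding T_def by (rule transition_smooth[OF c' c])
    qed
    then have "smooth_on T (in_chart c' (chart_fun c w))"
      by (rule smooth_on_cong[OF T(1), rotated])
        (auto simp: T_def transition_eq[OF c'] in_chart_def chart(5)[OF c'] chart_fun_def)
    then show ?thesis using T by blast
  next
    case False
    define T where "T = snd c' ` (fst c' \<inter> - (ci c ` K))"
    have T: "open T" "y \<in> T" unfolding T_def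
      using q False KM compact_imp_closed[OF KM(1)] by (auto intro!: open_chart_image[OF c'])
    have "smooth_on T (\<lambda>z. 0 :: real)" by simp
    then have "smooth_on T (in_chart c' (chart_fun c w))"
      by (rule smooth_on_cong[OF T(1), rotated])
        (auto simp: T_def in_chart_def chart(5)[OF c'] chart_fun_zero[OF c w0])
    then show ?thesis using T by blast
  qed
qed

lemma bump:
  assumes W: "open W" "p \<in> W" and c: "c \<in> A" "p \<in> fst c"
  shows "\<exists>f K. smooth_fun_on A UNIV f \<and> (\<forall>q. 0 \<le> f q) \<and> f p > 0 \<and> compact K \<and> K \<subseteq> W \<inter> fst c \<and> (\<forall>q. q \<notin> K \<longrightarrow> f q = 0)"
proof -
  have "open (snd c ` (fst c \<inter> W))" by (rule open_chart_image[OF c(1) W(1)])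
  then obtain r where r: "r > 0" "cball (snd c p) r \<subseteq> snd c ` (fst c \<inter> W)"
    using c W open_contains_cball by (metis IntI imageI)
  obtain b :: "real ^ 'n \<Rightarrow> real" where b: "smooth_on UNIV b" "\<And>x. 0 \<le> b x"
    "\<And>x. x \<in> ball (snd c p) r \<Longrightarrow> b x > 0" "\<And>x. x \<notin> ball (snd c p) r \<Longrightarrow> b x = 0"
    using euclidean_bump[OF r(1), of "snd c p"] by blast
  define K where "K = cball (snd c p) r"
  have K: "compact K" "K \<subseteq> V c" using r by (auto simp: K_def)
  have b0: "b y = 0" if "y \<notin> K" for y using b(4)[of y] that by (auto simp: K_def)
  have "smooth_fun_on A UNIV (chart_fun c b)"
    by (rule smooth_chart_fun[OF c(1) smooth_on_subset[OF b(1)] K]) (use b0 in auto)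
  moreover have "ci c ` K \<subseteq> W \<inter> fst c"
  proof
    fix q assume "q \<in> ci c ` K"
    then obtain y where "y \<in> K" "q = ci c y" by blast
    moreover then obtain q' where "q' \<in> fst c \<inter> W" "y = snd c q'" using r(2) unfolding K_def by blast
    ultimately show "q \<in> W \<inter> fst c" using chart(5)[OF c(1)] by auto
  qed
  moreover have "chart_fun c b q = 0" if "q \<notin> ci c ` K" for q
    by (rule chart_fun_zero[OF c(1) _ that]) (use b0 in auto)
  moreover have "chart_fun c b p > 0" using c b(3) r by (simp add: chart_fun_def)
  moreover have "chart_fun c b q \<ge> 0" for q using b(2) by (simp add: chart_fun_def)
  ultimately show ?thesis using compact_chart_preimage(1)[OF c(1) K]
    by (intro exI[of _ "chart_fun c b"] exI[of _ "ci c ` K"]) simp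
qed

text \<open>Finitely many of the sets where a bump is positive cover \<open>K\<close>, and the sum
  of these bumps is positive on \<open>K\<close>.\<close>

lemma smooth_bump:
  assumes K: "compact K" and W: "open W" "K \<subseteq> W"
  shows "\<exists>s K'. smooth_fun_on A UNIV s \<and> (\<forall>q. 0 \<le> s q) \<and> (\<forall>q\<in>K. s q > 0) \<and> compact K' \<and> K' \<subseteq> W \<and> (\<forall>q. q \<notin> K' \<longrightarrow> s q = 0)"
proof -
  define P where "P p f C \<longleftrightarrow> smooth_fun_on A UNIV f \<and> (\<forall>q. 0 \<le> f q) \<and> f p > 0 \<and> compact C \<and> C \<subseteq> W \<and> (\<forall>q. q \<notin> C \<longrightarrow> f q = 0)"
    for p and f :: "'a \<Rightarrow> real" and C
  have "\<exists>z. P p (fst z) (snd z)" if "p \<in> K" for p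
    using bump[OF W(1) subsetD[OF W(2) that] chart_at] by (elim exE) (auto simp: P_def)
  then have "\<exists>z. \<forall>p\<in>K. P p (fst (z p)) (snd (z p))" by (intro bchoice) blast
  then obtain z where z: "\<And>p. p \<in> K \<Longrightarrow> P p (fst (z p)) (snd (z p))" by blast
  define f where "f p = fst (z p)" for p
  define C where "C p = snd (z p)" for p
  have f: "smooth_fun_on A UNIV (f p)" "0 \<le> f p q" "f p p > 0" "compact (C p)" "C p \<subseteq> W" "q \<notin> C p \<Longrightarrow> f p q = 0"
    if "p \<in> K" for p q
    using z[OF that] unfolding P_def f_def C_def by auto
  have fc: "continuous_on UNIV (f p)" if "p \<in> K" for p by (intro pws_continuous pws_smooth f that)
  obtain T where T: "T \<subseteq> K" "finite T" "K \<subseteq> (\<Union>p\<in>T. {q. f p q > 0})"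
  proof (rule compactE_image[OF K, of K "\<lambda>p. {q. f p q > 0}"])
    show "open {q. f p q > 0}" if "p \<in> K" for p
      using continuous_on_open_vimage[OF open_UNIV, of "f p"] fc[OF that] open_greaterThan[of "0::real"]
      by (auto simp: vimage_def greaterThan_def)
    show "K \<subseteq> (\<Union>p\<in>K. {q. f p q > 0})" using f(3) by auto
  qed auto
  define s where "s q = (\<Sum>p\<in>T. f p q)" for q
  have sp: "smooth_fun_on A UNIV s" unfolding s_def using T f(1) by (intro smooth_fun_on_sum) auto
  have spos: "s q > 0" if qK: "q \<in> K" for q
  proof -
    obtain p where p: "p \<in> T" "f p q > 0" using T(3) qK by auto
    have "f p q \<le> s q" unfolding s_def using T p(1) f(2) by (intro member_le_sum) auto
    then show ?thesis using p by simp
  qed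
  have s0: "s q \<ge> 0" for q unfolding s_def using T f(2) by (intro sum_nonneg) auto
  have "compact (\<Union>p\<in>T. C p)" using T f(4) by (intro compact_UN) auto
  moreover have "(\<Union>p\<in>T. C p) \<subseteq> W" using T f(5) by auto
  moreover have "s q = 0" if "q \<notin> (\<Union>p\<in>T. C p)" for q
    unfolding s_def using that T f(6) by (intro sum.neutral) auto
  ultimately show ?thesis using sp s0 spos by (intro exI[of _ s] exI[of _ "\<Union>p\<in>T. C p"]) simp
qed

lemma cutoff:
  assumes K: "compact K" and W: "open W" "K \<subseteq> W"
  shows "\<exists>\<eta> K'. cpws \<eta> \<and> (\<forall>q. 0 \<le> \<eta> q \<and> \<eta> q \<le> 1) \<and> (\<forall>q\<in>K. \<eta> q = 1) \<and> compact K' \<and> K' \<subseteq> W \<and> (\<forall>q. q \<notin> K' \<longrightarrow> \<eta> q = 0)"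
proof -
  obtain s K' where s: "smooth_fun_on A UNIV s" "\<And>q. 0 \<le> s q" and spos: "\<And>q. q \<in> K \<Longrightarrow> s q > 0"
    and K': "compact K'" "K' \<subseteq> W" and s0: "\<And>q. q \<notin> K' \<Longrightarrow> s q = 0"
    using smooth_bump[OF assms] by (elim exE conjE) (rule that, assumption+, auto)
  have sp: "pws s" by (rule pws_smooth[OF s(1)])
  obtain d where d: "d > 0" "\<And>q. q \<in> K \<Longrightarrow> s q \<ge> d"
  proof (cases "K = {}")
    case False
    obtain q where "q \<in> K" "\<forall>q'\<in>K. s q \<le> s q'"
      using continuous_attains_inf[OF K False continuous_on_subset[OF pws_continuous[OF sp]]] by auto
    then show thesis using that[of "s q"] spos by auto
  qed (use that[of 1] in auto)
  \<comment> \<open>Dividing by a lower bound \<open>d\<close> on \<open>K\<close> and clipping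
    gives the value \<open>1\<close> on \<open>K\<close>. Clipping costs smoothness, but the result
    stays piecewise smooth.\<close>
  define \<eta> where "\<eta> q = min 1 (max 0 ((1/d) * s q))" for q
  have "pws \<eta>" unfolding \<eta>_def[abs_def] by (intro pws_min pws_max pws_const pws_scale sp)
  then have "cpws \<eta>" by (rule cpsI[OF _ K'(1)]) (simp add: \<eta>_def s0)
  moreover have "\<eta> q = 1" if "q \<in> K" for q
    using d(2)[OF that] d(1) by (simp add: \<eta>_def min_def max_def field_simps)
  moreover have "0 \<le> \<eta> q" "\<eta> q \<le> 1" for q by (auto simp: \<eta>_def)
  moreover have "\<eta> q = 0" if "q \<notin> K'" for q using that by (simp add: \<eta>_def s0)
  ultimately show ?thesis using K' by (intro exI[of _ \<eta>] exI[of _ K']) simp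
qed


subsection \<open>Integration by parts\<close>

text \<open>The coefficients of the weighted Laplacian in divergence form.\<close>

definition flux_coeff :: "('a, 'n) chart \<Rightarrow> 'n \<Rightarrow> 'n \<Rightarrow> real ^ 'n \<Rightarrow> real" where
  "flux_coeff c i j y = wdens c y * matrix_inv (g c (ci c y)) $ i $ j"

text \<open>The coordinate expression of the weighted Laplacian. The drift term is hidden in the
  exponential inside \<open>wdens\<close>.\<close>

definition coord_wl :: "('a, 'n) chart \<Rightarrow> ('a \<Rightarrow> real) \<Rightarrow> real ^ 'n \<Rightarrow> real" where
  "coord_wl c u y = div_op (flux_coeff c) (in_chart c u) y / wdens c y"

lemma smooth_flux_coeff: "c \<in> A \<Longrightarrow> smooth_on (V c) (flux_coeff c i j)"
  unfolding flux_coeff_def[abs_def] by (intro smooth_on_mult smooth_wdens smooth_ginv chart(2))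

lemma Ck_flux:
  assumes c: "c \<in> A" and u: "Ck_on (Suc k) (V c) w"
  shows "Ck_on k (V c) (\<lambda>y. \<Sum>j\<in>UNIV. flux_coeff c i j y * pd j w y)"
  by (intro Ck_on_sum Ck_on_mult chart(2)[OF c] smooth_onD[OF smooth_flux_coeff[OF c]] Ck_on_pd u)

lemma coord_wl_continuous:
  assumes c: "c \<in> A" and u: "Ck_fun A 2 u"
  shows "continuous_on (V c) (coord_wl c u)"
proof -
  have "Ck_on (Suc (Suc 0)) (V c) (in_chart c u)" using u c by (simp add: Ck_fun_def numeral_2_eq_2)
  from Ck_on_pd[OF Ck_flux[OF c this]]
  have "Ck_on 0 (V c) (pd i (\<lambda>y. \<Sum>j\<in>UNIV. flux_coeff c i j y * pd j (in_chart c u) y))" for i .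
  then have "continuous_on (V c) (div_op (flux_coeff c) (in_chart c u))"
    unfolding div_op_def[abs_def] by (intro continuous_on_sum) simp
  moreover have "continuous_on (V c) (wdens c)" by (rule smooth_on_imp_continuous_on[OF smooth_wdens[OF c]])
  ultimately show ?thesis
    unfolding coord_wl_def[abs_def] using wdens_pos[OF c] by (intro continuous_on_divide) force+
qed

definition coord_wl_fun :: "('a, 'n) chart \<Rightarrow> ('a \<Rightarrow> real) \<Rightarrow> 'a \<Rightarrow> real" where
  "coord_wl_fun c u p = (if p \<in> fst c then ext c (coord_wl c u) (coord0 c p) else 0)"

lemma coord_wl_fun_eq: "c \<in> A \<Longrightarrow> p \<in> fst c \<Longrightarrow> coord_wl_fun c u p = coord_wl c u (snd c p)"
  by (simp add: coord_wl_fun_def coord0_def ext_def)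

lemma coord_wl_fun_borel: "c \<in> A \<Longrightarrow> Ck_fun A 2 u \<Longrightarrow> coord_wl_fun c u \<in> borel_measurable borel"
proof -
  assume c: "c \<in> A" and u: "Ck_fun A 2 u"
  note [measurable] = ext_borel[OF c coord_wl_continuous[OF c u]] coord0_borel[OF c] borel_V(2)[OF c]
  show ?thesis unfolding coord_wl_fun_def[abs_def] by measurable
qed

lemma diff_at_zero_outside:
  assumes "closed K" "\<And>p. p \<notin> K \<Longrightarrow> f p = 0" "p \<notin> K"
  shows "diff_at f p" "grad_ip f h p = 0"
proof -
  have W: "open (- K)" "p \<in> - K" using assms by auto
  show "diff_at f p"
    by (rule diff_at_cong[OF W _ diff_at_const[of 0]]) (use assms in auto)
  have "grad_ip f h p = grad_ip (\<lambda>_. 0) h p" by (rule grad_ip_cong[OF W]) (use assms in auto)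
  then show "grad_ip f h p = 0" by (simp add: grad_ip_const)
qed

lemma bgrad_ip_zero_outside:
  assumes "closed K" "\<And>p. p \<notin> K \<Longrightarrow> f p = 0" "p \<notin> K" "diff_at h p"
  shows "bgrad_ip f h p = 0"
  using bgrad_ip_eq[OF diff_at_zero_outside(1)[OF assms(1-3)] assms(4)] diff_at_zero_outside(2)[OF assms(1-3)] by simp

text \<open>The coordinate functions \<open>?f * X i\<close>, extended by zero, are locally
  Lipschitz with compact support, so their divergence integrates to zero. The product rule splits
  this divergence into the gradient product and \<open>f\<close> times the operator, both multiplied
  by the density.\<close>

lemma IBP_chart:
  assumes c: "c \<in> A" and f: "loc_lip f" and K: "compact K" "K \<subseteq> fst c" and f0: "\<And>p. p \<notin> K \<Longrightarrow> f p = 0"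
    and u: "Ck_fun A 2 u"
  shows "integrable mu (\<lambda>p. f p * coord_wl_fun c u p)" "integrable mu (bgrad_ip f u)"
    "(\<integral>p. bgrad_ip f u p \<partial>mu) = - (\<integral>p. f p * coord_wl_fun c u p \<partial>mu)"
proof -
  let ?f = "in_chart c f" and ?u = "in_chart c u"
  have u2: "Ck_on (Suc (Suc 0)) (V c) ?u" using u c by (simp add: Ck_fun_def numeral_2_eq_2)
  have udfa: "diff_at u p" for p by (rule C2_diff_at[OF u])
  have uLL: "loc_lip u" by (rule C2_loc_lip[OF u])
  note [measurable] = loc_lip_borel[OF f] loc_lip_borel[OF uLL] coord_wl_fun_borel[OF c u] borel_V(2)[OF c]
  define X where "X i y = (\<Sum>j\<in>UNIV. flux_coeff c i j y * pd j ?u y)" for i y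
  have XC: "Ck_on (Suc 0) (V c) (X i)" for i unfolding X_def[abs_def] by (rule Ck_flux[OF c u2])
  define F where "F i y = (if y \<in> V c then ?f y * X i y else 0)" for i y
  define K2 where "K2 = snd c ` K"
  have K2: "compact K2" "K2 \<subseteq> V c"
    unfolding K2_def using K by (auto intro!: compact_continuous_image continuous_on_subset[OF chart(3)[OF c]])
  have f2: "?f y = 0" if "y \<in> V c" "y \<notin> K2" for y
  proof -
    have "ci c y \<notin> K" using that chart(6)[OF c that(1)] unfolding K2_def by (metis image_eqI)
    then show ?thesis using f0 by (simp add: in_chart_def)
  qed
  have F0: "F i y = 0" if "y \<notin> K2" for i y using f2 that by (simp add: F_def)
  have cl2: "open (- K2)" using compact_imp_closed[OF K2(1)] by auto
  have Flip: "lip_at (F i) y" for i y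
  proof (cases "y \<in> V c")
    case True
    have 1: "lip_at ?f y" using f c True unfolding loc_lip_def by blast
    have 2: "lip_at (X i) y" by (rule lip_at_C1[OF chart(2)[OF c] True XC])
    show ?thesis by (rule lip_at_cong[OF lip_at_mult[OF 1 2] chart(2)[OF c] True]) (simp add: F_def)
  next
    case False
    then have "y \<in> - K2" using K2 by auto
    then show ?thesis by (intro lip_at_cong[OF lip_at_const[of 0] cl2]) (use F0 in auto)
  qed
  have Xdiff: "X i differentiable (at y)" if "y \<in> V c" for i y using Ck_on_SucE[OF XC that] by (rule differentiableI)
  have fdiff: "AE y in lborel. y \<in> V c \<longrightarrow> diff_at f (ci c y)"
    using loc_lip_AE[OF f] c unfolding AE_mu_charts by blast
  have at: "?f differentiable (at y)" if "y \<in> V c" "diff_at f (ci c y)" for y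
    using dfaD[OF that(2) c chart(7)[OF c that(1)]] chart(6)[OF c that(1)] by simp
  have Fd: "(F i has_derivative D) (at y) \<longleftrightarrow> ((\<lambda>y. ?f y * X i y) has_derivative D) (at y)" if "y \<in> V c" for i y D
    using has_derivative_transform_within_open[OF _ chart(2)[OF c] that, of "F i" D UNIV "\<lambda>y. ?f y * X i y"]
      has_derivative_transform_within_open[OF _ chart(2)[OF c] that, of "\<lambda>y. ?f y * X i y" D UNIV "F i"]
    by (auto simp: F_def)
  have prodd: "(\<lambda>y. ?f y * X i y) differentiable (at y)" if "y \<in> V c" "diff_at f (ci c y)" for i y
    using at[OF that] Xdiff[OF that(1)] by simp
  have Fzero: "(F i has_derivative (\<lambda>_. 0)) (at y)" if "y \<notin> V c" for i y
    by (rule has_derivative_transform_within_open[OF has_derivative_const cl2, of y 0])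
      (use that K2 F0 in auto)
  have Fdiff: "AE y in lborel. F i differentiable (at y)" for i
    using fdiff
  proof eventually_elim
    case (elim y)
    show ?case
    proof (cases "y \<in> V c")
      case True
      then show ?thesis using prodd[OF True] elim Fd[OF True] unfolding differentiable_def by blast
    next
      case False
      then show ?thesis using Fzero differentiableI by blast
    qed
  qed
  note zero = integral_dird_eq_0[OF Flip K2(1) F0 Fdiff]
  define S where "S y = (\<Sum>i\<in>UNIV. dird (F i) (axis i 1) y)" for y
  have Sint: "integrable lborel S" "(\<integral>y. S y \<partial>lborel) = 0"
    unfolding S_def using zero by auto
  \<comment> \<open>\<open>H\<close> is the divergence divided by the density, as a function on the
    manifold. Only this sum is controlled at first; its second part is integrable by continuity, and
    the gradient product is their difference.\<close>
  define H where "H p = (if p \<in> fst c then bgrad_ip f u p + f p * coord_wl_fun c u p else 0)" for p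
  have Hb [measurable]: "H \<in> borel_measurable borel" unfolding H_def[abs_def] by measurable
  have SH: "AE y in lborel. ext c (\<lambda>y. wdens c y * H (ci c y)) y = S y"
    using fdiff
  proof eventually_elim
    case (elim y)
    show ?case
    proof (cases "y \<in> V c")
      case False
      then have "dird (F i) (axis i 1) y = 0" for i using dird_eq[OF Fzero[OF False, of i]] by simp
      then show ?thesis using False by (simp add: ext_def S_def)
    next
      case True
      let ?p = "ci c y"
      have p: "?p \<in> fst c" "snd c ?p = y" using chart(6,7)[OF c True] by auto
      have fp: "diff_at f ?p" using elim True by simp
      have dF: "dird (F i) (axis i 1) y = pd i ?f y * X i y + ?f y * pd i (X i) y" for i
      proof -
        obtain D where D: "((\<lambda>y. ?f y * X i y) has_derivative D) (at y)"
          using prodd[OF True fp] by (auto simp: differentiable_def)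
        then have "dird (F i) (axis i 1) y = D (axis i 1)" using Fd[OF True] dird_eq by blast
        also have "\<dots> = pd i (\<lambda>y. ?f y * X i y) y" using pd_eq[OF D] by simp
        finally show ?thesis using pd_mult[OF at[OF True fp] Xdiff[OF True]] by simp
      qed
      have g1: "(\<Sum>i\<in>UNIV. pd i ?f y * X i y) = wdens c y * bgrad_ip f u ?p"
      proof -
        have "wdens c y * bgrad_ip f u ?p = wdens c y * cgrad_ip c f u ?p"
          using bgrad_ip_eq[OF fp udfa] grad_ip_chart[OF c p(1) fp udfa] by simp
        also have "\<dots> = (\<Sum>i\<in>UNIV. pd i ?f y * X i y)"
          by (simp add: cgrad_ip_def inner_vec_def matrix_vector_mult_def cgrad_def partial_deriv_pd p X_def flux_coeff_def sum_distrib_left mult_ac)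
        finally show ?thesis by simp
      qed
      have g2: "(\<Sum>i\<in>UNIV. ?f y * pd i (X i) y) = wdens c y * (f ?p * coord_wl_fun c u ?p)"
        using wdens_pos[OF c True] p
        by (simp add: coord_wl_fun_eq[OF c] coord_wl_def div_op_def X_def[abs_def] in_chart_def sum_distrib_left[symmetric])
      show ?thesis
        unfolding S_def dF sum.distrib g1 g2 using True p by (simp add: ext_def H_def distrib_left)
    qed
  qed
  have cb: "ext c (\<lambda>y. wdens c y * H (ci c y)) \<in> borel_measurable borel"
  proof -
    note [measurable] = ext_wdens_borel[OF c] ci'_borel[OF c]
    have "ext c (\<lambda>y. wdens c y * H (ci c y)) = (\<lambda>y. ext c (wdens c) y * H (ci' c y))" by (auto simp: ext_def ci'_def fun_eq_iff)
    then show ?thesis by simp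
  qed
  have "integrable lborel (ext c (\<lambda>y. wdens c y * H (ci c y)))"
    using Sint(1) by (rule integrable_cong_AE_imp) (use cb SH in \<open>auto elim: eventually_mono\<close>)
  then have Hint: "integrable mu H"
    using int_chart(1)[OF c Hb] by (simp add: H_def)
  have "(\<integral>p. H p \<partial>mu) = (\<integral>y. ext c (\<lambda>y. wdens c y * H (ci c y)) y \<partial>lborel)"
    by (rule int_chart(2)[OF c Hb]) (simp add: H_def)
  also have "\<dots> = (\<integral>y. S y \<partial>lborel)"
    by (rule integral_cong_AE) (use cb SH borel_measurable_integrable[OF Sint(1)] in auto)
  finally have H0: "(\<integral>p. H p \<partial>mu) = 0" using Sint(2) by simp
  have fz: "f p = 0" if "p \<notin> fst c" for p using that K f0 by auto
  have HG: "H p = bgrad_ip f u p + f p * coord_wl_fun c u p" for p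
  proof (cases "p \<in> fst c")
    case False
    then have "p \<notin> K" using K by auto
    then show ?thesis using False fz bgrad_ip_zero_outside[OF compact_imp_closed[OF K(1)] f0 _ udfa] by (simp add: H_def)
  qed (simp add: H_def)
  show i1: "integrable mu (\<lambda>p. f p * coord_wl_fun c u p)"
  proof (subst int_chart(1)[OF c])
    show "f p * coord_wl_fun c u p = 0" if "p \<notin> fst c" for p using fz[OF that] by simp
    have "continuous_on K2 (\<lambda>y. wdens c y * (?f y * coord_wl c u y))"
      by (intro continuous_intros continuous_on_subset[OF _ K2(2)] smooth_on_imp_continuous_on[OF smooth_wdens[OF c]]
          continuous_in_chart[OF loc_lip_continuous[OF f] c] coord_wl_continuous[OF c u])
    then have "integrable lborel (\<lambda>y. indicator K2 y *\<^sub>R (wdens c y * (?f y * coord_wl c u y)))"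
      by (rule borel_integrable_compact[OF K2(1)])
    moreover have "(\<lambda>y. indicator K2 y *\<^sub>R (wdens c y * (?f y * coord_wl c u y))) = ext c (\<lambda>y. wdens c y * (f (ci c y) * coord_wl_fun c u (ci c y)))"
    proof
      fix y
      show "indicator K2 y *\<^sub>R (wdens c y * (?f y * coord_wl c u y)) = ext c (\<lambda>y. wdens c y * (f (ci c y) * coord_wl_fun c u (ci c y))) y"
      proof (cases "y \<in> V c")
        case True
        then show ?thesis
          using f2[OF True] coord_wl_fun_eq[OF c chart(7)[OF c True], of u] chart(6)[OF c True]
          by (auto simp: ext_def indicator_def in_chart_def)
      next
        case False
        then show ?thesis using K2 by (auto simp: ext_def indicator_def)
      qed
    qed
    ultimately show "integrable lborel (ext c (\<lambda>y. wdens c y * (f (ci c y) * coord_wl_fun c u (ci c y))))" by simp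
  qed measurable
  have "bgrad_ip f u = (\<lambda>p. H p - f p * coord_wl_fun c u p)" using HG by auto
  then show "integrable mu (bgrad_ip f u)" "(\<integral>p. bgrad_ip f u p \<partial>mu) = - (\<integral>p. f p * coord_wl_fun c u p \<partial>mu)"
    using Hint i1 H0 by simp_all
qed

subsection \<open>The weighted Laplacian\<close>

abbreviation wl :: "('a \<Rightarrow> real) \<Rightarrow> 'a \<Rightarrow> real" where "wl \<equiv> weighted_laplacian A g \<phi>"

text \<open>Differentiating the factor \<open>exp \<phi>\<close> of the density produces the inner
  product with the gradient of \<open>\<phi>\<close>; what remains is the Laplacian in divergence
  form in the chart selected at \<open>p\<close>.\<close>

lemma wl_coord_wl:
  assumes u: "Ck_fun A 2 u"
  shows "wl u p = coord_wl (chart_at A p) u (snd (chart_at A p) p)"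
proof -
  define c where "c = chart_at A p"
  have c: "c \<in> A" "p \<in> fst c" unfolding c_def by (rule chart_at)+
  let ?u = "in_chart c u" and ?y = "snd c p"
  have y: "?y \<in> V c" using c by simp
  have u2: "Ck_on (Suc (Suc 0)) (V c) ?u" using u c by (simp add: Ck_fun_def numeral_2_eq_2)
  define Y where "Y i y = (\<Sum>j\<in>UNIV. matrix_inv (g c (ci c y)) $ i $ j * pd j ?u y)" for i y
  have YC: "Ck_on (Suc 0) (V c) (Y i)" for i
    unfolding Y_def[abs_def]
    by (intro Ck_on_sum Ck_on_mult chart(2)[OF c(1)] smooth_onD[OF smooth_ginv[OF c(1)]] Ck_on_pd u2)
  have Yd: "Y i differentiable (at ?y)" for i using Ck_on_SucE[OF YC y] by (rule differentiableI)
  have vdd: "vdens c differentiable (at ?y)"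
    using smooth_on_has_derivative[OF smooth_vdens[OF c(1)] y] by (rule differentiableI)
  have phd: "in_chart c \<phi> differentiable (at ?y)"
    using smooth_on_has_derivative[OF smooth_phi[OF c(1)] y] by (rule differentiableI)
  have ed: "((\<lambda>y. exp (in_chart c \<phi> y)) has_derivative (\<lambda>v. exp (in_chart c \<phi> ?y) * frechet_derivative (in_chart c \<phi>) (at ?y) v)) (at ?y)"
    using has_derivative_exp[OF phd[unfolded frechet_derivative_works]] by (simp add: mult.commute)
  have pe: "pd i (\<lambda>y. exp (in_chart c \<phi> y)) ?y = exp (in_chart c \<phi> ?y) * pd i (in_chart c \<phi>) ?y" for i
    using pd_eq[OF ed, of i] by (simp add: pd_def)
  have vY: "(\<lambda>y. vdens c y * Y i y) differentiable (at ?y)" for i using vdd Yd by simp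
  have lap: "laplacian A g u p = (\<Sum>i\<in>UNIV. pd i (\<lambda>y. vdens c y * Y i y) ?y) / vdens c ?y"
  proof -
    have "pd i (in_chart c (\<lambda>q. volume_density g c q * gradient g u c q $ i)) ?y = pd i (\<lambda>y. vdens c y * Y i y) ?y" for i
    proof (rule pd_cong_open[OF chart(2)[OF c(1)] y])
      fix z assume z: "z \<in> V c"
      show "in_chart c (\<lambda>q. volume_density g c q * gradient g u c q $ i) z = vdens c z * Y i z"
        using chart(6)[OF c(1) z]
        by (simp add: in_chart_def vdens_eq gradient_def Y_def matrix_vector_mult_def partial_deriv_def pd_def)
    qed
    then show ?thesis
      unfolding laplacian_def divergence_def Let_def c_def[symmetric] partial_deriv_pd
      by (simp add: vdens_eq chart(5)[OF c])
  qed
  have gr: "metric_inner A g (gradient g \<phi>) (gradient g u) p = (\<Sum>i\<in>UNIV. pd i (in_chart c \<phi>) ?y * Y i ?y)"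
  proof -
    have "metric_inner A g (gradient g \<phi>) (gradient g u) p = cgrad_ip c \<phi> u p"
      using grad_ip_cgrad_ip[of \<phi> u p] by (simp add: grad_ip_def c_def)
    also have "\<dots> = (\<Sum>i\<in>UNIV. pd i (in_chart c \<phi>) ?y * Y i ?y)"
      by (simp add: cgrad_ip_def inner_vec_def matrix_vector_mult_def cgrad_def partial_deriv_pd Y_def chart(5)[OF c])
    finally show ?thesis .
  qed
  have fl: "pd i (\<lambda>y. \<Sum>j\<in>UNIV. flux_coeff c i j y * pd j ?u y) ?y
      = exp (in_chart c \<phi> ?y) * (pd i (in_chart c \<phi>) ?y * (vdens c ?y * Y i ?y) + pd i (\<lambda>y. vdens c y * Y i y) ?y)" for i
  proof -
    have "(\<lambda>y. \<Sum>j\<in>UNIV. flux_coeff c i j y * pd j ?u y) = (\<lambda>y. exp (in_chart c \<phi> y) * (vdens c y * Y i y))"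
      by (simp add: flux_coeff_def wdens_def Y_def sum_distrib_left mult_ac)
    then show ?thesis
      using pd_mult[OF differentiableI[OF ed] vY, of i i] by (simp add: pe algebra_simps)
  qed
  have vpos: "vdens c ?y > 0" by (rule vdens_pos[OF c(1) y])
  have "coord_wl c u ?y = (\<Sum>i\<in>UNIV. exp (in_chart c \<phi> ?y) * (pd i (in_chart c \<phi>) ?y * (vdens c ?y * Y i ?y) + pd i (\<lambda>y. vdens c y * Y i y) ?y)) / (vdens c ?y * exp (in_chart c \<phi> ?y))"
    unfolding coord_wl_def div_op_def fl by (simp add: wdens_def)
  also have "\<dots> = (\<Sum>i\<in>UNIV. pd i (in_chart c \<phi>) ?y * (vdens c ?y * Y i ?y) + pd i (\<lambda>y. vdens c y * Y i y) ?y) / vdens c ?y"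
    by (simp flip: sum_distrib_left)
  also have "\<dots> = (\<Sum>i\<in>UNIV. pd i (in_chart c \<phi>) ?y * Y i ?y) + (\<Sum>i\<in>UNIV. pd i (\<lambda>y. vdens c y * Y i y) ?y) / vdens c ?y"
    using vpos by (simp add: sum.distrib add_divide_distrib sum_divide_distrib)
  also have "\<dots> = wl u p" unfolding weighted_laplacian_def lap gr by simp
  finally show ?thesis by (simp add: c_def)
qed

text \<open>Both sides satisfy the same integration by parts formula, whose gradient term is already known
  not to depend on the chart.\<close>

lemma coord_wl_invariant:
  assumes c: "c \<in> A" "p \<in> fst c" and c': "c' \<in> A" "p \<in> fst c'" and u: "Ck_fun A 2 u"
  shows "coord_wl c u (snd c p) = coord_wl c' u (snd c' p)"
proof (rule ccontr)
  assume ne: "coord_wl c u (snd c p) \<noteq> coord_wl c' u (snd c' p)"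
  define d where "d q = coord_wl c u (snd c q) - coord_wl c' u (snd c' q)" for q
  \<comment> \<open>The sign makes \<open>s * d\<close> positive near \<open>p\<close>, so a bump
    there would have a positive integral against it.\<close>
  define s where "s = sgn (d p)"
  define U where "U = fst c \<inter> fst c'"
  have U: "open U" "p \<in> U" unfolding U_def using c c' chart(1)[OF c(1)] chart(1)[OF c'(1)] by auto
  have "continuous_on U d"
    unfolding d_def U_def
    by (intro continuous_intros continuous_on_compose2[OF coord_wl_continuous[OF _ u]] continuous_on_subset[OF chart(3)])
      (use c c' in auto)
  then have dc: "continuous_on U (\<lambda>q. s * d q)" by (intro continuous_intros)
  define W where "W = U \<inter> (\<lambda>q. s * d q) -` {0<..}"
  have W: "open W" unfolding W_def by (rule continuous_open_preimage[OF dc U(1)]) simp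
  have "p \<in> W" using U ne by (auto simp: W_def s_def d_def sgn_real_def)
  from bump[OF W this c] obtain f K where f: "smooth_fun_on A UNIV f" "\<And>q. 0 \<le> f q" "f p > 0"
    "compact K" "K \<subseteq> W \<inter> fst c" "\<And>q. q \<notin> K \<Longrightarrow> f q = 0" by blast
  have KU: "K \<subseteq> fst c" "K \<subseteq> fst c'" using f(5) by (auto simp: W_def U_def)
  have fLL: "loc_lip f" by (intro pws_loc_lip pws_smooth f)
  note i1 = IBP_chart[OF c(1) fLL f(4) KU(1) f(6) u] and i2 = IBP_chart[OF c'(1) fLL f(4) KU(2) f(6) u]
  have eq: "s * (f q * coord_wl_fun c u q) - s * (f q * coord_wl_fun c' u q) = f q * (s * d q)" for q
  proof (cases "q \<in> K")
    case True
    then have "q \<in> fst c" "q \<in> fst c'" using KU by auto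
    then show ?thesis using c(1) c'(1) by (simp add: coord_wl_fun_eq d_def algebra_simps)
  qed (simp add: f(6))
  have int: "integrable mu (\<lambda>q. f q * (s * d q))"
    unfolding eq[symmetric] using i1(1) i2(1) by simp
  have "(\<integral>q. f q * (s * d q) \<partial>mu) = s * (\<integral>q. f q * coord_wl_fun c u q \<partial>mu) - s * (\<integral>q. f q * coord_wl_fun c' u q \<partial>mu)"
    unfolding eq[symmetric] using i1(1) i2(1) by simp
  also have "\<dots> = 0" using i1(3) i2(3) by simp
  finally have z: "(\<integral>q. f q * (s * d q) \<partial>mu) = 0" .
  have nn: "f q * (s * d q) \<ge> 0" for q
  proof (cases "q \<in> K")
    case True
    then have "s * d q > 0" using f(5) by (auto simp: W_def)
    then show ?thesis using f(2)[of q] by simp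
  qed (simp add: f(6))
  have "AE q in mu. f q * (s * d q) = 0"
    using integral_nonneg_eq_0_iff_AE[OF int] z nn by simp
  then have AE: "AE q in mu. q \<in> W \<longrightarrow> f q = 0"
    by eventually_elim (auto simp: W_def)
  have "f p = 0"
    by (rule continuous_AE_eq[OF W _ _ AE \<open>p \<in> W\<close>])
      (use pws_continuous[OF pws_smooth[OF f(1)]] in \<open>auto intro: continuous_on_subset\<close>)
  then show False using f(3) by simp
qed

lemma wl_chart: "c \<in> A \<Longrightarrow> p \<in> fst c \<Longrightarrow> Ck_fun A 2 u \<Longrightarrow> wl u p = coord_wl c u (snd c p)"
  unfolding wl_coord_wl using coord_wl_invariant chart_at by blast

lemma wl_continuous:
  assumes u: "Ck_fun A 2 u" shows "continuous_on UNIV (wl u)"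
proof (rule continuous_chartsI)
  fix c assume c: "c \<in> A"
  show "continuous_on (V c) (in_chart c (wl u))"
    by (rule continuous_on_eq[OF coord_wl_continuous[OF c u]])
      (use wl_chart[OF c _ u] chart(6,7)[OF c] in \<open>auto simp: in_chart_def\<close>)
qed

definition IBP :: "('a \<Rightarrow> real) \<Rightarrow> ('a \<Rightarrow> real) \<Rightarrow> bool" where
  "IBP u f \<longleftrightarrow> integrable mu (\<lambda>p. f p * wl u p) \<and> integrable mu (bgrad_ip f u) \<and>
    (\<integral>p. bgrad_ip f u p \<partial>mu) = - (\<integral>p. f p * wl u p \<partial>mu)"

lemma IBP_in_chart:
  assumes c: "c \<in> A" and f: "loc_lip f" and K: "compact K" "K \<subseteq> fst c" and f0: "\<And>p. p \<notin> K \<Longrightarrow> f p = 0"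
    and u: "Ck_fun A 2 u"
  shows "IBP u f"
proof -
  have "f p * coord_wl_fun c u p = f p * wl u p" for p
    using K f0[of p] wl_chart[OF c _ u, of p] coord_wl_fun_eq[OF c, of p u] by (cases "p \<in> K") auto
  then have "(\<lambda>p. f p * coord_wl_fun c u p) = (\<lambda>p. f p * wl u p)" by (rule ext)
  then show ?thesis using IBP_chart[OF assms] unfolding IBP_def by simp
qed

lemma IBP_add:
  assumes f: "loc_lip f" and h: "loc_lip h" and u: "Ck_fun A 2 u" and "IBP u f" "IBP u h"
  shows "IBP u (\<lambda>p. f p + h p)"
proof -
  have udfa: "diff_at u p" for p by (rule C2_diff_at[OF u])
  have uLL: "loc_lip u" by (rule C2_loc_lip[OF u])
  note [measurable] = loc_lip_borel[OF f] loc_lip_borel[OF uLL] loc_lip_borel[OF h]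
  have AE: "AE p in mu. bgrad_ip f u p + bgrad_ip h u p = bgrad_ip (\<lambda>p. f p + h p) u p"
    using loc_lip_AE[OF f] loc_lip_AE[OF h]
    by eventually_elim (simp add: bgrad_ip_eq udfa diff_at_add grad_ip_add)
  have i: "integrable mu (bgrad_ip f u)" "integrable mu (bgrad_ip h u)" using assms by (auto simp: IBP_def)
  have "integrable mu (bgrad_ip (\<lambda>p. f p + h p) u)"
    by (rule integrable_cong_AE_imp[OF Bochner_Integration.integrable_add[OF i] _ AE]) simp
  moreover have "(\<integral>p. bgrad_ip (\<lambda>p. f p + h p) u p \<partial>mu) = (\<integral>p. bgrad_ip f u p + bgrad_ip h u p \<partial>mu)"
    by (rule integral_cong_AE) (use AE in \<open>auto elim: eventually_mono\<close>)
  ultimately show ?thesis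
    using assms(4,5) unfolding IBP_def by (simp add: distrib_right)
qed

text \<open>Cutoffs supported in single charts are peeled off one at a time by
  \<open>f = f * \<eta> + f * (1 - \<eta>)\<close>. The remainder vanishes where
  \<open>\<eta>\<close> equals \<open>1\<close>, so nothing is left once every point of the support
  has met its cutoff.\<close>

lemma IBP_compact:
  assumes f: "loc_lip f" and K: "compact K" and f0: "\<And>p. p \<notin> K \<Longrightarrow> f p = 0" and u: "Ck_fun A 2 u"
  shows "IBP u f"
proof -
  define good where "good \<eta> \<longleftrightarrow> (\<exists>K' c. cpws \<eta> \<and> compact K' \<and> c \<in> A \<and> K' \<subseteq> fst c \<and> (\<forall>q. q \<notin> K' \<longrightarrow> \<eta> q = 0))" for \<eta>
  have ind: "IBP u f"
    if "finite T" "\<forall>\<eta>\<in>T. good \<eta>" "loc_lip f" "\<And>p. p \<notin> K \<Longrightarrow> f p = 0" "\<And>p. f p \<noteq> 0 \<Longrightarrow> \<exists>\<eta>\<in>T. \<eta> p = 1" for T f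
    using that
  proof (induction T arbitrary: f rule: finite_induct)
    case empty
    then have "f = (\<lambda>p. 0)" by auto
    moreover have "IBP u (\<lambda>p. 0)"
      by (rule IBP_in_chart[OF cseq(1)[of 0] loc_lip_const _ _ _ u, of "{}"]) auto
    ultimately show ?case by simp
  next
    case (insert \<eta> T)
    obtain K' c where \<eta>: "cpws \<eta>" "compact K'" "c \<in> A" "K' \<subseteq> fst c" "\<And>q. q \<notin> K' \<Longrightarrow> \<eta> q = 0"
    proof -
      have "good \<eta>" using insert.prems(1) by simp
      then show ?thesis unfolding good_def by (elim exE conjE) (rule that, auto)
    qed
    define f1 where "f1 p = f p * \<eta> p" for p
    define f2 where "f2 p = f p * (1 + (-1) * \<eta> p)" for p
    have \<eta>L: "loc_lip \<eta>" by (rule cpws_loc_lip[OF \<eta>(1)])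
    have f1: "loc_lip f1" unfolding f1_def by (intro loc_lip_mult insert.prems \<eta>L)
    have f2: "loc_lip f2" unfolding f2_def by (intro loc_lip_mult loc_lip_add loc_lip_const insert.prems \<eta>L)
    have "IBP u f1"
      by (rule IBP_in_chart[OF \<eta>(3) f1 \<eta>(2,4) _ u]) (simp add: f1_def \<eta>(5))
    moreover have "IBP u f2"
    proof (rule insert.IH[OF _ f2])
      show "\<forall>\<eta>\<in>T. good \<eta>" using insert.prems by auto
      show "f2 p = 0" if "p \<notin> K" for p using insert.prems(3)[OF that] by (simp add: f2_def)
      show "\<exists>\<eta>\<in>T. \<eta> p = 1" if "f2 p \<noteq> 0" for p
      proof -
        have "f p \<noteq> 0" "\<eta> p \<noteq> 1" using that by (auto simp: f2_def)
        then show ?thesis using insert.prems(4)[of p] by auto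
      qed
    qed
    moreover have "f = (\<lambda>p. f1 p + f2 p)" by (auto simp: f1_def f2_def algebra_simps)
    ultimately show ?case using IBP_add[OF f1 f2 u] by simp
  qed
  \<comment> \<open>A cutoff that is \<open>1\<close> on the compact support of a bump at
    \<open>p\<close> is \<open>1\<close> on a neighbourhood of \<open>p\<close>, which the covering
    argument needs.\<close>
  have "\<exists>\<eta> W. open W \<and> p \<in> W \<and> good \<eta> \<and> (\<forall>q\<in>W. \<eta> q = 1)" for p
  proof -
    define c where "c = chart_at A p"
    have c: "c \<in> A" "p \<in> fst c" unfolding c_def by (rule chart_at)+
    obtain b C where b: "smooth_fun_on A UNIV b" "\<And>q. 0 \<le> b q" "b p > 0"
       "compact C" "C \<subseteq> fst c \<inter> fst c" "\<And>q. q \<notin> C \<Longrightarrow> b q = 0" 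
      using bump[OF chart(1)[OF c(1)] c(2) c] by (elim exE conjE) (rule that, assumption+, auto)
    have "continuous_on UNIV b" by (rule pws_continuous[OF pws_smooth[OF b(1)]])
    then have W: "open (b -` {b p / 2 <..})" by (rule open_vimage[OF open_greaterThan])
    have "C \<subseteq> fst c" using b(5) by simp
    from cutoff[OF b(4) chart(1)[OF c(1)] this] obtain \<eta> K' where e: "cpws \<eta>" "\<And>q. q \<in> C \<Longrightarrow> \<eta> q = 1"
      "compact K'" "K' \<subseteq> fst c" "\<And>q. q \<notin> K' \<Longrightarrow> \<eta> q = 0"
      by (elim exE conjE) (rule that, assumption, auto)
    have "good \<eta>" unfolding good_def by (intro exI conjI allI impI; (rule e c)?) assumption
    moreover have "\<eta> q = 1" if "q \<in> b -` {b p / 2 <..}" for q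
      using that b(3) b(6)[of q] by (intro e(2)) auto
    ultimately show ?thesis using W b(3) by (intro exI[of _ \<eta>] exI[of _ "b -` {b p / 2 <..}"]) auto
  qed
  then have "\<forall>p. \<exists>z. open (snd z) \<and> p \<in> snd z \<and> good (fst z) \<and> (\<forall>q\<in>snd z. fst z q = 1)" by (metis fst_conv snd_conv)
  from choice[OF this] obtain z where z: "\<And>p. open (snd (z p)) \<and> p \<in> snd (z p) \<and> good (fst (z p)) \<and> (\<forall>q\<in>snd (z p). fst (z p) q = 1)" 
    by blast
  have cov: "K \<subseteq> (\<Union>p\<in>K. snd (z p))" using z by auto
  obtain T where T: "T \<subseteq> K" "finite T" "K \<subseteq> (\<Union>p\<in>T. snd (z p))"
    by (rule compactE_image[OF K _ cov]) (use z in auto)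
  show ?thesis
  proof (rule ind[of "(\<lambda>p. fst (z p)) ` T" f])
    show "\<exists>\<eta>\<in>(\<lambda>p. fst (z p)) ` T. \<eta> p = 1" if "f p \<noteq> 0" for p
    proof -
      have "p \<in> K" using f0 that by auto
      then obtain q where "q \<in> T" "p \<in> snd (z q)" using T(3) by auto
      then show ?thesis using z[of q] by auto
    qed
  qed (use T(2) z f f0 in auto)
qed


subsection \<open>Finite capacity implies parabolicity\<close>

text \<open>\<open>weighted_energy\<close> is built on \<open>grad_ip\<close>, whose values are
  unspecified where \<open>\<psi>\<close> is not differentiable. These points form a null set, so
  the Borel version has the same integral.\<close>

lemma energy_eq:
  assumes \<psi>: "loc_lip \<psi>"
  shows "weighted_energy A g \<phi> \<psi> = (\<integral>\<^sup>+p. ennreal (bgrad_ip \<psi> \<psi> p) \<partial>mu)"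
proof -
  note [measurable] = loc_lip_borel[OF \<psi>]
  have "AE p in vol. diff_at \<psi> p"
    using loc_lip_AE[OF \<psi>] unfolding mu_def by (subst (asm) AE_density) auto
  then have "AE p in vol. ennreal (grad_ip \<psi> \<psi> p * exp (\<phi> p)) = ennreal (exp (\<phi> p)) * ennreal (bgrad_ip \<psi> \<psi> p)"
    by eventually_elim (simp add: bgrad_ip_eq grad_ip_nonneg ennreal_mult mult.commute)
  then show ?thesis
    unfolding weighted_energy_def grad_ip_def[symmetric] by (subst nn_mu) (auto intro: nn_integral_cong_AE)
qed

lemma loc_lip_inverse:
  assumes u: "loc_lip u" and u0: "\<And>p. u p \<ge> 0"
  shows "loc_lip (\<lambda>p. 1 / (1 + u p))"
    and "diff_at u p \<Longrightarrow> diff_at (\<lambda>p. 1 / (1 + u p)) p"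
proof -
  have lip: "lip_at (in_chart c (\<lambda>p. 1 / (1 + u p))) y" if l: "lip_at (in_chart c u) y" for c :: "('a, 'n) chart" and y
  proof -
    obtain r L where r: "r > 0" and L: "\<And>y' z. y' \<in> ball y r \<Longrightarrow> z \<in> ball y r \<Longrightarrow> \<bar>in_chart c u y' - in_chart c u z\<bar> \<le> L * dist y' z"
      using l unfolding lip_at_def by blast
    have *: "\<bar>1 / (1 + a) - 1 / (1 + b)\<bar> \<le> \<bar>a - b\<bar>" if "a \<ge> 0" "b \<ge> 0" for a b :: real
    proof -
      have "1 / (1 + a) - 1 / (1 + b) = (b - a) / ((1 + a) * (1 + b))"
        using that by (simp add: field_simps)
      moreover have "(1 + a) * (1 + b) \<ge> 1"
        using that by (simp add: algebra_simps)
      ultimately show ?thesis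
        by (simp add: divide_le_eq abs_minus_commute mult_le_cancel_left1 mult_left_mono abs_divide)
    qed
    have "\<bar>in_chart c (\<lambda>p. 1 / (1 + u p)) y' - in_chart c (\<lambda>p. 1 / (1 + u p)) z\<bar> \<le> L * dist y' z"
      if "y' \<in> ball y r" "z \<in> ball y r" for y' z
      using L[OF that] *[of "in_chart c u y'" "in_chart c u z"] u0 by (simp add: in_chart_def)
    then show ?thesis unfolding lip_at_def using r by blast
  qed
  have diff_at: "diff_at (\<lambda>p. 1 / (1 + u p)) p" if d: "diff_at u p" for p
    unfolding diff_at_def
  proof (intro ballI impI)
    fix c assume c: "c \<in> A" "p \<in> fst c"
    have "in_chart c u differentiable (at (snd c p))" by (rule dfaD[OF d c])
    moreover have "1 + in_chart c u (snd c p) \<noteq> 0"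
      using u0[of "ci c (snd c p)"] by (simp add: in_chart_def)
    ultimately have "(\<lambda>y. 1 / (1 + in_chart c u y)) differentiable (at (snd c p))"
      by (intro differentiable_divide differentiable_add differentiable_const) auto
    then show "in_chart c (\<lambda>p. 1 / (1 + u p)) differentiable (at (snd c p))"
      by (simp add: in_chart_def comp_def)
  qed
  show "loc_lip (\<lambda>p. 1 / (1 + u p))" by (rule loc_lip_comb[OF u u]) (auto intro: lip diff_at)
  show "diff_at (\<lambda>p. 1 / (1 + u p)) p" if "diff_at u p" using diff_at[OF that] .
qed

text \<open>Applying the product rule to the constant function
  \<open>(1 / (1 + u)) * (1 + u)\<close> determines the gradient of the reciprocal.\<close>

lemma grad_ip_inverse:
  assumes u: "diff_at u p" and u0: "\<And>p. u p \<ge> 0" and h: "diff_at (\<lambda>p. 1 / (1 + u p)) p"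
  shows "grad_ip (\<lambda>p. 1 / (1 + u p)) k p = - (1 / (1 + u p))\<^sup>2 * grad_ip u k p"
proof -
  let ?h = "\<lambda>p. 1 / (1 + u p)"
  have pos: "1 + u q > 0" for q using u0[of q] by linarith
  have d: "diff_at (\<lambda>p. 1 + u p) p" by (intro diff_at_add diff_at_const u)
  have "(\<lambda>p. ?h p * (1 + u p)) = (\<lambda>p. 1)" using pos by (auto simp: less_le)
  then have "0 = grad_ip (\<lambda>p. ?h p * (1 + u p)) k p" by (simp add: grad_ip_const)
  also have "\<dots> = ?h p * grad_ip (\<lambda>p. 1 + u p) k p + (1 + u p) * grad_ip ?h k p"
    by (rule grad_ip_mult[OF h d])
  also have "grad_ip (\<lambda>p. 1 + u p) k p = grad_ip u k p"
    using grad_ip_add[OF diff_at_const u, of 1 k] by (simp add: grad_ip_const)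
  finally have "0 = 1 / (1 + u p) * grad_ip u k p + (1 + u p) * grad_ip ?h k p" .
  moreover have "X = - (1 / a)\<^sup>2 * G" if "0 = 1 / a * G + a * X" "a > 0" for a X G :: real
  proof -
    have "X = (a * X) / a" using that(2) by simp
    also have "a * X = - (1 / a * G)" using that(1) by linarith
    finally show ?thesis by (simp add: power2_eq_square)
  qed
  ultimately show ?thesis using pos[of p] by blast
qed

text \<open>The test function is \<open>\<psi>\<^sup>2 / (1 + u)\<close>; the gradient of \<open>\<psi>\<close> vanishes where \<open>\<psi>\<close> attains its
  maximum \<open>1\<close>, so the last term only sees the complement of that set.\<close>

lemma test_inequality:
  assumes u: "Ck_fun A 2 u" and u0: "\<And>p. u p \<ge> 0" and wl: "\<And>p. wl u p \<le> 0"
    and \<psi>: "cpws \<psi>" "\<And>p. 0 \<le> \<psi> p" "\<And>p. \<psi> p \<le> 1"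
  defines "q \<equiv> \<lambda>p. (1 / (1 + u p))\<^sup>2 * bgrad_ip u u p"
  shows "\<exists>F. integrable mu F \<and> (\<integral>p. F p \<partial>mu) \<ge> 0 \<and>
    (\<forall>t>0. AE p in mu. (\<psi> p)\<^sup>2 * q p + F p \<le> t * bgrad_ip \<psi> \<psi> p + 1 / t * ((\<psi> p)\<^sup>2 * q p * indicator (- \<psi> -` {1}) p))"
proof -
  let ?h = "\<lambda>p. 1 / (1 + u p)"
  have uLL: "loc_lip u" by (rule C2_loc_lip[OF u])
  have ud: "diff_at u p" for p by (rule C2_diff_at[OF u])
  have hLL: "loc_lip ?h" by (rule loc_lip_inverse(1)[OF uLL u0])
  have hd: "diff_at ?h p" for p by (rule loc_lip_inverse(2)[OF uLL u0 ud])
  have hpos: "?h p > 0" for p using u0[of p] by simp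
  have \<psi>L: "loc_lip \<psi>" by (rule cpws_loc_lip[OF \<psi>(1)])
  define f where "f p = (\<psi> p * \<psi> p) * ?h p" for p
  have fLL: "loc_lip f" unfolding f_def by (intro loc_lip_mult \<psi>L hLL)
  obtain K where K: "compact K" "\<And>p. p \<notin> K \<Longrightarrow> \<psi> p = 0" using cpws_support[OF \<psi>(1)] by blast
  have ibp: "IBP u f" by (rule IBP_compact[OF fLL K(1) _ u]) (simp add: f_def K(2))
  have f0: "f p \<ge> 0" for p unfolding f_def using hpos[of p] by (intro mult_nonneg_nonneg \<psi>(2)) simp
  have "0 \<le> (\<integral>p. f p * (- wl u p) \<partial>mu)"
    by (rule integral_nonneg_AE) (intro AE_I2 mult_nonneg_nonneg f0, simp add: wl)
  then have "(\<integral>p. f p * wl u p \<partial>mu) \<le> 0" by simp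
  \<comment> \<open>This is where superharmonicity enters: the integral of
    \<open>bgrad_ip f u\<close> is minus that of \<open>f\<close> times the weighted Laplacian,
    hence nonnegative.\<close>
  then have F: "integrable mu (bgrad_ip f u)" "(\<integral>p. bgrad_ip f u p \<partial>mu) \<ge> 0"
    using ibp by (auto simp: IBP_def)
  have "AE p in mu. (\<psi> p)\<^sup>2 * q p + bgrad_ip f u p \<le> t * bgrad_ip \<psi> \<psi> p + 1 / t * ((\<psi> p)\<^sup>2 * q p * indicator (- \<psi> -` {1}) p)" 
    if t: "t > 0" for t :: real
    using loc_lip_AE[OF \<psi>L]
  proof eventually_elim
    case (elim p)
    define G where "G = grad_ip \<psi> u p"
    have q: "q p = (?h p)\<^sup>2 * grad_ip u u p" by (simp add: q_def bgrad_ip_eq ud)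
    have q0: "q p \<ge> 0" unfolding q by (simp add: grad_ip_nonneg)
    have d2: "diff_at (\<lambda>p. \<psi> p * \<psi> p) p" by (intro diff_at_mult elim)
    have "diff_at f p" unfolding f_def by (intro diff_at_mult elim hd)
    then have "bgrad_ip f u p = grad_ip f u p" by (simp add: bgrad_ip_eq ud)
    also have "\<dots> = (\<psi> p * \<psi> p) * grad_ip ?h u p + ?h p * grad_ip (\<lambda>p. \<psi> p * \<psi> p) u p"
      unfolding f_def by (rule grad_ip_mult[OF d2 hd])
    also have "grad_ip (\<lambda>p. \<psi> p * \<psi> p) u p = \<psi> p * G + \<psi> p * G"
      unfolding G_def by (rule grad_ip_mult[OF elim elim])
    also have "grad_ip ?h u p = - (?h p)\<^sup>2 * grad_ip u u p" by (rule grad_ip_inverse[OF ud u0 hd])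
    finally have F: "bgrad_ip f u p = 2 * \<psi> p * ?h p * G - (\<psi> p)\<^sup>2 * q p"
      by (simp add: q power2_eq_square algebra_simps)
    have Gpsi: "bgrad_ip \<psi> \<psi> p = grad_ip \<psi> \<psi> p" by (rule bgrad_ip_eq[OF elim elim])
    show ?case
    proof (cases "\<psi> p = 1")
      case True
      have "G = 0" unfolding G_def by (rule grad_ip_extremum(1)[OF elim]) (use True \<psi>(3) in simp)
      then show ?thesis using F True t by (simp add: Gpsi grad_ip_nonneg)
    next
      case False
      define a where "a = ?h p * G"
      define b where "b = \<psi> p"
      define k where "k = grad_ip \<psi> \<psi> p"
      have k0: "k \<ge> 0" by (simp add: k_def grad_ip_nonneg)
      have "a\<^sup>2 \<le> k * q p"
        using mult_left_mono[OF grad_ip_Cauchy[of \<psi> u p], of "(?h p)\<^sup>2"]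
        unfolding a_def k_def G_def q power_mult_distrib by (simp only: mult_ac zero_le_power2)
      then have "(b * a)\<^sup>2 \<le> k * (b\<^sup>2 * q p)"
        using mult_left_mono[of "a\<^sup>2" "k * q p" "b\<^sup>2"] by (simp add: power_mult_distrib mult_ac)
      then have "\<bar>b * a\<bar> \<le> sqrt (k * (b\<^sup>2 * q p))"
        using real_le_rsqrt real_sqrt_abs real_sqrt_le_mono by metis
      \<comment> \<open>Cauchy-Schwarz has bounded the mixed term by this root. The inequality of
        the means with weights \<open>t\<close> and \<open>1 / t\<close> separates the energy of
        \<open>\<psi>\<close> from that of \<open>u\<close>.\<close>
      moreover have "2 * sqrt (k * (b\<^sup>2 * q p)) \<le> t * k + 1 / t * (b\<^sup>2 * q p)"
      proof -
        have "sqrt ((t * k) * (1 / t * (b\<^sup>2 * q p))) \<le> (t * k + 1 / t * (b\<^sup>2 * q p)) / 2"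
          by (rule arith_geo_mean_sqrt) (use t k0 q0 in auto)
        then show ?thesis using t by simp
      qed
      ultimately have "2 * (b * a) \<le> t * k + 1 / t * (b\<^sup>2 * q p)" by linarith
      then show ?thesis using False by (simp add: F Gpsi a_def b_def k_def mult_ac)
    qed
  qed
  then show ?thesis using F by (intro exI[of _ "bgrad_ip f u"]) simp
qed

text \<open>Integrability of \<open>a\<close> is something to be concluded from it, so the estimate
  is made for nonnegative integrals: \<open>b - F\<close> dominates \<open>a\<close>, and its
  integral is at most that of \<open>b\<close>.\<close>

lemma nn_integral_le_if_add_le:
  fixes a F b :: "'b \<Rightarrow> real"
  assumes F: "integrable M F" "integral\<^sup>L M F \<ge> 0" and b: "integrable M b"
    and le: "AE p in M. a p + F p \<le> b p" and a: "\<And>p. a p \<ge> 0"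
  shows "(\<integral>\<^sup>+p. ennreal (a p) \<partial>M) \<le> ennreal (integral\<^sup>L M b)"
proof -
  have "(\<integral>\<^sup>+p. ennreal (a p) \<partial>M) \<le> (\<integral>\<^sup>+p. ennreal (b p - F p) \<partial>M)"
    by (rule nn_integral_mono_AE) (use le in \<open>eventually_elim, auto intro!: ennreal_leI\<close>)
  also have "\<dots> = ennreal (\<integral>p. b p - F p \<partial>M)"
  proof (rule nn_integral_eq_integral)
    show "AE p in M. 0 \<le> b p - F p" using le
    proof eventually_elim
      case (elim p)
      then show ?case using a[of p] by linarith
    qed
  qed (use F b in simp)
  also have "\<dots> \<le> ennreal (integral\<^sup>L M b)"
    using F b by (intro ennreal_leI) simp
  finally show ?thesis .
qed

lemma finite_capacity_gradient_zero:
  assumes cap: "finite_capacity A g \<phi>" and u: "Ck_fun A 2 u" and u0: "\<And>p. u p \<ge> 0" and wl: "\<And>p. wl u p \<le> 0"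
  shows "AE p in mu. bgrad_ip u u p = 0"
proof -
  obtain \<psi> :: "nat \<Rightarrow> 'a \<Rightarrow> real" and C :: real where
    \<psi>: "\<And>i. cpws (\<psi> i)" "\<And>i p. 0 \<le> \<psi> i p" "\<And>i p. \<psi> i p \<le> 1" "\<And>i. compact (\<psi> i -` {1})" 
      "incseq (\<lambda>i. \<psi> i -` {1})" "(\<Union>i. \<psi> i -` {1}) = UNIV" and C: "\<And>i. weighted_energy A g \<phi> (\<psi> i) \<le> ennreal C"
    using cap unfolding finite_capacity_def cpws_def by auto
  define C' where "C' = max C 0"
  have C': "C' \<ge> 0" "\<And>i. weighted_energy A g \<phi> (\<psi> i) \<le> ennreal C'"
    using C unfolding C'_def by (auto intro: order_trans[OF C] ennreal_leI)
  define q where "q p = (1 / (1 + u p))\<^sup>2 * bgrad_ip u u p" for p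
  have uLL: "loc_lip u" by (rule C2_loc_lip[OF u])
  have ud: "diff_at u p" for p by (rule C2_diff_at[OF u])
  note [measurable] = loc_lip_borel[OF uLL]
  have q_borel [measurable]: "q \<in> borel_measurable borel" unfolding q_def[abs_def] by measurable
  have q0: "q p \<ge> 0" for p by (simp add: q_def bgrad_ip_eq ud grad_ip_nonneg)
  define \<Omega> where "\<Omega> i = \<psi> i -` {1}" for i
  have \<Omega>_borel [measurable]: "\<Omega> i \<in> sets borel" for i
    unfolding \<Omega>_def using \<psi>(4) by (simp add: borel_closed compact_imp_closed)
  have G: "integrable mu (bgrad_ip (\<psi> i) (\<psi> i))" "(\<integral>p. bgrad_ip (\<psi> i) (\<psi> i) p \<partial>mu) \<le> C'" for i
  proof -
    have L: "loc_lip (\<psi> i)" by (rule cpws_loc_lip[OF \<psi>(1)])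
    note [measurable] = loc_lip_borel[OF L]
    have nn: "AE p in mu. 0 \<le> bgrad_ip (\<psi> i) (\<psi> i) p"
      using loc_lip_AE[OF L] by eventually_elim (simp add: bgrad_ip_eq grad_ip_nonneg)
    have le: "(\<integral>\<^sup>+p. ennreal (bgrad_ip (\<psi> i) (\<psi> i) p) \<partial>mu) \<le> ennreal C'"
      using C'(2)[of i] by (simp add: energy_eq[OF L])
    then show int: "integrable mu (bgrad_ip (\<psi> i) (\<psi> i))"
      by (intro integrableI_nonneg nn) (auto simp: top_unique intro: le_less_trans)
    show "(\<integral>p. bgrad_ip (\<psi> i) (\<psi> i) p \<partial>mu) \<le> C'"
      using le C'(1) unfolding nn_integral_eq_integral[OF int nn] by simp
  qed
  have \<psi>q: "q p * indicator (\<Omega> i) p \<le> (\<psi> i p)\<^sup>2 * q p" for i p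
    using q0[of p] by (cases "p \<in> \<Omega> i") (auto simp: \<Omega>_def)
  have bound: "(\<integral>\<^sup>+p. ennreal (q p * indicator (\<Omega> i) p) \<partial>mu) \<le> ennreal (4 * C')" for i
  proof -
    obtain F where F: "integrable mu F" "(\<integral>p. F p \<partial>mu) \<ge> 0" 
      and le: "\<And>t. t > 0 \<Longrightarrow> AE p in mu. (\<psi> i p)\<^sup>2 * q p + F p \<le> t * bgrad_ip (\<psi> i) (\<psi> i) p + 1 / t * ((\<psi> i p)\<^sup>2 * q p * indicator (- \<psi> i -` {1}) p)"
      using test_inequality[OF u u0 wl \<psi>(1,2,3), of i] unfolding q_def by blast
    \<comment> \<open>With \<open>t = 2\<close> half of \<open>(\<psi> i p)\<^sup>2 * q p\<close> is
      absorbed on the left, leaving twice the energy on the right. Doubling gives the constant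
      \<open>4 * C'\<close>.\<close>
    have "AE p in mu. 1 / 2 * (q p * indicator (\<Omega> i) p) + F p \<le> 2 * bgrad_ip (\<psi> i) (\<psi> i) p"
      using le[of 2, OF zero_less_numeral]
    proof eventually_elim
      case (elim p)
      have "(\<psi> i p)\<^sup>2 * q p * indicator (- \<psi> i -` {1}) p \<le> (\<psi> i p)\<^sup>2 * q p"
        using q0[of p] by (auto simp: indicator_def)
      then show ?case using elim \<psi>q[of p i] by linarith
    qed
    then have "(\<integral>\<^sup>+p. ennreal (1 / 2 * (q p * indicator (\<Omega> i) p)) \<partial>mu) \<le> ennreal (\<integral>p. 2 * bgrad_ip (\<psi> i) (\<psi> i) p \<partial>mu)"
      by (intro nn_integral_le_if_add_le[OF F]) (use G q0 in auto)
    also have "\<dots> \<le> ennreal (2 * C')" using G by (intro ennreal_leI) simp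
    finally have *: "(\<integral>\<^sup>+p. ennreal (1 / 2 * (q p * indicator (\<Omega> i) p)) \<partial>mu) \<le> ennreal (2 * C')" .
    have "(\<integral>\<^sup>+p. ennreal (q p * indicator (\<Omega> i) p) \<partial>mu) = (\<integral>\<^sup>+p. 2 * ennreal (1 / 2 * (q p * indicator (\<Omega> i) p)) \<partial>mu)"
      using q0 by (intro nn_integral_cong) (simp add: ennreal_mult[symmetric] ennreal_numeral[symmetric] del: ennreal_numeral)
    also have "\<dots> = 2 * (\<integral>\<^sup>+p. ennreal (1 / 2 * (q p * indicator (\<Omega> i) p)) \<partial>mu)"
      by (rule nn_integral_cmult) simp
    also have "\<dots> \<le> 2 * ennreal (2 * C')" by (rule mult_left_mono[OF *]) simp
    also have "\<dots> = ennreal (4 * C')" using C'(1) by (simp add: ennreal_mult[symmetric] ennreal_numeral[symmetric] del: ennreal_numeral)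
    finally show ?thesis .
  qed
  \<comment> \<open>With \<open>q\<close> as the density of a measure, the uniform bound on the
    exhausting sets becomes finiteness of the total mass, and the mass off \<open>\<Omega> i\<close>
    becomes a difference.\<close>
  define \<nu> where "\<nu> = density mu (\<lambda>p. ennreal (q p))"
  have sets_\<nu> [simp]: "sets \<nu> = sets borel" by (simp add: \<nu>_def)
  have em: "emeasure \<nu> B = (\<integral>\<^sup>+p. ennreal (q p * indicator B p) \<partial>mu)" if [measurable]: "B \<in> sets borel" for B
    unfolding \<nu>_def using that
    by (subst emeasure_density) (auto intro!: nn_integral_cong simp: indicator_def)
  have inc: "incseq \<Omega>" using \<psi>(5) by (simp add: \<Omega>_def[abs_def])
  have "(SUP i. emeasure \<nu> (\<Omega> i)) = emeasure \<nu> (\<Union>i. \<Omega> i)"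
    by (rule SUP_emeasure_incseq) (use inc in auto)
  also have "(\<Union>i. \<Omega> i) = space \<nu>" using \<psi>(6) by (simp add: \<Omega>_def \<nu>_def)
  finally have sup: "(SUP i. emeasure \<nu> (\<Omega> i)) = emeasure \<nu> (space \<nu>)" .
  have "emeasure \<nu> (space \<nu>) \<le> ennreal (4 * C')"
    unfolding sup[symmetric] by (rule SUP_least) (use bound in \<open>simp add: em\<close>)
  then have "emeasure \<nu> (space \<nu>) \<noteq> \<infinity>" by (auto simp: top_unique)
  then interpret \<nu>: finite_measure \<nu> by (rule finite_measureI)
  have space_\<nu> [simp]: "space \<nu> = UNIV" by (simp add: \<nu>_def)
  define m where "m = measure \<nu> UNIV"
  have lim: "(\<lambda>i. measure \<nu> (\<Omega> i)) \<longlonglongrightarrow> m"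
    using \<nu>.finite_Lim_measure_incseq[of \<Omega>] inc \<psi>(6) unfolding m_def \<Omega>_def by (simp add: \<Omega>_def image_subset_iff \<psi>(4) borel_closed compact_imp_closed)
  have q_int: "integrable mu (\<lambda>p. q p * indicator B p)" "(\<integral>p. q p * indicator B p \<partial>mu) = measure \<nu> B" if [measurable]: "B \<in> sets borel" for B
  proof -
    have fin: "(\<integral>\<^sup>+p. ennreal (q p * indicator B p) \<partial>mu) = ennreal (measure \<nu> B)"
      using that by (simp add: em[symmetric] \<nu>.emeasure_eq_measure)
    then show "integrable mu (\<lambda>p. q p * indicator B p)"
      by (intro integrableI_nonneg) (auto simp: q0)
    show "(\<integral>p. q p * indicator B p \<partial>mu) = measure \<nu> B"
      by (rule integral_eq_nn_integral[THEN trans]) (use fin q0 in auto)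
  qed
  have step: "measure \<nu> (\<Omega> i) \<le> t * C' + 1 / t * (m - measure \<nu> (\<Omega> i))" if t: "t > 0" for t :: real and i
  proof -
    obtain F where F: "integrable mu F" "(\<integral>p. F p \<partial>mu) \<ge> 0" 
      and le: "\<And>t. t > 0 \<Longrightarrow> AE p in mu. (\<psi> i p)\<^sup>2 * q p + F p \<le> t * bgrad_ip (\<psi> i) (\<psi> i) p + 1 / t * ((\<psi> i p)\<^sup>2 * q p * indicator (- \<psi> i -` {1}) p)"
      using test_inequality[OF u u0 wl \<psi>(1,2,3), of i] unfolding q_def by blast
    have "AE p in mu. q p * indicator (\<Omega> i) p + F p \<le> t * bgrad_ip (\<psi> i) (\<psi> i) p + 1 / t * (q p * indicator (- \<Omega> i) p)"
      using le[OF t]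
    proof eventually_elim
      case (elim p)
      have "(\<psi> i p)\<^sup>2 \<le> 1" using \<psi>(2,3)[of i p] by (simp add: power_le_one)
      then have "(\<psi> i p)\<^sup>2 * (q p * indicator (- \<psi> i -` {1}) p) \<le> 1 * (q p * indicator (- \<Omega> i) p)"
        unfolding \<Omega>_def by (rule mult_right_mono) (use q0 in simp)
      then have "1 / t * ((\<psi> i p)\<^sup>2 * q p * indicator (- \<psi> i -` {1}) p) \<le> 1 / t * (q p * indicator (- \<Omega> i) p)"
        using t by (intro mult_left_mono) (auto simp: mult_ac)
      then show ?case using elim \<psi>q[of p i] by linarith
    qed
    then have "(\<integral>\<^sup>+p. ennreal (q p * indicator (\<Omega> i) p) \<partial>mu) \<le> ennreal (\<integral>p. t * bgrad_ip (\<psi> i) (\<psi> i) p + 1 / t * (q p * indicator (- \<Omega> i) p) \<partial>mu)"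
      by (intro nn_integral_le_if_add_le[OF F]) (use G q0 q_int in auto)
    also have "(\<integral>p. t * bgrad_ip (\<psi> i) (\<psi> i) p + 1 / t * (q p * indicator (- \<Omega> i) p) \<partial>mu) = 
        t * (\<integral>p. bgrad_ip (\<psi> i) (\<psi> i) p \<partial>mu) + 1 / t * measure \<nu> (- \<Omega> i)"
      using G q_int[of "- \<Omega> i"] by (subst Bochner_Integration.integral_add) auto
    also have "measure \<nu> (- \<Omega> i) = m - measure \<nu> (\<Omega> i)"
      using \<nu>.finite_measure_compl[of "\<Omega> i"] by (simp add: m_def Compl_eq_Diff_UNIV)
    finally have "ennreal (measure \<nu> (\<Omega> i)) \<le> ennreal (t * (\<integral>p. bgrad_ip (\<psi> i) (\<psi> i) p \<partial>mu) + 1 / t * (m - measure \<nu> (\<Omega> i)))"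
      by (simp add: em[symmetric] \<nu>.emeasure_eq_measure)
    moreover have "t * (\<integral>p. bgrad_ip (\<psi> i) (\<psi> i) p \<partial>mu) \<le> t * C'" using G(2)[of i] t by simp
    moreover have "m - measure \<nu> (\<Omega> i) \<ge> 0" unfolding m_def by (simp add: \<nu>.bounded_measure[unfolded space_\<nu>])
    moreover have "0 \<le> t * (\<integral>p. bgrad_ip (\<psi> i) (\<psi> i) p \<partial>mu)"
    proof -
      have "AE p in mu. 0 \<le> bgrad_ip (\<psi> i) (\<psi> i) p"
        using loc_lip_AE[OF cpws_loc_lip[OF \<psi>(1)[of i]]] by eventually_elim (simp add: bgrad_ip_eq grad_ip_nonneg)
      then show ?thesis using t by (simp add: integral_nonneg_AE)
    qed
    ultimately have "measure \<nu> (\<Omega> i) \<le> t * (\<integral>p. bgrad_ip (\<psi> i) (\<psi> i) p \<partial>mu) + 1 / t * (m - measure \<nu> (\<Omega> i))"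
      using t by (subst (asm) ennreal_le_iff) auto
    then show ?thesis using \<open>t * _ \<le> t * C'\<close> by linarith
  qed
  \<comment> \<open>For fixed \<open>t\<close> the sets exhaust the manifold first, so
    \<open>1 / t\<close> times the remaining mass tends to zero; only afterwards may
    \<open>t\<close> shrink.\<close>
  have "m \<le> t * C'" if t: "t > 0" for t :: real
  proof -
    have "(\<lambda>i. t * C' + 1 / t * (m - measure \<nu> (\<Omega> i))) \<longlonglongrightarrow> t * C' + 1 / t * (m - m)"
      by (intro tendsto_intros lim)
    then have "m \<le> t * C' + 1 / t * (m - m)"
      by (rule LIMSEQ_le[OF lim]) (use step[OF t] in blast)
    then show ?thesis by simp
  qed
  have "m \<le> 0"
  proof (rule field_le_epsilon)
    fix e :: real assume e: "e > 0"
    have "m \<le> e / (C' + 1) * C'" using e C'(1) \<open>\<And>t. t > 0 \<Longrightarrow> m \<le> t * C'\<close>[of "e / (C' + 1)"] by simp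
    also have "\<dots> \<le> e" using e C'(1) by (simp add: field_simps)
    finally show "m \<le> 0 + e" by simp
  qed
  then have "m = 0" unfolding m_def using measure_nonneg[of \<nu> UNIV] by linarith
  then have "(\<integral>\<^sup>+p. ennreal (q p) \<partial>mu) = 0"
    using em[of UNIV] by (simp add: \<nu>.emeasure_eq_measure m_def)
  then have "AE p in mu. q p = 0"
    by (subst (asm) nn_integral_0_iff_AE) (auto elim!: eventually_mono simp: q0 ennreal_eq_0_iff intro: antisym)
  then show ?thesis
  proof eventually_elim
    case (elim p)
    then show ?case using u0[of p] unfolding q_def by (simp add: add_nonneg_eq_0_iff)
  qed
qed

text \<open>Positivity of the dual metric makes the partial derivatives vanish almost everywhere,
  their continuity makes them vanish everywhere, and connectedness leads from locally constant to
  constant.\<close>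

lemma constant_if_gradient_zero:
  assumes u: "Ck_fun A 2 u" and AE: "AE p in mu. bgrad_ip u u p = 0"
  shows "u constant_on UNIV"
proof -
  have ud: "diff_at u p" for p by (rule C2_diff_at[OF u])
  have u1: "Ck_on (Suc 1) (V c) (in_chart c u)" if "c \<in> A" for c using u that by (simp add: Ck_fun_def numeral_2_eq_2)
  have pd0: "pd i (in_chart c u) (snd c p) = 0" if c: "c \<in> A" and p: "p \<in> fst c" for c i p
  proof (rule continuous_AE_eq[OF chart(1)[OF c] _ continuous_on_const _ p])
    have "continuous_on (V c) (pd i (in_chart c u))"
      using Ck_on_imp_continuous_on[OF Ck_on_pd[OF u1[OF c]]] .
    from continuous_on_compose2[OF this chart(3)[OF c] order_refl]
    show "continuous_on (fst c) (\<lambda>p. pd i (in_chart c u) (snd c p))" .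
    show "AE q in mu. q \<in> fst c \<longrightarrow> pd i (in_chart c u) (snd c q) = 0"
      using AE
    proof eventually_elim
      case (elim q)
      show ?case
      proof
        assume q: "q \<in> fst c"
        have "cgrad_ip c u u q = 0" using elim by (simp add: bgrad_ip_eq ud grad_ip_chart[OF c q])
        then have "cgrad c u q = 0"
          unfolding cgrad_ip_def using pos_def_inv(3)[OF metric_pos_def[OF c q], of "cgrad c u q"] by fastforce
        then show "pd i (in_chart c u) (snd c q) = 0"
          unfolding cgrad_def partial_deriv_pd by (simp add: vec_eq_iff)
      qed
    qed
  qed
  have "\<exists>T. openin (top_of_set UNIV) T \<and> p \<in> T \<and> (\<forall>q\<in>T. u q = u p)" for p
  proof -
    obtain c where c: "c \<in> A" "p \<in> fst c" using ex_chart by blast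
    have "snd c p \<in> V c" using c(2) by (rule imageI)
    then obtain r where r: "r > 0" "ball (snd c p) r \<subseteq> V c" using chart(2)[OF c(1)] open_contains_ball by blast
    have der: "(in_chart c u has_derivative (\<lambda>v. 0)) (at y)" if y: "y \<in> V c" for y
    proof -
      have D: "(in_chart c u has_derivative frechet_derivative (in_chart c u) (at y)) (at y)"
        by (rule Ck_on_SucE[OF u1[OF c(1)] y])
      have "frechet_derivative (in_chart c u) (at y) v = 0" for v
      proof -
        interpret linear "frechet_derivative (in_chart c u) (at y)" using has_derivative_linear[OF D] .
        have "frechet_derivative (in_chart c u) (at y) (axis i 1) = 0" for i
          using pd0[OF c(1) chart(7)[OF c(1) y], of i] chart(6)[OF c(1) y] by (simp add: pd_def)
        then have "frechet_derivative (in_chart c u) (at y) (\<Sum>i\<in>UNIV. v $ i *\<^sub>R axis i 1) = 0"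
          by (simp add: sum scale)
        then show ?thesis using basis_expansion[of v] by (simp add: scalar_mult_eq_scaleR)
      qed
      then have "frechet_derivative (in_chart c u) (at y) = (\<lambda>v. 0)" by (rule ext)
      then show ?thesis using D by simp
    qed
    define T where "T = {q \<in> fst c. snd c q \<in> ball (snd c p) r}"
    have "open T" unfolding T_def by (rule open_chart_preimage[OF c(1) open_ball])
    moreover have "p \<in> T" using c r by (simp add: T_def)
    moreover have "u q = u p" if q: "q \<in> T" for q
    proof -
      have "\<exists>k. \<forall>y\<in>ball (snd c p) r. in_chart c u y = k"
      proof (rule has_derivative_zero_constant[OF convex_ball])
        show "(in_chart c u has_derivative (\<lambda>h. 0)) (at y within ball (snd c p) r)" if "y \<in> ball (snd c p) r" for y
          by (rule has_derivative_at_withinI[OF der[OF subsetD[OF r(2) that]]])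
      qed
      then have "in_chart c u (snd c q) = in_chart c u (snd c p)" using q r by (auto simp: T_def)
      then show ?thesis using q c by (simp add: T_def in_chart_at)
    qed
    moreover have "openin (top_of_set UNIV) T" using \<open>open T\<close> by simp
    ultimately show ?thesis by (intro exI[of _ T] conjI ballI)
  qed
  then show ?thesis by (rule locally_constant_imp_constant[OF conn])
qed

lemma finite_capacity_imp_parabolic: "finite_capacity A g \<phi> \<Longrightarrow> parabolic A g \<phi>"
  unfolding parabolic_def
  by (intro allI impI, elim conjE, rule constant_if_gradient_zero, assumption, rule finite_capacity_gradient_zero) auto


subsection \<open>Exhaustions and weights\<close>

text \<open>A cutoff that equals \<open>1\<close> on \<open>C\<close> is positive on an open
  neighbourhood of \<open>C\<close>, and that neighbourhood lies in its compact support.\<close>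

lemma compact_in_interior:
  fixes C :: "'a set"
  assumes C: "compact C" shows "\<exists>C'. compact C' \<and> C \<subseteq> interior C'"
proof -
  obtain \<eta> K' where e: "cpws \<eta>" "\<And>q. q \<in> C \<Longrightarrow> \<eta> q = 1" "compact K'" "\<And>q. q \<notin> K' \<Longrightarrow> \<eta> q = 0"
    using cutoff[OF C open_UNIV subset_UNIV] by (elim exE conjE) (rule that, assumption, auto)
  have "open (\<eta> -` {0<..})" by (rule open_vimage[OF open_greaterThan pws_continuous[OF cpws_pws[OF e(1)]]])
  moreover have "C \<subseteq> \<eta> -` {0<..}" using e(2) by auto
  moreover have "\<eta> -` {0<..} \<subseteq> K'" using e(4) by fastforce
  ultimately have "C \<subseteq> interior K'" by (meson interior_maximal order_trans)
  then show ?thesis using e(3) by blast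
qed

text \<open>The exhaustion starts with the empty set so that the construction of the weight can
  treat the first shell like the others.\<close>

lemma ex_exhaustion:
  "\<exists>K :: nat \<Rightarrow> 'a set. K 0 = {} \<and> (\<forall>j. compact (K j) \<and> K j \<subseteq> interior (K (Suc j))) \<and> (\<Union>j. K j) = UNIV"
proof -
  have "\<exists>C. compact C \<and> p \<in> interior C" for p :: 'a
    using compact_in_interior[of "{p}"] by auto
  then have "\<forall>p :: 'a. \<exists>C. compact C \<and> p \<in> interior C" by blast
  from choice[OF this] obtain C :: "'a \<Rightarrow> 'a set" where C: "\<And>p. compact (C p)" "\<And>p. p \<in> interior (C p)" by blast
  obtain F where F: "F \<subseteq> range (\<lambda>p. interior (C p))" "countable F" "\<Union>F = \<Union>(range (\<lambda>p. interior (C p)))"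
    by (rule Lindelof[of "range (\<lambda>p. interior (C p))"]) auto
  have FU: "\<Union>F = UNIV" using F(3) C(2) by auto
  then have "F \<noteq> {}" by auto
  define W where "W = from_nat_into F"
  have WF: "range W = F" unfolding W_def by (rule range_from_nat_into[OF \<open>F \<noteq> {}\<close> F(2)])
  have "\<exists>D. compact D \<and> W n \<subseteq> D" for n :: nat
  proof -
    obtain p where "W n = interior (C p)" using WF F(1) by blast
    then show ?thesis using C(1)[of p] interior_subset[of "C p"] by auto
  qed
  then have "\<forall>n :: nat. \<exists>D. compact D \<and> W n \<subseteq> D" by blast
  from choice[OF this] obtain D where D: "\<And>n :: nat. compact (D n)" "\<And>n :: nat. W n \<subseteq> D n" by blast
  have "\<exists>K :: nat \<Rightarrow> 'a set. \<forall>n. (compact (K n) \<and> (n = 0 \<longrightarrow> K n = {})) \<and> K n \<union> D n \<subseteq> interior (K (Suc n))"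
  proof (rule dependent_nat_choice)
    fix X :: "'a set" and n :: nat assume "compact X \<and> (n = 0 \<longrightarrow> X = {})"
    then have "compact (X \<union> D n)" using D(1) by auto
    from compact_in_interior[OF this] obtain Y where Y: "compact Y" "X \<union> D n \<subseteq> interior Y" by blast
    show "\<exists>Y. (compact Y \<and> (Suc n = 0 \<longrightarrow> Y = {})) \<and> X \<union> D n \<subseteq> interior Y"
      using Y by (intro exI[of _ Y]) simp
  qed auto
  then obtain K where K: "\<And>n. compact (K n)" "K 0 = {}" "\<And>n. K n \<union> D n \<subseteq> interior (K (Suc n))" by blast
  have "p \<in> (\<Union>j. K j)" for p
  proof -
    obtain n where "p \<in> W n" using FU WF by blast
    then have "p \<in> K (Suc n)" using D(2) K(3) interior_subset[of "K (Suc n)"] by blast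
    then show ?thesis by blast
  qed
  then show ?thesis using K by (intro exI[of _ K]) auto
qed

text \<open>On a small closed coordinate ball the density and the inverse metric are bounded by
  compactness. The Lipschitz constant bounds the difference quotients in unit directions and hence
  the partial derivatives.\<close>

lemma local_bounds:
  assumes v: "loc_lip v"
  shows "\<exists>W C. open W \<and> p \<in> W \<and> emeasure mu W < \<infinity> \<and> (\<forall>q\<in>W. diff_at v q \<longrightarrow> grad_ip v v q \<le> C)"
proof -
  obtain c where c: "c \<in> A" "p \<in> fst c" using ex_chart by blast
  have y0: "snd c p \<in> V c" using c(2) by (rule imageI)
  have "lip_at (in_chart c v) (snd c p)" using v c y0 unfolding loc_lip_def by blast
  then obtain r L where r: "r > 0" and L0: "L \<ge> 0" and 
    L: "\<And>y z. y \<in> ball (snd c p) r \<Longrightarrow> z \<in> ball (snd c p) r \<Longrightarrow> \<bar>in_chart c v y - in_chart c v z\<bar> \<le> L * dist y z"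
    using lip_atE by metis
  obtain r1 where r1: "r1 > 0" "cball (snd c p) r1 \<subseteq> V c" using chart(2)[OF c(1)] y0 open_contains_cball by metis
  define d where "d = min r r1"
  define B where "B = ball (snd c p) d"
  have d: "d > 0" "cball (snd c p) d \<subseteq> V c" "B \<subseteq> ball (snd c p) r" "B \<subseteq> cball (snd c p) d" "B \<subseteq> V c"
    using r r1 ball_subset_cball[of "snd c p" d] cball_min_Int[of "snd c p" r r1] ball_min_Int[of "snd c p" r r1]
    by (auto simp: d_def B_def)
  define N where "N y = (\<Sum>i\<in>UNIV. \<Sum>j\<in>UNIV. \<bar>matrix_inv (g c (ci c y)) $ i $ j\<bar>)" for y
  have cN: "continuous_on (cball (snd c p) d) N"
    unfolding N_def
    by (intro continuous_on_sum continuous_on_rabs continuous_on_subset[OF smooth_on_imp_continuous_on[OF smooth_ginv[OF c(1)]] d(2)])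
  have "bounded (N ` cball (snd c p) d)"
    by (intro compact_imp_bounded compact_continuous_image[OF cN] compact_cball)
  then obtain M where M: "\<And>y. y \<in> cball (snd c p) d \<Longrightarrow> \<bar>N y\<bar> \<le> M" unfolding bounded_iff by force
  have cwd: "continuous_on (cball (snd c p) d) (wdens c)"
    by (rule continuous_on_subset[OF smooth_on_imp_continuous_on[OF smooth_wdens[OF c(1)]] d(2)])
  have "bounded (wdens c ` cball (snd c p) d)"
    by (intro compact_imp_bounded compact_continuous_image[OF cwd] compact_cball)
  then obtain M' where M': "\<And>y. y \<in> cball (snd c p) d \<Longrightarrow> \<bar>wdens c y\<bar> \<le> M'" unfolding bounded_iff by force
  define W where "W = {q \<in> fst c. snd c q \<in> B}"
  have W: "open W" unfolding W_def B_def by (rule open_chart_preimage[OF c(1) open_ball])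
  have pW: "p \<in> W" using c d(1) by (simp add: W_def B_def)
  have "grad_ip v v q \<le> L * L * M" if q: "q \<in> W" and cgrad: "diff_at v q" for q
  proof -
    let ?y = "snd c q"
    have y: "?y \<in> B" "q \<in> fst c" using q by (auto simp: W_def)
    have D: "(in_chart c v has_derivative frechet_derivative (in_chart c v) (at ?y)) (at ?y)"
      using dfaD[OF cgrad c(1) y(2)] frechet_derivative_works by blast
    have "\<bar>frechet_derivative (in_chart c v) (at ?y) h\<bar> \<le> L" if h: "norm h = 1" for h
    proof (rule LIMSEQ_le_const2[OF tendsto_rabs[OF dird_tendsto[OF D, of h]]])
      have "?y \<in> ball (snd c p) r" using subsetD[OF d(3) y(1)] .
      then obtain e where e: "e > 0" "ball ?y e \<subseteq> ball (snd c p) r" using open_contains_ball open_ball by metis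
      obtain k0 :: nat where k0: "1 / e < real k0" using reals_Archimedean2 by blast
      have "\<bar>(in_chart c v (?y + h /\<^sub>R Suc k) - in_chart c v ?y) * Suc k\<bar> \<le> L" if k: "k \<ge> k0" for k
      proof -
        have "1 / e < real (Suc k)" using k0 k by linarith
        then have "1 / real (Suc k) < e" using e(1) by (simp add: field_simps)
        then have dist: "dist (?y + h /\<^sub>R Suc k) ?y = 1 / real (Suc k)" "?y + h /\<^sub>R Suc k \<in> ball ?y e"
          using h by (simp_all add: dist_norm divide_inverse)
        have "\<bar>in_chart c v (?y + h /\<^sub>R Suc k) - in_chart c v ?y\<bar> \<le> L * (1 / real (Suc k))"
          using L[of "?y + h /\<^sub>R Suc k" ?y] dist subsetD[OF e(2) dist(2)] subsetD[OF d(3) y(1)] by simp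
        then have "\<bar>in_chart c v (?y + h /\<^sub>R Suc k) - in_chart c v ?y\<bar> * Suc k \<le> L * (1 / real (Suc k)) * Suc k"
          by (rule mult_right_mono) simp
        then show ?thesis by (simp add: abs_mult)
      qed
      then show "\<exists>N. \<forall>k\<ge>N. \<bar>(in_chart c v (?y + h /\<^sub>R Suc k) - in_chart c v ?y) * Suc k\<bar> \<le> L" by blast
    qed
    then have b: "\<bar>cgrad c v q $ i\<bar> \<le> L" for i
      unfolding cgrad_def partial_deriv_def by (simp add: norm_axis_1)
    have "grad_ip v v q = (\<Sum>i\<in>UNIV. \<Sum>j\<in>UNIV. cgrad c v q $ i * matrix_inv (g c q) $ i $ j * cgrad c v q $ j)"
      by (simp add: grad_ip_chart[OF c(1) y(2) cgrad cgrad] cgrad_ip_def inner_vec_def matrix_vector_mult_def sum_distrib_left mult_ac)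
    also have "\<dots> \<le> (\<Sum>i\<in>UNIV. \<Sum>j\<in>UNIV. L * \<bar>matrix_inv (g c q) $ i $ j\<bar> * L)"
    proof (intro sum_mono)
      fix i j
      have "cgrad c v q $ i * matrix_inv (g c q) $ i $ j * cgrad c v q $ j \<le> \<bar>cgrad c v q $ i\<bar> * \<bar>matrix_inv (g c q) $ i $ j\<bar> * \<bar>cgrad c v q $ j\<bar>"
        by (metis abs_ge_self abs_mult)
      also have "\<dots> \<le> L * \<bar>matrix_inv (g c q) $ i $ j\<bar> * L"
        using b L0 by (intro mult_mono) auto
      finally show "cgrad c v q $ i * matrix_inv (g c q) $ i $ j * cgrad c v q $ j \<le> L * \<bar>matrix_inv (g c q) $ i $ j\<bar> * L" .
    qed
    also have "\<dots> = L * L * N ?y"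
      using chart(5)[OF c(1) y(2)] by (simp add: N_def sum_distrib_left mult_ac)
    also have "\<dots> \<le> L * L * M"
      using M[of ?y] subsetD[OF d(4) y(1)] by (intro mult_left_mono) auto
    finally show ?thesis .
  qed
  moreover have "emeasure mu W < \<infinity>"
  proof -
    have [measurable]: "W \<in> sets borel" using W by simp
    have "emeasure mu W = (\<integral>\<^sup>+q. indicator W q \<partial>mu)" by simp
    also have "\<dots> = (\<integral>\<^sup>+y. ennreal (ext c (wdens c) y) * indicator W (ci' c y) \<partial>lborel)"
    proof (rule nn_chart[OF c(1)])
      show "indicator W q = (0 :: ennreal)" if "q \<notin> fst c" for q using that by (auto simp: W_def)
    qed simp
    also have "\<dots> \<le> (\<integral>\<^sup>+y. ennreal M' * indicator (cball (snd c p) d) y \<partial>lborel)"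
    proof (rule nn_integral_mono)
      fix y
      show "ennreal (ext c (wdens c) y) * indicator W (ci' c y) \<le> ennreal M' * indicator (cball (snd c p) d) y"
      proof (cases "y \<in> V c \<and> ci c y \<in> W")
        case True
        then have "y \<in> B" using chart(6)[OF c(1)] by (auto simp: W_def)
        then have "y \<in> cball (snd c p) d" using d(4) by auto
        then show ?thesis using True M'[of y] by (simp add: ext_def ci'_def ennreal_leI)
      qed (auto simp: ext_def ci'_def)
    qed
    also have "\<dots> = ennreal M' * emeasure lborel (cball (snd c p) d)" by (simp add: nn_integral_cmult_indicator)
    also have "\<dots> < \<infinity>" using emeasure_bounded_finite[of "cball (snd c p) d"] by (simp add: ennreal_mult_less_top)
    finally show ?thesis .
  qed
  ultimately show ?thesis using W pW by (intro exI[of _ W] exI[of _ "L * L * M"]) simp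
qed

lemma compact_bounds:
  assumes v: "loc_lip v" and K: "compact K"
  shows "emeasure mu K < \<infinity>" "\<exists>C. \<forall>q\<in>K. diff_at v q \<longrightarrow> grad_ip v v q \<le> C"
proof -
  have "\<forall>p. \<exists>z. open (fst z) \<and> p \<in> fst z \<and> emeasure mu (fst z) < \<infinity> \<and> (\<forall>q\<in>fst z. diff_at v q \<longrightarrow> grad_ip v v q \<le> snd z)"
    using local_bounds[OF v] by simp
  from choice[OF this] obtain z where z: "\<And>p. open (fst (z p))" "\<And>p. p \<in> fst (z p)" "\<And>p. emeasure mu (fst (z p)) < \<infinity>"
    "\<And>p q. q \<in> fst (z p) \<Longrightarrow> diff_at v q \<Longrightarrow> grad_ip v v q \<le> snd (z p)" by blast
  have cov: "K \<subseteq> (\<Union>p\<in>K. fst (z p))" using z(2) by auto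
  obtain T where T: "T \<subseteq> K" "finite T" "K \<subseteq> (\<Union>p\<in>T. fst (z p))"
    by (rule compactE_image[OF K _ cov]) (use z(1) in auto)
  have "emeasure mu K \<le> emeasure mu (\<Union>p\<in>T. fst (z p))"
    using T(3) z(1) by (intro emeasure_mono) (auto intro!: borel_open open_UN)
  also have "\<dots> \<le> (\<Sum>p\<in>T. emeasure mu (fst (z p)))"
    using T(2) z(1) by (intro emeasure_subadditive_finite) auto
  also have "\<dots> < \<infinity>" using z(3) T(2) by (simp add: less_top)
  finally show "emeasure mu K < \<infinity>" .
  have "grad_ip v v q \<le> (\<Sum>p\<in>T. \<bar>snd (z p)\<bar>)" if q: "q \<in> K" and d: "diff_at v q" for q
  proof -
    obtain p where p: "p \<in> T" "q \<in> fst (z p)" using T(3) q by auto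
    have "grad_ip v v q \<le> \<bar>snd (z p)\<bar>" using z(4)[OF p(2) d] by simp
    also have "\<dots> \<le> (\<Sum>p\<in>T. \<bar>snd (z p)\<bar>)" by (rule member_le_sum[OF p(1)]) (use T(2) in auto)
    finally show ?thesis .
  qed
  then show "\<exists>C. \<forall>q\<in>K. diff_at v q \<longrightarrow> grad_ip v v q \<le> C" by blast
qed

lemma integrable_compact:
  assumes [measurable]: "F \<in> borel_measurable borel" and K: "compact K" and C: "AE p in mu. p \<in> K \<longrightarrow> \<bar>F p\<bar> \<le> C"
    and F0: "AE p in mu. p \<notin> K \<longrightarrow> F p = 0"
  shows "integrable mu (F :: 'a \<Rightarrow> real)"
proof (rule Bochner_Integration.integrable_bound)
  have [measurable]: "K \<in> sets borel" using K by (simp add: borel_closed compact_imp_closed)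
  show "integrable mu (\<lambda>p. C * indicator K p :: real)"
    using compact_bounds(1)[OF loc_lip_const K] by simp
  show "AE p in mu. norm (F p) \<le> norm (C * indicator K p :: real)"
    using C F0 by eventually_elim (auto simp: indicator_def)
qed simp

lemma cpws_bounded:
  assumes "cpws v" shows "\<exists>C. \<forall>p. \<bar>v p\<bar> \<le> C"
proof -
  obtain K where K: "compact K" "\<And>p. p \<notin> K \<Longrightarrow> v p = 0" using cpws_support[OF assms] by blast
  have "bounded (v ` K)"
    by (intro compact_imp_bounded compact_continuous_image K continuous_on_subset[OF pws_continuous[OF cpws_pws[OF assms]]]) simp
  then obtain C where C: "\<And>p. p \<in> K \<Longrightarrow> \<bar>v p\<bar> \<le> C" unfolding bounded_iff by auto
  have "\<bar>v p\<bar> \<le> \<bar>C\<bar>" for p using C[of p] K(2)[of p] by (cases "p \<in> K") auto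
  then show ?thesis by blast
qed

text \<open>The diagonal terms are bounded and vanish off a compact set of finite measure; the mixed
  ones follow by Cauchy-Schwarz.\<close>

lemma cpws_energy_integrable:
  assumes v: "cpws v" and w: "cpws w"
  shows "integrable mu (bgrad_ip v w)"
proof -
  have diag: "integrable mu (bgrad_ip v v)" if v: "cpws v" for v
  proof -
    have L: "loc_lip v" by (rule cpws_loc_lip[OF v])
    note [measurable] = loc_lip_borel[OF L]
    obtain K where K: "compact K" "\<And>p. p \<notin> K \<Longrightarrow> v p = 0" using cpws_support[OF v] by blast
    obtain C where C: "\<And>q. q \<in> K \<Longrightarrow> diff_at v q \<Longrightarrow> grad_ip v v q \<le> C" using compact_bounds(2)[OF L K(1)] by blast
    show ?thesis
    proof (rule integrable_compact[OF _ K(1)])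
      show "AE p in mu. p \<in> K \<longrightarrow> \<bar>bgrad_ip v v p\<bar> \<le> C"
        using loc_lip_AE[OF L] by eventually_elim (use C in \<open>simp add: bgrad_ip_eq grad_ip_nonneg\<close>)
      show "AE p in mu. p \<notin> K \<longrightarrow> bgrad_ip v v p = 0"
        using loc_lip_AE[OF L] by eventually_elim (use bgrad_ip_zero_outside[of K v _ v] compact_imp_closed[OF K(1)] K(2) in blast)
    qed simp
  qed
  note [measurable] = loc_lip_borel[OF cpws_loc_lip[OF v]] loc_lip_borel[OF cpws_loc_lip[OF w]]
  have "AE p in mu. norm (bgrad_ip v w p) \<le> norm (bgrad_ip v v p + bgrad_ip w w p)"
    using loc_lip_AE[OF cpws_loc_lip[OF v]] loc_lip_AE[OF cpws_loc_lip[OF w]]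
  proof eventually_elim
    case (elim p)
    have "\<bar>grad_ip v w p\<bar> \<le> sqrt (grad_ip v v p * grad_ip w w p)"
      using grad_ip_Cauchy[of v w p] real_le_rsqrt by (metis real_sqrt_abs real_sqrt_le_mono)
    also have "\<dots> \<le> (grad_ip v v p + grad_ip w w p) / 2"
      by (rule arith_geo_mean_sqrt) (auto simp: grad_ip_nonneg)
    also have "\<dots> \<le> grad_ip v v p + grad_ip w w p" using grad_ip_nonneg[of v p] grad_ip_nonneg[of w p] by simp
    finally show ?case using elim by (simp add: bgrad_ip_eq)
  qed
  then show ?thesis
    by (intro Bochner_Integration.integrable_bound[OF Bochner_Integration.integrable_add[OF diag[OF v] diag[OF w]]]) auto
qed

text \<open>The weight is a locally finite sum of bumps, one for each shell between consecutive sets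
  of an exhaustion. The coefficients make the integral of summand \<open>j\<close> at most
  \<open>(1/2) ^ j\<close>.\<close>

lemma ex_weight:
  "\<exists>f. smooth_fun_on A UNIV f \<and> (\<forall>p. f p > 0) \<and> integrable mu f"
proof -
  obtain K :: "nat \<Rightarrow> 'a set" where K: "K 0 = {}" "\<And>j. compact (K j)" "\<And>j. K j \<subseteq> interior (K (Suc j))" "(\<Union>j. K j) = UNIV"
    using ex_exhaustion by blast
  have mono: "K i \<subseteq> K j" if "i \<le> j" for i j
    by (rule lift_Suc_mono_le[OF _ that]) (use K(3) interior_subset in blast)
  have "\<exists>z. smooth_fun_on A UNIV (fst z) \<and> (\<forall>q. 0 \<le> fst z q) \<and> (\<forall>q\<in>K (Suc j) - interior (K j). fst z q > 0) \<and>
      compact (snd z) \<and> snd z \<subseteq> - K (j - 1) \<and> (\<forall>q. q \<notin> snd z \<longrightarrow> fst z q = 0)" for j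
  proof -
    have c: "compact (K (Suc j) - interior (K j))" by (rule compact_diff[OF K(2) open_interior])
    have o: "open (- K (j - 1))" using K(2) compact_imp_closed by blast
    \<comment> \<open>For \<open>j = 0\<close> truncated subtraction yields \<open>K 0\<close>,
      which is empty, so the inclusion holds for the first shell as well.\<close>
    have s: "K (Suc j) - interior (K j) \<subseteq> - K (j - 1)"
      using K(1) K(3)[of "j - 1"] by (cases j) auto
    obtain \<sigma> K' where "smooth_fun_on A UNIV \<sigma>" "\<forall>q. 0 \<le> \<sigma> q" "\<forall>q\<in>K (Suc j) - interior (K j). \<sigma> q > 0"
      "compact K'" "K' \<subseteq> - K (j - 1)" "\<forall>q. q \<notin> K' \<longrightarrow> \<sigma> q = 0"
      using smooth_bump[OF c o s] by (elim exE conjE) (rule that)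
    then show ?thesis by (intro exI[of _ "(\<sigma>, K')"]) simp
  qed
  then have "\<exists>z. \<forall>j. smooth_fun_on A UNIV (fst (z j)) \<and> (\<forall>q. 0 \<le> fst (z j) q) \<and> (\<forall>q\<in>K (Suc j) - interior (K j). fst (z j) q > 0) \<and>
      compact (snd (z j)) \<and> snd (z j) \<subseteq> - K (j - 1) \<and> (\<forall>q. q \<notin> snd (z j) \<longrightarrow> fst (z j) q = 0)" by (intro choice allI)
  then obtain z where z: "\<And>j. smooth_fun_on A UNIV (fst (z j))" "\<And>j q. 0 \<le> fst (z j) q" 
    "\<And>j q. q \<in> K (Suc j) \<Longrightarrow> q \<notin> interior (K j) \<Longrightarrow> fst (z j) q > 0"
    "\<And>j. compact (snd (z j))" "\<And>j. snd (z j) \<subseteq> - K (j - 1)" "\<And>j q. q \<notin> snd (z j) \<Longrightarrow> fst (z j) q = 0" by blast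
  define \<sigma> where "\<sigma> j = fst (z j)" for j
  note \<sigma> = z(1-3)[folded \<sigma>_def]
  have \<sigma>0: "\<sigma> j q = 0" if "q \<in> K i" "i < j" for q i j
  proof -
    have "q \<in> K (j - 1)" using subsetD[OF mono[of i "j - 1"] that(1)] that(2) by simp
    then show ?thesis using z(5,6) unfolding \<sigma>_def by blast
  qed
  have cpws: "cpws (\<sigma> j)" for j
    by (rule cpsI[OF pws_smooth[OF \<sigma>(1)] z(4)[of j]]) (simp add: \<sigma>_def z(6))
  have [measurable]: "\<sigma> j \<in> borel_measurable borel" for j by (rule loc_lip_borel[OF cpws_loc_lip[OF cpws]])
  have int: "integrable mu (\<sigma> j)" for j
  proof -
    obtain C where C: "\<And>p. \<bar>\<sigma> j p\<bar> \<le> C" using cpws_bounded[OF cpws] by blast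
    show ?thesis
    proof (rule integrable_compact[OF _ z(4)[of j], of _ C])
      show "AE p in mu. p \<in> snd (z j) \<longrightarrow> \<bar>\<sigma> j p\<bar> \<le> C" using C by simp
      show "AE p in mu. p \<notin> snd (z j) \<longrightarrow> \<sigma> j p = 0" by (simp add: \<sigma>_def z(6))
    qed simp
  qed
  define a where "a j = (1 / 2) ^ j / (1 + (\<integral>p. \<sigma> j p \<partial>mu))" for j
  have I0: "(\<integral>p. \<sigma> j p \<partial>mu) \<ge> 0" for j by (simp add: \<sigma>(2))
  have a: "a j > 0" for j unfolding a_def using I0[of j] by simp
  have aI: "a j * (\<integral>p. \<sigma> j p \<partial>mu) \<le> (1 / 2) ^ j" for j
  proof -
    have "(1 / 2) ^ j * ((\<integral>p. \<sigma> j p \<partial>mu) / (1 + (\<integral>p. \<sigma> j p \<partial>mu))) \<le> (1 / 2 :: real) ^ j"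
      using I0[of j] by (intro mult_right_le_one_le) (auto simp: divide_le_eq)
    then show ?thesis by (simp add: a_def)
  qed
  define f where "f p = (\<Sum>j. a j * \<sigma> j p)" for p
  have fin: "f p = (\<Sum>j\<le>i. a j * \<sigma> j p)" if p: "p \<in> K i" for p i
    unfolding f_def by (rule suminf_finite) (use \<sigma>0[OF p] in auto)
  have summ: "summable (\<lambda>j. a j * \<sigma> j p)" for p
  proof -
    obtain i where "p \<in> K i" using K(4) by blast
    then show ?thesis by (intro summable_finite[of "{..i}"]) (use \<sigma>0 in auto)
  qed
  have pos: "f p > 0" for p
  proof -
    obtain i where "p \<in> K i" using K(4) by blast
    \<comment> \<open>The first set of the exhaustion that contains \<open>p\<close> puts
      \<open>p\<close> into a shell whose bump is positive at \<open>p\<close>.\<close>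
    define k where "k = (LEAST i. p \<in> K i)"
    have k: "p \<in> K k" unfolding k_def by (rule LeastI[where P = "\<lambda>i. p \<in> K i", OF \<open>p \<in> K i\<close>])
    obtain j where j: "k = Suc j" using k K(1) by (cases k) auto
    have "p \<notin> K j" using not_less_Least[of j "\<lambda>i. p \<in> K i"] j unfolding k_def by simp
    then have "\<sigma> j p > 0" using k j interior_subset[of "K j"] by (intro \<sigma>(3)) auto
    then show ?thesis unfolding f_def using a \<sigma>(2)
      by (intro suminf_pos2[OF summ, of _ j]) (auto intro: mult_nonneg_nonneg less_imp_le)
  qed
  have smooth: "smooth_fun_on A UNIV f"
    unfolding smooth_fun_on_def
  proof (intro ballI smooth_on_local)
    fix c y assume c: "c \<in> A" and y: "y \<in> snd c ` (fst c \<inter> UNIV)"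
    then obtain q where q: "q \<in> fst c" "y = snd c q" by auto
    obtain i where "q \<in> K i" using K(4) by blast
    then have qi: "q \<in> interior (K (Suc i))" using K(3) by blast
    define T where "T = snd c ` (fst c \<inter> interior (K (Suc i)))"
    have T: "open T" "y \<in> T" unfolding T_def using q qi by (auto intro!: open_chart_image[OF c])
    have "smooth_fun_on A UNIV (\<lambda>p. \<Sum>j\<le>Suc i. a j * \<sigma> j p)"
      by (intro smooth_fun_on_sum smooth_fun_on_mult smooth_fun_on_const \<sigma>(1)) auto
    then have "smooth_on (V c) (in_chart c (\<lambda>p. \<Sum>j\<le>Suc i. a j * \<sigma> j p))"
      using c by (simp add: smooth_fun_on_def)
    then have "smooth_on T (in_chart c (\<lambda>p. \<Sum>j\<le>Suc i. a j * \<sigma> j p))"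
      by (rule smooth_on_subset) (auto simp: T_def)
    then have "smooth_on T (in_chart c f)"
    proof (rule smooth_on_cong[OF T(1), rotated])
      fix x assume "x \<in> T"
      then obtain p where "p \<in> fst c" "p \<in> K (Suc i)" "x = snd c p" unfolding T_def using interior_subset by blast
      then show "in_chart c (\<lambda>p. \<Sum>j\<le>Suc i. a j * \<sigma> j p) x = in_chart c f x"
        by (simp only: in_chart_at[OF c] fin)
    qed
    then show "\<exists>T. open T \<and> y \<in> T \<and> smooth_on T (in_chart c f)" using T by blast
  qed
  have fb [measurable]: "f \<in> borel_measurable borel" by (rule loc_lip_borel[OF pws_loc_lip[OF pws_smooth[OF smooth]]])
  have "integrable mu f"
  proof (rule integrableI_nonneg)
    show "AE p in mu. 0 \<le> f p" using pos by (simp add: less_imp_le)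
    have "(\<integral>\<^sup>+p. ennreal (f p) \<partial>mu) = (\<integral>\<^sup>+p. (\<Sum>j. ennreal (a j * \<sigma> j p)) \<partial>mu)"
      unfolding f_def using a \<sigma>(2) summ
      by (intro nn_integral_cong suminf_ennreal2[symmetric]) (auto intro: mult_nonneg_nonneg less_imp_le)
    also have "\<dots> = (\<Sum>j. \<integral>\<^sup>+p. ennreal (a j * \<sigma> j p) \<partial>mu)" by (rule nn_integral_suminf) simp
    also have "\<dots> = (\<Sum>j. ennreal (a j * (\<integral>p. \<sigma> j p \<partial>mu)))"
    proof (rule suminf_cong)
      fix j
      have "(\<integral>\<^sup>+p. ennreal (a j * \<sigma> j p) \<partial>mu) = ennreal (\<integral>p. a j * \<sigma> j p \<partial>mu)"
      proof (rule nn_integral_eq_integral)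
        show "AE p in mu. 0 \<le> a j * \<sigma> j p" by (intro AE_I2 mult_nonneg_nonneg less_imp_le[OF a] \<sigma>(2))
      qed (use int in simp)
      then show "(\<integral>\<^sup>+p. ennreal (a j * \<sigma> j p) \<partial>mu) = ennreal (a j * (\<integral>p. \<sigma> j p \<partial>mu))" by simp
    qed
    also have "\<dots> \<le> (\<Sum>j. ennreal ((1 / 2) ^ j))" by (intro suminf_le ennreal_leI aI) auto
    also have "\<dots> = ennreal (\<Sum>j. (1 / 2) ^ j)" by (rule suminf_ennreal2) auto
    also have "\<dots> < \<infinity>" by simp
    finally show "(\<integral>\<^sup>+p. ennreal (f p) \<partial>mu) < \<infinity>" .
  qed simp
  then show ?thesis using smooth pos by blast
qed


subsection \<open>The variational problem\<close>

text \<open>The bilinear form of the quadratic part of the functional, kept polarized so that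
  variations in a direction can be expanded.\<close>

definition energy :: "('a \<Rightarrow> real) \<Rightarrow> ('a \<Rightarrow> real) \<Rightarrow> ('a \<Rightarrow> real) \<Rightarrow> real" where
  "energy f v w = (\<integral>p. bgrad_ip v w p + f p * (v p * w p) \<partial>mu)"

lemma cpws_borel: "cpws v \<Longrightarrow> v \<in> borel_measurable borel" by (rule loc_lip_borel[OF cpws_loc_lip])

lemma cpws_AE: "cpws v \<Longrightarrow> AE p in mu. diff_at v p" by (rule loc_lip_AE[OF cpws_loc_lip])

lemma cpws_zero: "cpws (\<lambda>p. 0)" by (rule cpsI[OF pws_const, of "{}"]) auto

text \<open>Where \<open>0 < v < 1\<close> the truncation coincides with \<open>v\<close> nearby. At
  every other point it has a global extremum, so its gradient vanishes if it exists.\<close>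

lemma bgrad_ip_truncate:
  assumes v: "cpws v"
  defines "v' \<equiv> \<lambda>p. min 1 (max 0 (v p))"
  shows "cpws v'" "AE p in mu. bgrad_ip v' v' p \<le> bgrad_ip v v p"
proof -
  obtain K where K: "compact K" "\<And>p. p \<notin> K \<Longrightarrow> v p = 0" using cpws_support[OF v] by blast
  have "pws v'" unfolding v'_def by (intro pws_min pws_max pws_const cpws_pws v)
  then show c: "cpws v'" by (rule cpsI[OF _ K(1)]) (simp add: v'_def K(2))
  have cont: "continuous_on UNIV v" by (rule pws_continuous[OF cpws_pws[OF v]])
  show "AE p in mu. bgrad_ip v' v' p \<le> bgrad_ip v v p"
    using cpws_AE[OF v] cpws_AE[OF c]
  proof eventually_elim
    case (elim p)
    show ?case
    proof (cases "0 < v p \<and> v p < 1")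
      case True
      have W: "open (v -` {0<..<1})" by (rule open_vimage[OF open_greaterThanLessThan cont])
      have e: "v' q = v q" if "q \<in> v -` {0<..<1}" for q using that by (simp add: v'_def)
      have "grad_ip v' v' p = grad_ip v v' p" by (rule grad_ip_cong[OF W _ e]) (use True in auto)
      also have "\<dots> = grad_ip v' v p" by (rule grad_ip_commute)
      also have "\<dots> = grad_ip v v p" by (rule grad_ip_cong[OF W _ e]) (use True in auto)
      finally show ?thesis using elim by (simp add: bgrad_ip_eq)
    next
      case False
      then have "(\<forall>q. v' q \<le> v' p) \<or> (\<forall>q. v' p \<le> v' q)" by (auto simp: v'_def)
      then have "grad_ip v' v' p = 0" by (rule grad_ip_extremum(1)[OF elim(2)])
      then show ?thesis using elim by (simp add: bgrad_ip_eq grad_ip_nonneg)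
    qed
  qed
qed

lemma wl_zero_outside:
  assumes u: "Ck_fun A 2 u" and K: "closed K" "\<And>p. p \<notin> K \<Longrightarrow> u p = 0" and p: "p \<notin> K"
  shows "wl u p = 0"
proof -
  obtain c where c: "c \<in> A" "p \<in> fst c" using ex_chart by blast
  define T where "T = snd c ` (fst c \<inter> - K)"
  have T: "open T" "snd c p \<in> T" unfolding T_def using c p K(1) by (auto intro!: open_chart_image)
  have u0: "in_chart c u y = 0" if "y \<in> T" for y
    using that chart(5)[OF c(1)] K(2) by (auto simp: T_def in_chart_def)
  have "pd j (in_chart c u) y = 0" if "y \<in> T" for y j
    using pd_cong_open[OF T(1) that u0, where i = j] by simp
  then have f0: "(\<Sum>j\<in>UNIV. flux_coeff c i j y * pd j (in_chart c u) y) = 0" if "y \<in> T" for i y using that by simp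
  have "pd i (\<lambda>y. \<Sum>j\<in>UNIV. flux_coeff c i j y * pd j (in_chart c u) y) (snd c p) = 0" for i
    using pd_cong_open[OF T f0, where i = i] by simp
  then show ?thesis by (simp add: wl_chart[OF c u] coord_wl_def div_op_def)
qed

lemma wl_const: "wl (\<lambda>p. k) p = 0"
proof -
  obtain c where c: "c \<in> A" "p \<in> fst c" using ex_chart by blast
  have "Ck_fun A 2 (\<lambda>p. k)" by (rule smooth_Ck_fun[OF smooth_fun_on_const])
  from wl_chart[OF c this] show ?thesis by (simp add: coord_wl_def div_op_def in_chart_const)
qed

text \<open>\<open>u\<close> need not have compact support, so it is multiplied by a cutoff equal to
  \<open>1\<close> on \<open>K\<close>. The cutoff attains its maximum there, so its gradient
  contributes nothing, and both sides arise from the same gradient product.\<close>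

lemma wl_symmetric:
  assumes w: "Ck_fun A 2 w" and K: "compact K" "\<And>p. p \<notin> K \<Longrightarrow> w p = 0" and u: "Ck_fun A 2 u"
  shows "(\<integral>p. u p * wl w p \<partial>mu) = (\<integral>p. w p * wl u p \<partial>mu)"
proof -
  obtain \<eta> K' where e: "cpws \<eta>" "\<And>q. \<eta> q \<le> 1" "\<And>q. q \<in> K \<Longrightarrow> \<eta> q = 1" "compact K'" "\<And>q. q \<notin> K' \<Longrightarrow> \<eta> q = 0"
    using cutoff[OF K(1) open_UNIV subset_UNIV] by (elim exE conjE) (rule that, assumption, auto)
  have C: "diff_at w p" "diff_at u p" "loc_lip w" "loc_lip u" for p
    by (rule C2_diff_at C2_loc_lip w u)+
  define h where "h p = \<eta> p * u p" for p
  have h: "loc_lip h" unfolding h_def[abs_def] by (intro loc_lip_mult cpws_loc_lip e C)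
  have "IBP w h" by (rule IBP_compact[OF h e(4) _ w]) (simp add: h_def e(5))
  then have 1: "(\<integral>p. bgrad_ip h w p \<partial>mu) = - (\<integral>p. h p * wl w p \<partial>mu)" by (simp add: IBP_def)
  have "IBP u w" by (rule IBP_compact[OF C(3) K u])
  then have 2: "(\<integral>p. bgrad_ip w u p \<partial>mu) = - (\<integral>p. w p * wl u p \<partial>mu)" by (simp add: IBP_def)
  have "h p * wl w p = u p * wl w p" for p
    using wl_zero_outside[OF w compact_imp_closed[OF K(1)] K(2)] e(3)[of p] by (cases "p \<in> K") (auto simp: h_def)
  then have "(\<lambda>p. h p * wl w p) = (\<lambda>p. u p * wl w p)" by (rule ext)
  then have 3: "(\<integral>p. h p * wl w p \<partial>mu) = (\<integral>p. u p * wl w p \<partial>mu)" by simp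
  note [measurable] = loc_lip_borel[OF h] loc_lip_borel[OF C(3)] loc_lip_borel[OF C(4)]
  have "AE p in mu. bgrad_ip h w p = bgrad_ip w u p"
    using loc_lip_AE[OF h] cpws_AE[OF e(1)]
  proof eventually_elim
    case (elim p)
    show ?case
    proof (cases "p \<in> K")
      case True
      have "grad_ip h w p = \<eta> p * grad_ip u w p + u p * grad_ip \<eta> w p"
        unfolding h_def[abs_def] by (rule grad_ip_mult[OF elim(2) C(2)])
      also have "grad_ip \<eta> w p = 0" by (rule grad_ip_extremum(1)[OF elim(2)]) (use e(2) e(3)[OF True] in simp)
      finally show ?thesis using elim by (simp add: bgrad_ip_eq C e(3)[OF True] grad_ip_commute[of u])
    next
      case False
      have "grad_ip w u p = 0" "grad_ip w h p = 0"
        using diff_at_zero_outside(2)[OF compact_imp_closed[OF K(1)] K(2) False] by auto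
      then show ?thesis using elim by (simp add: bgrad_ip_eq C grad_ip_commute[of h])
    qed
  qed
  then have "(\<integral>p. bgrad_ip h w p \<partial>mu) = (\<integral>p. bgrad_ip w u p \<partial>mu)" by (intro integral_cong_AE) auto
  then show ?thesis using 1 2 3 by simp
qed

section \<open>The minimizing sequence for a fixed weight\<close>

context
  fixes f :: "'a \<Rightarrow> real"
  assumes fs: "smooth_fun_on A UNIV f" and fpos: "\<And>p. f p > 0" and fint: "integrable mu f"
begin

lemma f_borel [measurable]: "f \<in> borel_measurable borel"
  by (rule loc_lip_borel[OF pws_loc_lip[OF pws_smooth[OF fs]]])

lemma integrable_weighted:
  assumes [measurable]: "b \<in> borel_measurable borel" and b: "\<And>p. \<bar>b p\<bar> \<le> C"
  shows "integrable mu (\<lambda>p. f p * b p)"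
proof (rule Bochner_Integration.integrable_bound[of mu "\<lambda>p. C * f p"])
  show "AE p in mu. norm (f p * b p) \<le> norm (C * f p)"
  proof (rule AE_I2)
    fix p
    have "\<bar>b p\<bar> * f p \<le> \<bar>C\<bar> * f p" using b[of p] fpos[of p] by (intro mult_right_mono) auto
    then show "norm (f p * b p) \<le> norm (C * f p)" using fpos[of p] by (simp add: abs_mult mult.commute)
  qed
qed (use fint in auto)

lemma integrable_weighted_cpws:
  assumes v: "cpws v" and w: "cpws w"
  shows "integrable mu (\<lambda>p. f p * v p)" "integrable mu (\<lambda>p. f p * (v p * w p))"
proof -
  note [measurable] = cpws_borel[OF v] cpws_borel[OF w]
  obtain C D where C: "\<And>p. \<bar>v p\<bar> \<le> C" and D: "\<And>p. \<bar>w p\<bar> \<le> D" using cpws_bounded[OF v] cpws_bounded[OF w] by blast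
  show "integrable mu (\<lambda>p. f p * v p)" by (rule integrable_weighted[OF _ C]) simp
  have "C \<ge> 0" using C abs_ge_zero order_trans by blast
  then show "integrable mu (\<lambda>p. f p * (v p * w p))"
    by (intro integrable_weighted[where C = "C * D"]) (auto simp: abs_mult intro!: mult_mono C D)
qed

lemma integrable_energy: "cpws v \<Longrightarrow> cpws w \<Longrightarrow> integrable mu (\<lambda>p. bgrad_ip v w p + f p * (v p * w p))"
  using cpws_energy_integrable integrable_weighted_cpws(2) by (intro Bochner_Integration.integrable_add)

lemma energy_nonneg:
  assumes v: "cpws v" shows "(\<integral>p. f p * (v p)\<^sup>2 \<partial>mu) \<le> energy f v v" "energy f v v \<ge> 0"
proof -
  have AE: "AE p in mu. 0 \<le> bgrad_ip v v p" using cpws_AE[OF v] by eventually_elim (simp add: bgrad_ip_eq grad_ip_nonneg)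
  show "(\<integral>p. f p * (v p)\<^sup>2 \<partial>mu) \<le> energy f v v"
    unfolding energy_def power2_eq_square
    by (rule integral_mono_AE[OF integrable_weighted_cpws(2)[OF v v] integrable_energy[OF v v]]) (use AE in \<open>eventually_elim, simp\<close>)
  moreover have "0 \<le> (\<integral>p. f p * (v p)\<^sup>2 \<partial>mu)" using fpos by (simp add: less_imp_le)
  ultimately show "energy f v v \<ge> 0" by linarith
qed

lemma energy_expand:
  assumes v: "cpws v" and w: "cpws w"
  shows "energy f (\<lambda>p. v p + t * w p) (\<lambda>p. v p + t * w p) = energy f v v + 2 * t * energy f v w + t\<^sup>2 * energy f w w"
proof -
  define z where "z p = v p + t * w p" for p
  have tw: "cpws (\<lambda>p. t * w p)" by (rule cpws_scale[OF w])
  have z: "cpws z" unfolding z_def[abs_def] by (rule cpws_add[OF v tw])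
  note [measurable] = cpws_borel[OF v] cpws_borel[OF w] cpws_borel[OF z]
  have "energy f z z = (\<integral>p. (bgrad_ip v v p + f p * (v p * v p)) + (2 * t * (bgrad_ip v w p + f p * (v p * w p)) + t\<^sup>2 * (bgrad_ip w w p + f p * (w p * w p))) \<partial>mu)"
    unfolding energy_def
  proof (rule integral_cong_AE)
    show "AE p in mu. bgrad_ip z z p + f p * (z p * z p) = (bgrad_ip v v p + f p * (v p * v p)) + (2 * t * (bgrad_ip v w p + f p * (v p * w p)) + t\<^sup>2 * (bgrad_ip w w p + f p * (w p * w p)))"
      using cpws_AE[OF v] cpws_AE[OF w] cpws_AE[OF z] cpws_AE[OF tw]
    proof eventually_elim
      case (elim p)
      have 1: "grad_ip z k p = grad_ip v k p + t * grad_ip w k p" for k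
        unfolding z_def[abs_def] by (simp add: grad_ip_add[OF elim(1,4)] grad_ip_scale[OF elim(2)])
      have "grad_ip z z p = grad_ip v z p + t * grad_ip w z p" by (rule 1)
      also have "grad_ip v z p = grad_ip v v p + t * grad_ip v w p" using 1[of v] by (simp only: grad_ip_commute[of v z] grad_ip_commute[of w v])
      also have "grad_ip w z p = grad_ip v w p + t * grad_ip w w p" using 1[of w] by (simp only: grad_ip_commute[of w z])
      finally have "grad_ip z z p = grad_ip v v p + 2 * t * grad_ip v w p + t\<^sup>2 * grad_ip w w p"
        by (simp add: algebra_simps power2_eq_square)
      then show ?case using elim by (simp add: bgrad_ip_eq) (simp add: z_def algebra_simps power2_eq_square)
    qed
  qed auto
  also have "\<dots> = energy f v v + (2 * t * energy f v w + t\<^sup>2 * energy f w w)"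
  proof -
    have sum: "(\<integral>p. X p + (a * Y p + b * Z p) \<partial>mu) = integral\<^sup>L mu X + (a * integral\<^sup>L mu Y + b * integral\<^sup>L mu Z)"
      if "integrable mu X" "integrable mu Y" "integrable mu Z" for X Y Z :: "'a \<Rightarrow> real" and a b
      using that by simp
    show ?thesis unfolding energy_def by (rule sum[OF integrable_energy[OF v v] integrable_energy[OF v w] integrable_energy[OF w w]])
  qed
  finally show ?thesis unfolding z_def[abs_def] by simp
qed

text \<open>The functional to be minimized without its constant part, the integral of
  \<open>f\<close>; the quadratic and the linear term in \<open>v\<close> remain.\<close>

definition excess :: "('a \<Rightarrow> real) \<Rightarrow> real" where
  "excess v = energy f v v - 2 * (\<integral>p. f p * v p \<partial>mu)"

lemma excess_expand:
  assumes v: "cpws v" and w: "cpws w"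
  shows "excess (\<lambda>p. v p + t * w p) = excess v + 2 * t * (energy f v w - (\<integral>p. f p * w p \<partial>mu)) + t\<^sup>2 * energy f w w"
proof -
  have "(\<integral>p. f p * (v p + t * w p) \<partial>mu) = (\<integral>p. f p * v p + t * (f p * w p) \<partial>mu)"
    by (simp add: algebra_simps)
  also have "\<dots> = (\<integral>p. f p * v p \<partial>mu) + t * (\<integral>p. f p * w p \<partial>mu)"
    using integrable_weighted_cpws(1)[OF v v] integrable_weighted_cpws(1)[OF w w] by simp
  finally show ?thesis unfolding excess_def energy_expand[OF assms] by (simp add: algebra_simps)
qed

lemma excess_integral:
  assumes v: "cpws v"
  shows "excess v + (\<integral>p. f p \<partial>mu) = (\<integral>p. bgrad_ip v v p + f p * (1 - v p)\<^sup>2 \<partial>mu)"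
    and "integrable mu (\<lambda>p. bgrad_ip v v p + f p * (1 - v p)\<^sup>2)"
proof -
  have *: "(\<lambda>p. bgrad_ip v v p + f p * (1 - v p)\<^sup>2) = (\<lambda>p. (bgrad_ip v v p + f p * (v p * v p)) - 2 * (f p * v p) + f p)"
    by (rule ext) (simp add: algebra_simps power2_eq_square)
  note i = integrable_energy[OF v v] integrable_weighted_cpws(1)[OF v v]
  show "excess v + (\<integral>p. f p \<partial>mu) = (\<integral>p. bgrad_ip v v p + f p * (1 - v p)\<^sup>2 \<partial>mu)"
  proof -
    have sum: "(\<integral>p. X p - 2 * Y p + Z p \<partial>mu) = integral\<^sup>L mu X - 2 * integral\<^sup>L mu Y + integral\<^sup>L mu Z"
      if "integrable mu X" "integrable mu Y" "integrable mu Z" for X Y Z :: "'a \<Rightarrow> real"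
      using that by simp
    show ?thesis unfolding * excess_def energy_def by (rule sum[OF i fint, symmetric])
  qed
  show "integrable mu (\<lambda>p. bgrad_ip v v p + f p * (1 - v p)\<^sup>2)"
    unfolding * by (rule Bochner_Integration.integrable_add[OF Bochner_Integration.integrable_diff[OF i(1) integrable_mult_right[OF i(2)]] fint])
qed

lemma excess_bounded_below:
  assumes v: "cpws v" shows "excess v \<ge> - (\<integral>p. f p \<partial>mu)"
proof -
  have "0 \<le> (\<integral>p. bgrad_ip v v p + f p * (1 - v p)\<^sup>2 \<partial>mu)"
    by (rule integral_nonneg_AE) (use cpws_AE[OF v] in \<open>eventually_elim, simp add: bgrad_ip_eq grad_ip_nonneg fpos less_imp_le\<close>)
  then show ?thesis using excess_integral(1)[OF v] by linarith
qed

lemma excess_truncate: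
  assumes v: "cpws v" shows "excess (\<lambda>p. min 1 (max 0 (v p))) \<le> excess v"
proof -
  have "(\<integral>p. bgrad_ip (\<lambda>p. min 1 (max 0 (v p))) (\<lambda>p. min 1 (max 0 (v p))) p + f p * (1 - min 1 (max 0 (v p)))\<^sup>2 \<partial>mu) \<le> (\<integral>p. bgrad_ip v v p + f p * (1 - v p)\<^sup>2 \<partial>mu)"
  proof (rule integral_mono_AE[OF excess_integral(2)[OF bgrad_ip_truncate(1)[OF v]] excess_integral(2)[OF v]])
    show "AE p in mu. bgrad_ip (\<lambda>p. min 1 (max 0 (v p))) (\<lambda>p. min 1 (max 0 (v p))) p + f p * (1 - min 1 (max 0 (v p)))\<^sup>2 \<le> bgrad_ip v v p + f p * (1 - v p)\<^sup>2"
      using bgrad_ip_truncate(2)[OF v]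
    proof eventually_elim
      case (elim p)
      have "(1 - min 1 (max 0 (v p)))\<^sup>2 \<le> (1 - v p)\<^sup>2"
        by (rule abs_le_square_iff[THEN iffD1]) auto
      then have "f p * (1 - min 1 (max 0 (v p)))\<^sup>2 \<le> f p * (1 - v p)\<^sup>2"
        using fpos[of p] by (intro mult_left_mono) auto
      then show ?case using elim by (rule add_mono[rotated])
    qed
  qed
  then show ?thesis using excess_integral(1)[OF v] excess_integral(1)[OF bgrad_ip_truncate(1)[OF v]] by linarith
qed

text \<open>What is kept of a minimizing sequence: an approximate Euler-Lagrange equation and small
  increments. The rate \<open>(1/4)^k\<close> is chosen because its square root
  \<open>(1/2)^k\<close> is still summable.\<close>

definition minseq :: "(nat \<Rightarrow> 'a \<Rightarrow> real) \<Rightarrow> bool" where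
  "minseq v \<longleftrightarrow> (\<forall>k. cpws (v k)) \<and> (\<forall>k p. 0 \<le> v k p \<and> v k p \<le> 1) \<and>
    (\<forall>k w. cpws w \<longrightarrow> (energy f (v k) w - (\<integral>p. f p * w p \<partial>mu))\<^sup>2 \<le> (1/4)^k * energy f w w) \<and>
    (\<forall>k. (\<integral>p. f p * (v (Suc k) p - v k p)\<^sup>2 \<partial>mu) \<le> 4 * (1/4)^k)"

lemma ex_minseq: "\<exists>v. minseq v"
proof -
  define m where "m = (INF v\<in>{v. cpws v}. excess v)"
  have bdd: "bdd_below (excess ` {v. cpws v})" using excess_bounded_below by (intro bdd_belowI2) auto
  have m: "m \<le> excess v" if "cpws v" for v unfolding m_def by (rule cINF_lower[OF bdd]) (use that in simp)
  have "\<exists>v. cpws v \<and> (\<forall>p. 0 \<le> v p \<and> v p \<le> 1) \<and> excess v \<le> m + (1/4)^k" for k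
  proof -
    have "\<exists>v\<in>{v. cpws v}. excess v < m + (1/4)^k"
      unfolding m_def by (rule cINF_less_iff[OF _ bdd, THEN iffD1]) (use cpws_zero in auto)
    then obtain v where v: "cpws v" "excess v < m + (1/4)^k" by auto
    show ?thesis
      by (rule exI[of _ "\<lambda>p. min 1 (max 0 (v p))"])
        (use bgrad_ip_truncate(1)[OF v(1)] excess_truncate[OF v(1)] v(2) in auto)
  qed
  then have "\<forall>k. \<exists>v. cpws v \<and> (\<forall>p. 0 \<le> v p \<and> v p \<le> 1) \<and> excess v \<le> m + (1/4)^k" by blast
  from choice[OF this] obtain v where v: "\<And>k. cpws (v k)" "\<And>k p. 0 \<le> v k p" "\<And>k p. v k p \<le> 1" "\<And>k. excess (v k) \<le> m + (1/4)^k"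
    by blast
  \<comment> \<open>Along \<open>w\<close> the change of \<open>excess\<close> is a quadratic
    polynomial in \<open>t\<close> that is bounded below by \<open>- (1/4)^k\<close>; its
    discriminant gives the estimate.\<close>
  have EL: "(energy f (v k) w - (\<integral>p. f p * w p \<partial>mu))\<^sup>2 \<le> (1/4)^k * energy f w w" if w: "cpws w" for k w
  proof -
    define b where "b = energy f (v k) w - (\<integral>p. f p * w p \<partial>mu)"
    have "b\<^sup>2 \<le> energy f w w * (1/4)^k"
    proof (rule quadratic_nonneg_discriminant)
      fix t :: real
      have "m \<le> excess (\<lambda>p. v k p + t * w p)" by (intro m cpws_add cpws_scale v w)
      then show "energy f w w * t\<^sup>2 + 2 * b * t + (1/4)^k \<ge> 0"
        using v(4)[of k] unfolding excess_expand[OF v(1) w] b_def by (simp add: algebra_simps)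
    qed (rule energy_nonneg(2)[OF w])
    then show ?thesis by (simp add: b_def mult.commute)
  qed
  \<comment> \<open>Parallelogram argument: \<open>excess\<close> at the midpoint of two
    near-minimizers is at least \<open>m\<close>, so their difference has small energy.\<close>
  have D: "(\<integral>p. f p * (v (Suc k) p - v k p)\<^sup>2 \<partial>mu) \<le> 4 * (1/4)^k" for k
  proof -
    define d where "d p = v (Suc k) p + (-1) * v k p" for p
    have d: "cpws d" unfolding d_def[abs_def] by (intro cpws_add cpws_scale v)
    define b where "b = energy f (v k) d - (\<integral>p. f p * d p \<partial>mu)"
    have 1: "excess (v (Suc k)) = excess (v k) + 2 * b + energy f d d"
      using excess_expand[OF v(1)[of k] d, of 1] by (simp add: b_def d_def)
    have "m \<le> excess (\<lambda>p. v k p + 1/2 * d p)" by (intro m cpws_add cpws_scale v d)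
    then have 2: "m \<le> excess (v k) + b + energy f d d / 4"
      using excess_expand[OF v(1)[of k] d, of "1/2"] by (simp add: b_def power2_eq_square)
    have "energy f d d \<le> 2 * (1/4)^k + 2 * (1/4)^Suc k" using 1 2 v(4)[of k] v(4)[of "Suc k"] by linarith
    also have "\<dots> \<le> 4 * (1/4)^k" by simp
    finally have "energy f d d \<le> 4 * (1/4)^k" .
    then show ?thesis using energy_nonneg(1)[OF d] by (simp add: d_def)
  qed
  show ?thesis unfolding minseq_def using v EL D by blast
qed

lemma minseq_limit:
  assumes v: "minseq v"
  shows "\<exists>u. u \<in> borel_measurable borel \<and> (\<forall>p. 0 \<le> u p \<and> u p \<le> 1) \<and> (AE p in mu. (\<lambda>k. v k p) \<longlonglongrightarrow> u p)"
proof -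
  have c: "cpws (v k)" and v01: "0 \<le> v k p" "v k p \<le> 1" 
    and D: "(\<integral>p. f p * (v (Suc k) p - v k p)\<^sup>2 \<partial>mu) \<le> 4 * (1/4)^k" for k p
    using v unfolding minseq_def by auto
  have [measurable]: "v k \<in> borel_measurable borel" for k by (rule cpws_borel[OF c])
  define d where "d k p = \<bar>v (Suc k) p - v k p\<bar>" for k p
  have [measurable]: "d k \<in> borel_measurable borel" for k unfolding d_def by measurable
  have d1: "d k p \<le> 1" "d k p \<ge> 0" for k p using v01[of k p] v01[of "Suc k" p] by (auto simp: d_def)
  define c0 where "c0 = (\<integral>p. f p \<partial>mu)"
  have c0: "c0 \<ge> 0" unfolding c0_def using fpos by (simp add: less_imp_le)
  \<comment> \<open>The weights \<open>2^k\<close> and \<open>(1/2)^k\<close> trade squared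
    increments, with integrals of size \<open>(1/4)^k\<close>, for first powers with integrals of
    size \<open>(1/2)^k\<close>, which can be summed.\<close>
  have le: "d k p \<le> (1/2)^k + 2^k * (d k p)\<^sup>2" for k p
  proof -
    have "2 * d k p = 2 * sqrt ((1/2)^k * (2^k * (d k p)\<^sup>2))"
      using d1(2) by (simp add: power_mult_distrib[symmetric] mult.assoc[symmetric])
    also have "\<dots> \<le> (1/2)^k + 2^k * (d k p)\<^sup>2"
      using arith_geo_mean_sqrt[of "(1/2)^k" "2^k * (d k p)\<^sup>2"] by simp
    finally show ?thesis using d1(2)[of k p] by linarith
  qed
  have i1: "integrable mu (\<lambda>p. f p * d k p)" for k by (rule integrable_weighted[of _ 1]) (use d1 in \<open>auto simp: abs_le_iff intro: order_trans[of _ 0]\<close>)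
  have i2: "integrable mu (\<lambda>p. f p * (d k p)\<^sup>2)" for k
    by (rule integrable_weighted[of _ 1]) (use d1 in \<open>auto simp: power_le_one\<close>)
  have I: "(\<integral>p. f p * d k p \<partial>mu) \<le> (c0 + 4) * (1/2)^k" for k
  proof -
    have "(\<integral>p. f p * d k p \<partial>mu) \<le> (\<integral>p. (1/2)^k * f p + 2^k * (f p * (d k p)\<^sup>2) \<partial>mu)"
    proof (rule integral_mono[OF i1])
      show "integrable mu (\<lambda>p. (1/2)^k * f p + 2^k * (f p * (d k p)\<^sup>2))"
        using fint i2 by (intro Bochner_Integration.integrable_add integrable_mult_right)
      show "f p * d k p \<le> (1/2)^k * f p + 2^k * (f p * (d k p)\<^sup>2)" for p
        using mult_left_mono[OF le[of k p], of "f p"] fpos[of p] by (simp add: algebra_simps)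
    qed
    also have "\<dots> = (1/2)^k * c0 + 2^k * (\<integral>p. f p * (d k p)\<^sup>2 \<partial>mu)"
      using fint i2[of k] by (simp add: c0_def)
    also have "\<dots> \<le> (1/2)^k * c0 + 2^k * (4 * (1/4)^k)"
      using D[of k] by (intro add_left_mono mult_left_mono) (auto simp: d_def)
    also have "(2::real)^k * (4 * (1/4)^k) = 4 * (1/2)^k" 
      by (simp add: power_mult_distrib[symmetric] mult.left_commute)
    finally show ?thesis by (simp add: algebra_simps)
  qed
  have "(\<integral>\<^sup>+p. (\<Sum>k. ennreal (f p * d k p)) \<partial>mu) = (\<Sum>k. \<integral>\<^sup>+p. ennreal (f p * d k p) \<partial>mu)"
    by (rule nn_integral_suminf) simp
  also have "\<dots> = (\<Sum>k. ennreal (\<integral>p. f p * d k p \<partial>mu))"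
    by (intro suminf_cong nn_integral_eq_integral i1 AE_I2 mult_nonneg_nonneg less_imp_le[OF fpos] d1(2))
  also have "\<dots> \<le> (\<Sum>k. ennreal ((c0 + 4) * (1/2)^k))" by (intro suminf_le ennreal_leI I) auto
  also have "\<dots> = ennreal (\<Sum>k. (c0 + 4) * (1/2)^k)" using c0 by (intro suminf_ennreal2 summable_mult) auto
  finally have "(\<integral>\<^sup>+p. (\<Sum>k. ennreal (f p * d k p)) \<partial>mu) \<noteq> \<infinity>" by (auto simp: top_unique)
  then have "AE p in mu. (\<Sum>k. ennreal (f p * d k p)) \<noteq> \<infinity>"
    by (intro nn_integral_PInf_AE) auto
  then have conv: "AE p in mu. convergent (\<lambda>k. v k p)"
  proof eventually_elim
    case (elim p)
    have "summable (\<lambda>k. f p * d k p)"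
    proof (rule summable_suminf_not_top)
      show "0 \<le> f p * d k p" for k using fpos[of p] d1(2)[of k p] by simp
    qed (use elim in simp)
    then have "summable (\<lambda>k. d k p)" using fpos[of p] by (simp add: summable_cmult_iff)
    then have "summable (\<lambda>k. v (Suc k) p - v k p)" unfolding d_def by (rule summable_rabs_cancel)
    then have "convergent (\<lambda>n. \<Sum>k<n. v (Suc k) p - v k p)" by (simp add: summable_iff_convergent)
    then have "convergent (\<lambda>n. v n p - v 0 p)" unfolding sum_lessThan_telescope[where f = "\<lambda>k. v k p"] .
    then have "convergent (\<lambda>n. (v n p - v 0 p) + v 0 p)" by (intro convergent_add convergent_const)
    then show ?case by simp
  qed
  \<comment> \<open>Clipping makes the bounds hold at every point, also where the sequence diverges
    and \<open>lim\<close> is unspecified. Where it converges the limit is unchanged.\<close>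
  define u where "u p = min 1 (max 0 (lim (\<lambda>k. v k p)))" for p
  have "u \<in> borel_measurable borel" unfolding u_def[abs_def] by measurable
  moreover have "AE p in mu. (\<lambda>k. v k p) \<longlonglongrightarrow> u p"
    using conv
  proof eventually_elim
    case (elim p)
    then have l: "(\<lambda>k. v k p) \<longlonglongrightarrow> lim (\<lambda>k. v k p)" by (simp add: convergent_LIMSEQ_iff)
    have "0 \<le> lim (\<lambda>k. v k p)" "lim (\<lambda>k. v k p) \<le> 1"
      using v01 by (auto intro!: LIMSEQ_le_const[OF l] LIMSEQ_le_const2[OF l])
    then show ?case using l by (simp add: u_def)
  qed
  moreover have "0 \<le> u p \<and> u p \<le> 1" for p by (simp add: u_def)
  ultimately show ?thesis by blast
qed

text \<open>Integrated by parts, the approximate Euler-Lagrange equation passes to the limit by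
  dominated convergence. As the Laplacian of \<open>w\<close> has integral zero, the inhomogeneous
  equation for \<open>u\<close> becomes a homogeneous one for \<open>1 - u\<close>.\<close>

lemma minseq_limit_weak:
  assumes v: "minseq v" and [measurable]: "u \<in> borel_measurable borel" and lim: "AE p in mu. (\<lambda>k. v k p) \<longlonglongrightarrow> u p"
    and u01: "\<And>p. 0 \<le> u p \<and> u p \<le> 1"
    and w: "Ck_fun A 2 w" "cpws w"
  shows "(\<integral>p. (1 - u p) * (wl w p - f p * w p) \<partial>mu) = 0"
proof -
  have c: "cpws (v k)" and v01: "0 \<le> v k p" "v k p \<le> 1" 
    and EL: "cpws w \<Longrightarrow> (energy f (v k) w - (\<integral>p. f p * w p \<partial>mu))\<^sup>2 \<le> (1/4)^k * energy f w w" for k p w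
    using v unfolding minseq_def by auto
  have [measurable]: "v k \<in> borel_measurable borel" "w \<in> borel_measurable borel" for k using cpws_borel c w(2) by auto
  have [measurable]: "wl w \<in> borel_measurable borel" 
    by (rule borel_measurable_continuous_onI[OF wl_continuous[OF w(1)]])
  obtain K where K: "compact K" "\<And>p. p \<notin> K \<Longrightarrow> w p = 0" using cpws_support[OF w(2)] by blast
  have wl0: "wl w p = 0" if "p \<notin> K" for p by (rule wl_zero_outside[OF w(1) compact_imp_closed[OF K(1)] K(2) that])
  have "bounded (wl w ` K)"
    by (intro compact_imp_bounded compact_continuous_image K continuous_on_subset[OF wl_continuous[OF w(1)]]) simp
  then obtain C where C: "\<And>p. p \<in> K \<Longrightarrow> \<bar>wl w p\<bar> \<le> C" unfolding bounded_iff by auto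
  have iwl: "integrable mu (wl w)"
    by (rule integrable_compact[OF _ K(1)]) (use C wl0 in auto)
  have ifw: "integrable mu (\<lambda>p. f p * w p)" by (rule integrable_weighted_cpws(1)[OF w(2) w(2)])
  define F where "F p = f p * w p - wl w p" for p
  have iF: "integrable mu F" unfolding F_def[abs_def] using ifw iwl by simp
  have [measurable]: "F \<in> borel_measurable borel" unfolding F_def[abs_def] by measurable
  have energy: "energy f (v k) w = (\<integral>p. v k p * F p \<partial>mu)" for k
  proof -
    obtain K' where K': "compact K'" "\<And>p. p \<notin> K' \<Longrightarrow> v k p = 0" using cpws_support[OF c] by blast
    have "IBP w (v k)" by (rule IBP_compact[OF cpws_loc_lip[OF c] K' w(1)])
    then have I: "integrable mu (\<lambda>p. v k p * wl w p)" "integrable mu (bgrad_ip (v k) w)" 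
      "(\<integral>p. bgrad_ip (v k) w p \<partial>mu) = - (\<integral>p. v k p * wl w p \<partial>mu)" by (auto simp: IBP_def)
    have i2: "integrable mu (\<lambda>p. f p * (v k p * w p))" by (rule integrable_weighted_cpws(2)[OF c w(2)])
    have "energy f (v k) w = (\<integral>p. f p * (v k p * w p) \<partial>mu) - (\<integral>p. v k p * wl w p \<partial>mu)"
      unfolding energy_def using I i2 by simp
    also have "\<dots> = (\<integral>p. f p * (v k p * w p) - v k p * wl w p \<partial>mu)" using I i2 by simp
    finally show ?thesis by (simp add: F_def algebra_simps)
  qed
  have lim1: "(\<lambda>k. \<integral>p. v k p * F p \<partial>mu) \<longlonglongrightarrow> (\<integral>p. u p * F p \<partial>mu)"
  proof (rule integral_dominated_convergence)
    show "integrable mu (\<lambda>p. \<bar>F p\<bar>)" using iF by simp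
    show "AE p in mu. (\<lambda>k. v k p * F p) \<longlonglongrightarrow> u p * F p"
      using lim by eventually_elim (intro tendsto_intros)
    show "AE p in mu. norm (v k p * F p) \<le> \<bar>F p\<bar>" for k
      using v01 by (auto simp: abs_mult intro!: mult_left_le_one_le)
  qed auto
  have lim2: "(\<lambda>k. energy f (v k) w) \<longlonglongrightarrow> (\<integral>p. f p * w p \<partial>mu)"
  proof -
    have "(\<lambda>k. (1/4::real)^k * energy f w w) \<longlonglongrightarrow> 0 * energy f w w" by (intro tendsto_intros LIMSEQ_realpow_zero) auto
    then have l: "(\<lambda>k. (1/4::real)^k * energy f w w) \<longlonglongrightarrow> 0" by simp
    have "(\<lambda>k. (energy f (v k) w - (\<integral>p. f p * w p \<partial>mu))\<^sup>2) \<longlonglongrightarrow> 0"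
      by (rule tendsto_sandwich[OF always_eventually always_eventually tendsto_const l]) (intro allI zero_le_power2 EL[OF w(2)])+
    from tendsto_real_sqrt[OF this] have "(\<lambda>k. energy f (v k) w - (\<integral>p. f p * w p \<partial>mu)) \<longlonglongrightarrow> 0" 
      by (simp only: real_sqrt_abs real_sqrt_zero tendsto_rabs_zero_iff)
    then show ?thesis by (simp add: LIM_zero_iff)
  qed
  have eq: "(\<integral>p. u p * F p \<partial>mu) = (\<integral>p. f p * w p \<partial>mu)"
    using LIMSEQ_unique[OF lim1 lim2[unfolded energy]] .
  have "(\<integral>p. 1 * wl w p \<partial>mu) = (\<integral>p. w p * wl (\<lambda>p. 1) p \<partial>mu)"
    by (rule wl_symmetric[OF w(1) K smooth_Ck_fun[OF smooth_fun_on_const]])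
  then have wl_int: "(\<integral>p. wl w p \<partial>mu) = 0" by (simp add: wl_const)
  have iuF: "integrable mu (\<lambda>p. u p * F p)"
    by (rule Bochner_Integration.integrable_bound[OF iF]) (use u01 in \<open>auto simp: abs_mult intro!: mult_left_le_one_le\<close>)
  have "(\<integral>p. (1 - u p) * (wl w p - f p * w p) \<partial>mu) = (\<integral>p. wl w p - f p * w p + u p * F p \<partial>mu)"
    by (simp add: F_def algebra_simps)
  also have "\<dots> = (\<integral>p. wl w p \<partial>mu) - (\<integral>p. f p * w p \<partial>mu) + (\<integral>p. u p * F p \<partial>mu)"
    using iwl ifw iuF by simp
  finally show ?thesis using eq wl_int by simp
qed

text \<open>With \<open>w = v k\<close> in the Euler-Lagrange estimate, the energy form tends to the
  integral of \<open>f\<close>. So does the weighted integral of the square, and the difference of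
  the two is the gradient energy.\<close>

lemma minseq_energy:
  assumes v: "minseq v" and lim: "AE p in mu. (\<lambda>k. v k p) \<longlonglongrightarrow> 1"
  shows "(\<lambda>k. \<integral>p. bgrad_ip (v k) (v k) p \<partial>mu) \<longlonglongrightarrow> 0"
proof -
  have c: "cpws (v k)" and v01: "0 \<le> v k p" "v k p \<le> 1" 
    and EL: "(energy f (v k) (v k) - (\<integral>p. f p * v k p \<partial>mu))\<^sup>2 \<le> (1/4)^k * energy f (v k) (v k)" for k p
    using v unfolding minseq_def by auto
  have [measurable]: "v k \<in> borel_measurable borel" for k by (rule cpws_borel[OF c])
  define c0 where "c0 = (\<integral>p. f p \<partial>mu)"
  have l1: "(\<lambda>k. \<integral>p. f p * v k p \<partial>mu) \<longlonglongrightarrow> (\<integral>p. f p * 1 \<partial>mu)"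
  proof (rule integral_dominated_convergence[OF _ _ fint])
    show "AE p in mu. (\<lambda>k. f p * v k p) \<longlonglongrightarrow> f p * 1"
      using lim by eventually_elim (intro tendsto_intros)
    show "AE p in mu. norm (f p * v k p) \<le> f p" for k
      using v01 fpos by (auto simp: abs_mult less_imp_le intro!: mult_right_le_one_le)
  qed auto
  have l2: "(\<lambda>k. \<integral>p. f p * (v k p * v k p) \<partial>mu) \<longlonglongrightarrow> (\<integral>p. f p * (1 * 1) \<partial>mu)"
  proof (rule integral_dominated_convergence[OF _ _ fint])
    show "AE p in mu. (\<lambda>k. f p * (v k p * v k p)) \<longlonglongrightarrow> f p * (1 * 1)"
      using lim by eventually_elim (intro tendsto_intros)
    show "AE p in mu. norm (f p * (v k p * v k p)) \<le> f p" for k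
      using v01 fpos by (auto simp: abs_mult less_imp_le intro!: mult_right_le_one_le mult_le_one)
  qed auto
  define b where "b k = energy f (v k) (v k)" for k
  have b0: "b k \<ge> 0" for k unfolding b_def by (rule energy_nonneg(2)[OF c])
  have diff: "\<bar>b k - (\<integral>p. f p * v k p \<partial>mu)\<bar> \<le> (1/2)^k * (1 + b k)" for k
  proof -
    have "(b k - (\<integral>p. f p * v k p \<partial>mu))\<^sup>2 \<le> (1/4)^k * b k" using EL[of k] by (simp add: b_def)
    \<comment> \<open>The unknown \<open>b k\<close> stands on both sides. Bounding it by
      \<open>(1 + b k)\<^sup>2\<close> makes the estimate linear after taking roots, and for
      \<open>k \<ge> 1\<close> the factor \<open>(1/2)^k\<close> is small enough to absorb
      it.\<close>
    also have "\<dots> \<le> (1/4)^k * (1 + b k)\<^sup>2"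
      using b0[of k] by (intro mult_left_mono) (auto simp: power2_eq_square algebra_simps)
    also have "(1/4)^k * (1 + b k)\<^sup>2 = ((1/2)^k * (1 + b k))\<^sup>2"
    proof -
      have "(1/4::real)^k = ((1/2)^k)\<^sup>2" by (simp add: power2_eq_square flip: power_mult_distrib)
      then show ?thesis by (simp add: power_mult_distrib)
    qed
    finally have "\<bar>b k - (\<integral>p. f p * v k p \<partial>mu)\<bar> \<le> \<bar>(1/2)^k * (1 + b k)\<bar>" by (rule abs_le_square_iff[THEN iffD2])
    then show ?thesis using b0[of k] by simp
  qed
  have lle: "(\<integral>p. f p * v k p \<partial>mu) \<le> c0" for k
    unfolding c0_def
    by (rule integral_mono[OF integrable_weighted_cpws(1)[OF c c] fint])
      (use v01 fpos in \<open>auto intro!: mult_right_le_one_le less_imp_le\<close>)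
  have small: "\<bar>b k - (\<integral>p. f p * v k p \<partial>mu)\<bar> \<le> (1/2)^k * (2 * c0 + 2)" if k: "k \<ge> 1" for k
  proof -
    have "(1/2::real)^k \<le> (1/2)^1" by (rule power_decreasing) (use k in auto)
    then have "(1/2)^k * (1 + b k) \<le> 1/2 * (1 + b k)" using b0[of k] by (intro mult_right_mono) auto
    moreover have "b k - (\<integral>p. f p * v k p \<partial>mu) \<le> (1/2)^k * (1 + b k)" using diff[of k] by (rule abs_le_D1)
    ultimately have "b k - (\<integral>p. f p * v k p \<partial>mu) \<le> 1/2 * (1 + b k)" by (rule order_trans[rotated])
    then have "1 + b k \<le> 2 * c0 + 2" using lle[of k] by (simp add: field_simps)
    then have "(1/2)^k * (1 + b k) \<le> (1/2)^k * (2 * c0 + 2)" by (intro mult_left_mono) auto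
    then show ?thesis using diff[of k] by linarith
  qed
  have "(\<lambda>k. (1/2::real)^k * (2 * c0 + 2)) \<longlonglongrightarrow> 0 * (2 * c0 + 2)"
    by (intro tendsto_intros LIMSEQ_realpow_zero) auto
  then have l: "(\<lambda>k. (1/2::real)^k * (2 * c0 + 2)) \<longlonglongrightarrow> 0" by simp
  have "(\<lambda>k. \<bar>b k - (\<integral>p. f p * v k p \<partial>mu)\<bar>) \<longlonglongrightarrow> 0"
    by (rule tendsto_sandwich[OF always_eventually eventually_sequentiallyI[of 1] tendsto_const l]) (use small in auto)
  then have "(\<lambda>k. b k - (\<integral>p. f p * v k p \<partial>mu)) \<longlonglongrightarrow> 0" by (simp only: tendsto_rabs_zero_iff)
  from tendsto_add[OF this l1] have "b \<longlonglongrightarrow> (\<integral>p. f p \<partial>mu)" by simp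
  from tendsto_diff[OF this l2] have "(\<lambda>k. b k - (\<integral>p. f p * (v k p * v k p) \<partial>mu)) \<longlonglongrightarrow> 0" by simp
  moreover have "b k - (\<integral>p. f p * (v k p * v k p) \<partial>mu) = (\<integral>p. bgrad_ip (v k) (v k) p \<partial>mu)" for k
    unfolding b_def energy_def using cpws_energy_integrable[OF c c] integrable_weighted_cpws(2)[OF c c] by simp
  ultimately show ?thesis by simp
qed

end

end

lemma div_op_cong_open:
  assumes "open S" "x \<in> S" "\<And>y. y \<in> S \<Longrightarrow> v y = w y"
  shows "div_op \<alpha> v x = div_op \<alpha> w x"
proof -
  have "pd j v y = pd j w y" if "y \<in> S" for j y by (rule pd_cong_open[OF assms(1) that assms(3)])
  then show ?thesis
    unfolding div_op_def by (intro sum.cong refl pd_cong_open[OF assms(1,2)]) simp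
qed

context mwd
begin

subsection \<open>Parabolicity implies finite capacity\<close>

lemma integrable_continuous_compact:
  assumes F: "continuous_on UNIV F" and K: "compact K" "\<And>p. p \<notin> K \<Longrightarrow> F p = 0"
  shows "integrable mu (F :: 'a \<Rightarrow> real)"
proof -
  have "bounded (F ` K)"
    by (intro compact_imp_bounded compact_continuous_image K(1) continuous_on_subset[OF F]) simp
  then obtain C where C: "\<And>p. p \<in> K \<Longrightarrow> \<bar>F p\<bar> \<le> C" unfolding bounded_iff by auto
  show ?thesis
  proof (rule integrable_compact[OF _ K(1)])
    show "AE p in mu. p \<in> K \<longrightarrow> \<bar>F p\<bar> \<le> C" using C by simp
    show "AE p in mu. p \<notin> K \<longrightarrow> F p = 0" using K(2) by simp
  qed (rule borel_measurable_continuous_onI[OF F])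
qed

lemma AE_le_imp_le:
  fixes u h :: "'a \<Rightarrow> real"
  assumes "continuous_on UNIV u" "continuous_on UNIV h" "AE p in mu. u p \<le> h p"
  shows "u p \<le> h p"
proof (rule ccontr)
  assume "\<not> u p \<le> h p"
  then have p: "p \<in> (\<lambda>q. u q - h q) -` {0<..}" by simp
  have "open ((\<lambda>q. u q - h q) -` {0<..})"
    by (rule open_vimage[OF open_greaterThan]) (intro continuous_intros assms)
  moreover have "AE q in mu. q \<in> (\<lambda>q. u q - h q) -` {0<..} \<longrightarrow> u q \<le> h q"
    using assms(3) by eventually_elim simp
  ultimately have "\<exists>q\<in>(\<lambda>q. u q - h q) -` {0<..}. u q \<le> h q" by (rule mu_open_pos[OF _ p])
  then show False by simp
qed

section \<open>Regularity and equation of the limit\<close>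

context
  fixes f u0 :: "'a \<Rightarrow> real"
  assumes fs: "smooth_fun_on A UNIV f" and fpos: "\<And>p. f p > 0"
    and u0_borel [measurable]: "u0 \<in> borel_measurable borel" and u01: "\<And>p. 0 \<le> u0 p \<and> u0 p \<le> 1"
    and weak: "\<And>w. smooth_fun_on A UNIV w \<Longrightarrow> cpws w \<Longrightarrow> (\<integral>p. (1 - u0 p) * (wl w p - f p * w p) \<partial>mu) = 0"
begin

text \<open>In a chart \<open>1 - u0\<close> solves the divergence-form equation with coefficients
  \<open>flux_coeff c\<close> and zero order term \<open>wdens c * f\<close>; the density of the
  measure cancels the division in \<open>coord_wl\<close>. Coordinate test functions become global
  ones by extension with zero.\<close>

lemma weak_limit_regular:
  assumes c: "c \<in> A" and y: "y \<in> V c"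
  shows "\<exists>r F. r > 0 \<and> ball y r \<subseteq> V c \<and> Ck_on 2 (ball y r) F \<and> (AE x in lborel. x \<in> ball y r \<longrightarrow> u0 (ci c x) = F x)"
proof -
  define s where "s = ext c (in_chart c (\<lambda>p. 1 - u0 p))"
  define \<beta> where "\<beta> x = wdens c x * in_chart c f x" for x
  interpret elliptic_weak "V c" "flux_coeff c" \<beta> s 1
  proof
    show "open (V c)" by (rule chart(2)[OF c])
    show "smooth_on (V c) (flux_coeff c i j)" for i j by (rule smooth_flux_coeff[OF c])
    have "smooth_on (V c) (in_chart c f)" using fs c by (simp add: smooth_fun_on_def)
    then show "smooth_on (V c) \<beta>" unfolding \<beta>_def[abs_def] by (intro smooth_on_mult chart(2)[OF c] smooth_wdens[OF c])
    show "(\<Sum>i\<in>UNIV. \<Sum>j\<in>UNIV. flux_coeff c i j x * \<theta> $ j * \<theta> $ i) > 0" if x: "x \<in> V c" and "\<theta> \<noteq> 0" for x \<theta>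
    proof -
      have "\<theta> \<bullet> (matrix_inv (g c (ci c x)) *v \<theta>) > 0"
        by (rule pos_def_inv(3)[OF metric_pos_def[OF c chart(7)[OF c x]] \<open>\<theta> \<noteq> 0\<close>])
      then have "wdens c x * (\<theta> \<bullet> (matrix_inv (g c (ci c x)) *v \<theta>)) > 0" using wdens_pos[OF c x] by simp
      also have "wdens c x * (\<theta> \<bullet> (matrix_inv (g c (ci c x)) *v \<theta>)) = (\<Sum>i\<in>UNIV. \<Sum>j\<in>UNIV. flux_coeff c i j x * \<theta> $ j * \<theta> $ i)"
        by (simp add: flux_coeff_def inner_vec_def matrix_vector_mult_def sum_distrib_left mult_ac)
      finally show ?thesis .
    qed
    show "s \<in> borel_measurable borel" unfolding s_def by (rule ext_in_chart_borel[OF c]) simp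
    show "\<bar>s x\<bar> \<le> 1" for x using u01 by (simp add: s_def ext_def in_chart_def)
  next
    fix w :: "real ^ 'n \<Rightarrow> real" and K assume w: "smooth_on (V c) w" and K: "compact K" "K \<subseteq> V c" and w0: "\<And>x. x \<notin> K \<Longrightarrow> w x = 0"
    define W where "W = chart_fun c w"
    have W: "smooth_fun_on A UNIV W" unfolding W_def by (rule smooth_chart_fun[OF c w K w0])
    have W2: "Ck_fun A 2 W" by (rule smooth_Ck_fun[OF W])
    note K' = compact_chart_preimage[OF c K]
    have W0: "W p = 0" if "p \<notin> ci c ` K" for p unfolding W_def by (rule chart_fun_zero[OF c w0 that])
    have cW: "cpws W" by (rule cpsI[OF pws_smooth[OF W] K'(1) W0])
    have wl0: "wl W p = 0" if "p \<notin> ci c ` K" for p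
      by (rule wl_zero_outside[OF W2 compact_imp_closed[OF K'(1)] W0 that])
    define F where "F p = (1 - u0 p) * (wl W p - f p * W p)" for p
    note [measurable] = cpws_borel[OF cW] borel_measurable_continuous_onI[OF wl_continuous[OF W2]] loc_lip_borel[OF pws_loc_lip[OF pws_smooth[OF fs]]]
    have "(\<integral>p. F p \<partial>mu) = (\<integral>x. ext c (\<lambda>x. wdens c x * F (ci c x)) x \<partial>lborel)"
    proof (rule int_chart(2)[OF c])
      show "F \<in> borel_measurable borel" unfolding F_def[abs_def] by measurable
      show "F p = 0" if "p \<notin> fst c" for p
      proof -
        have "p \<notin> ci c ` K" using K'(2) that by blast
        then show ?thesis by (simp add: F_def W0 wl0)
      qed
    qed
    also have "(\<lambda>x. ext c (\<lambda>x. wdens c x * F (ci c x)) x) = (\<lambda>x. s x * (div_op (flux_coeff c) w x - \<beta> x * w x))"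
    proof (rule ext)
      fix x
      show "ext c (\<lambda>x. wdens c x * F (ci c x)) x = s x * (div_op (flux_coeff c) w x - \<beta> x * w x)"
      proof (cases "x \<in> V c")
        case True
        have Wc: "in_chart c W z = w z" if "z \<in> V c" for z
          using chart(6,7)[OF c that] by (simp add: in_chart_def W_def chart_fun_def)
        have "wl W (ci c x) = div_op (flux_coeff c) (in_chart c W) x / wdens c x"
          using wl_chart[OF c chart(7)[OF c True] W2] by (simp add: chart(6)[OF c True] coord_wl_def)
        also have "div_op (flux_coeff c) (in_chart c W) x = div_op (flux_coeff c) w x" by (rule div_op_cong_open[OF chart(2)[OF c] True Wc])
        finally show ?thesis
          using True wdens_pos[OF c True] Wc[OF True]
          by (simp add: ext_def s_def F_def \<beta>_def in_chart_def field_simps)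
      qed (simp add: ext_def s_def)
    qed
    finally show "(\<integral>x. s x * (div_op (flux_coeff c) w x - \<beta> x * w x) \<partial>lborel) = 0"
      using weak[OF W cW] by (simp add: F_def)
  qed
  obtain r F where r: "r > 0" "ball y r \<subseteq> V c" "Ck_on 2 (ball y r) F" and AE: "AE x in lborel. x \<in> ball y r \<longrightarrow> s x = F x"
    by (rule regularity[OF y])
  have "Ck_on 2 (ball y r) (\<lambda>x. 1 + (-1) * F x)"
    by (intro Ck_on_add Ck_on_mult Ck_on_const open_ball r(3))
  moreover have "AE x in lborel. x \<in> ball y r \<longrightarrow> u0 (ci c x) = 1 + (-1) * F x"
    using AE
  proof eventually_elim
    case (elim x)
    then show ?case using subsetD[OF r(2)] by (auto simp: s_def ext_def in_chart_def)
  qed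
  ultimately show ?thesis using r(1,2) by (intro exI[of _ r] exI[of _ "\<lambda>x. 1 + (-1) * F x"]) simp
qed

text \<open>Regularity identifies \<open>u0\<close> up to null sets only. Continuous representatives
  have definite values, and these agree on overlaps, so they can be glued.\<close>

definition rep :: "'a set \<Rightarrow> ('a \<Rightarrow> real) \<Rightarrow> bool" where
  "rep T h \<longleftrightarrow> open T \<and> continuous_on T h \<and> (AE q in mu. q \<in> T \<longrightarrow> u0 q = h q)"

lemma rep_unique:
  assumes "rep T h" "rep T' h'" "p \<in> T" "p \<in> T'" shows "h p = h' p"
proof (rule continuous_AE_eq[of "T \<inter> T'"])
  show "open (T \<inter> T')" using assms by (auto simp: rep_def)
  show "continuous_on (T \<inter> T') h" "continuous_on (T \<inter> T') h'"
    using assms by (auto simp: rep_def intro: continuous_on_subset)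
  have "AE q in mu. q \<in> T \<longrightarrow> u0 q = h q" "AE q in mu. q \<in> T' \<longrightarrow> u0 q = h' q"
    using assms by (auto simp: rep_def)
  then show "AE q in mu. q \<in> T \<inter> T' \<longrightarrow> h q = h' q" by eventually_elim auto
qed (use assms in simp)

lemma rep_chart:
  assumes c: "c \<in> A" and r: "ball y r \<subseteq> V c" "Ck_on 2 (ball y r) F" "AE x in lborel. x \<in> ball y r \<longrightarrow> u0 (ci c x) = F x"
  shows "rep {q \<in> fst c. snd c q \<in> ball y r} (\<lambda>q. F (snd c q))"
  unfolding rep_def
proof (intro conjI)
  show "open {q \<in> fst c. snd c q \<in> ball y r}" by (rule open_chart_preimage[OF c open_ball])
  show "continuous_on {q \<in> fst c. snd c q \<in> ball y r} (\<lambda>q. F (snd c q))"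
    by (rule continuous_on_compose2[OF Ck_on_imp_continuous_on[OF r(2)] continuous_on_subset[OF chart(3)[OF c]]]) auto
  have "AE x in lborel. x \<in> V c \<longrightarrow> snd c (ci c x) \<in> ball y r \<longrightarrow> u0 (ci c x) = F (snd c (ci c x))"
    using r(3) by eventually_elim (simp add: chart(6)[OF c] del: mem_ball)
  then have "AE q in mu. q \<in> fst c \<longrightarrow> snd c q \<in> ball y r \<longrightarrow> u0 q = F (snd c q)"
    using AE_mu_chart[OF c, of "\<lambda>q. snd c q \<in> ball y r \<longrightarrow> u0 q = F (snd c q)"] by blast
  then show "AE q in mu. q \<in> {q \<in> fst c. snd c q \<in> ball y r} \<longrightarrow> u0 q = F (snd c q)"
    by eventually_elim simp
qed

lemma weak_limit_C2: "\<exists>u. Ck_fun A 2 u \<and> (AE p in mu. u0 p = u p)"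
proof -
  have ex: "\<exists>T h. rep T h \<and> p \<in> T" for p
  proof -
    obtain c where c: "c \<in> A" "p \<in> fst c" using ex_chart by blast
    have "snd c p \<in> V c" using c(2) by (rule imageI)
    from weak_limit_regular[OF c(1) this] obtain r F where r: "r > 0" "ball (snd c p) r \<subseteq> V c" "Ck_on 2 (ball (snd c p) r) F"
      "AE x in lborel. x \<in> ball (snd c p) r \<longrightarrow> u0 (ci c x) = F x" by blast
    have "p \<in> {q \<in> fst c. snd c q \<in> ball (snd c p) r}" using c r by simp
    with rep_chart[OF c(1) r(2-4)] show ?thesis by blast
  qed
  \<comment> \<open>The choice is harmless, because \<open>rep_unique\<close> makes the value
    independent of the representative.\<close>
  define u where "u p = (SOME a. \<exists>T h. rep T h \<and> p \<in> T \<and> a = h p)" for p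
  have u: "u p = h p" if "rep T h" "p \<in> T" for T h p
  proof -
    have "\<exists>T' h'. rep T' h' \<and> p \<in> T' \<and> u p = h' p"
      unfolding u_def by (rule someI[of "\<lambda>a. \<exists>T h. rep T h \<and> p \<in> T \<and> a = h p" "h p"]) (use that in blast)
    then show ?thesis using rep_unique[OF that(1)] that(2) by metis
  qed
  have "Ck_fun A 2 u"
    unfolding Ck_fun_def
  proof (intro ballI Ck_on_local)
    fix c y assume c: "c \<in> A" and y: "y \<in> V c"
    from weak_limit_regular[OF c y] obtain r F where r: "r > 0" "ball y r \<subseteq> V c" "Ck_on 2 (ball y r) F"
      "AE x in lborel. x \<in> ball y r \<longrightarrow> u0 (ci c x) = F x" by blast
    note R = rep_chart[OF c r(2-4)]
    have "F x = in_chart c u x" if x: "x \<in> ball y r" for x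
    proof -
      have xV: "x \<in> V c" using r(2) x by (rule subsetD)
      have "u (ci c x) = F (snd c (ci c x))"
        by (rule u[OF R]) (use x chart(6,7)[OF c xV] in simp)
      then show ?thesis using chart(6)[OF c xV] by (simp add: in_chart_def)
    qed
    then have "Ck_on 2 (ball y r) (in_chart c u)" by (rule Ck_on_cong[OF open_ball _ r(3)])
    then show "\<exists>T. open T \<and> y \<in> T \<and> Ck_on 2 T (in_chart c u)" using r(1) by (intro exI[of _ "ball y r"]) simp
  qed
  moreover have "AE p in mu. u0 p = u p"
  proof -
    \<comment> \<open>Each representative comes with its own exceptional null set, so the family is
      first reduced to a countable one.\<close>
    obtain F where F: "F \<subseteq> {T. \<exists>h. rep T h}" "countable F" "\<Union>F = \<Union>{T. \<exists>h. rep T h}"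
      by (rule Lindelof[of "{T. \<exists>h. rep T h}"]) (auto simp: rep_def)
    have "AE p in mu. \<forall>T\<in>F. p \<in> T \<longrightarrow> u0 p = u p"
    proof (subst AE_ball_countable[OF F(2)], intro ballI)
      fix T assume "T \<in> F"
      then obtain h where h: "rep T h" using F(1) by blast
      then have "AE q in mu. q \<in> T \<longrightarrow> u0 q = h q" by (simp add: rep_def)
      then show "AE q in mu. q \<in> T \<longrightarrow> u0 q = u q" by eventually_elim (use u[OF h] in simp)
    qed
    moreover have "p \<in> \<Union>F" for p unfolding F(3) using ex[of p] by blast
    ultimately show ?thesis by (auto elim!: eventually_mono)
  qed
  ultimately show ?thesis by blast
qed

text \<open>Now that \<open>u\<close> is C2, symmetry moves the weighted Laplacian from the test
  function to \<open>u\<close>. A bump near a point where the equation fails, with the sign of the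
  defect fixed, then has a positive integral that should be zero.\<close>

lemma weak_limit_equation:
  assumes u: "Ck_fun A 2 u" and AE: "AE p in mu. u0 p = u p"
  shows "wl u p = - f p * (1 - u p)"
proof (rule ccontr)
  assume ne: "wl u p \<noteq> - f p * (1 - u p)"
  have uc: "continuous_on UNIV u" by (rule loc_lip_continuous[OF C2_loc_lip[OF u]])
  have fc: "continuous_on UNIV f" by (rule pws_continuous[OF pws_smooth[OF fs]])
  define e where "e q = wl u q + f q * (1 - u q)" for q
  have ec: "continuous_on UNIV e" unfolding e_def[abs_def] by (intro continuous_intros wl_continuous u uc fc)
  define s where "s = sgn (e p)"
  define W where "W = (\<lambda>q. s * e q) -` {0<..}"
  have W: "open W" unfolding W_def by (rule open_vimage[OF open_greaterThan]) (intro continuous_intros ec)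
  have pW: "p \<in> W" using ne by (auto simp: W_def s_def e_def sgn_real_def)
  obtain c where c: "c \<in> A" "p \<in> fst c" using ex_chart by blast
  obtain b K where b: "smooth_fun_on A UNIV b" "\<And>q. 0 \<le> b q" "b p > 0" "compact K" "K \<subseteq> W \<inter> fst c" "\<And>q. q \<notin> K \<Longrightarrow> b q = 0"
    using bump[OF W pW c] by (elim exE conjE) (rule that, assumption+, auto)
  have cb: "cpws b" by (rule cpsI[OF pws_smooth[OF b(1)] b(4,6)])
  have b2: "Ck_fun A 2 b" by (rule smooth_Ck_fun[OF b(1)])
  have bc: "continuous_on UNIV b" by (rule pws_continuous[OF cpws_pws[OF cb]])
  have wl0: "wl b q = 0" if "q \<notin> K" for q by (rule wl_zero_outside[OF b2 compact_imp_closed[OF b(4)] b(6) that])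
  have i: "integrable mu (wl b)" "integrable mu (\<lambda>q. u q * wl b q)" "integrable mu (\<lambda>q. b q * wl u q)" "integrable mu (\<lambda>q. b q * (f q * (1 - u q)))"
    "integrable mu (\<lambda>q. b q * (s * e q))"
    by (rule integrable_continuous_compact[OF _ b(4)], intro continuous_intros wl_continuous b2 u uc fc bc ec, simp add: b(6) wl0)+
  have "(\<integral>q. 1 * wl b q \<partial>mu) = (\<integral>q. b q * wl (\<lambda>p. 1) q \<partial>mu)"
    by (rule wl_symmetric[OF b2 b(4,6) smooth_Ck_fun[OF smooth_fun_on_const]])
  then have 1: "(\<integral>q. wl b q \<partial>mu) = 0" by (simp add: wl_const)
  have 2: "(\<integral>q. u q * wl b q \<partial>mu) = (\<integral>q. b q * wl u q \<partial>mu)" by (rule wl_symmetric[OF b2 b(4,6) u])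
  note [measurable] = borel_measurable_continuous_onI[OF uc] borel_measurable_continuous_onI[OF fc] borel_measurable_continuous_onI[OF bc]
    borel_measurable_continuous_onI[OF wl_continuous[OF b2]]
  have "0 = (\<integral>q. (1 - u0 q) * (wl b q - f q * b q) \<partial>mu)" using weak[OF b(1) cb] by simp
  also have "\<dots> = (\<integral>q. wl b q - u q * wl b q - b q * (f q * (1 - u q)) \<partial>mu)"
    by (rule integral_cong_AE) (use AE in \<open>auto elim!: eventually_mono simp: algebra_simps\<close>)
  also have "\<dots> = (\<integral>q. wl b q \<partial>mu) - (\<integral>q. u q * wl b q \<partial>mu) - (\<integral>q. b q * (f q * (1 - u q)) \<partial>mu)"
    using i by simp
  also have "\<dots> = - ((\<integral>q. b q * wl u q \<partial>mu) + (\<integral>q. b q * (f q * (1 - u q)) \<partial>mu))" using 1 2 by simp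
  also have "(\<integral>q. b q * wl u q \<partial>mu) + (\<integral>q. b q * (f q * (1 - u q)) \<partial>mu) = (\<integral>q. b q * wl u q + b q * (f q * (1 - u q)) \<partial>mu)"
    using i by simp
  also have "(\<lambda>q. b q * wl u q + b q * (f q * (1 - u q))) = (\<lambda>q. b q * e q)" by (simp add: e_def algebra_simps)
  finally have "(\<integral>q. b q * e q \<partial>mu) = 0" by simp
  then have "s * (\<integral>q. b q * e q \<partial>mu) = 0" by simp
  then have z: "(\<integral>q. b q * (s * e q) \<partial>mu) = 0" by (simp add: mult.left_commute flip: integral_mult_right_zero)
  have nn: "0 \<le> b q * (s * e q)" for q
  proof (cases "q \<in> K")
    case True
    then have "s * e q > 0" using b(5) by (auto simp: W_def)
    then show ?thesis using b(2)[of q] by simp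
  qed (simp add: b(6))
  have "AE q in mu. b q * (s * e q) = 0"
    using integral_nonneg_eq_0_iff_AE[OF i(5)] nn z by simp
  then have "b p * (s * e p) = 0"
    by (intro continuous_AE_eq[OF open_UNIV _ continuous_on_const]) (auto intro!: continuous_intros bc ec)
  moreover have "s * e p > 0" using pW by (simp add: W_def)
  ultimately show False using b(3) by auto
qed

lemma parabolic_limit:
  assumes par: "parabolic A g \<phi>"
  shows "AE p in mu. u0 p = 1"
proof -
  obtain u where u: "Ck_fun A 2 u" and AE: "AE p in mu. u0 p = u p" using weak_limit_C2 by blast
  have uc: "continuous_on UNIV u" by (rule loc_lip_continuous[OF C2_loc_lip[OF u]])
  have "0 \<le> u p" for p
    by (rule AE_le_imp_le[OF continuous_on_const uc]) (use AE in \<open>eventually_elim, metis u01\<close>)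
  moreover have u1: "u p \<le> 1" for p
    by (rule AE_le_imp_le[OF uc continuous_on_const]) (use AE in \<open>eventually_elim, metis u01\<close>)
  moreover have "wl u p \<le> 0" for p
    unfolding weak_limit_equation[OF u AE] using u1[of p] fpos[of p] by simp
  ultimately have "u constant_on UNIV" using par u unfolding parabolic_def by blast
  then obtain a where a: "u = (\<lambda>p. a)" unfolding constant_on_def by auto
  have "u p = 1" for p
    using weak_limit_equation[OF u AE, of p] fpos[of p] by (simp add: a wl_const)
  then show ?thesis using AE by simp
qed

end

lemma parabolic_cutoff:
  assumes par: "parabolic A g \<phi>" and C: "compact C"
  shows "\<exists>\<psi>. cpws \<psi> \<and> (\<forall>p. 0 \<le> \<psi> p \<and> \<psi> p \<le> 1) \<and> (\<forall>p\<in>C. \<psi> p = 1) \<and> weighted_energy A g \<phi> \<psi> \<le> ennreal 1"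
proof -
  obtain f where f: "smooth_fun_on A UNIV f" "\<And>p. f p > 0" "integrable mu f" using ex_weight by blast
  obtain v where v: "minseq f v" using ex_minseq[OF f] by blast
  obtain u where u: "u \<in> borel_measurable borel" "\<And>p. 0 \<le> u p \<and> u p \<le> 1" and lim: "AE p in mu. (\<lambda>k. v k p) \<longlonglongrightarrow> u p"
    using minseq_limit[OF f v] by blast
  have weak: "(\<integral>p. (1 - u p) * (wl w p - f p * w p) \<partial>mu) = 0" if "smooth_fun_on A UNIV w" "cpws w" for w
    by (rule minseq_limit_weak[OF f v u(1) lim u(2) smooth_Ck_fun[OF that(1)] that(2)])
  have "AE p in mu. u p = 1" by (rule parabolic_limit[OF f(1,2) u weak par])
  with lim have lim1: "AE p in mu. (\<lambda>k. v k p) \<longlonglongrightarrow> 1" by eventually_elim simp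
  have E: "(\<lambda>k. \<integral>p. bgrad_ip (v k) (v k) p \<partial>mu) \<longlonglongrightarrow> 0" by (rule minseq_energy[OF f v lim1])
  have c: "cpws (v k)" and v01: "0 \<le> v k p" "v k p \<le> 1" for k p
    using v unfolding minseq_def[OF f] by auto
  obtain \<eta> K' where \<eta>: "cpws \<eta>" "\<And>p. 0 \<le> \<eta> p" "\<And>p. \<eta> p \<le> 1" "\<And>p. p \<in> C \<Longrightarrow> \<eta> p = 1"
    using cutoff[OF C open_UNIV subset_UNIV] by (elim exE conjE) (rule that, assumption, auto)
  note [measurable] = cpws_borel[OF \<eta>(1)] cpws_borel[OF c]
  \<comment> \<open>This is \<open>\<eta> + (1 - \<eta>) * v k\<close>, expanded so that every
    summand has compact support.\<close>
  define \<psi> where "\<psi> k p = \<eta> p + (v k p + (-1) * (\<eta> p * v k p))" for k p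
  have \<psi>: "cpws (\<psi> k)" for k
    unfolding \<psi>_def[abs_def] by (intro cpws_add cpws_scale cpws_mult cpws_pws \<eta>(1) c)
  note [measurable] = cpws_borel[OF \<psi>]
  have \<psi>01: "0 \<le> \<psi> k p" "\<psi> k p \<le> 1" for k p
  proof -
    have "\<psi> k p = \<eta> p + (1 - \<eta> p) * v k p" by (simp add: \<psi>_def algebra_simps)
    then show "0 \<le> \<psi> k p" using \<eta>(2,3)[of p] v01[of k p] by simp
    have "1 - \<psi> k p = (1 - \<eta> p) * (1 - v k p)" by (simp add: \<psi>_def algebra_simps)
    moreover have "0 \<le> (1 - \<eta> p) * (1 - v k p)" using \<eta>(3)[of p] v01[of k p] by simp
    ultimately show "\<psi> k p \<le> 1" by linarith
  qed
  \<comment> \<open>The gradient of \<open>\<psi> k\<close> is \<open>1 - v k\<close> times that of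
    \<open>\<eta>\<close> plus \<open>1 - \<eta>\<close> times that of \<open>v k\<close>. The
    square of a sum is at most twice the sum of the squares, and \<open>1 - \<eta>\<close> is at
    most \<open>1\<close>.\<close>
  define h where "h k p = 2 * ((1 - v k p)\<^sup>2 * bgrad_ip \<eta> \<eta> p) + 2 * bgrad_ip (v k) (v k) p" for k p
  have G\<eta>: "AE p in mu. 0 \<le> bgrad_ip \<eta> \<eta> p" using cpws_AE[OF \<eta>(1)] by eventually_elim (simp add: bgrad_ip_eq grad_ip_nonneg)
  have i\<eta>: "integrable mu (bgrad_ip \<eta> \<eta>)" by (rule cpws_energy_integrable[OF \<eta>(1) \<eta>(1)])
  have le: "AE p in mu. bgrad_ip (\<psi> k) (\<psi> k) p \<le> h k p" for k
    using cpws_AE[OF \<eta>(1)] cpws_AE[OF c[of k]] cpws_AE[OF \<psi>[of k]]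
  proof eventually_elim
    case (elim p)
    define a where "a = 1 - v k p"
    define b where "b = 1 - \<eta> p"
    have d1: "diff_at (\<lambda>p. \<eta> p * v k p) p" by (rule diff_at_mult[OF elim(1,2)])
    have d2: "diff_at (\<lambda>p. (-1) * (\<eta> p * v k p)) p" by (rule diff_at_mult[OF diff_at_const d1])
    have d3: "diff_at (\<lambda>p. v k p + (-1) * (\<eta> p * v k p)) p" by (rule diff_at_add[OF elim(2) d2])
    have G: "grad_ip (\<psi> k) z p = a * grad_ip \<eta> z p + b * grad_ip (v k) z p" for z
      unfolding \<psi>_def[abs_def] a_def b_def
      by (simp only: grad_ip_add[OF elim(1) d3] grad_ip_add[OF elim(2) d2] grad_ip_scale[OF d1] grad_ip_mult[OF elim(1,2)]) (simp add: algebra_simps)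
    have "grad_ip (\<psi> k) (\<psi> k) p = a * grad_ip \<eta> (\<psi> k) p + b * grad_ip (v k) (\<psi> k) p" by (rule G)
    also have "grad_ip \<eta> (\<psi> k) p = a * grad_ip \<eta> \<eta> p + b * grad_ip \<eta> (v k) p"
      using G[of \<eta>] by (simp only: grad_ip_commute[of \<eta> "\<psi> k"] grad_ip_commute[of "v k" \<eta>])
    also have "grad_ip (v k) (\<psi> k) p = a * grad_ip \<eta> (v k) p + b * grad_ip (v k) (v k) p"
      using G[of "v k"] by (simp only: grad_ip_commute[of "v k" "\<psi> k"])
    finally have e: "grad_ip (\<psi> k) (\<psi> k) p = a\<^sup>2 * grad_ip \<eta> \<eta> p + 2 * (a * b) * grad_ip \<eta> (v k) p + b\<^sup>2 * grad_ip (v k) (v k) p"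
      by (simp add: algebra_simps power2_eq_square)
    have "\<bar>(a * b) * grad_ip \<eta> (v k) p\<bar> \<le> sqrt ((a\<^sup>2 * grad_ip \<eta> \<eta> p) * (b\<^sup>2 * grad_ip (v k) (v k) p))"
    proof (rule real_le_rsqrt)
      have "(a * b)\<^sup>2 * (grad_ip \<eta> (v k) p)\<^sup>2 \<le> (a * b)\<^sup>2 * (grad_ip \<eta> \<eta> p * grad_ip (v k) (v k) p)"
        by (rule mult_left_mono[OF grad_ip_Cauchy]) simp
      then show "\<bar>(a * b) * grad_ip \<eta> (v k) p\<bar>\<^sup>2 \<le> (a\<^sup>2 * grad_ip \<eta> \<eta> p) * (b\<^sup>2 * grad_ip (v k) (v k) p)"
        by (simp add: power_mult_distrib mult_ac)
    qed
    also have "\<dots> \<le> (a\<^sup>2 * grad_ip \<eta> \<eta> p + b\<^sup>2 * grad_ip (v k) (v k) p) / 2"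
      by (rule arith_geo_mean_sqrt) (simp_all add: grad_ip_nonneg)
    finally have "grad_ip (\<psi> k) (\<psi> k) p \<le> 2 * (a\<^sup>2 * grad_ip \<eta> \<eta> p) + 2 * (b\<^sup>2 * grad_ip (v k) (v k) p)"
      unfolding e by (simp add: abs_le_iff field_simps)
    also have "b\<^sup>2 * grad_ip (v k) (v k) p \<le> grad_ip (v k) (v k) p"
      using \<eta>(2,3)[of p] by (intro mult_left_le_one_le) (auto simp: grad_ip_nonneg b_def power_le_one)
    finally show ?case using elim by (simp add: bgrad_ip_eq h_def a_def)
  qed
  \<comment> \<open>The gradient of \<open>\<eta>\<close> does not become small, but its coefficient
    \<open>1 - v k\<close> tends to zero almost everywhere, with the integrable
    \<open>bgrad_ip \<eta> \<eta>\<close> as dominating function.\<close>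
  have l: "(\<lambda>k. \<integral>p. (1 - v k p)\<^sup>2 * bgrad_ip \<eta> \<eta> p \<partial>mu) \<longlonglongrightarrow> (\<integral>p. (1 - 1)\<^sup>2 * bgrad_ip \<eta> \<eta> p \<partial>mu)"
  proof (rule integral_dominated_convergence[OF _ _ i\<eta>])
    show "AE p in mu. (\<lambda>k. (1 - v k p)\<^sup>2 * bgrad_ip \<eta> \<eta> p) \<longlonglongrightarrow> (1 - 1)\<^sup>2 * bgrad_ip \<eta> \<eta> p"
      using lim1 by eventually_elim (intro tendsto_intros)
    show "AE p in mu. norm ((1 - v k p)\<^sup>2 * bgrad_ip \<eta> \<eta> p) \<le> bgrad_ip \<eta> \<eta> p" for k
      using G\<eta>
    proof eventually_elim
      case (elim p)
      have "(1 - v k p)\<^sup>2 \<le> 1" using v01[of k p] by (intro power_le_one) auto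
      then show ?case using elim by (simp add: abs_mult mult_left_le_one_le)
    qed
  qed auto
  have ih: "integrable mu (\<lambda>p. (1 - v k p)\<^sup>2 * bgrad_ip \<eta> \<eta> p)" for k
  proof (rule Bochner_Integration.integrable_bound[OF i\<eta>])
    show "AE p in mu. norm ((1 - v k p)\<^sup>2 * bgrad_ip \<eta> \<eta> p) \<le> norm (bgrad_ip \<eta> \<eta> p)"
    proof (rule AE_I2)
      fix p
      have "(1 - v k p)\<^sup>2 \<le> 1" using v01[of k p] by (intro power_le_one) auto
      then show "norm ((1 - v k p)\<^sup>2 * bgrad_ip \<eta> \<eta> p) \<le> norm (bgrad_ip \<eta> \<eta> p)" by (simp add: abs_mult mult_left_le_one_le)
    qed
  qed auto
  have hint: "integrable mu (h k)" "(\<integral>p. h k p \<partial>mu) = 2 * (\<integral>p. (1 - v k p)\<^sup>2 * bgrad_ip \<eta> \<eta> p \<partial>mu) + 2 * (\<integral>p. bgrad_ip (v k) (v k) p \<partial>mu)" for k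
    unfolding h_def[abs_def] using ih[of k] cpws_energy_integrable[OF c c, of k k] by simp_all
  have "(\<lambda>k. \<integral>p. h k p \<partial>mu) \<longlonglongrightarrow> 2 * (\<integral>p. (1 - 1)\<^sup>2 * bgrad_ip \<eta> \<eta> p \<partial>mu) + 2 * 0"
    unfolding hint(2) by (intro tendsto_intros l E)
  then have "(\<lambda>k. \<integral>p. h k p \<partial>mu) \<longlonglongrightarrow> 0" by simp
  then have "eventually (\<lambda>k. (\<integral>p. h k p \<partial>mu) < 1) sequentially" by (rule order_tendstoD(2)) simp
  then obtain k where k: "(\<integral>p. h k p \<partial>mu) < 1" unfolding eventually_sequentially by blast
  have "weighted_energy A g \<phi> (\<psi> k) = (\<integral>\<^sup>+p. ennreal (bgrad_ip (\<psi> k) (\<psi> k) p) \<partial>mu)" by (rule energy_eq[OF cpws_loc_lip[OF \<psi>]])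
  also have "\<dots> \<le> (\<integral>\<^sup>+p. ennreal (h k p) \<partial>mu)"
    by (rule nn_integral_mono_AE) (rule eventually_mono[OF le[of k] ennreal_leI])
  also have "\<dots> = ennreal (\<integral>p. h k p \<partial>mu)"
  proof (rule nn_integral_eq_integral[OF hint(1)])
    show "AE p in mu. 0 \<le> h k p"
      using G\<eta> cpws_AE[OF c[of k]] by eventually_elim (simp add: h_def bgrad_ip_eq grad_ip_nonneg)
  qed
  also have "\<dots> \<le> ennreal 1" using k by (intro ennreal_leI) simp
  finally have "weighted_energy A g \<phi> (\<psi> k) \<le> ennreal 1" .
  moreover have "\<psi> k p = 1" if "p \<in> C" for p using \<eta>(4)[OF that] by (simp add: \<psi>_def)
  ultimately show ?thesis using \<psi> \<psi>01 by (intro exI[of _ "\<psi> k"]) blast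
qed

text \<open>Each new cutoff is asked to be \<open>1\<close> on the next set of a compact exhaustion
  and on the compact set where the previous cutoff is \<open>1\<close>. This makes the sets
  increase, while all energies stay below \<open>1\<close>.\<close>

lemma parabolic_imp_finite_capacity:
  assumes par: "parabolic A g \<phi>" shows "finite_capacity A g \<phi>"
proof -
  obtain K :: "nat \<Rightarrow> 'a set" where K: "\<And>j. compact (K j)" "(\<Union>j. K j) = UNIV"
    using ex_exhaustion by blast
  define P where "P \<psi> \<longleftrightarrow> cpws \<psi> \<and> (\<forall>p. 0 \<le> \<psi> p \<and> \<psi> p \<le> 1) \<and> weighted_energy A g \<phi> \<psi> \<le> ennreal 1" for \<psi>
  have P: "\<exists>\<psi>. P \<psi> \<and> C \<subseteq> \<psi> -` {1}" if C: "compact C" for C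
    using parabolic_cutoff[OF par C] unfolding P_def by (elim exE conjE) (rule exI, auto)
  have comp: "compact (\<psi> -` {1})" if "P \<psi>" for \<psi>
  proof -
    have c: "cpws \<psi>" using that by (simp add: P_def)
    obtain K where K: "compact K" "\<And>p. p \<notin> K \<Longrightarrow> \<psi> p = 0" using cpws_support[OF c] by blast
    have "closed (\<psi> -` {1})" by (rule closed_vimage[OF closed_singleton pws_continuous[OF cpws_pws[OF c]]])
    moreover have "\<psi> -` {1} \<subseteq> K" using K(2) by fastforce
    ultimately show ?thesis using K(1) by (metis closed_Int_compact inf.orderE)
  qed
  have "\<exists>\<psi>. \<forall>n. (P (\<psi> n) \<and> K n \<subseteq> \<psi> n -` {1}) \<and> \<psi> n -` {1} \<subseteq> \<psi> (Suc n) -` {1}"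
  proof (rule dependent_nat_choice)
    show "\<exists>\<psi>. P \<psi> \<and> K 0 \<subseteq> \<psi> -` {1}" by (rule P[OF K(1)])
    fix \<psi> n assume "P \<psi> \<and> K n \<subseteq> \<psi> -` {1}"
    then have "compact (K (Suc n) \<union> \<psi> -` {1})" using comp K(1) by (intro compact_Un) auto
    from P[OF this] obtain \<psi>' where "P \<psi>'" "K (Suc n) \<union> \<psi> -` {1} \<subseteq> \<psi>' -` {1}" by (elim exE conjE) (rule that)
    then show "\<exists>\<psi>'. (P \<psi>' \<and> K (Suc n) \<subseteq> \<psi>' -` {1}) \<and> \<psi> -` {1} \<subseteq> \<psi>' -` {1}"
      by (intro exI[of _ \<psi>']) simp
  qed
  then obtain \<psi> :: "nat \<Rightarrow> 'a \<Rightarrow> real"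
    where "\<forall>n. (P (\<psi> n) \<and> K n \<subseteq> \<psi> n -` {1}) \<and> \<psi> n -` {1} \<subseteq> \<psi> (Suc n) -` {1}" by (rule exE)
  then have \<psi>: "P (\<psi> n)" "K n \<subseteq> \<psi> n -` {1}" "\<psi> n -` {1} \<subseteq> \<psi> (Suc n) -` {1}" for n by simp_all
  have "UNIV \<subseteq> (\<Union>i. \<psi> i -` {1})" unfolding K(2)[symmetric] by (rule UN_mono[OF order_refl \<psi>(2)])
  then have "(\<Union>i. \<psi> i -` {1}) = UNIV" by (rule top_le)
  moreover have "incseq (\<lambda>i. \<psi> i -` {1})" by (rule incseq_SucI) (rule \<psi>(3))
  moreover have "compact (\<psi> i -` {1})" for i by (rule comp[OF \<psi>(1)])
  moreover have "\<psi> i \<in> compact_piecewise_smooth A" "0 \<le> \<psi> i p" "\<psi> i p \<le> 1" "weighted_energy A g \<phi> (\<psi> i) \<le> ennreal 1" for i p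
    using \<psi>(1)[of i] unfolding P_def cpws_def by auto
  ultimately show ?thesis unfolding finite_capacity_def by (intro exI[of _ \<psi>] conjI allI exI[of _ 1])
qed

end

theorem corollary3p2:
  fixes A :: "('a::{t2_space, second_countable_topology}, 'n::finite) chart set"
    and g :: "('a, 'n) metric_tensor"
    and \<phi> :: "'a \<Rightarrow> real"
  assumes "manifold_with_density A g \<phi>"
    and "complete_manifold A g"
  shows "finite_capacity A g \<phi> \<longleftrightarrow> parabolic A g \<phi>"
proof -
  interpret mwd A g \<phi> using assms(1) by unfold_locales
  show ?thesis using finite_capacity_imp_parabolic parabolic_imp_finite_capacity by blast
qed

end
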